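(* Let $\{X(t):t\in\mathbb{R}\}$ be a centered stationary real Gaussian process with absolutely continuous sample paths and unit variance, with covariance $r$ and spectral measure $\rho$. Suppose that $\rho$ is non-atomic, that $\int_{\mathbb{R}}e^{|\lambda|\kappa}\,d\rho(\lambda)<\infty$ for some $\kappa>0$, and that for some $\kappa'\in(0,\kappa/2)$ and some finite real number $x_\star$, $$\omega_\star(k):=\sum_{j\ge k}|r(jx_\star)|+\sup_{|y|<\kappa'}\Big\{\sum_{j\ge k}|r_1'(jx_\star;2y)|+\sum_{j\ge k}|r_2''(jx_\star;y)|\Big\}\to0\quad\text{as }k\to\infty,$$ where, with $\varphi(\lambda):=\sinh(\lambda)/\lambda$, $$r_\ell(x;y):=\int_{\mathbb{R}}e^{-i\lambda x}\varphi^\ell(\lambda y)\,d\rho(\lambda),\qquad\ell=1,2,$$ and primes denote derivatives with respect to $x$. Let $\alpha:=\mathbb{E}N_X([0,1])$. Then there exist a finite constant $C$ and a function $c:(0,\infty)\to(0,\infty)$ such that $$\mathbb{P}\big(N_X([0,T])-\alpha T\ge3\eta T\big)\le Ce^{-c(\eta)T}\qquad\text{for all }\eta>0\text{ and all }0<T<\infty.$$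
   Context: The covariance is $r(t-s)=\mathrm{Cov}[X(t),X(s)]$, $r(0)=1$, and the spectral measure $\rho$ is the (symmetric) probability measure on $\mathbb{R}$ with $r(t)=\int_{\mathbb{R}}e^{-i\lambda t}\,d\rho(\lambda)$. For an interval $I\subset\mathbb{R}$, $N_X(I)=|\{t\in I:X(t)=0\}|$ is the (possibly infinite) number of zeroes of the sample path in $I$. By the Kac-Rice formula $\alpha=\frac1\pi\big(\int\lambda^2\,d\rho\big)^{1/2}<\infty$. The value $\varphi(0)$ is $1$, and $\varphi^\ell(\lambda y)=(\varphi(\lambda y))^\ell$. *)

theory Defs
  imports "HOL-Probability.Probability"
begin

(* Degenerate (almost surely constant) Gaussian variables are included: linear combinations of
   the values of a Gaussian process may be degenerate. *)
definition gaussian_rv :: "'a measure \<Rightarrow> ('a \<Rightarrow> real) \<Rightarrow> bool" where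
  "gaussian_rv M Y \<longleftrightarrow> Y \<in> borel_measurable M \<and>
     (\<exists>\<mu>. (AE \<omega> in M. Y \<omega> = \<mu>) \<or>
          (\<exists>\<sigma>>0. distributed M lborel Y (\<lambda>x. ennreal (normal_density \<mu> \<sigma> x))))"

definition gaussian_process :: "'a measure \<Rightarrow> (real \<Rightarrow> 'a \<Rightarrow> real) \<Rightarrow> bool" where
  "gaussian_process M X \<longleftrightarrow>
     (\<forall>J a. finite J \<longrightarrow> gaussian_rv M (\<lambda>\<omega>. \<Sum>t\<in>J. a t * X t \<omega>))"

definition centered_process :: "'a measure \<Rightarrow> (real \<Rightarrow> 'a \<Rightarrow> real) \<Rightarrow> bool" where
  "centered_process M X \<longleftrightarrow> (\<forall>t. integrable M (X t) \<and> (LINT \<omega>|M. X t \<omega>) = 0)"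

definition stationary_process :: "'a measure \<Rightarrow> (real \<Rightarrow> 'a \<Rightarrow> real) \<Rightarrow> bool" where
  "stationary_process M X \<longleftrightarrow>
     (\<forall>J h. finite J \<longrightarrow>
        distr M (\<Pi>\<^sub>M t\<in>J. borel) (\<lambda>\<omega>. \<lambda>t\<in>J. X (t + h) \<omega>) =
        distr M (\<Pi>\<^sub>M t\<in>J. borel) (\<lambda>\<omega>. \<lambda>t\<in>J. X t \<omega>))"

definition covariance :: "'a measure \<Rightarrow> ('a \<Rightarrow> real) \<Rightarrow> ('a \<Rightarrow> real) \<Rightarrow> real" where
  "covariance M Y Z =
     (LINT \<omega>|M. (Y \<omega> - (LINT \<omega>'|M. Y \<omega>')) * (Z \<omega> - (LINT \<omega>'|M. Z \<omega>')))"

definition covariance_function ::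
    "'a measure \<Rightarrow> (real \<Rightarrow> 'a \<Rightarrow> real) \<Rightarrow> (real \<Rightarrow> real) \<Rightarrow> bool" where
  "covariance_function M X r \<longleftrightarrow> (\<forall>t s. r (t - s) = covariance M (X t) (X s))"

definition spectral_measure :: "(real \<Rightarrow> real) \<Rightarrow> real measure \<Rightarrow> bool" where
  "spectral_measure r \<rho> \<longleftrightarrow>
     real_distribution \<rho> \<and> distr \<rho> borel uminus = \<rho> \<and>
     (\<forall>t. complex_of_real (r t) = (CLINT s|\<rho>. exp (- \<i> * of_real (s * t))))"

(* The library's absolutely_continuous is the relation between measures, not the one for functions. *)
definition absolutely_continuous_fun_on :: "real \<Rightarrow> real \<Rightarrow> (real \<Rightarrow> real) \<Rightarrow> bool" where
  "absolutely_continuous_fun_on a b f \<longleftrightarrow>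
     (\<forall>\<epsilon>>0. \<exists>\<delta>>0. \<forall>(n::nat) u v.
        (\<forall>i<n. a \<le> u i \<and> u i \<le> v i \<and> v i \<le> b) \<longrightarrow>
        disjoint_family_on (\<lambda>i. {u i<..<v i}) {..<n} \<longrightarrow>
        (\<Sum>i<n. v i - u i) < \<delta> \<longrightarrow>
        (\<Sum>i<n. \<bar>f (v i) - f (u i)\<bar>) < \<epsilon>)"

(* On the whole line, absolute continuity is understood on every compact interval. *)
definition absolutely_continuous_paths :: "'a measure \<Rightarrow> (real \<Rightarrow> 'a \<Rightarrow> real) \<Rightarrow> bool" where
  "absolutely_continuous_paths M X \<longleftrightarrow>
     (\<forall>\<omega>\<in>space M. \<forall>a b. absolutely_continuous_fun_on a b (\<lambda>t. X t \<omega>))"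

(* The number of zeroes in I, with value infinity if there are infinitely many. *)
definition num_zeroes :: "(real \<Rightarrow> 'a \<Rightarrow> real) \<Rightarrow> real set \<Rightarrow> 'a \<Rightarrow> ennreal" where
  "num_zeroes X I \<omega> = emeasure (count_space UNIV) {t\<in>I. X t \<omega> = 0}"

definition non_atomic :: "real measure \<Rightarrow> bool" where
  "non_atomic \<rho> \<longleftrightarrow> (\<forall>x. emeasure \<rho> {x} = 0)"

definition sinhc :: "real \<Rightarrow> real" where
  "sinhc x = (if x = 0 then 1 else sinh x / x)"

definition r_ell :: "real measure \<Rightarrow> nat \<Rightarrow> real \<Rightarrow> real \<Rightarrow> complex" where
  "r_ell \<rho> l x y =
     (CLINT s|\<rho>. exp (- \<i> * of_real (s * x)) * of_real (sinhc (s * y) ^ l))"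

definition r_ell' :: "real measure \<Rightarrow> nat \<Rightarrow> real \<Rightarrow> real \<Rightarrow> complex" where
  "r_ell' \<rho> l x y = vector_derivative (\<lambda>x. r_ell \<rho> l x y) (at x)"

definition r_ell'' :: "real measure \<Rightarrow> nat \<Rightarrow> real \<Rightarrow> real \<Rightarrow> complex" where
  "r_ell'' \<rho> l x y = vector_derivative (\<lambda>x. r_ell' \<rho> l x y) (at x)"

(* Valued in [0, infinity]: the series and the supremum may diverge.
   The sums over indices at least k are reindexed by j + k. *)
definition omega_star ::
    "(real \<Rightarrow> real) \<Rightarrow> real measure \<Rightarrow> real \<Rightarrow> real \<Rightarrow> nat \<Rightarrow> ennreal" where
  "omega_star r \<rho> \<kappa>' x k =
     (\<Sum>j. ennreal \<bar>r (real (j + k) * x)\<bar>) +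
     (SUP y\<in>{y. \<bar>y\<bar> < \<kappa>'}.
        (\<Sum>j. ennreal (norm (r_ell' \<rho> 1 (real (j + k) * x) (2 * y)))) +
        (\<Sum>j. ennreal (norm (r_ell'' \<rho> 2 (real (j + k) * x) y))))"

end

theory Submission
  imports Defs "HOL-Complex_Analysis.Complex_Analysis" "HOL-Real_Asymp.Real_Asymp"
begin

text \<open>
  Almost surely the path agrees near each grid point with the sum of its Taylor series, a random
  holomorphic function on a disc of radius \<open>\<kappa>'\<close>. On an interval of length \<open>d\<close> Jensen-type bounds
  show that the number of zeroes exceeds the indicator of a sign change of the linearised path
  \<open>x + s * x'\<close> only if \<open>\<bar>x\<bar>\<close> is of order \<open>d\<^sup>2\<close>, and is then controlled by \<open>ln (1 / \<bar>x\<bar>)\<close> and the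
  mean square \<open>Q\<close> of the holomorphic function over a circle. The grid splits into residue classes of
  spacing \<open>L\<close>. Along one class the decay hypothesis makes the pairs \<open>(x, x')\<close>, and the values at the
  points of the circle, a Gaussian family whose covariance is close to diagonal. By comparison with
  independent Gaussians, the exponential moments of the three terms over a class factorise up to
  constants close to one, and a Chernoff bound for each term gives the claim with the intensity
  \<open>\<mu> / pi\<close>. Counting sign changes on a fine mesh shows that \<open>\<alpha>\<close> is at least \<open>\<mu> / pi\<close>.
\<close>

section \<open>Centered Gaussian variables\<close>

text \<open>All that is known along a class is a two-sided bound on the quadratic form of its
  covariance, so every comparison with independent variables is phrased for quadratic forms. The
  terms of \<open>omega_star\<close> fit this. Up to sign, r, r_1' and r_2'' at y = 0 are the
  covariances between the entries of the pairs. Also y^2 r_2''(.;y) is, up to sign, the Fourier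
  transform of sinh(sy)^2, and cosh^2 = 1 + sinh^2, so r and r_2'' control the real and the
  imaginary parts on the circle. The cell length is \<open>d = \<nu> ^ 5\<close> in order to
  separate scales. The linearisation error has order \<nu>^10. The logarithmic term lives on |x|
  below a multiple of \<nu>^6 and costs about \<nu>^(11/2). The mean square enters with weight
  \<nu>^6. Both are small against d, so only the sign changes, of probability about d \<mu> / pi per
  cell, are seen in the intensity. A lower bound on \<alpha> suffices, since a smaller centring
  enlarges the event. The prefactor must not depend on \<eta>; this is arranged at the very end by
  lowering the rate.\<close>

lemma std_normal_exp_quadratic:
  fixes b c :: real
  assumes "c < 1"
  shows "(\<integral>\<^sup>+x. ennreal (exp (b * x + c * x\<^sup>2 / 2)) \<partial>std_normal_distribution) =
    ennreal (exp (b\<^sup>2 / (2 * (1 - c))) / sqrt (1 - c))"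
proof -
  define d where "d = 1 - c"
  have d: "d > 0" "c = 1 - d" using assms by (auto simp: d_def)
  have sq: "(x - b / d)\<^sup>2 * d = x\<^sup>2 * d - 2 * b * x + b\<^sup>2 / d" for x
    using d(1) by (simp add: power2_eq_square field_simps)
  \<comment> \<open>Completing the square splits off the normal density with mean b/d and variance
    1/d. The case c = 0 is the moment generating function; b = 0 gives exponential moments of
    squares, with negative c allowed.\<close>
  have eq: "std_normal_density x * exp (b * x + c * x\<^sup>2 / 2) =
      exp (b\<^sup>2 / (2 * d)) / sqrt d * normal_density (b / d) (1 / sqrt d) x" for x
  proof -
    have "- x\<^sup>2 / 2 + (b * x + c * x\<^sup>2 / 2) = b\<^sup>2 / (2 * d) + - (x - b / d)\<^sup>2 * d / 2"
      using sq[of x] d(1) unfolding d(2) by (simp add: field_simps)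
    moreover have "(x - b / d)\<^sup>2 * d / 2 = (x - b / d)\<^sup>2 / (2 * (1 / sqrt d)\<^sup>2)"
      using d(1) by (simp add: power_divide)
    ultimately have e: "- x\<^sup>2 / 2 + (b * x + c * x\<^sup>2 / 2) = b\<^sup>2 / (2 * d) + - (x - b / d)\<^sup>2 / (2 * (1 / sqrt d)\<^sup>2)"
      by simp
    have "sqrt (2 * pi * (1 / sqrt d)\<^sup>2) = sqrt (2 * pi) / sqrt d"
      using d(1) by (simp add: power_divide real_sqrt_divide)
    then show ?thesis
      unfolding normal_density_def using e d(1)
      by (simp add: exp_add[symmetric] mult_exp_exp field_simps)
  qed
  have "(\<integral>\<^sup>+x. ennreal (exp (b * x + c * x\<^sup>2 / 2)) \<partial>std_normal_distribution) =
    (\<integral>\<^sup>+x. ennreal (std_normal_density x) * ennreal (exp (b * x + c * x\<^sup>2 / 2)) \<partial>lborel)"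
    by (subst nn_integral_density) auto
  also have "\<dots> = (\<integral>\<^sup>+x. ennreal (exp (b\<^sup>2 / (2 * d)) / sqrt d) * ennreal (normal_density (b / d) (1 / sqrt d) x) \<partial>lborel)"
    using d(1) by (simp add: ennreal_mult[symmetric] eq)
  also have "\<dots> = ennreal (exp (b\<^sup>2 / (2 * d)) / sqrt d) * (\<integral>\<^sup>+x. ennreal (normal_density (b / d) (1 / sqrt d) x) \<partial>lborel)"
    by (rule nn_integral_cmult) auto
  also have "(\<integral>\<^sup>+x. ennreal (normal_density (b / d) (1 / sqrt d) x) \<partial>lborel) = 1"
    using d(1) by (subst nn_integral_eq_integral) auto
  finally show ?thesis by (simp add: d_def)
qed

text \<open>Encoding by the characteristic function includes the degenerate case v = 0 and passes to
  mean-square limits without any density.\<close>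

definition centered_gaussian :: "'a measure \<Rightarrow> ('a \<Rightarrow> real) \<Rightarrow> real \<Rightarrow> bool" where
  "centered_gaussian M Y v \<longleftrightarrow> Y \<in> borel_measurable M \<and> v \<ge> 0 \<and>
     (\<forall>u. (CLINT \<omega>|M. exp (\<i> * of_real (u * Y \<omega>))) = of_real (exp (- (u\<^sup>2 * v / 2))))"

lemma centered_gaussian_distr:
  assumes "prob_space M" "centered_gaussian M Y v"
  shows "distr M borel Y = distr std_normal_distribution borel (\<lambda>x. sqrt v * x)"
proof (rule Levy_uniqueness)
  interpret prob_space M by fact
  interpret N: real_distribution std_normal_distribution by (rule real_dist_normal_dist)
  have [measurable]: "Y \<in> borel_measurable M" and v: "v \<ge> 0"
    using assms(2) by (auto simp: centered_gaussian_def)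
  show "real_distribution (distr M borel Y)" by (rule real_distribution_distr) auto
  show "real_distribution (distr std_normal_distribution borel (\<lambda>x. sqrt v * x))"
    by (rule N.real_distribution_distr) auto
  show "char (distr M borel Y) = char (distr std_normal_distribution borel (\<lambda>x. sqrt v * x))"
  proof
    fix u
    have "char (distr std_normal_distribution borel (\<lambda>x. sqrt v * x)) u = char std_normal_distribution (u * sqrt v)"
      unfolding char_def by (subst integral_distr) (auto simp: mult.assoc)
    also have "\<dots> = of_real (exp (- (u\<^sup>2 * v / 2)))"
      using v by (simp add: char_std_normal_distribution power_mult_distrib)
    also have "\<dots> = char (distr M borel Y) u"
      using assms(2) unfolding char_def centered_gaussian_def
      by (subst integral_distr) (auto simp: mult.assoc)
    finally show "char (distr M borel Y) u = char (distr std_normal_distribution borel (\<lambda>x. sqrt v * x)) u" by simp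
  qed
qed

lemma centered_gaussian_nn_integral:
  assumes "prob_space M" "centered_gaussian M Y v" and [measurable]: "f \<in> borel_measurable borel"
  shows "(\<integral>\<^sup>+\<omega>. f (Y \<omega>) \<partial>M) = (\<integral>\<^sup>+x. f (sqrt v * x) \<partial>std_normal_distribution)"
proof -
  have [measurable]: "Y \<in> borel_measurable M" using assms(2) by (auto simp: centered_gaussian_def)
  have "(\<integral>\<^sup>+\<omega>. f (Y \<omega>) \<partial>M) = (\<integral>\<^sup>+x. f x \<partial>distr M borel Y)"
    by (subst nn_integral_distr) auto
  also have "\<dots> = (\<integral>\<^sup>+x. f (sqrt v * x) \<partial>std_normal_distribution)"
    unfolding centered_gaussian_distr[OF assms(1,2)] by (subst nn_integral_distr) auto
  finally show ?thesis .
qed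

lemma centered_gaussian_mgf:
  assumes "prob_space M" "centered_gaussian M Y v"
  shows "(\<integral>\<^sup>+\<omega>. ennreal (exp (Y \<omega>)) \<partial>M) = ennreal (exp (v / 2))"
proof -
  have "v \<ge> 0" using assms(2) by (auto simp: centered_gaussian_def)
  then show ?thesis
    using centered_gaussian_nn_integral[OF assms, of "\<lambda>x. ennreal (exp x)"]
      std_normal_exp_quadratic[of 0 "sqrt v"] by simp
qed

lemma centered_gaussian_AE_nonzero:
  assumes "prob_space M" "centered_gaussian M Y v" "v > 0"
  shows "AE \<omega> in M. Y \<omega> \<noteq> 0"
proof -
  have [measurable]: "Y \<in> borel_measurable M" using assms(2) by (auto simp: centered_gaussian_def)
  have "(\<integral>\<^sup>+\<omega>. indicator {0} (Y \<omega>) \<partial>M) = (\<integral>\<^sup>+x. indicator {0} (sqrt v * x) \<partial>std_normal_distribution)"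
    by (rule centered_gaussian_nn_integral[OF assms(1,2)]) auto
  also have "\<dots> = (\<integral>\<^sup>+x. ennreal (std_normal_density x) * indicator {0} (sqrt v * x) \<partial>lborel)"
    by (subst nn_integral_density) auto
  also have "\<dots> = (\<integral>\<^sup>+(x::real). 0 \<partial>lborel)"
    using AE_lborel_singleton[of "0::real"] assms(3)
    by (intro nn_integral_cong_AE) (auto simp: indicator_def)
  finally have "(\<integral>\<^sup>+\<omega>. indicator {0} (Y \<omega>) \<partial>M) = 0" by simp
  then have "AE \<omega> in M. indicator {0} (Y \<omega>) = (0::ennreal)"
    by (subst (asm) nn_integral_0_iff_AE) auto
  then show ?thesis by (auto simp: indicator_def split: if_splits)
qed

text \<open>The function z -> E exp(A + zB) is a convergent power series, and on the real axis it
  equals the exponential of a quadratic polynomial. By the identity theorem the two agree at z = i,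
  where the squared term changes sign and produces the decay exp(-b/2).\<close>

lemma complex_moment_generating_bound:
  fixes A B :: "'a \<Rightarrow> real" and a b c :: real
  assumes [measurable]: "A \<in> borel_measurable M" "B \<in> borel_measurable M"
    and mgf: "\<And>s. (\<integral>\<^sup>+\<omega>. ennreal (exp (A \<omega> + s * B \<omega>)) \<partial>M) = ennreal (exp ((a + 2 * c * s + b * s\<^sup>2) / 2))"
  shows "integrable M (\<lambda>\<omega>. exp (of_real (A \<omega>) + \<i> * of_real (B \<omega>)))"
    and "norm (CLINT \<omega>|M. exp (of_real (A \<omega>) + \<i> * of_real (B \<omega>))) \<le> exp ((a - b) / 2)"
proof -
  have intr: "integrable M (\<lambda>\<omega>. exp (A \<omega> + s * B \<omega>))"
    and intr_eq: "(\<integral>\<omega>. exp (A \<omega> + s * B \<omega>) \<partial>M) = exp ((a + 2 * c * s + b * s\<^sup>2) / 2)" for s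
  proof -
    show "integrable M (\<lambda>\<omega>. exp (A \<omega> + s * B \<omega>))"
      by (rule integrableI_nonneg) (auto simp: mgf)
    show "(\<integral>\<omega>. exp (A \<omega> + s * B \<omega>) \<partial>M) = exp ((a + 2 * c * s + b * s\<^sup>2) / 2)"
      using mgf[of s] by (subst integral_eq_nn_integral) auto
  qed
  define f where "f z n \<omega> = (exp (A \<omega>) * B \<omega> ^ n / fact n) *\<^sub>R (z::complex) ^ n" for z n \<omega>
  have [measurable]: "f z n \<in> borel_measurable M" for z n unfolding f_def by measurable
  have nf: "norm (f z n \<omega>) = exp (A \<omega>) * ((norm z * \<bar>B \<omega>\<bar>) ^ n / fact n)" for z n \<omega>
    by (simp add: f_def norm_mult norm_power abs_mult power_mult_distrib power_abs)
  \<comment> \<open>exp(x|y|) is at most exp(xy) + exp(-xy), so two real moments dominate the whole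
    series.\<close>
  have dom: "integrable M (\<lambda>\<omega>. exp (A \<omega>) * exp (norm z * \<bar>B \<omega>\<bar>))" for z :: complex
  proof (rule Bochner_Integration.integrable_bound)
    show "integrable M (\<lambda>\<omega>. exp (A \<omega> + norm z * B \<omega>) + exp (A \<omega> + (- norm z) * B \<omega>))"
      by (intro Bochner_Integration.integrable_add intr)
    have "exp u * exp (x * \<bar>y\<bar>) \<le> exp (u + x * y) + exp (u + (- x) * y)" if "x \<ge> 0" for u x y :: real
      by (cases "y \<ge> 0") (auto simp: exp_add[symmetric])
    then show "AE \<omega> in M. norm (exp (A \<omega>) * exp (norm z * \<bar>B \<omega>\<bar>)) \<le>
        norm (exp (A \<omega> + norm z * B \<omega>) + exp (A \<omega> + (- norm z) * B \<omega>))"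
      by (intro always_eventually allI) simp
  qed auto
  have expsums: "(\<lambda>n. x ^ n / fact n) sums exp x" for x :: real
    using exp_converges[of x] by (simp add: scaleR_conv_of_real field_simps)
  have nsums: "(\<lambda>n. norm (f z n \<omega>)) sums (exp (A \<omega>) * exp (norm z * \<bar>B \<omega>\<bar>))" for z \<omega>
    unfolding nf by (intro sums_mult expsums)
  have fsums: "(\<lambda>n. f z n \<omega>) sums (exp (of_real (A \<omega>) + z * of_real (B \<omega>)))" for z \<omega>
  proof -
    have "(\<lambda>n. of_real (exp (A \<omega>)) * ((z * of_real (B \<omega>)) ^ n /\<^sub>R fact n)) sums (of_real (exp (A \<omega>)) * exp (z * of_real (B \<omega>)))"
      by (intro sums_mult exp_converges)
    moreover have "of_real (exp (A \<omega>)) * ((z * of_real (B \<omega>)) ^ n /\<^sub>R fact n) = f z n \<omega>" for n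
      by (simp add: f_def scaleR_conv_of_real power_mult_distrib divide_inverse)
    ultimately show ?thesis by (simp add: exp_add exp_of_real)
  qed
  have intf: "integrable M (f z n)" for z n
  proof (rule Bochner_Integration.integrable_bound[OF dom[of z]])
    have "norm (f z n \<omega>) \<le> exp (A \<omega>) * exp (norm z * \<bar>B \<omega>\<bar>)" for \<omega>
      using sum_le_suminf[OF sums_summable[OF nsums], of "{n}" z \<omega>] sums_unique[OF nsums[of z \<omega>]] by auto
    then show "AE \<omega> in M. norm (f z n \<omega>) \<le> norm (exp (A \<omega>) * exp (norm z * \<bar>B \<omega>\<bar>))"
      by auto
  qed auto
  have sumint: "summable (\<lambda>n. \<integral>\<omega>. norm (f z n \<omega>) \<partial>M)" for z
  proof (rule bounded_imp_summable)
    fix n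
    have "(\<Sum>k\<le>n. \<integral>\<omega>. norm (f z k \<omega>) \<partial>M) = (\<integral>\<omega>. (\<Sum>k\<le>n. norm (f z k \<omega>)) \<partial>M)"
      by (subst Bochner_Integration.integral_sum) (auto intro: intf integrable_norm)
    also have "\<dots> \<le> (\<integral>\<omega>. exp (A \<omega>) * exp (norm z * \<bar>B \<omega>\<bar>) \<partial>M)"
    proof (rule integral_mono)
      show "(\<Sum>k\<le>n. norm (f z k \<omega>)) \<le> exp (A \<omega>) * exp (norm z * \<bar>B \<omega>\<bar>)" for \<omega>
        using sum_le_suminf[OF sums_summable[OF nsums], of "{..n}" z \<omega>] sums_unique[OF nsums[of z \<omega>]] by auto
    qed (auto intro!: intf dom integrable_norm Bochner_Integration.integrable_sum)
    finally show "(\<Sum>k\<le>n. \<integral>\<omega>. norm (f z k \<omega>) \<partial>M) \<le> (\<integral>\<omega>. exp (A \<omega>) * exp (norm z * \<bar>B \<omega>\<bar>) \<partial>M)" .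
  qed auto
  define F where "F z = (\<integral>\<omega>. exp (of_real (A \<omega>) + z * of_real (B \<omega>)) \<partial>M)" for z :: complex
  define m where "m n = (\<integral>\<omega>. exp (A \<omega>) * B \<omega> ^ n / fact n \<partial>M)" for n
  have suminf_f: "(\<Sum>n. f z n \<omega>) = exp (of_real (A \<omega>) + z * of_real (B \<omega>))" for z \<omega>
    using sums_unique[OF fsums[of z \<omega>]] by simp
  have int_f: "integral\<^sup>L M (f z n) = of_real (m n) * z ^ n" for z n
  proof -
    have "integrable M (\<lambda>\<omega>. exp (A \<omega>) * B \<omega> ^ n / fact n)"
      using integrable_Re[OF intf[of 1 n]] by (simp add: f_def)
    then show ?thesis
      unfolding f_def m_def by (subst integral_scaleR_left) (auto simp: scaleR_conv_of_real)
  qed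
  have F_sums: "(\<lambda>n. of_real (m n) * z ^ n) sums F z" for z
  proof -
    have "(\<lambda>n. integral\<^sup>L M (f z n)) sums (\<integral>\<omega>. (\<Sum>n. f z n \<omega>) \<partial>M)"
      by (rule sums_integral) (use intf sumint in \<open>auto intro: sums_summable[OF nsums]\<close>)
    then show ?thesis by (simp add: suminf_f int_f F_def)
  qed
  have int_F: "integrable M (\<lambda>\<omega>. exp (of_real (A \<omega>) + z * of_real (B \<omega>)))" for z :: complex
  proof -
    have "integrable M (\<lambda>\<omega>. \<Sum>n. f z n \<omega>)"
      by (rule integrable_suminf) (use intf sumint in \<open>auto intro: sums_summable[OF nsums]\<close>)
    then show ?thesis by (simp add: suminf_f)
  qed
  show "integrable M (\<lambda>\<omega>. exp (of_real (A \<omega>) + \<i> * of_real (B \<omega>)))" by (rule int_F)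
  have F_hol: "F holomorphic_on ball 0 2"
    by (rule power_series_holomorphic[where a = "\<lambda>n. of_real (m n)"]) (use F_sums in auto)
  define G where "G z = exp ((of_real a + 2 * of_real c * z + of_real b * z\<^sup>2) / 2)" for z :: complex
  have G_hol: "G holomorphic_on ball 0 2"
    unfolding G_def by (intro holomorphic_intros) auto
  have FG_real: "F (of_real s) = G (of_real s)" for s
  proof -
    have "F (of_real s) = (\<integral>\<omega>. of_real (exp (A \<omega> + s * B \<omega>)) \<partial>M)"
      unfolding F_def by (intro Bochner_Integration.integral_cong refl) (simp add: exp_of_real[symmetric])
    also have "\<dots> = of_real (exp ((a + 2 * c * s + b * s\<^sup>2) / 2))"
      by (simp only: integral_complex_of_real intr_eq)
    also have "\<dots> = G (of_real s)" unfolding G_def by (simp add: exp_of_real[symmetric])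
    finally show ?thesis .
  qed
  have "F \<i> - G \<i> = 0"
  \<comment> \<open>Radius 2 only has to cover the point i; the real segment accumulates at
    0.\<close>
  proof (rule analytic_continuation[where f = "\<lambda>z. F z - G z" and S = "ball 0 2" and U = "of_real ` {-1<..<1}" and \<xi> = 0])
    show "(\<lambda>z. F z - G z) holomorphic_on ball 0 2" using F_hol G_hol by (intro holomorphic_intros)
    have "of_real ` {-1<..<1::real} \<subseteq> ball (0::complex) 2" by auto
    then show "of_real ` {-1<..<1::real} \<subseteq> ball (0::complex) 2" .
    have "(0::complex) islimpt (of_real ` {-1<..<1::real})"
    proof (rule islimpt_approachable[THEN iffD2], intro allI impI)
      fix e :: real assume "e > 0"
      define d where "d = min (e/2) (1/2)"
      have d: "0 < d" "d < e" "d < 1" using \<open>e > 0\<close> by (auto simp: d_def)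
      then show "\<exists>x'\<in>of_real ` {-1<..<1::real}. x' \<noteq> 0 \<and> dist x' (0::complex) < e"
        by (intro bexI[of _ "of_real d"]) auto
    qed
    then show "(0::complex) islimpt (of_real ` {-1<..<1::real})" .
  qed (auto simp: FG_real)
  then have "F \<i> = G \<i>" by simp
  \<comment> \<open>The covariance term contributes the phase exp(ic), which the norm does not
    see.\<close>
  moreover have "norm (G \<i>) = exp ((a - b) / 2)"
    unfolding G_def by (simp add: norm_exp_eq_Re)
  ultimately show "norm (CLINT \<omega>|M. exp (of_real (A \<omega>) + \<i> * of_real (B \<omega>))) \<le> exp ((a - b) / 2)"
    unfolding F_def by simp
qed

section \<open>Gaussian families\<close>

text \<open>Joint Gaussianity through all real linear combinations. \<open>C\<close> enters only
  through its quadratic form, so it need not be invertible.\<close>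

definition gaussian_family :: "'a measure \<Rightarrow> 'i set \<Rightarrow> ('i \<Rightarrow> 'a \<Rightarrow> real) \<Rightarrow> ('i \<Rightarrow> 'i \<Rightarrow> real) \<Rightarrow> bool" where
  "gaussian_family M I Y C \<longleftrightarrow> finite I \<and>
     (\<forall>w. centered_gaussian M (\<lambda>\<omega>. \<Sum>i\<in>I. w i * Y i \<omega>) (\<Sum>i\<in>I. \<Sum>j\<in>I. w i * w j * C i j))"

lemma gaussian_family_measurable:
  assumes "gaussian_family M I Y C" "i \<in> I"
  shows "Y i \<in> borel_measurable M"
proof -
  have "finite I" using assms by (simp add: gaussian_family_def)
  have "(\<lambda>\<omega>. \<Sum>j\<in>I. (if j = i then 1 else 0) * Y j \<omega>) \<in> borel_measurable M"
    using conjunct2[OF assms(1)[unfolded gaussian_family_def]]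
    unfolding centered_gaussian_def by (drule_tac spec[where x = "\<lambda>j. if j = i then 1 else 0"]) simp
  also have "(\<lambda>\<omega>. \<Sum>j\<in>I. (if j = i then 1 else 0) * Y j \<omega>) = Y i"
    using assms(2) \<open>finite I\<close> by (simp add: if_distrib[of "\<lambda>x. x * _"] sum.delta cong: if_cong)
  finally show ?thesis .
qed

lemma gaussian_family_mgf:
  assumes "prob_space M" "gaussian_family M I Y C"
  shows "(\<integral>\<^sup>+\<omega>. ennreal (exp (\<Sum>i\<in>I. w i * Y i \<omega>)) \<partial>M) =
    ennreal (exp ((\<Sum>i\<in>I. \<Sum>j\<in>I. w i * w j * C i j) / 2))"
  using assms by (intro centered_gaussian_mgf) (auto simp: gaussian_family_def)

text \<open>Writing each factor as a moment generating function of an independent standard Gaussian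
  avoids diagonalising the covariance matrix.\<close>

lemma nn_integral_exp_sum_squares_le:
  fixes I :: "'i set"
  assumes "prob_space M" and fam: "gaussian_family M I Y C"
    and up: "\<And>w. (\<Sum>i\<in>I. \<Sum>j\<in>I. w i * w j * C i j) \<le> \<Lambda> * (\<Sum>i\<in>I. (w i)\<^sup>2)"
    and s: "s \<ge> 0" "s * \<Lambda> < 1"
  shows "(\<integral>\<^sup>+\<omega>. ennreal (exp (\<Sum>i\<in>I. s * (Y i \<omega>)\<^sup>2 / 2)) \<partial>M) \<le>
    ennreal ((1 / sqrt (1 - s * \<Lambda>)) ^ card I)"
proof -
  interpret prob_space M by fact
  interpret N: real_distribution std_normal_distribution by (rule real_dist_normal_dist)
  interpret PP: prob_space "PiM I (\<lambda>_::'i. std_normal_distribution)"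
    by (rule prob_space_PiM) (rule N.prob_space_axioms)
  interpret P: product_prob_space "\<lambda>_::'i. std_normal_distribution" I ..
  have fin: "finite I" using fam by (simp add: gaussian_family_def)
  interpret P': finite_product_prob_space "\<lambda>_::'i. std_normal_distribution" I by standard (rule fin)
  let ?P = "PiM I (\<lambda>_::'i. std_normal_distribution)"
  interpret Q: pair_sigma_finite M ?P ..
  note [measurable] = gaussian_family_measurable[OF fam]
  have ms: "sets std_normal_distribution = sets borel" by simp
  have comp[measurable]: "(\<lambda>g. g i) \<in> borel_measurable ?P" if "i \<in> I" for i
    using measurable_component_singleton[OF that, of "\<lambda>_::'i. std_normal_distribution"]
    by (simp cong: measurable_cong_sets)
  have "(\<integral>\<^sup>+\<omega>. ennreal (exp (\<Sum>i\<in>I. s * (Y i \<omega>)\<^sup>2 / 2)) \<partial>M) =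
      (\<integral>\<^sup>+\<omega>. (\<integral>\<^sup>+g. (\<Prod>i\<in>I. ennreal (exp (sqrt s * Y i \<omega> * g i))) \<partial>?P) \<partial>M)"
  proof (rule nn_integral_cong)
    fix \<omega>
    have "ennreal (exp (\<Sum>i\<in>I. s * (Y i \<omega>)\<^sup>2 / 2)) = (\<Prod>i\<in>I. ennreal (exp (s * (Y i \<omega>)\<^sup>2 / 2)))"
      by (simp add: exp_sum[OF fin] prod_ennreal)
    also have "\<dots> = (\<Prod>i\<in>I. \<integral>\<^sup>+x. ennreal (exp (sqrt s * Y i \<omega> * x)) \<partial>std_normal_distribution)"
      using std_normal_exp_quadratic[of 0] s(1) by (simp add: power_mult_distrib)
    also have "\<dots> = (\<integral>\<^sup>+g. (\<Prod>i\<in>I. ennreal (exp (sqrt s * Y i \<omega> * g i))) \<partial>?P)"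
      by (subst P.product_nn_integral_prod[OF fin]) auto
    finally show "ennreal (exp (\<Sum>i\<in>I. s * (Y i \<omega>)\<^sup>2 / 2)) =
      (\<integral>\<^sup>+g. (\<Prod>i\<in>I. ennreal (exp (sqrt s * Y i \<omega> * g i))) \<partial>?P)" .
  qed
  \<comment> \<open>After the exchange, for fixed \<open>g\<close> the inner integral is the moment
    generating function of a linear combination with weights \<open>sqrt s * g i\<close>. The bound
    on the quadratic form makes it a product over the coordinates again.\<close>
  also have "\<dots> = (\<integral>\<^sup>+g. (\<integral>\<^sup>+\<omega>. (\<Prod>i\<in>I. ennreal (exp (sqrt s * Y i \<omega> * g i))) \<partial>M) \<partial>?P)"
    by (rule Q.Fubini'[symmetric]) measurable
  also have "\<dots> \<le> (\<integral>\<^sup>+g. (\<Prod>i\<in>I. ennreal (exp (s * \<Lambda> * (g i)\<^sup>2 / 2))) \<partial>?P)"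
  proof (rule nn_integral_mono)
    fix g
    define w :: "'i \<Rightarrow> real" where "w i = sqrt s * g i" for i
    have "(\<integral>\<^sup>+\<omega>. (\<Prod>i\<in>I. ennreal (exp (sqrt s * Y i \<omega> * g i))) \<partial>M) = (\<integral>\<^sup>+\<omega>. ennreal (exp (\<Sum>i\<in>I. w i * Y i \<omega>)) \<partial>M)"
      by (simp add: exp_sum[OF fin] prod_ennreal w_def mult_ac)
    also have "\<dots> = ennreal (exp ((\<Sum>i\<in>I. \<Sum>j\<in>I. w i * w j * C i j) / 2))"
      by (rule gaussian_family_mgf[OF \<open>prob_space M\<close> fam])
    also have "\<dots> \<le> ennreal (exp (\<Lambda> * (\<Sum>i\<in>I. (w i)\<^sup>2) / 2))"
      by (intro ennreal_leI) (use up[of w] in simp)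
    also have "\<Lambda> * (\<Sum>i\<in>I. (w i)\<^sup>2) / 2 = (\<Sum>i\<in>I. s * \<Lambda> * (g i)\<^sup>2 / 2)"
      using s(1) by (simp add: w_def power_mult_distrib sum_distrib_left sum_divide_distrib mult_ac)
    finally show "(\<integral>\<^sup>+\<omega>. (\<Prod>i\<in>I. ennreal (exp (sqrt s * Y i \<omega> * g i))) \<partial>M) \<le> (\<Prod>i\<in>I. ennreal (exp (s * \<Lambda> * (g i)\<^sup>2 / 2)))"
      by (simp add: exp_sum[OF fin] prod_ennreal)
  qed
  also have "\<dots> = (\<Prod>i\<in>I. \<integral>\<^sup>+x. ennreal (exp (s * \<Lambda> * x\<^sup>2 / 2)) \<partial>std_normal_distribution)"
    by (subst P.product_nn_integral_prod[OF fin]) auto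
  also have "\<dots> = ennreal ((1 / sqrt (1 - s * \<Lambda>)) ^ card I)"
    using std_normal_exp_quadratic[OF s(2), of 0] s(2) by (simp add: ennreal_power)
  finally show ?thesis .
qed

text \<open>The kernel is the Fourier transform of an independent Gaussian, shifted by an exponential tilt that
  produces the Gaussian factor in \<open>a\<close>; the complex exponential moment left after exchanging the
  integrals is bounded by \<open>complex_moment_generating_bound\<close>.\<close>

lemma nn_integral_prod_gaussian_kernel_le:
  fixes I :: "'i set"
  assumes "prob_space M" and fam: "gaussian_family M I Y C"
    and low: "\<And>w. \<mu> * (\<Sum>i\<in>I. (w i)\<^sup>2) \<le> (\<Sum>i\<in>I. \<Sum>j\<in>I. w i * w j * C i j)"
    and up: "\<And>w. (\<Sum>i\<in>I. \<Sum>j\<in>I. w i * w j * C i j) \<le> \<Lambda> * (\<Sum>i\<in>I. (w i)\<^sup>2)"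
    and pos: "\<mu> > 0" "\<Lambda> > 0" "\<sigma> > 0"
  shows "(\<integral>\<^sup>+\<omega>. (\<Prod>i\<in>I. ennreal (exp (- (a i - Y i \<omega>)\<^sup>2 / (2 * \<sigma>\<^sup>2)))) \<partial>M) \<le>
    (\<Prod>i\<in>I. ennreal (exp (- (a i)\<^sup>2 / (2 * (\<Lambda> + \<sigma>\<^sup>2))) * (\<sigma> / sqrt (\<mu> + \<sigma>\<^sup>2))))"
proof -
  interpret prob_space M by fact
  interpret N: real_distribution std_normal_distribution by (rule real_dist_normal_dist)
  interpret PP: prob_space "PiM I (\<lambda>_::'i. std_normal_distribution)"
    by (rule prob_space_PiM) (rule N.prob_space_axioms)
  interpret P: product_prob_space "\<lambda>_::'i. std_normal_distribution" I ..
  have fin: "finite I" using fam by (simp add: gaussian_family_def)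
  interpret P': finite_product_prob_space "\<lambda>_::'i. std_normal_distribution" I by standard (rule fin)
  let ?P = "PiM I (\<lambda>_::'i. std_normal_distribution)"
  interpret Q: pair_sigma_finite M ?P ..
  note [measurable] = gaussian_family_measurable[OF fam]
  have comp[measurable]: "(\<lambda>g. g i) \<in> borel_measurable ?P" if "i \<in> I" for i
    using measurable_component_singleton[OF that, of "\<lambda>_::'i. std_normal_distribution"]
    by (simp cong: measurable_cong_sets)
  \<comment> \<open>The tilt costs exp(-wa + w^2 (\<sigma>^2 + \<Lambda>) / 2) per coordinate, and
    this \<open>w\<close> minimises it. The minimum is the Gaussian factor of variance \<Lambda> +
    \<sigma>^2 in the claim, and \<open>b\<close> is the centre of the kernel after the
    tilt.\<close>
  define w where "w i = a i / (\<Lambda> + \<sigma>\<^sup>2)" for i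
  define b where "b i = a i - w i * \<sigma>\<^sup>2" for i
  define A where "A \<omega> = (\<Sum>i\<in>I. w i * Y i \<omega>)" for \<omega>
  have [measurable]: "A \<in> borel_measurable M" unfolding A_def by measurable
  define q where "q u = (\<Sum>i\<in>I. \<Sum>j\<in>I. u i * u j * C i j)" for u :: "'i \<Rightarrow> real"
  \<comment> \<open>Averaging over \<open>g\<close> turns the characters into the Gaussian kernel in
    b - Y; averaging over \<omega> first leaves a complex exponential moment.\<close>
  define H where "H \<omega> g = exp (of_real (A \<omega>)) * (\<Prod>i\<in>I. exp (\<i> * of_real (g i * (b i - Y i \<omega>) / \<sigma>)))" for \<omega> g
  have [measurable]: "(\<lambda>(\<omega>, g). H \<omega> g) \<in> borel_measurable (M \<Otimes>\<^sub>M ?P)"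
    unfolding H_def by measurable
  have normH: "norm (H \<omega> g) = exp (A \<omega>)" for \<omega> g
    by (simp add: H_def norm_mult prod_norm[symmetric])
  have intA: "integrable M (\<lambda>\<omega>. exp (A \<omega>))"
    unfolding A_def by (rule integrableI_nonneg) (auto simp: gaussian_family_mgf[OF \<open>prob_space M\<close> fam])
  have intH: "integrable (M \<Otimes>\<^sub>M ?P) (\<lambda>(\<omega>, g). H \<omega> g)"
  proof (rule Q.Fubini_integrable)
    show "integrable M (\<lambda>\<omega>. \<integral>g. norm (case (\<omega>, g) of (\<omega>, g) \<Rightarrow> H \<omega> g) \<partial>?P)"
      using intA by (simp add: normH PP.prob_space)
    have "integrable ?P (\<lambda>g. H \<omega> g)" for \<omega>
    proof (rule PP.integrable_const_bound[where B = "exp (A \<omega>)"])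
      show "AE g in ?P. norm (H \<omega> g) \<le> exp (A \<omega>)" by (intro AE_I2) (simp add: normH)
      show "H \<omega> \<in> borel_measurable ?P" unfolding H_def by measurable
    qed
    then show "AE \<omega> in M. integrable ?P (\<lambda>g. case (\<omega>, g) of (\<omega>, g) \<Rightarrow> H \<omega> g)" by simp
  qed measurable
  have Hint: "(\<integral>g. H \<omega> g \<partial>?P) = of_real (exp (A \<omega>) * (\<Prod>i\<in>I. exp (- (b i - Y i \<omega>)\<^sup>2 / (2 * \<sigma>\<^sup>2))))" for \<omega>
  proof -
    have "(\<integral>g. H \<omega> g \<partial>?P) = exp (of_real (A \<omega>)) * (\<integral>g. (\<Prod>i\<in>I. exp (\<i> * of_real (g i * (b i - Y i \<omega>) / \<sigma>))) \<partial>?P)"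
      unfolding H_def by simp
    also have "(\<integral>g. (\<Prod>i\<in>I. exp (\<i> * of_real (g i * (b i - Y i \<omega>) / \<sigma>))) \<partial>?P) =
       (\<Prod>i\<in>I. \<integral>x. exp (\<i> * of_real (x * (b i - Y i \<omega>) / \<sigma>)) \<partial>std_normal_distribution)"
      by (rule P.product_integral_prod[OF fin]) (auto intro!: N.integrable_const_bound[where B = 1])
    also have "\<dots> = (\<Prod>i\<in>I. char std_normal_distribution ((b i - Y i \<omega>) / \<sigma>))"
      unfolding char_def by (intro prod.cong refl Bochner_Integration.integral_cong) (auto simp: mult_ac)
    finally show ?thesis
      by (simp add: char_std_normal_distribution exp_of_real power_divide mult.commute)
  qed
  have HM: "ennreal (norm (\<integral>\<omega>. H \<omega> g \<partial>M)) \<le> ennreal (exp (\<Lambda> * (\<Sum>i\<in>I. (w i)\<^sup>2) / 2)) * (\<Prod>i\<in>I. ennreal (exp (- \<mu> / \<sigma>\<^sup>2 * (g i)\<^sup>2 / 2)))" for g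
  proof -
    \<comment> \<open>Here H is a phase times exp(A + iB) with B the combination of weights
      \<open>u\<close>, so the norm of its mean is at most exp((q w - q u) / 2). The upper bound on
      the form handles \<open>w\<close>, the lower bound handles \<open>u\<close>.\<close>
    define u :: "'i \<Rightarrow> real" where "u i = - g i / \<sigma>" for i
    define B where "B \<omega> = (\<Sum>i\<in>I. u i * Y i \<omega>)" for \<omega>
    have [measurable]: "B \<in> borel_measurable M" unfolding B_def by measurable
    define c where "c = (\<Sum>i\<in>I. \<Sum>j\<in>I. (w i * u j + u i * w j) * C i j) / 2"
    have mgf: "(\<integral>\<^sup>+\<omega>. ennreal (exp (A \<omega> + s * B \<omega>)) \<partial>M) = ennreal (exp ((q w + 2 * c * s + q u * s\<^sup>2) / 2))" for s
    proof -
      have "A \<omega> + s * B \<omega> = (\<Sum>i\<in>I. (w i + s * u i) * Y i \<omega>)" for \<omega>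
        by (simp add: A_def B_def sum_distrib_left sum.distrib[symmetric] algebra_simps)
      moreover have "(\<Sum>i\<in>I. \<Sum>j\<in>I. (w i + s * u i) * (w j + s * u j) * C i j) =
          q w + (\<Sum>i\<in>I. \<Sum>j\<in>I. (w i * u j + u i * w j) * C i j) * s + q u * s\<^sup>2"
        by (simp add: q_def sum_distrib_left sum_distrib_right sum.distrib[symmetric] algebra_simps power2_eq_square)
      moreover have "(\<Sum>i\<in>I. \<Sum>j\<in>I. (w i * u j + u i * w j) * C i j) = 2 * c" by (simp add: c_def)
      ultimately show ?thesis
        using gaussian_family_mgf[OF \<open>prob_space M\<close> fam, of "\<lambda>i. w i + s * u i"] by simp
    qed
    have Heq: "H \<omega> g = exp (\<i> * of_real (\<Sum>i\<in>I. g i * b i / \<sigma>)) * exp (of_real (A \<omega>) + \<i> * of_real (B \<omega>))" for \<omega>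
    proof -
      have "(\<Prod>i\<in>I. exp (\<i> * of_real (g i * (b i - Y i \<omega>) / \<sigma>))) = exp (\<Sum>i\<in>I. \<i> * complex_of_real (g i * (b i - Y i \<omega>) / \<sigma>))"
        by (rule exp_sum[OF fin, symmetric])
      also have "(\<Sum>i\<in>I. \<i> * complex_of_real (g i * (b i - Y i \<omega>) / \<sigma>)) = \<i> * of_real (\<Sum>i\<in>I. g i * (b i - Y i \<omega>) / \<sigma>)"
        by (simp only: sum_distrib_left of_real_sum)
      also have "(\<Sum>i\<in>I. g i * (b i - Y i \<omega>) / \<sigma>) = (\<Sum>i\<in>I. g i * b i / \<sigma>) + B \<omega>"
        by (simp add: B_def u_def sum.distrib[symmetric] algebra_simps diff_divide_distrib)
      finally show ?thesis unfolding H_def by (simp add: exp_add distrib_left mult_ac)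
    qed
    have "norm (\<integral>\<omega>. H \<omega> g \<partial>M) = norm (\<integral>\<omega>. exp (of_real (A \<omega>) + \<i> * of_real (B \<omega>)) \<partial>M)"
      unfolding Heq by (simp add: norm_mult)
    also have "\<dots> \<le> exp ((q w - q u) / 2)"
      by (rule complex_moment_generating_bound(2)[OF _ _ mgf]) measurable
    also have "\<dots> \<le> exp (\<Lambda> * (\<Sum>i\<in>I. (w i)\<^sup>2) / 2 + (\<Sum>i\<in>I. - \<mu> / \<sigma>\<^sup>2 * (g i)\<^sup>2 / 2))"
    proof -
      have "(\<Sum>i\<in>I. - \<mu> / \<sigma>\<^sup>2 * (g i)\<^sup>2 / 2) = - (\<mu> * (\<Sum>i\<in>I. (u i)\<^sup>2)) / 2"
        by (simp add: u_def power_divide sum_distrib_left sum_negf sum_divide_distrib mult.commute)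
      moreover have "q w \<le> \<Lambda> * (\<Sum>i\<in>I. (w i)\<^sup>2)" "\<mu> * (\<Sum>i\<in>I. (u i)\<^sup>2) \<le> q u"
        using up[of w] low[of u] by (simp_all add: q_def)
      ultimately show ?thesis by simp
    qed
    also have "\<dots> = exp (\<Lambda> * (\<Sum>i\<in>I. (w i)\<^sup>2) / 2) * (\<Prod>i\<in>I. exp (- \<mu> / \<sigma>\<^sup>2 * (g i)\<^sup>2 / 2))"
      by (simp add: exp_add exp_sum[OF fin])
    finally show ?thesis
      by (simp add: prod_ennreal ennreal_mult[symmetric] prod_nonneg ennreal_leI)
  qed
  have split: "(\<Prod>i\<in>I. exp (- (a i - Y i \<omega>)\<^sup>2 / (2 * \<sigma>\<^sup>2))) =
     (\<Prod>i\<in>I. exp (- w i * a i + (w i)\<^sup>2 * \<sigma>\<^sup>2 / 2)) * (exp (A \<omega>) * (\<Prod>i\<in>I. exp (- (b i - Y i \<omega>)\<^sup>2 / (2 * \<sigma>\<^sup>2))))" for \<omega>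
  proof -
    have "- (a i - Y i \<omega>)\<^sup>2 / (2 * \<sigma>\<^sup>2) = (- w i * a i + (w i)\<^sup>2 * \<sigma>\<^sup>2 / 2) + (w i * Y i \<omega> + - (b i - Y i \<omega>)\<^sup>2 / (2 * \<sigma>\<^sup>2))" for i
      using pos by (simp add: b_def field_simps power2_eq_square)
    then show ?thesis
      by (simp add: A_def exp_sum[OF fin] prod.distrib[symmetric] exp_add[symmetric])
  qed
  define g0 where "g0 \<omega> = exp (A \<omega>) * (\<Prod>i\<in>I. exp (- (b i - Y i \<omega>)\<^sup>2 / (2 * \<sigma>\<^sup>2)))" for \<omega>
  have g0_nn: "g0 \<omega> \<ge> 0" for \<omega> by (simp add: g0_def prod_nonneg)
  have g0_int: "integrable M g0"
  proof (rule Bochner_Integration.integrable_bound[OF intA])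
    show "g0 \<in> borel_measurable M" unfolding g0_def by measurable
    have "(\<Prod>i\<in>I. exp (- (b i - Y i \<omega>)\<^sup>2 / (2 * \<sigma>\<^sup>2))) \<le> 1" for \<omega>
      by (rule prod_le_1) auto
    then show "AE \<omega> in M. norm (g0 \<omega>) \<le> norm (exp (A \<omega>))"
      by (auto simp: g0_def prod_nonneg abs_mult intro!: mult_left_le)
  qed
  have swap: "of_real (\<integral>\<omega>. g0 \<omega> \<partial>M) = (\<integral>g. (\<integral>\<omega>. H \<omega> g \<partial>M) \<partial>?P)"
  proof -
    have "(\<integral>\<omega>. (\<integral>g. H \<omega> g \<partial>?P) \<partial>M) = of_real (\<integral>\<omega>. g0 \<omega> \<partial>M)"
      unfolding Hint g0_def[symmetric] by (rule integral_complex_of_real)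
    then show ?thesis using Q.Fubini_integral[OF intH] by simp
  qed
  have "(\<integral>\<^sup>+\<omega>. ennreal (g0 \<omega>) \<partial>M) = ennreal (\<integral>\<omega>. g0 \<omega> \<partial>M)"
    by (rule nn_integral_eq_integral[OF g0_int]) (simp add: g0_nn)
  also have "\<dots> \<le> ennreal (norm (complex_of_real (\<integral>\<omega>. g0 \<omega> \<partial>M)))"
    by (intro ennreal_leI) simp
  also have "\<dots> \<le> (\<integral>\<^sup>+g. ennreal (norm (\<integral>\<omega>. H \<omega> g \<partial>M)) \<partial>?P)"
    unfolding swap by (rule integral_norm_bound_ennreal) (use Q.integrable_snd[OF intH] in simp)
  also have "\<dots> \<le> (\<integral>\<^sup>+g. ennreal (exp (\<Lambda> * (\<Sum>i\<in>I. (w i)\<^sup>2) / 2)) * (\<Prod>i\<in>I. ennreal (exp (- \<mu> / \<sigma>\<^sup>2 * (g i)\<^sup>2 / 2))) \<partial>?P)"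
    by (intro nn_integral_mono HM)
  also have "\<dots> = ennreal (exp (\<Lambda> * (\<Sum>i\<in>I. (w i)\<^sup>2) / 2)) * (\<integral>\<^sup>+g. (\<Prod>i\<in>I. ennreal (exp (- \<mu> / \<sigma>\<^sup>2 * (g i)\<^sup>2 / 2))) \<partial>?P)"
    by (rule nn_integral_cmult) measurable
  also have "(\<integral>\<^sup>+g. (\<Prod>i\<in>I. ennreal (exp (- \<mu> / \<sigma>\<^sup>2 * (g i)\<^sup>2 / 2))) \<partial>?P) =
     (\<Prod>i\<in>I. \<integral>\<^sup>+x. ennreal (exp (- \<mu> / \<sigma>\<^sup>2 * x\<^sup>2 / 2)) \<partial>std_normal_distribution)"
    by (rule P.product_nn_integral_prod[OF fin]) auto
  also have "\<dots> = (\<Prod>i\<in>I. ennreal (\<sigma> / sqrt (\<mu> + \<sigma>\<^sup>2)))"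
  proof -
    have "\<mu> / \<sigma>\<^sup>2 > 0" using pos by simp
    then have c1: "- \<mu> / \<sigma>\<^sup>2 < 1" by simp
    have "1 - - \<mu> / \<sigma>\<^sup>2 = (\<mu> + \<sigma>\<^sup>2) / \<sigma>\<^sup>2" using pos by (simp add: field_simps)
    then have "1 / sqrt (1 - - \<mu> / \<sigma>\<^sup>2) = \<sigma> / sqrt (\<mu> + \<sigma>\<^sup>2)"
      using pos by (simp add: real_sqrt_divide)
    then show ?thesis using std_normal_exp_quadratic[OF c1, of 0] by simp
  qed
  finally have g0_le: "(\<integral>\<^sup>+\<omega>. ennreal (g0 \<omega>) \<partial>M) \<le>
    ennreal (exp (\<Lambda> * (\<Sum>i\<in>I. (w i)\<^sup>2) / 2)) * (\<Prod>i\<in>I. ennreal (\<sigma> / sqrt (\<mu> + \<sigma>\<^sup>2)))" .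
  have "(\<integral>\<^sup>+\<omega>. (\<Prod>i\<in>I. ennreal (exp (- (a i - Y i \<omega>)\<^sup>2 / (2 * \<sigma>\<^sup>2)))) \<partial>M) =
    (\<integral>\<^sup>+\<omega>. ennreal (\<Prod>i\<in>I. exp (- w i * a i + (w i)\<^sup>2 * \<sigma>\<^sup>2 / 2)) * ennreal (g0 \<omega>) \<partial>M)"
  proof (rule nn_integral_cong)
    fix \<omega>
    have "(\<Prod>i\<in>I. ennreal (exp (- (a i - Y i \<omega>)\<^sup>2 / (2 * \<sigma>\<^sup>2)))) = ennreal (\<Prod>i\<in>I. exp (- (a i - Y i \<omega>)\<^sup>2 / (2 * \<sigma>\<^sup>2)))"
      by (rule prod_ennreal) simp
    also have "\<dots> = ennreal (\<Prod>i\<in>I. exp (- w i * a i + (w i)\<^sup>2 * \<sigma>\<^sup>2 / 2)) * ennreal (g0 \<omega>)"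
      unfolding split g0_def[symmetric] by (rule ennreal_mult) (auto simp: g0_nn intro!: prod_nonneg)
    finally show "(\<Prod>i\<in>I. ennreal (exp (- (a i - Y i \<omega>)\<^sup>2 / (2 * \<sigma>\<^sup>2)))) =
      ennreal (\<Prod>i\<in>I. exp (- w i * a i + (w i)\<^sup>2 * \<sigma>\<^sup>2 / 2)) * ennreal (g0 \<omega>)" .
  qed
  also have "\<dots> = ennreal (\<Prod>i\<in>I. exp (- w i * a i + (w i)\<^sup>2 * \<sigma>\<^sup>2 / 2)) * (\<integral>\<^sup>+\<omega>. ennreal (g0 \<omega>) \<partial>M)"
    by (rule nn_integral_cmult) (use g0_int in auto)
  also have "\<dots> \<le> ennreal (\<Prod>i\<in>I. exp (- w i * a i + (w i)\<^sup>2 * \<sigma>\<^sup>2 / 2)) *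
    (ennreal (exp (\<Lambda> * (\<Sum>i\<in>I. (w i)\<^sup>2) / 2)) * (\<Prod>i\<in>I. ennreal (\<sigma> / sqrt (\<mu> + \<sigma>\<^sup>2))))"
    by (intro mult_left_mono g0_le) auto
  also have "\<dots> = (\<Prod>i\<in>I. ennreal (exp (- (a i)\<^sup>2 / (2 * (\<Lambda> + \<sigma>\<^sup>2))) * (\<sigma> / sqrt (\<mu> + \<sigma>\<^sup>2))))"
  proof -
    have e1: "exp (\<Lambda> * (\<Sum>i\<in>I. (w i)\<^sup>2) / 2) = (\<Prod>i\<in>I. exp (\<Lambda> * (w i)\<^sup>2 / 2))"
      by (simp add: exp_sum[OF fin, symmetric] sum_distrib_left sum_divide_distrib)
    have e2: "- w i * a i + (w i)\<^sup>2 * \<sigma>\<^sup>2 / 2 + \<Lambda> * (w i)\<^sup>2 / 2 = - (a i)\<^sup>2 / (2 * (\<Lambda> + \<sigma>\<^sup>2))" for i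
    proof -
      have "(w i)\<^sup>2 * (\<Lambda> + \<sigma>\<^sup>2) = w i * a i"
      proof -
        have "\<Lambda> + \<sigma>\<^sup>2 \<noteq> 0" using pos by (metis add_pos_pos less_irrefl zero_less_power)
        then have "w i * (\<Lambda> + \<sigma>\<^sup>2) = a i" by (simp add: w_def)
        then show ?thesis by (simp add: power2_eq_square mult.assoc)
      qed
      then have "- w i * a i + (w i)\<^sup>2 * \<sigma>\<^sup>2 / 2 + \<Lambda> * (w i)\<^sup>2 / 2 = - w i * a i / 2"
        by (simp add: algebra_simps)
      then show ?thesis by (simp add: w_def power2_eq_square)
    qed
    define k where "k = \<sigma> / sqrt (\<mu> + \<sigma>\<^sup>2)"
    have k: "k \<ge> 0" using pos by (simp add: k_def)
    have "(\<Prod>i\<in>I. ennreal (exp (- w i * a i + (w i)\<^sup>2 * \<sigma>\<^sup>2 / 2 + \<Lambda> * (w i)\<^sup>2 / 2) * k)) =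
      (\<Prod>i\<in>I. ennreal (exp (- w i * a i + (w i)\<^sup>2 * \<sigma>\<^sup>2 / 2)) * (ennreal (exp (\<Lambda> * (w i)\<^sup>2 / 2)) * ennreal k))"
      by (intro prod.cong refl) (simp only: exp_add ennreal_mult k exp_ge_zero mult_nonneg_nonneg mult.assoc)
    also have "\<dots> = ennreal (\<Prod>i\<in>I. exp (- w i * a i + (w i)\<^sup>2 * \<sigma>\<^sup>2 / 2)) * (ennreal (\<Prod>i\<in>I. exp (\<Lambda> * (w i)\<^sup>2 / 2)) * (\<Prod>i\<in>I. ennreal k))"
      by (simp only: prod.distrib prod_ennreal exp_ge_zero)
    finally show ?thesis unfolding e1 e2[symmetric] k_def by simp
  qed
  finally show ?thesis .
qed

text \<open>Moves the noise from the argument of f into a kernel around y. Afterwards the random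
  value y occurs only in a Gaussian kernel, to which the previous estimate applies.\<close>

lemma nn_integral_std_normal_affine:
  assumes "\<sigma> > 0" and [measurable]: "f \<in> borel_measurable borel"
  shows "(\<integral>\<^sup>+z. f (y + \<sigma> * z) \<partial>std_normal_distribution) =
    (\<integral>\<^sup>+a. f a * ennreal (normal_density 0 \<sigma> (a - y)) \<partial>lborel)"
proof -
  have eq: "\<sigma> * normal_density 0 \<sigma> (\<sigma> * x) = std_normal_density x" for x
    using assms(1) by (simp add: normal_density_def power_mult_distrib real_sqrt_mult field_simps)
  have "(\<integral>\<^sup>+a. f a * ennreal (normal_density 0 \<sigma> (a - y)) \<partial>lborel) =
    ennreal \<bar>\<sigma>\<bar> * (\<integral>\<^sup>+x. f (y + \<sigma> * x) * ennreal (normal_density 0 \<sigma> ((y + \<sigma> * x) - y)) \<partial>lborel)"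
    using assms(1) by (intro nn_integral_real_affine) auto
  also have "\<dots> = (\<integral>\<^sup>+x. ennreal \<sigma> * (f (y + \<sigma> * x) * ennreal (normal_density 0 \<sigma> (\<sigma> * x))) \<partial>lborel)"
    using assms(1) by (subst nn_integral_cmult[symmetric]) auto
  also have "\<dots> = (\<integral>\<^sup>+x. ennreal (std_normal_density x) * f (y + \<sigma> * x) \<partial>lborel)"
    using assms(1) by (intro nn_integral_cong) (simp add: eq[symmetric] ennreal_mult mult_ac)
  also have "\<dots> = (\<integral>\<^sup>+z. f (y + \<sigma> * z) \<partial>std_normal_distribution)"
    by (subst nn_integral_density) auto
  finally show ?thesis by simp
qed

text \<open>Instead of a joint density, independent Gaussian noise of variance tending to \<open>0\<close> is added to
  the pairs, and the limit is taken by Fatou's lemma, which is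
  why \<open>h\<close> has to be continuous where it does not vanish.\<close>

lemma nn_integral_prod_gaussian_pairs_le:
  fixes S :: "'j set" and X V :: "'j \<Rightarrow> 'a \<Rightarrow> real" and h :: "real \<times> real \<Rightarrow> real"
  assumes "prob_space M" "finite S"
    and fam: "gaussian_family M (S \<times> (UNIV :: bool set)) (\<lambda>(j, e). if e then V j else X j) C"
    and low: "\<And>w. \<mu> * (\<Sum>i\<in>S \<times> UNIV. (w i)\<^sup>2) \<le> (\<Sum>i\<in>S \<times> UNIV. \<Sum>j\<in>S \<times> UNIV. w i * w j * C i j)"
    and up: "\<And>w. (\<Sum>i\<in>S \<times> UNIV. \<Sum>j\<in>S \<times> UNIV. w i * w j * C i j) \<le> \<Lambda> * (\<Sum>i\<in>S \<times> UNIV. (w i)\<^sup>2)"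
    and pos: "\<mu> > 0" "\<Lambda> > 0"
    and h[measurable]: "h \<in> borel_measurable borel" and h_nn: "\<And>y. h y \<ge> 0"
    and h_cont: "\<And>y. h y \<noteq> 0 \<Longrightarrow> isCont h y"
    and h_le: "\<And>s. s \<ge> \<Lambda> \<Longrightarrow> (\<integral>\<^sup>+x. \<integral>\<^sup>+v. ennreal (h (x, v) * normal_density 0 (sqrt s) x * normal_density 0 (sqrt s) v) \<partial>lborel \<partial>lborel) \<le> ennreal b"
    and b: "b \<ge> 0"
  shows "(\<integral>\<^sup>+\<omega>. (\<Prod>j\<in>S. ennreal (h (X j \<omega>, V j \<omega>))) \<partial>M) \<le> ennreal ((b * \<Lambda> / \<mu>) ^ card S)"
proof -
  interpret prob_space M by fact
  interpret N: real_distribution std_normal_distribution by (rule real_dist_normal_dist)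
  interpret NN: pair_prob_space std_normal_distribution std_normal_distribution ..
  define N2 where "N2 = std_normal_distribution \<Otimes>\<^sub>M std_normal_distribution"
  define L2 where "L2 = (lborel :: real measure) \<Otimes>\<^sub>M (lborel :: real measure)"
  interpret N2: prob_space N2 unfolding N2_def by (rule NN.prob_space_axioms)
  interpret L2: sigma_finite_measure L2
    unfolding L2_def by (intro sigma_finite_pair_measure lborel.sigma_finite_measure_axioms)
  interpret PP: prob_space "PiM S (\<lambda>_. N2)" by (rule prob_space_PiM) (rule N2.prob_space_axioms)
  interpret PN: product_sigma_finite "\<lambda>_::'j. N2" ..
  interpret PL: product_sigma_finite "\<lambda>_::'j. L2" ..
  interpret PL': finite_product_sigma_finite "\<lambda>_::'j. L2" S by standard (rule \<open>finite S\<close>)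
  interpret Q: pair_sigma_finite M "PiM S (\<lambda>_::'j. L2)" ..
  have sN2[measurable_cong]: "sets N2 = sets borel"
    unfolding N2_def borel_prod[symmetric] by (rule sets_pair_measure_cong) auto
  have sL2[measurable_cong]: "sets L2 = sets borel"
    unfolding L2_def borel_prod[symmetric] by (rule sets_pair_measure_cong) auto
  have comp1: "(\<lambda>g. g j) \<in> PiM S (\<lambda>_. N2) \<rightarrow>\<^sub>M borel" if "j \<in> S" for j
    using measurable_component_singleton[OF that, of "\<lambda>_. N2"] by (simp add: sN2 cong: measurable_cong_sets)
  have comp2: "(\<lambda>g. g j) \<in> PiM S (\<lambda>_. L2) \<rightarrow>\<^sub>M borel" if "j \<in> S" for j
    using measurable_component_singleton[OF that, of "\<lambda>_. L2"] by (simp add: sL2 cong: measurable_cong_sets)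
  have fs[measurable]: "(fst :: real \<times> real \<Rightarrow> real) \<in> borel_measurable borel" "(snd :: real \<times> real \<Rightarrow> real) \<in> borel_measurable borel"
    by (auto intro!: borel_measurable_continuous_onI continuous_intros)
  have mm: "(\<lambda>x. fst (snd x j)) \<in> borel_measurable (M \<Otimes>\<^sub>M PiM S (\<lambda>_. N2))"
    "(\<lambda>x. snd (snd x j)) \<in> borel_measurable (M \<Otimes>\<^sub>M PiM S (\<lambda>_. N2))"
    "(\<lambda>g. fst (g j)) \<in> borel_measurable (PiM S (\<lambda>_. N2))"
    "(\<lambda>g. snd (g j)) \<in> borel_measurable (PiM S (\<lambda>_. N2))"
    "(\<lambda>x. fst (snd x j)) \<in> borel_measurable (M \<Otimes>\<^sub>M PiM S (\<lambda>_. L2))"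
    "(\<lambda>x. snd (snd x j)) \<in> borel_measurable (M \<Otimes>\<^sub>M PiM S (\<lambda>_. L2))"
    "(\<lambda>x. snd x j) \<in> borel_measurable (M \<Otimes>\<^sub>M PiM S (\<lambda>_. L2))"
    "(\<lambda>g. fst (g j)) \<in> borel_measurable (PiM S (\<lambda>_. L2))"
    "(\<lambda>g. snd (g j)) \<in> borel_measurable (PiM S (\<lambda>_. L2))" if "j \<in> S" for j
    by (auto intro!: measurable_compose[OF _ fs(1)] measurable_compose[OF _ fs(2)]
      measurable_compose[OF measurable_snd comp1] measurable_compose[OF measurable_snd comp2] comp1 comp2 that)
  have [measurable]: "(\<lambda>x. fst (fst x)) \<in> borel_measurable ((borel :: (real \<times> real) measure) \<Otimes>\<^sub>M (borel :: (real \<times> real) measure))"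
    "(\<lambda>x. snd (fst x)) \<in> borel_measurable ((borel :: (real \<times> real) measure) \<Otimes>\<^sub>M (borel :: (real \<times> real) measure))"
    "(\<lambda>x. fst (snd x)) \<in> borel_measurable ((borel :: (real \<times> real) measure) \<Otimes>\<^sub>M (borel :: (real \<times> real) measure))"
    "(\<lambda>x. snd (snd x)) \<in> borel_measurable ((borel :: (real \<times> real) measure) \<Otimes>\<^sub>M (borel :: (real \<times> real) measure))"
    by (auto intro!: measurable_compose[OF measurable_fst fs(1)] measurable_compose[OF measurable_fst fs(2)]
      measurable_compose[OF measurable_snd fs(1)] measurable_compose[OF measurable_snd fs(2)])
  have [measurable]: "fst \<in> borel_measurable N2" "snd \<in> borel_measurable N2"
      "fst \<in> borel_measurable L2" "snd \<in> borel_measurable L2"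
    using fs by (simp_all add: sN2 sL2 cong: measurable_cong_sets)
  have X[measurable]: "X j \<in> borel_measurable M" if "j \<in> S" for j
    using gaussian_family_measurable[OF fam, of "(j, False)"] that by simp
  have V[measurable]: "V j \<in> borel_measurable M" if "j \<in> S" for j
    using gaussian_family_measurable[OF fam, of "(j, True)"] that by simp
  define \<sigma> where "\<sigma> n = inverse (real (Suc n))" for n
  have \<sigma>_pos: "\<sigma> n > 0" for n by (simp add: \<sigma>_def)
  have \<sigma>_lim: "\<sigma> \<longlonglongrightarrow> 0" unfolding \<sigma>_def by (rule LIMSEQ_inverse_real_of_nat)
  define Z where "Z n \<omega> z = (\<Prod>j\<in>S. ennreal (h (X j \<omega> + \<sigma> n * fst (z j), V j \<omega> + \<sigma> n * snd (z j))))" for n \<omega> and z :: "'j \<Rightarrow> real \<times> real"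
  have Z_meas[measurable]: "(\<lambda>(\<omega>, z). Z n \<omega> z) \<in> borel_measurable (M \<Otimes>\<^sub>M PiM S (\<lambda>_. N2))" for n
    supply mm[measurable] comp1[measurable] comp2[measurable] unfolding Z_def case_prod_beta by measurable
  have pw: "(\<Prod>j\<in>S. ennreal (h (X j \<omega>, V j \<omega>))) \<le> liminf (\<lambda>n. Z n \<omega> z)" for \<omega> z
  \<comment> \<open>Where some factor vanishes the left side is 0, so continuity of \<open>h\<close>
    is used only at points with h nonzero.\<close>
  proof (cases "\<exists>j\<in>S. h (X j \<omega>, V j \<omega>) = 0")
    case True
    then have "(\<Prod>j\<in>S. ennreal (h (X j \<omega>, V j \<omega>))) = 0" by (intro prod_zero \<open>finite S\<close>) (metis ennreal_0)
    then show ?thesis by (simp only: zero_le)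
  next
    case False
    have "(\<lambda>n. h (X j \<omega> + \<sigma> n * fst (z j), V j \<omega> + \<sigma> n * snd (z j))) \<longlonglongrightarrow> h (X j \<omega>, V j \<omega>)" if "j \<in> S" for j
    proof (rule isCont_tendsto_compose[where g = h])
      show "isCont h (X j \<omega>, V j \<omega>)" using False that h_cont by auto
      show "(\<lambda>n. (X j \<omega> + \<sigma> n * fst (z j), V j \<omega> + \<sigma> n * snd (z j))) \<longlonglongrightarrow> (X j \<omega>, V j \<omega>)"
        by (rule tendsto_eq_intros \<sigma>_lim refl | simp)+
    qed
    then have "(\<lambda>n. \<Prod>j\<in>S. h (X j \<omega> + \<sigma> n * fst (z j), V j \<omega> + \<sigma> n * snd (z j))) \<longlonglongrightarrow> (\<Prod>j\<in>S. h (X j \<omega>, V j \<omega>))"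
      by (rule tendsto_prod)
    then have "(\<lambda>n. Z n \<omega> z) \<longlonglongrightarrow> (\<Prod>j\<in>S. ennreal (h (X j \<omega>, V j \<omega>)))"
      unfolding Z_def by (simp add: prod_ennreal h_nn tendsto_ennrealI)
    then show ?thesis by (simp add: lim_imp_Liminf)
  qed
  \<comment> \<open>The kernel bound returns normal densities of variance \<Lambda> + \<sigma>^2;
    this is why \<open>h_le\<close> is required for every variance from \<Lambda> on.\<close>
  define s where "s n = \<Lambda> + (\<sigma> n)\<^sup>2" for n
  have s_pos: "s n > 0" "s n \<ge> \<Lambda>" for n using pos by (auto simp: s_def add_pos_nonneg)
  define G where "G n p q = ennreal (h p * normal_density 0 (\<sigma> n) (fst p - fst q) * normal_density 0 (\<sigma> n) (snd p - snd q))"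
    for n and p q :: "real \<times> real"
  have G_meas[measurable]: "(\<lambda>(p, q). G n p q) \<in> borel_measurable (borel \<Otimes>\<^sub>M borel)" for n
    unfolding G_def case_prod_beta by measurable
  have GL: "(\<lambda>a. G n a q) \<in> borel_measurable (lborel \<Otimes>\<^sub>M lborel)" for n q
    unfolding L2_def[symmetric] G_def by measurable
  have step1: "(\<integral>\<^sup>+z. Z n \<omega> z \<partial>PiM S (\<lambda>_. N2)) = (\<integral>\<^sup>+a. (\<Prod>j\<in>S. G n (a j) (X j \<omega>, V j \<omega>)) \<partial>PiM S (\<lambda>_. L2))" for n \<omega>
  proof -
    have "(\<integral>\<^sup>+z. Z n \<omega> z \<partial>PiM S (\<lambda>_. N2)) = (\<Prod>j\<in>S. \<integral>\<^sup>+p. ennreal (h (X j \<omega> + \<sigma> n * fst p, V j \<omega> + \<sigma> n * snd p)) \<partial>N2)"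
      unfolding Z_def by (rule PN.product_nn_integral_prod[OF \<open>finite S\<close>]) measurable
    also have "\<dots> = (\<Prod>j\<in>S. \<integral>\<^sup>+a. G n a (X j \<omega>, V j \<omega>) \<partial>L2)"
    proof (rule prod.cong[OF refl])
      fix j
      have "(\<integral>\<^sup>+p. ennreal (h (X j \<omega> + \<sigma> n * fst p, V j \<omega> + \<sigma> n * snd p)) \<partial>N2) =
        (\<integral>\<^sup>+x. \<integral>\<^sup>+v. ennreal (h (X j \<omega> + \<sigma> n * x, V j \<omega> + \<sigma> n * v)) \<partial>std_normal_distribution \<partial>std_normal_distribution)"
        unfolding N2_def by (subst N.nn_integral_fst[symmetric]) auto
      also have "\<dots> = (\<integral>\<^sup>+x. (\<integral>\<^sup>+v. ennreal (h (X j \<omega> + \<sigma> n * x, v)) * ennreal (normal_density 0 (\<sigma> n) (v - V j \<omega>)) \<partial>lborel) \<partial>std_normal_distribution)"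
        by (intro nn_integral_cong nn_integral_std_normal_affine \<sigma>_pos) measurable
      also have "\<dots> = (\<integral>\<^sup>+x. (\<integral>\<^sup>+v. ennreal (h (x, v)) * ennreal (normal_density 0 (\<sigma> n) (v - V j \<omega>)) \<partial>lborel) * ennreal (normal_density 0 (\<sigma> n) (x - X j \<omega>)) \<partial>lborel)"
        by (rule nn_integral_std_normal_affine[OF \<sigma>_pos]) measurable
      also have "\<dots> = (\<integral>\<^sup>+x. \<integral>\<^sup>+v. G n (x, v) (X j \<omega>, V j \<omega>) \<partial>lborel \<partial>lborel)"
        by (subst nn_integral_multc[symmetric]) (auto simp: G_def ennreal_mult h_nn mult_ac)
      also have "\<dots> = (\<integral>\<^sup>+a. G n a (X j \<omega>, V j \<omega>) \<partial>L2)"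
        unfolding L2_def by (rule lborel.nn_integral_fst[OF GL])
      finally show "(\<integral>\<^sup>+p. ennreal (h (X j \<omega> + \<sigma> n * fst p, V j \<omega> + \<sigma> n * snd p)) \<partial>N2) = (\<integral>\<^sup>+a. G n a (X j \<omega>, V j \<omega>) \<partial>L2)" .
    qed
    also have "\<dots> = (\<integral>\<^sup>+a. (\<Prod>j\<in>S. G n (a j) (X j \<omega>, V j \<omega>)) \<partial>PiM S (\<lambda>_. L2))"
      by (rule PL.product_nn_integral_prod[OF \<open>finite S\<close>, symmetric]) measurable
    finally show ?thesis .
  qed
  define K where "K n p = ennreal (h p * normal_density 0 (sqrt (s n)) (fst p) * normal_density 0 (sqrt (s n)) (snd p))" for n and p :: "real \<times> real"
  have K_meas[measurable]: "K n \<in> borel_measurable borel" for n unfolding K_def by measurable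
  have KL: "K n \<in> borel_measurable (lborel \<Otimes>\<^sub>M lborel)" for n
    unfolding L2_def[symmetric] K_def by measurable
  \<comment> \<open>The kernel bound is applied to the 2 |S| coordinates at once. The two square
    roots belonging to one pair multiply to 1 / (\<mu> + \<sigma>^2), and the normalisation of the
    two densities supplies the numerator.\<close>
  have step2: "(\<integral>\<^sup>+\<omega>. (\<Prod>j\<in>S. G n (a j) (X j \<omega>, V j \<omega>)) \<partial>M) \<le> (\<Prod>j\<in>S. ennreal (s n / (\<mu> + (\<sigma> n)\<^sup>2)) * K n (a j))" for n a
  proof -
    define A where "A i = (if snd i then snd (a (fst i)) else fst (a (fst i)))" for i :: "'j \<times> bool"
    define k where "k = 1 / (2 * pi * (\<sigma> n)\<^sup>2)"
    have k: "k > 0" using \<sigma>_pos[of n] by (simp add: k_def)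
    have pairprod: "(\<Prod>i\<in>S \<times> UNIV. f i) = (\<Prod>j\<in>S. f (j, False) * f (j, True))" for f :: "'j \<times> bool \<Rightarrow> ennreal"
      using prod.cartesian_product[of "\<lambda>j e. f (j, e)" UNIV S] by (simp add: UNIV_bool mult.commute)
    have G_eq: "G n (a j) (X j \<omega>, V j \<omega>) = ennreal (h (a j) * k) *
        (ennreal (exp (- (fst (a j) - X j \<omega>)\<^sup>2 / (2 * (\<sigma> n)\<^sup>2))) * ennreal (exp (- (snd (a j) - V j \<omega>)\<^sup>2 / (2 * (\<sigma> n)\<^sup>2))))" for j \<omega>
    proof -
      have "normal_density 0 (\<sigma> n) x * normal_density 0 (\<sigma> n) y = k * (exp (- x\<^sup>2 / (2 * (\<sigma> n)\<^sup>2)) * exp (- y\<^sup>2 / (2 * (\<sigma> n)\<^sup>2)))" for x y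
        by (simp add: normal_density_def k_def)
      then show ?thesis
        unfolding G_def using h_nn[of "a j"] k by (simp add: ennreal_mult[symmetric] mult.assoc)
    qed
    have "(\<integral>\<^sup>+\<omega>. (\<Prod>j\<in>S. G n (a j) (X j \<omega>, V j \<omega>)) \<partial>M) =
      (\<integral>\<^sup>+\<omega>. (\<Prod>j\<in>S. ennreal (h (a j) * k)) * (\<Prod>i\<in>S \<times> UNIV. ennreal (exp (- (A i - (case i of (j, e) \<Rightarrow> if e then V j else X j) \<omega>)\<^sup>2 / (2 * (\<sigma> n)\<^sup>2)))) \<partial>M)"
      by (simp add: G_eq pairprod A_def prod.distrib)
    also have "\<dots> = (\<Prod>j\<in>S. ennreal (h (a j) * k)) * (\<integral>\<^sup>+\<omega>. (\<Prod>i\<in>S \<times> UNIV. ennreal (exp (- (A i - (case i of (j, e) \<Rightarrow> if e then V j else X j) \<omega>)\<^sup>2 / (2 * (\<sigma> n)\<^sup>2)))) \<partial>M)"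
    proof (rule nn_integral_cmult)
      have "(\<lambda>\<omega>. (\<Prod>j\<in>S. ennreal (exp (- (A (j, False) - X j \<omega>)\<^sup>2 / (2 * (\<sigma> n)\<^sup>2))) * ennreal (exp (- (A (j, True) - V j \<omega>)\<^sup>2 / (2 * (\<sigma> n)\<^sup>2))))) \<in> borel_measurable M"
        by measurable
      then show "(\<lambda>\<omega>. (\<Prod>i\<in>S \<times> UNIV. ennreal (exp (- (A i - (case i of (j, e) \<Rightarrow> if e then V j else X j) \<omega>)\<^sup>2 / (2 * (\<sigma> n)\<^sup>2))))) \<in> borel_measurable M"
        by (simp add: pairprod)
    qed
    also have "\<dots> \<le> (\<Prod>j\<in>S. ennreal (h (a j) * k)) *
      (\<Prod>i\<in>S \<times> UNIV. ennreal (exp (- (A i)\<^sup>2 / (2 * (\<Lambda> + (\<sigma> n)\<^sup>2))) * (\<sigma> n / sqrt (\<mu> + (\<sigma> n)\<^sup>2))))"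
      by (intro mult_left_mono nn_integral_prod_gaussian_kernel_le[OF \<open>prob_space M\<close> fam low up pos \<sigma>_pos]) auto
    also have "\<dots> = (\<Prod>j\<in>S. ennreal (s n / (\<mu> + (\<sigma> n)\<^sup>2)) * K n (a j))"
      unfolding pairprod prod.distrib[symmetric]
    proof (rule prod.cong[OF refl])
      fix j
      define x y where "x = fst (a j)" and "y = snd (a j)"
      have m: "\<mu> + (\<sigma> n)\<^sup>2 > 0" using pos by (simp add: add_pos_nonneg)
      have sq: "sqrt (\<mu> + (\<sigma> n)\<^sup>2) * sqrt (\<mu> + (\<sigma> n)\<^sup>2) = \<mu> + (\<sigma> n)\<^sup>2" using m by simp
      have nd: "normal_density 0 (sqrt (s n)) x * normal_density 0 (sqrt (s n)) y =
        1 / (2 * pi * s n) * (exp (- x\<^sup>2 / (2 * s n)) * exp (- y\<^sup>2 / (2 * s n)))"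
      proof -
        have "sqrt (2 * pi * s n) * sqrt (2 * pi * s n) = 2 * pi * s n" using s_pos(1)[of n] by simp
        then show ?thesis using s_pos(1)[of n] by (simp add: normal_density_def)
      qed
      have "(h (a j) * k) * ((exp (- x\<^sup>2 / (2 * s n)) * (\<sigma> n / sqrt (\<mu> + (\<sigma> n)\<^sup>2))) * (exp (- y\<^sup>2 / (2 * s n)) * (\<sigma> n / sqrt (\<mu> + (\<sigma> n)\<^sup>2)))) =
        (h (a j) * k * (\<sigma> n * \<sigma> n) / (sqrt (\<mu> + (\<sigma> n)\<^sup>2) * sqrt (\<mu> + (\<sigma> n)\<^sup>2))) * (exp (- x\<^sup>2 / (2 * s n)) * exp (- y\<^sup>2 / (2 * s n)))"
        by (simp add: mult_ac)
      also have "\<dots> = s n / (\<mu> + (\<sigma> n)\<^sup>2) * (h (a j) * (normal_density 0 (sqrt (s n)) x * normal_density 0 (sqrt (s n)) y))"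
        unfolding sq nd k_def using s_pos(1)[of n] \<sigma>_pos[of n] m by (simp add: power2_eq_square)
      finally have eq: "(h (a j) * k) * ((exp (- x\<^sup>2 / (2 * s n)) * (\<sigma> n / sqrt (\<mu> + (\<sigma> n)\<^sup>2))) * (exp (- y\<^sup>2 / (2 * s n)) * (\<sigma> n / sqrt (\<mu> + (\<sigma> n)\<^sup>2)))) =
        s n / (\<mu> + (\<sigma> n)\<^sup>2) * (h (a j) * normal_density 0 (sqrt (s n)) x * normal_density 0 (sqrt (s n)) y)"
        by (simp add: mult.assoc)
      have nn: "h (a j) * k \<ge> 0" "exp (- x\<^sup>2 / (2 * s n)) * (\<sigma> n / sqrt (\<mu> + (\<sigma> n)\<^sup>2)) \<ge> 0"
        "exp (- y\<^sup>2 / (2 * s n)) * (\<sigma> n / sqrt (\<mu> + (\<sigma> n)\<^sup>2)) \<ge> 0" "s n / (\<mu> + (\<sigma> n)\<^sup>2) \<ge> 0"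
        "h (a j) * normal_density 0 (sqrt (s n)) x * normal_density 0 (sqrt (s n)) y \<ge> 0"
        using m k h_nn[of "a j"] \<sigma>_pos[of n] s_pos(1)[of n] by auto
      show "ennreal (h (a j) * k) * (ennreal (exp (- (A (j, False))\<^sup>2 / (2 * (\<Lambda> + (\<sigma> n)\<^sup>2))) * (\<sigma> n / sqrt (\<mu> + (\<sigma> n)\<^sup>2))) *
          ennreal (exp (- (A (j, True))\<^sup>2 / (2 * (\<Lambda> + (\<sigma> n)\<^sup>2))) * (\<sigma> n / sqrt (\<mu> + (\<sigma> n)\<^sup>2)))) =
          ennreal (s n / (\<mu> + (\<sigma> n)\<^sup>2)) * K n (a j)"
        unfolding K_def A_def fst_conv snd_conv if_True if_False s_def[symmetric] x_def[symmetric] y_def[symmetric]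
        using eq nn by (simp only: ennreal_mult[symmetric] mult_nonneg_nonneg)
    qed
    finally show ?thesis .
  qed
  have step3: "(\<integral>\<^sup>+\<omega>. \<integral>\<^sup>+z. Z n \<omega> z \<partial>PiM S (\<lambda>_. N2) \<partial>M) \<le> ennreal ((b * (s n / (\<mu> + (\<sigma> n)\<^sup>2))) ^ card S)" for n
  proof -
    have m: "s n / (\<mu> + (\<sigma> n)\<^sup>2) \<ge> 0" using pos s_pos(1)[of n] by (simp add: add_pos_nonneg less_imp_le)
    have "(\<integral>\<^sup>+\<omega>. \<integral>\<^sup>+z. Z n \<omega> z \<partial>PiM S (\<lambda>_. N2) \<partial>M) = (\<integral>\<^sup>+a. \<integral>\<^sup>+\<omega>. (\<Prod>j\<in>S. G n (a j) (X j \<omega>, V j \<omega>)) \<partial>M \<partial>PiM S (\<lambda>_. L2))"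
      supply mm[measurable] comp1[measurable] comp2[measurable] unfolding step1 by (rule Q.Fubini'[symmetric]) measurable
    also have "\<dots> \<le> (\<integral>\<^sup>+a. (\<Prod>j\<in>S. ennreal (s n / (\<mu> + (\<sigma> n)\<^sup>2)) * K n (a j)) \<partial>PiM S (\<lambda>_. L2))"
      by (intro nn_integral_mono step2)
    also have "\<dots> = (\<Prod>j\<in>S. \<integral>\<^sup>+a. ennreal (s n / (\<mu> + (\<sigma> n)\<^sup>2)) * K n a \<partial>L2)"
      by (rule PL.product_nn_integral_prod[OF \<open>finite S\<close>]) measurable
    also have "\<dots> = (\<Prod>j\<in>S. ennreal (s n / (\<mu> + (\<sigma> n)\<^sup>2)) * (\<integral>\<^sup>+x. \<integral>\<^sup>+v. K n (x, v) \<partial>lborel \<partial>lborel))"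
      unfolding L2_def by (simp only: nn_integral_cmult[OF KL] lborel.nn_integral_fst[OF KL])
    also have "\<dots> \<le> (\<Prod>j\<in>S. ennreal (s n / (\<mu> + (\<sigma> n)\<^sup>2)) * ennreal b)"
      using h_le[OF s_pos(2)] by (intro prod_mono_ennreal mult_left_mono) (auto simp: K_def)
    also have "\<dots> = ennreal ((b * (s n / (\<mu> + (\<sigma> n)\<^sup>2))) ^ card S)"
      by (simp only: prod_constant ennreal_mult[symmetric, OF m b] ennreal_power[OF mult_nonneg_nonneg[OF m b]]) (simp only: mult.commute)
    finally show ?thesis .
  qed
  have "(\<integral>\<^sup>+\<omega>. (\<Prod>j\<in>S. ennreal (h (X j \<omega>, V j \<omega>))) \<partial>M) = (\<integral>\<^sup>+\<omega>. \<integral>\<^sup>+z. (\<Prod>j\<in>S. ennreal (h (X j \<omega>, V j \<omega>))) \<partial>PiM S (\<lambda>_. N2) \<partial>M)"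
    by (simp add: PP.emeasure_space_1)
  also have "\<dots> \<le> (\<integral>\<^sup>+\<omega>. \<integral>\<^sup>+z. liminf (\<lambda>n. Z n \<omega> z) \<partial>PiM S (\<lambda>_. N2) \<partial>M)"
    by (intro nn_integral_mono pw)
  also have "\<dots> \<le> (\<integral>\<^sup>+\<omega>. liminf (\<lambda>n. \<integral>\<^sup>+z. Z n \<omega> z \<partial>PiM S (\<lambda>_. N2)) \<partial>M)"
  proof (rule nn_integral_mono, rule nn_integral_liminf)
    show "\<And>\<omega> n. \<omega> \<in> space M \<Longrightarrow> Z n \<omega> \<in> borel_measurable (PiM S (\<lambda>_. N2))"
      supply mm[measurable] comp1[measurable] comp2[measurable] unfolding Z_def by measurable
  qed
  also have "\<dots> \<le> liminf (\<lambda>n. \<integral>\<^sup>+\<omega>. \<integral>\<^sup>+z. Z n \<omega> z \<partial>PiM S (\<lambda>_. N2) \<partial>M)"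
    by (rule nn_integral_liminf) measurable
  also have "\<dots> \<le> liminf (\<lambda>n. ennreal ((b * (s n / (\<mu> + (\<sigma> n)\<^sup>2))) ^ card S))"
    by (intro Liminf_mono always_eventually allI step3)
  also have "\<dots> = ennreal ((b * \<Lambda> / \<mu>) ^ card S)"
  proof (rule lim_imp_Liminf)
    have "(\<lambda>n. (b * (s n / (\<mu> + (\<sigma> n)\<^sup>2))) ^ card S) \<longlonglongrightarrow> (b * ((\<Lambda> + 0\<^sup>2) / (\<mu> + 0\<^sup>2))) ^ card S"
      unfolding s_def using pos by (intro tendsto_intros \<sigma>_lim) auto
    then show "(\<lambda>n. ennreal ((b * (s n / (\<mu> + (\<sigma> n)\<^sup>2))) ^ card S)) \<longlonglongrightarrow> ennreal ((b * \<Lambda> / \<mu>) ^ card S)"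
      by (intro tendsto_ennrealI) simp
  qed simp
  finally show ?thesis .
qed

text \<open>Expand the product over subsets of J, bound each sub-product, and resum by the binomial
  theorem. This suits exponentials that equal 1 off a rare event: u is then supported on that
  event.\<close>

lemma nn_integral_prod_one_plus_le:
  fixes u :: "'j \<Rightarrow> 'a \<Rightarrow> real"
  assumes "finite J" and [measurable]: "\<And>j. j \<in> J \<Longrightarrow> u j \<in> borel_measurable M"
    and nn: "\<And>j \<omega>. u j \<omega> \<ge> 0" and "b \<ge> 0"
    and le: "\<And>S. S \<subseteq> J \<Longrightarrow> (\<integral>\<^sup>+\<omega>. (\<Prod>j\<in>S. ennreal (u j \<omega>)) \<partial>M) \<le> ennreal (b ^ card S)"
  shows "(\<integral>\<^sup>+\<omega>. (\<Prod>j\<in>J. ennreal (1 + u j \<omega>)) \<partial>M) \<le> ennreal ((1 + b) ^ card J)"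
proof -
  have "(\<integral>\<^sup>+\<omega>. (\<Prod>j\<in>J. ennreal (1 + u j \<omega>)) \<partial>M) = (\<integral>\<^sup>+\<omega>. (\<Sum>S\<in>Pow J. \<Prod>j\<in>S. ennreal (u j \<omega>)) \<partial>M)"
    using prod_add[OF \<open>finite J\<close>, of "\<lambda>j. ennreal (u j _)" "\<lambda>_. 1"]
    by (simp add: ennreal_plus nn add.commute)
  also have "\<dots> = (\<Sum>S\<in>Pow J. \<integral>\<^sup>+\<omega>. (\<Prod>j\<in>S. ennreal (u j \<omega>)) \<partial>M)"
    by (rule nn_integral_sum) (auto intro!: borel_measurable_prod_ennreal)
  also have "\<dots> \<le> (\<Sum>S\<in>Pow J. ennreal (b ^ card S))"
    by (intro sum_mono le) auto
  also have "\<dots> = ennreal (\<Sum>S\<in>Pow J. b ^ card S)"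
    using \<open>b \<ge> 0\<close> by (intro sum_ennreal) auto
  also have "(\<Sum>S\<in>Pow J. b ^ card S) = (1 + b) ^ card J"
    using prod_add[OF \<open>finite J\<close>, of "\<lambda>_. b" "\<lambda>_. 1"] by (simp add: add.commute)
  finally show ?thesis .
qed

section \<open>Zeroes of holomorphic functions near a real interval\<close>

text \<open>The quotient extends holomorphically over s, and on the circle of radius r the
  denominator is at least r - |s|. The maximum principle carries the bound inside.\<close>

lemma holomorphic_divided_difference:
  assumes hol: "Z holomorphic_on ball 0 R1" and r: "0 < r" "r < R1" "norm s < r"
    and M: "\<And>z. norm z \<le> r \<Longrightarrow> norm (Z z - Z s) \<le> M"
  obtains Z1 where "Z1 holomorphic_on ball 0 R1" "\<And>z. Z z - Z s = (z - s) * Z1 z"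
    "Z1 s = deriv Z s" "\<And>z. norm z \<le> r \<Longrightarrow> norm (Z1 z) \<le> M / (r - norm s)"
proof
  define Z1 where "Z1 z = (if z = s then deriv Z s else (Z z - Z s) / (z - s))" for z
  show h1: "Z1 holomorphic_on ball 0 R1"
    unfolding Z1_def by (rule pole_lemma[OF hol]) (use r in \<open>auto simp: interior_open\<close>)
  show "Z z - Z s = (z - s) * Z1 z" for z by (simp add: Z1_def)
  show "Z1 s = deriv Z s" by (simp add: Z1_def)
  show "norm (Z1 z) \<le> M / (r - norm s)" if "norm z \<le> r" for z
  proof (rule maximum_modulus_frontier[where S = "cball 0 r" and f = Z1])
    show "Z1 holomorphic_on interior (cball 0 r)"
      using h1 r by (auto intro: holomorphic_on_subset)
    show "continuous_on (closure (cball 0 r)) Z1"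
      using h1 r by (intro holomorphic_on_imp_continuous_on) (auto intro: holomorphic_on_subset)
    show "z \<in> cball 0 r" using that by simp
    fix w assume "w \<in> frontier (cball (0::complex) r)"
    then have w: "norm w = r" using r(1) by (simp add: frontier_cball)
    then have "r - norm s \<le> norm (w - s)" using norm_triangle_ineq2[of w s] by simp
    moreover have "w \<noteq> s" using w r by auto
    moreover have "norm (Z w - Z s) \<le> M" using M w by simp
    moreover have "M \<ge> 0" using M[of s] r(3) by simp
    ultimately show "norm (Z1 w) \<le> M / (r - norm s)"
      unfolding Z1_def using r by (auto simp: norm_divide intro!: frac_le)
  qed (use that in auto)
qed

text \<open>A Jensen inequality obtained by dividing out the zeroes one at a time. Each division
  multiplies the bound on the disc by 1 / (r - d) and the value at 0 by at most d. Zeroes are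
  counted as distinct points, so the others survive a division.\<close>

lemma holomorphic_zeros_bound:
  assumes "finite S" "Z holomorphic_on ball 0 R1" and r: "0 \<le> d" "d < r" "r < R1"
    and "\<And>z. norm z \<le> r \<Longrightarrow> norm (Z z) \<le> M"
    and "\<And>s. s \<in> S \<Longrightarrow> 0 \<le> s \<and> s \<le> d \<and> Z (of_real s) = 0"
  shows "norm (Z 0) \<le> M * (d / (r - d)) ^ card S"
  using assms(1,2,6,7)
proof (induction S arbitrary: Z M rule: finite_induct)
  case empty
  then show ?case using r by simp
next
  case (insert s S)
  have s: "0 \<le> s" "s \<le> d" "Z (of_real s) = 0" using insert.prems(3) by auto
  obtain Z1 where Z1: "Z1 holomorphic_on ball 0 R1" "\<And>z. Z z - Z (of_real s) = (z - of_real s) * Z1 z"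
    "\<And>z. norm z \<le> r \<Longrightarrow> norm (Z1 z) \<le> M / (r - norm (complex_of_real s))"
    by (rule holomorphic_divided_difference[OF insert.prems(1), of r "of_real s" M])
       (use r s insert.prems(2) in auto)
  have M0: "M \<ge> 0" using insert.prems(2)[of 0] r norm_ge_zero[of "Z 0"] by (auto simp del: norm_ge_zero)
  have "norm (Z1 0) \<le> M / (r - d) * (d / (r - d)) ^ card S"
  proof (rule insert.IH[OF Z1(1)])
    show "norm (Z1 z) \<le> M / (r - d)" if "norm z \<le> r" for z
    proof -
      have "M / (r - norm (complex_of_real s)) \<le> M / (r - d)"
        using M0 s r by (intro divide_left_mono) auto
      then show ?thesis using Z1(3)[OF that] by linarith
    qed
    show "0 \<le> t \<and> t \<le> d \<and> Z1 (of_real t) = 0" if "t \<in> S" for t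
      using Z1(2)[of "of_real t"] that insert.prems(3)[of t] s(3) insert.hyps(2) by auto
  qed
  moreover have "norm (Z 0) = s * norm (Z1 0)"
    using Z1(2)[of 0] s by (simp add: norm_mult)
  ultimately have "norm (Z 0) \<le> d * (M / (r - d) * (d / (r - d)) ^ card S)"
    using s by (simp only:) (intro mult_mono, auto)
  then show ?case using insert.hyps by (simp add: mult_ac)
qed

text \<open>Two divided differences at 0; each one doubles the bound and divides it by r.\<close>

lemma holomorphic_second_order_bound:
  assumes hol: "Z holomorphic_on ball 0 R1" and r: "0 < r" "r < R1" "norm w \<le> r"
    and M: "\<And>z. norm z \<le> r \<Longrightarrow> norm (Z z) \<le> M"
  shows "norm (Z w - Z 0 - w * deriv Z 0) \<le> 4 * M * (norm w)\<^sup>2 / r\<^sup>2"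
proof -
  have "norm (Z z - Z 0) \<le> 2 * M" if "norm z \<le> r" for z
    using norm_triangle_ineq4[of "Z z" "Z 0"] M[OF that] M[of 0] r by simp
  then obtain Z1 where Z1: "Z1 holomorphic_on ball 0 R1" "\<And>z. Z z - Z 0 = (z - 0) * Z1 z"
      "Z1 0 = deriv Z 0" "\<And>z. norm z \<le> r \<Longrightarrow> norm (Z1 z) \<le> 2 * M / (r - norm (0::complex))"
    using holomorphic_divided_difference[OF hol, of r 0 "2 * M"] r by auto
  have st: "norm (Z1 z - Z1 0) \<le> 2 * (2 * M / r)" if "norm z \<le> r" for z
    using norm_triangle_ineq4[of "Z1 z" "Z1 0"] Z1(4)[OF that] Z1(4)[of 0] r by simp
  obtain Z2 where Z2: "\<And>z. Z1 z - Z1 0 = (z - 0) * Z2 z"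
      "\<And>z. norm z \<le> r \<Longrightarrow> norm (Z2 z) \<le> 2 * (2 * M / r) / (r - norm (0::complex))"
    by (rule holomorphic_divided_difference[OF Z1(1), of r 0 "2 * (2 * M / r)"]) (use r st in auto)
  have "Z w - Z 0 - w * deriv Z 0 = w * (Z1 w - Z1 0)" using Z1(2)[of w] Z1(3) by (simp add: algebra_simps)
  also have "\<dots> = w * w * Z2 w" using Z2(1)[of w] by simp
  finally have "norm (Z w - Z 0 - w * deriv Z 0) = (norm w)\<^sup>2 * norm (Z2 w)"
    by (simp add: norm_mult power2_eq_square)
  also have "\<dots> \<le> (norm w)\<^sup>2 * (4 * M / r\<^sup>2)"
    using Z2(2)[OF r(3)] by (intro mult_left_mono) (auto simp: power2_eq_square)
  finally show ?thesis by (simp add: mult_ac)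
qed

text \<open>Cauchy's formula with kernel at most 2 on the half disc, followed by comparing the mean
  with the mean square. The supremum is thereby replaced by a quadratic functional, whose
  exponential moments are accessible for Gaussian values.\<close>

lemma holomorphic_le_circle_L2_mean:
  assumes hol: "Z holomorphic_on ball 0 R1" and R: "0 < R" "R < R1" and w: "norm w \<le> R / 2"
  shows "norm (Z w) \<le> 2 * sqrt (integral {0..1} (\<lambda>t. (norm (Z (of_real R * exp (2 * of_real pi * \<i> * of_real t))))\<^sup>2))"
proof -
  define u where "u t = of_real R * exp (2 * of_real pi * \<i> * of_real t)" for t :: real
  have nu: "norm (u t) = R" for t using R by (simp add: u_def norm_mult)
  have cont_u: "continuous_on {0..1} u" unfolding u_def by (intro continuous_intros)
  have cont_Z: "continuous_on {0..1} (\<lambda>t. Z (u t))"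
    using R by (intro continuous_on_compose2[OF holomorphic_on_imp_continuous_on[OF hol] cont_u]) (auto simp: nu)
  define m where "m = integral {0..1} (\<lambda>t. norm (Z (u t)))"
  define q where "q = integral {0..1} (\<lambda>t. (norm (Z (u t)))\<^sup>2)"
  have int1: "(\<lambda>t. norm (Z (u t))) integrable_on {0..1}"
    and int2: "(\<lambda>t. (norm (Z (u t)))\<^sup>2) integrable_on {0..1}"
    by (intro integrable_continuous_real continuous_intros cont_Z)+
  \<comment> \<open>Nonnegativity of the variance of |Z| over the circle gives m^2 at most
    q.\<close>
  have "0 \<le> integral {0..1} (\<lambda>t. (norm (Z (u t)) - m)\<^sup>2)"
    by (rule integral_nonneg) (auto intro!: integrable_continuous_real continuous_intros cont_Z)
  also have "integral {0..1} (\<lambda>t. (norm (Z (u t)) - m)\<^sup>2) =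
      integral {0..1} (\<lambda>t. ((norm (Z (u t)))\<^sup>2 - (2 * m) * norm (Z (u t))) + m\<^sup>2)"
    by (intro Henstock_Kurzweil_Integration.integral_cong) (simp add: power2_eq_square algebra_simps)
  also have "\<dots> = q - 2 * m * m + m\<^sup>2"
  proof -
    have i3: "(\<lambda>t. 2 * m * norm (Z (u t))) integrable_on {0..1}"
      using integrable_on_cmult_left[OF int1, of "2 * m"] by simp
    have i4: "(\<lambda>t. (norm (Z (u t)))\<^sup>2 - 2 * m * norm (Z (u t))) integrable_on {0..1}"
      by (intro integrable_diff int2 i3)
    show ?thesis
      using Henstock_Kurzweil_Integration.integral_add[OF i4 integrable_const_ivl[of "m\<^sup>2" 0 1]]
        Henstock_Kurzweil_Integration.integral_diff[OF int2 i3]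
      by (simp add: m_def[symmetric] q_def[symmetric])
  qed
  finally have "m\<^sup>2 \<le> q" by (simp add: power2_eq_square)
  then have mq: "m \<le> sqrt q" by (rule real_le_rsqrt)
  have "((\<lambda>z. Z z / (z - w)) has_contour_integral (2 * of_real pi * \<i> * Z w)) (circlepath 0 R)"
  proof (rule Cauchy_integral_circlepath)
    show "continuous_on (cball 0 R) Z" using hol R
      by (intro holomorphic_on_imp_continuous_on) (auto intro: holomorphic_on_subset)
    show "Z holomorphic_on ball 0 R" using hol R by (auto intro: holomorphic_on_subset)
    show "norm (w - 0) < R" using w R by simp
  qed
  then have h1: "((\<lambda>t. Z (circlepath 0 R t) / (circlepath 0 R t - w) * vector_derivative (circlepath 0 R) (at t within {0..1}))
      has_integral (2 * of_real pi * \<i> * Z w)) {0..1}"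
    by (simp add: has_contour_integral_def)
  have "Z (circlepath 0 R t) / (circlepath 0 R t - w) * vector_derivative (circlepath 0 R) (at t within {0..1}) =
      Z (u t) / (u t - w) * (2 * of_real pi * \<i> * u t)" if "t \<in> {0..1}" for t
  proof -
    have "circlepath 0 R t = u t" by (simp add: circlepath u_def mult_ac)
    moreover have "vector_derivative (circlepath 0 R) (at t within {0..1}) = 2 * of_real pi * \<i> * u t"
      using that by (subst vector_derivative_circlepath01) (auto simp: u_def mult_ac)
    ultimately show ?thesis by simp
  qed
  then have "((\<lambda>t. Z (u t) / (u t - w) * (2 * of_real pi * \<i> * u t)) has_integral (2 * of_real pi * \<i> * Z w)) {0..1}"
    using h1 by (rule has_integral_eq)
  then have "((\<lambda>t. (1 / (2 * of_real pi * \<i>)) * (Z (u t) / (u t - w) * (2 * of_real pi * \<i> * u t))) has_integral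
      (1 / (2 * of_real pi * \<i>)) * (2 * of_real pi * \<i> * Z w)) {0..1}"
    by (rule has_integral_mult_right)
  then have hi: "((\<lambda>t. Z (u t) / (u t - w) * u t) has_integral Z w) {0..1}"
    by (simp add: field_simps)
  have "norm (Z w) = norm (integral {0..1} (\<lambda>t. Z (u t) / (u t - w) * u t))"
    using hi by (simp add: integral_unique)
  also have "\<dots> \<le> integral {0..1} (\<lambda>t. 2 * norm (Z (u t)))"
  proof (rule integral_norm_bound_integral)
    show "(\<lambda>t. Z (u t) / (u t - w) * u t) integrable_on {0..1}" using hi by (rule has_integral_integrable)
    show "(\<lambda>t. 2 * norm (Z (u t))) integrable_on {0..1}" using integrable_on_cmult_left[OF int1, of 2] by simp
    fix t :: real
    have "R / 2 \<le> norm (u t - w)" using norm_triangle_ineq2[of "u t" w] w nu[of t] by simp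
    moreover have "norm (u t - w) > 0" using calculation R by linarith
    ultimately have "R / norm (u t - w) \<le> R / (R / 2)" using R by (intro divide_left_mono) auto
    then have "R / norm (u t - w) \<le> 2" using R by simp
    then have "norm (Z (u t)) * (R / norm (u t - w)) \<le> norm (Z (u t)) * 2" by (rule mult_left_mono) simp
    then show "norm (Z (u t) / (u t - w) * u t) \<le> 2 * norm (Z (u t))"
      by (simp add: norm_mult norm_divide nu mult_ac)
  qed
  also have "\<dots> = 2 * m" by (simp add: m_def)
  finally show ?thesis using mq by (simp add: q_def u_def)
qed

text \<open>The count exceeds the indicator in two ways. With two zeroes, the Jensen bound makes f 0
  of order d^2. With one zero s and no sign change, the linearisation l is of order d^2 at s by the
  second order bound, while it keeps its sign on [-\<gamma> d, (1 + \<gamma>) d]. Since s stays at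
  distance \<gamma> d from both ends, l(s) controls l at the ends, hence l(0) = f 0, at the price of
  the factor (1 + 2 \<gamma>) / \<gamma>.\<close>

lemma zeros_count_bound:
  fixes f :: "real \<Rightarrow> real" and v \<gamma> d R R1 :: real
  defines "C \<equiv> 16 * ((1 + 2 * \<gamma>) / \<gamma>) / R\<^sup>2"
  assumes hol: "Z holomorphic_on ball 0 R1" and R: "0 < R" "R < R1"
    and f: "\<And>s. 0 \<le> s \<Longrightarrow> s \<le> d \<Longrightarrow> complex_of_real (f s) = Z (of_real s)"
    and v: "complex_of_real v = deriv Z 0"
    and q: "q = integral {0..1} (\<lambda>t. (norm (Z (of_real R * exp (2 * of_real pi * \<i> * of_real t))))\<^sup>2)"
    and d: "0 < d" "12 * d \<le> R" and \<gamma>: "\<gamma> > 0" and f0: "f 0 \<noteq> 0"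
  shows "finite {s\<in>{0..d}. f s = 0}"
    and "real (card {s\<in>{0..d}. f s = 0}) > of_bool ((f 0 - \<gamma> * d * v) * (f 0 + (1 + \<gamma>) * d * v) < 0) \<Longrightarrow>
      \<bar>f 0\<bar> \<le> C * (2 * sqrt q) * d\<^sup>2 \<and> real (card {s\<in>{0..d}. f s = 0}) \<le> ln (2 * sqrt q / \<bar>f 0\<bar>)"
proof -
  define A where "A = 2 * sqrt q"
  have A: "norm (Z w) \<le> A" if "norm w \<le> R / 2" for w
    unfolding A_def q by (rule holomorphic_le_circle_L2_mean[OF hol R that])
  have nf: "\<bar>f s\<bar> = norm (Z (of_real s))" if "0 \<le> s" "s \<le> d" for s
    using f[OF that] by (metis norm_of_real)
  have Apos: "A > 0" using A[of 0] nf[of 0] f0 R d by (auto intro: less_le_trans)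
  \<comment> \<open>The bound on |Z| holds on radius R/2, and 12 d at most R makes the gain per zero
    at most 1/3.\<close>
  have ratio: "d / (R / 2 - d) \<le> 4 * d / R" "4 * d / R \<le> 1 / 3"
  proof -
    have "d / (R / 2 - d) \<le> d / (R / 4)" using R d by (intro divide_left_mono) auto
    then show "d / (R / 2 - d) \<le> 4 * d / R" by (simp add: mult.commute)
    show "4 * d / R \<le> 1 / 3" using R d by (simp add: field_simps)
  qed
  have bnd: "\<bar>f 0\<bar> \<le> A * (4 * d / R) ^ card S" if "finite S" "S \<subseteq> {s\<in>{0..d}. f s = 0}" for S
  proof -
    have "norm (Z 0) \<le> A * (d / (R / 2 - d)) ^ card S"
    proof (rule holomorphic_zeros_bound[OF that(1) hol])
      show "0 \<le> s \<and> s \<le> d \<and> Z (of_real s) = 0" if "s \<in> S" for s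
        using \<open>S \<subseteq> _\<close> that f[of s] by auto
    qed (use d R A in auto)
    also have "\<dots> \<le> A * (4 * d / R) ^ card S"
      using ratio(1) Apos d R by (intro mult_left_mono power_mono) auto
    finally show ?thesis using nf[of 0] d by simp
  qed
  \<comment> \<open>A factor 1/3 per zero and ln 3 at least 1 give one unit of logarithm per
    zero.\<close>
  have lnb: "real (card S) \<le> ln (A / \<bar>f 0\<bar>)" if "finite S" "S \<subseteq> {s\<in>{0..d}. f s = 0}" for S
  proof -
    have "\<bar>f 0\<bar> \<le> A * (1 / 3) ^ card S"
      using bnd[OF that] ratio(2) Apos d R
      by (elim order_trans) (intro mult_left_mono power_mono, auto)
    then have "3 ^ card S \<le> A / \<bar>f 0\<bar>" using f0 by (simp add: field_simps)
    then have "ln (3 ^ card S) \<le> ln (A / \<bar>f 0\<bar>)" by (subst ln_le_cancel_iff) (use Apos f0 in auto)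
    moreover have "ln (3::real) \<ge> 1" using exp_le by (subst ln_ge_iff) auto
    then have "real (card S) * 1 \<le> real (card S) * ln 3" by (intro mult_left_mono) auto
    ultimately show ?thesis by (simp add: ln_realpow)
  qed
  show fin: "finite {s\<in>{0..d}. f s = 0}"
  proof (rule ccontr)
    assume "infinite {s\<in>{0..d}. f s = 0}"
    then obtain S where "finite S" "card S = Suc (nat \<lceil>ln (A / \<bar>f 0\<bar>)\<rceil>)" "S \<subseteq> {s\<in>{0..d}. f s = 0}"
      using infinite_arbitrarily_large by blast
    then show False using lnb[of S] by linarith
  qed
  assume gt: "real (card {s\<in>{0..d}. f s = 0}) > of_bool ((f 0 - \<gamma> * d * v) * (f 0 + (1 + \<gamma>) * d * v) < 0)"
  let ?S = "{s\<in>{0..d}. f s = 0}"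
  have C16: "16 / R\<^sup>2 \<le> C"
  proof -
    have "(1 + 2 * \<gamma>) / \<gamma> \<ge> 1" using \<gamma> by (simp add: field_simps)
    then have "16 * 1 \<le> 16 * ((1 + 2 * \<gamma>) / \<gamma>)" by (intro mult_left_mono) auto
    then have "16 * 1 / R\<^sup>2 \<le> 16 * ((1 + 2 * \<gamma>) / \<gamma>) / R\<^sup>2" by (intro divide_right_mono) auto
    then show ?thesis by (simp only: C_def mult_1_right)
  qed
  have "\<bar>f 0\<bar> \<le> C * A * d\<^sup>2"
  proof (cases "card ?S \<ge> 2")
    case True
    obtain S where S: "S \<subseteq> ?S" "card S = 2" "finite S" by (rule obtain_subset_with_card_n[OF True])
    have "\<bar>f 0\<bar> \<le> 16 / R\<^sup>2 * (A * d\<^sup>2)" using bnd[OF S(3,1)] S(2) by (simp add: power_divide power_mult_distrib mult_ac)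
    also have "\<dots> \<le> C * (A * d\<^sup>2)" using C16 Apos by (intro mult_right_mono) auto
    finally show ?thesis by (simp add: mult_ac)
  next
    case False
    with gt have c1: "card ?S = 1" and T: "(f 0 - \<gamma> * d * v) * (f 0 + (1 + \<gamma>) * d * v) \<ge> 0"
      by (auto split: if_splits simp: of_bool_def)
    from c1 obtain s where s: "0 \<le> s" "s \<le> d" "f s = 0" by (auto simp: card_1_singleton_iff)
    define l where "l u = f 0 + u * v" for u
    have "norm (Z (of_real s) - Z 0 - of_real s * deriv Z 0) \<le> 4 * A * (norm (complex_of_real s))\<^sup>2 / (R / 2)\<^sup>2"
      by (rule holomorphic_second_order_bound[OF hol]) (use R s d A in auto)
    also have "Z (of_real s) - Z 0 - of_real s * deriv Z 0 = - of_real (l s)"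
      using f[of s] f[of 0] s d by (simp add: v[symmetric] l_def)
    finally have "\<bar>l s\<bar> \<le> 16 * A * s\<^sup>2 / R\<^sup>2" using s by (simp add: power_divide)
    also have "\<dots> \<le> 16 * A * d\<^sup>2 / R\<^sup>2" using s Apos by (intro divide_right_mono mult_left_mono power_mono) auto
    finally have ls: "\<bar>l s\<bar> \<le> 16 * A * d\<^sup>2 / R\<^sup>2" .
    \<comment> \<open>Multiplied by the interval length, l(s) is the combination of the end values
      with weights (1 + \<gamma>) d - s and s + \<gamma> d, both at least \<gamma> d. For
      nonnegative end values it therefore dominates \<gamma> d times the larger one.\<close>
    have key: "\<gamma> * x \<le> (1 + 2 * \<gamma>) * y"
      if "a \<ge> 0" "b \<ge> 0" "x \<le> max a b" "(1 + 2 * \<gamma>) * d * y = ((1 + \<gamma>) * d - s) * a + (s + \<gamma> * d) * b" for a b x y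
    proof -
      have "(1 + \<gamma>) * d - s \<ge> \<gamma> * d" "s + \<gamma> * d \<ge> \<gamma> * d" using s by (auto simp: algebra_simps)
      then have "((1 + \<gamma>) * d - s) * a \<ge> \<gamma> * d * a" "(s + \<gamma> * d) * b \<ge> \<gamma> * d * b"
        using that by (auto intro: mult_right_mono)
      moreover have "\<gamma> * d * a \<ge> 0" "\<gamma> * d * b \<ge> 0" using \<gamma> d that by auto
      moreover have "\<gamma> * d * max a b = max (\<gamma> * d * a) (\<gamma> * d * b)"
        using \<gamma> d by (simp add: max_mult_distrib_left)
      moreover have "\<gamma> * d * x \<le> \<gamma> * d * max a b" using \<gamma> d that(3) by (intro mult_left_mono) auto
      ultimately have "\<gamma> * d * x \<le> (1 + 2 * \<gamma>) * d * y" using that(4) by linarith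
      then have "d * (\<gamma> * x) \<le> d * ((1 + 2 * \<gamma>) * y)" by (simp add: mult_ac)
      then show ?thesis using d by simp
    qed
    have "\<gamma> * \<bar>f 0\<bar> \<le> (1 + 2 * \<gamma>) * \<bar>l s\<bar>"
    proof -
      \<comment> \<open>The linearisation at the two ends, l(-\<gamma> d) and l((1 + \<gamma>) d).
        The hypothesis \<open>T\<close> says that they do not have opposite signs.\<close>
      define a b where "a = f 0 - \<gamma> * d * v" and "b = f 0 + (1 + \<gamma>) * d * v"
      have x: "(1 + 2 * \<gamma>) * f 0 = (1 + \<gamma>) * a + \<gamma> * b" by (simp add: a_def b_def algebra_simps)
      have y: "(1 + 2 * \<gamma>) * d * l s = ((1 + \<gamma>) * d - s) * a + (s + \<gamma> * d) * b"
        by (simp add: a_def b_def l_def algebra_simps)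
      have x1: "f 0 \<le> max a b"
      proof -
        have "(1 + \<gamma>) * a + \<gamma> * b \<le> (1 + \<gamma>) * max a b + \<gamma> * max a b"
          using \<gamma> by (intro add_mono mult_left_mono) auto
        then have "(1 + 2 * \<gamma>) * f 0 \<le> (1 + 2 * \<gamma>) * max a b" unfolding x by (simp add: algebra_simps)
        then show ?thesis using \<gamma> by simp
      qed
      have x2: "- f 0 \<le> max (- a) (- b)"
      proof -
        have "(1 + \<gamma>) * (- a) + \<gamma> * (- b) \<le> (1 + \<gamma>) * max (- a) (- b) + \<gamma> * max (- a) (- b)"
          using \<gamma> by (intro add_mono mult_left_mono) auto
        then have "(1 + 2 * \<gamma>) * (- f 0) \<le> (1 + 2 * \<gamma>) * max (- a) (- b)" using x by (simp add: algebra_simps)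
        then show ?thesis by (rule mult_left_le_imp_le) (use \<gamma> in simp)
      qed
      from T have "a \<ge> 0 \<and> b \<ge> 0 \<or> a \<le> 0 \<and> b \<le> 0" by (simp add: a_def b_def zero_le_mult_iff)
      then show ?thesis
      proof
        assume ab: "a \<ge> 0 \<and> b \<ge> 0"
        then have "\<gamma> * f 0 \<le> (1 + 2 * \<gamma>) * l s" using key[OF _ _ x1 y] by simp
        moreover have "(1 + 2 * \<gamma>) * f 0 \<ge> 0" unfolding x using ab \<gamma> by simp
        then have "f 0 \<ge> 0" using \<gamma> by (simp add: zero_le_mult_iff)
        moreover have "(1 + 2 * \<gamma>) * l s \<le> (1 + 2 * \<gamma>) * \<bar>l s\<bar>" using \<gamma> by (intro mult_left_mono) auto
        ultimately show ?thesis by simp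
      next
        assume ab: "a \<le> 0 \<and> b \<le> 0"
        have yneg: "(1 + 2 * \<gamma>) * d * (- l s) = ((1 + \<gamma>) * d - s) * (- a) + (s + \<gamma> * d) * (- b)"
          using y by simp
        then have "\<gamma> * (- f 0) \<le> (1 + 2 * \<gamma>) * (- l s)" using key[OF _ _ x2 yneg] ab by simp
        moreover have "(1 + 2 * \<gamma>) * f 0 \<le> 0" unfolding x using ab \<gamma>
          by (intro add_nonpos_nonpos mult_nonneg_nonpos) auto
        then have "f 0 \<le> 0" using \<gamma> by (simp add: mult_le_0_iff)
        moreover have "(1 + 2 * \<gamma>) * (- l s) \<le> (1 + 2 * \<gamma>) * \<bar>l s\<bar>" using \<gamma> by (intro mult_left_mono) auto
        ultimately show ?thesis by simp
      qed
    qed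
    also have "\<dots> \<le> (1 + 2 * \<gamma>) * (16 * A * d\<^sup>2 / R\<^sup>2)" using ls \<gamma> by (intro mult_left_mono) auto
    finally have "\<bar>f 0\<bar> \<le> (1 + 2 * \<gamma>) * (16 * A * d\<^sup>2 / R\<^sup>2) / \<gamma>" using \<gamma> by (subst pos_le_divide_eq) (simp_all only: mult.commute)
    then show ?thesis by (simp add: C_def mult_ac)
  qed
  then show "\<bar>f 0\<bar> \<le> C * (2 * sqrt q) * d\<^sup>2 \<and> real (card {s\<in>{0..d}. f s = 0}) \<le> ln (2 * sqrt q / \<bar>f 0\<bar>)"
    using lnb[OF fin] by (simp add: A_def)
qed

text \<open>If \<open>A \<le> 1 / \<nu> ^ 4\<close> then \<open>A \<le> 1 / x\<close>. Otherwise \<open>ln A\<close> is absorbed in \<open>A\<^sup>2 * \<nu> ^ 6\<close>, and \<open>ln (1 / x)\<close> either is at most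
  \<open>8 * ln A\<close> or forces \<open>x\<close> below the threshold.\<close>

lemma ln_ratio_split:
  fixes A x \<nu> C :: real
  assumes \<nu>: "0 < \<nu>" "\<nu> \<le> 1" and C: "1 \<le> C" "2 * C * \<nu>\<^sup>2 \<le> 1"
    and x: "0 < x" "x \<le> C * A * (\<nu> ^ 5)\<^sup>2" and A: "0 < A"
  shows "ln (A / x) \<le> 18 * A\<^sup>2 * \<nu> ^ 6 + 2 * (if x < 2 * C * \<nu> ^ 6 then ln (1 / x) else 0)"
proof -
  define \<tau> where "\<tau> = 2 * C * \<nu> ^ 6"
  have ln_eq: "ln (A / x) = ln A + ln (1 / x)" using A x by (simp add: ln_div)
  show ?thesis
  proof (cases "A \<le> 1 / \<nu> ^ 4")
    case True
    have "C * A * (\<nu> ^ 5)\<^sup>2 \<le> C * (1 / \<nu> ^ 4) * (\<nu> ^ 5)\<^sup>2"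
      using True C by (intro mult_right_mono mult_left_mono) auto
    also have "\<dots> = C * \<nu> ^ 6" using \<nu> by (simp add: power_mult[symmetric] field_simps power_add[symmetric])
    also have "\<dots> < \<tau>" using C \<nu> by (simp add: \<tau>_def)
    finally have xt: "x < \<tau>" using x by simp
    have "x * A \<le> \<tau> * (1 / \<nu> ^ 4)" using True xt x A by (intro mult_mono) auto
    also have "\<dots> = 2 * C * \<nu>\<^sup>2" unfolding \<tau>_def using \<nu> by (simp add: field_simps power_add[symmetric])
    finally have "A \<le> 1 / x" using C x by (simp add: field_simps)
    then have "ln A \<le> ln (1 / x)" using A x by (subst ln_le_cancel_iff) auto
    then have "ln (A / x) \<le> 2 * ln (1 / x)" using ln_eq by simp
    moreover have "18 * A\<^sup>2 * \<nu> ^ 6 \<ge> 0" using \<nu> by simp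
    moreover have "(if x < 2 * C * \<nu> ^ 6 then ln (1 / x) else 0) = ln (1 / x)" using xt by (simp add: \<tau>_def)
    ultimately show ?thesis by linarith
  next
    case False
    then have Ag: "A > 1 / \<nu> ^ 4" by simp
    have "1 / \<nu> ^ 4 \<ge> 1" using \<nu> by (simp add: power_le_one)
    then have A1: "A > 1" using Ag by simp
    have lnA: "ln A \<le> 2 * A\<^sup>2 * \<nu> ^ 6"
    proof -
      \<comment> \<open>With a = sqrt A the case assumption reads a \<nu>^2 > 1. Inserting its cube
        gives a at most a^4 \<nu>^6 = A^2 \<nu>^6, and ln A = 2 ln a is at most 2a.\<close>
      define a where "a = sqrt A"
      have a: "a > 0" "A = a\<^sup>2" using A by (auto simp: a_def)
      have "(1 / \<nu>\<^sup>2)\<^sup>2 < a\<^sup>2" using Ag a by (simp add: power_divide power_mult[symmetric])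
      then have "1 / \<nu>\<^sup>2 < a" using a by (simp add: power_less_imp_less_base)
      then have "1 < a * \<nu>\<^sup>2" using \<nu> by (simp add: field_simps)
      then have "1 \<le> (a * \<nu>\<^sup>2) ^ 3" by (intro one_le_power) simp
      then have "a * 1 \<le> a * (a * \<nu>\<^sup>2) ^ 3" using a by (intro mult_left_mono) auto
      also have "\<dots> = A\<^sup>2 * \<nu> ^ 6" 
      proof -
        have "(a * \<nu>\<^sup>2) ^ 3 = a ^ 3 * \<nu> ^ 6" by (simp add: power_mult_distrib power_mult[symmetric])
        moreover have "a * a ^ 3 = (a\<^sup>2)\<^sup>2" by (simp add: power_mult[symmetric] power_Suc[symmetric] del: power_Suc)
        ultimately show ?thesis unfolding a(2) by (simp add: mult.assoc[symmetric])
      qed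
      finally have "a \<le> A\<^sup>2 * \<nu> ^ 6" by simp
      moreover have "ln A = 2 * ln a" using a by (simp add: ln_realpow)
      moreover have "ln a \<le> a" using ln_bound[OF a(1)] .
      ultimately show ?thesis by simp
    qed
    show ?thesis
    proof (cases "ln (1 / x) \<le> 8 * ln A")
      case True
      then have "ln (A / x) \<le> 9 * ln A" using ln_eq by simp
      then have le: "ln (A / x) \<le> 18 * A\<^sup>2 * \<nu> ^ 6" using lnA by simp
      have "2 * C * \<nu> ^ 6 = (2 * C * \<nu>\<^sup>2) * \<nu> ^ 4" by (simp add: mult.assoc power_add[symmetric])
      also have "\<dots> \<le> 1 * 1" using C \<nu> by (intro mult_mono) (auto simp: power_le_one)
      finally have "x < 2 * C * \<nu> ^ 6 \<Longrightarrow> x \<le> 1" by simp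
      then have "(if x < 2 * C * \<nu> ^ 6 then ln (1 / x) else 0) \<ge> 0" using x by auto
      with le show ?thesis by linarith
    next
      case False
      then have "ln (A ^ 8) < ln (1 / x)" using A by (simp add: ln_realpow)
      then have "A ^ 8 < 1 / x" using A x by (subst (asm) ln_less_cancel_iff) auto
      then have "x < 1 / A ^ 8" using A x by (simp add: field_simps)
      also have "1 / A ^ 8 \<le> 1 / (1 / \<nu> ^ 4) ^ 8"
        using Ag \<nu> A by (intro divide_left_mono power_mono) auto
      also have "\<dots> = \<nu> ^ 32" by (simp add: power_divide power_mult[symmetric])
      also have "\<dots> \<le> \<nu> ^ 6" using \<nu> by (intro power_decreasing) auto
      also have "\<dots> \<le> \<tau>" unfolding \<tau>_def using C \<nu> by (simp add: mult_left_le)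
      finally have xt: "x < \<tau>" .
      have "ln (A / x) \<le> 2 * ln (1 / x)" using False ln_eq A1 by (smt (verit) ln_gt_zero)
      moreover have "18 * A\<^sup>2 * \<nu> ^ 6 \<ge> 0" using \<nu> by simp
      moreover have "(if x < 2 * C * \<nu> ^ 6 then ln (1 / x) else 0) = ln (1 / x)" using xt by (simp add: \<tau>_def)
      ultimately show ?thesis by linarith
    qed
  qed
qed

section \<open>The spectral isometry\<close>

lemma centered_gaussian_second_moment:
  assumes "prob_space M" "centered_gaussian M Y v"
  shows "(\<integral>\<^sup>+\<omega>. ennreal ((Y \<omega>)\<^sup>2) \<partial>M) = ennreal v"
proof -
  have v: "v \<ge> 0" using assms(2) by (auto simp: centered_gaussian_def)
  have "(\<integral>\<^sup>+\<omega>. ennreal ((Y \<omega>)\<^sup>2) \<partial>M) = (\<integral>\<^sup>+x. ennreal ((sqrt v * x)\<^sup>2) \<partial>std_normal_distribution)"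
    by (rule centered_gaussian_nn_integral[OF assms]) auto
  also have "\<dots> = (\<integral>\<^sup>+x. ennreal v * ennreal (x\<^sup>2) \<partial>std_normal_distribution)"
    using v by (simp add: power_mult_distrib ennreal_mult)
  also have "\<dots> = ennreal v * (\<integral>\<^sup>+x. ennreal (x\<^sup>2) \<partial>std_normal_distribution)"
    by (rule nn_integral_cmult) auto
  also have "(\<integral>\<^sup>+x. ennreal (x\<^sup>2) \<partial>std_normal_distribution) = 1"
    using std_normal_distribution_even_moments[of 1]
    by (subst nn_integral_eq_integral) (auto simp: power2_eq_square)
  finally show ?thesis by simp
qed

lemma AE_summable_of_nn_integral:
  fixes f :: "nat \<Rightarrow> 'a \<Rightarrow> real"
  assumes [measurable]: "\<And>n. f n \<in> borel_measurable M" and nn: "\<And>n x. f n x \<ge> 0"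
    and le: "\<And>n. (\<integral>\<^sup>+x. ennreal (f n x) \<partial>M) \<le> ennreal (b n)" and b: "\<And>n. b n \<ge> 0" "summable b"
  shows "AE x in M. summable (\<lambda>n. f n x)"
proof -
  have "(\<integral>\<^sup>+x. (\<Sum>n. ennreal (f n x)) \<partial>M) = (\<Sum>n. \<integral>\<^sup>+x. ennreal (f n x) \<partial>M)"
    by (rule nn_integral_suminf) measurable
  also have "\<dots> \<le> (\<Sum>n. ennreal (b n))" by (intro suminf_le le) auto
  also have "\<dots> = ennreal (suminf b)" using b by (intro suminf_ennreal2) auto
  also have "\<dots> < \<infinity>" by simp
  finally have "AE x in M. (\<Sum>n. ennreal (f n x)) \<noteq> \<infinity>"
    by (intro nn_integral_noteq_infinite) auto
  then show ?thesis using nn by (auto simp: summable_suminf_not_top)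
qed

lemma power2_le_add:
  fixes a b :: real assumes "\<bar>c\<bar> \<le> \<bar>a\<bar> + \<bar>b\<bar>" shows "c\<^sup>2 \<le> 2 * a\<^sup>2 + 2 * b\<^sup>2"
proof -
  have "c\<^sup>2 \<le> (\<bar>a\<bar> + \<bar>b\<bar>)\<^sup>2" using assms by (metis abs_le_square_iff abs_of_nonneg add_nonneg_nonneg abs_ge_zero)
  also have "\<dots> \<le> 2 * a\<^sup>2 + 2 * b\<^sup>2" using sum_squares_bound[of "\<bar>a\<bar>" "\<bar>b\<bar>"] by (simp add: power2_sum)
  finally show ?thesis .
qed

lemma nn_integral_power2_triangle:
  fixes a b c :: "'a \<Rightarrow> 'b::{second_countable_topology, real_normed_vector}"
  assumes [measurable]: "a \<in> borel_measurable M" "b \<in> borel_measurable M" "c \<in> borel_measurable M"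
  shows "(\<integral>\<^sup>+x. ennreal ((norm (a x - c x))\<^sup>2) \<partial>M) \<le>
    2 * (\<integral>\<^sup>+x. ennreal ((norm (a x - b x))\<^sup>2) \<partial>M) + 2 * (\<integral>\<^sup>+x. ennreal ((norm (b x - c x))\<^sup>2) \<partial>M)"
proof -
  have "(\<integral>\<^sup>+x. ennreal ((norm (a x - c x))\<^sup>2) \<partial>M) \<le>
      (\<integral>\<^sup>+x. 2 * ennreal ((norm (a x - b x))\<^sup>2) + 2 * ennreal ((norm (b x - c x))\<^sup>2) \<partial>M)"
  proof (rule nn_integral_mono)
    fix x
    have "(norm (a x - c x))\<^sup>2 \<le> 2 * (norm (a x - b x))\<^sup>2 + 2 * (norm (b x - c x))\<^sup>2"
      by (rule power2_le_add) (use norm_triangle_ineq[of "a x - b x" "b x - c x"] in simp)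
    then have "ennreal ((norm (a x - c x))\<^sup>2) \<le> ennreal (2 * (norm (a x - b x))\<^sup>2 + 2 * (norm (b x - c x))\<^sup>2)"
      by (rule ennreal_leI)
    also have "\<dots> = 2 * ennreal ((norm (a x - b x))\<^sup>2) + 2 * ennreal ((norm (b x - c x))\<^sup>2)"
      by (simp add: ennreal_plus ennreal_mult)
    finally show "ennreal ((norm (a x - c x))\<^sup>2) \<le> 2 * ennreal ((norm (a x - b x))\<^sup>2) + 2 * ennreal ((norm (b x - c x))\<^sup>2)" .
  qed
  also have "\<dots> = 2 * (\<integral>\<^sup>+x. ennreal ((norm (a x - b x))\<^sup>2) \<partial>M) + 2 * (\<integral>\<^sup>+x. ennreal ((norm (b x - c x))\<^sup>2) \<partial>M)"
    by (subst nn_integral_add) (auto simp: nn_integral_cmult)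
  finally show ?thesis .
qed

text \<open>The squared triangle inequality costs a factor 2 on each term, hence the shares
  \<epsilon> / 4.\<close>

lemma nn_integral_power2_triangle_less:
  fixes a b c :: "'a \<Rightarrow> 'b::{second_countable_topology, real_normed_vector}"
  assumes "a \<in> borel_measurable M" "b \<in> borel_measurable M" "c \<in> borel_measurable M"
    and "(\<integral>\<^sup>+x. ennreal ((norm (a x - b x))\<^sup>2) \<partial>M) < ennreal (\<epsilon> / 4)"
    and "(\<integral>\<^sup>+x. ennreal ((norm (b x - c x))\<^sup>2) \<partial>M) < ennreal (\<epsilon> / 4)" and "\<epsilon> > 0"
  shows "(\<integral>\<^sup>+x. ennreal ((norm (a x - c x))\<^sup>2) \<partial>M) < ennreal \<epsilon>"
proof -
  have "(\<integral>\<^sup>+x. ennreal ((norm (a x - c x))\<^sup>2) \<partial>M) \<le>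
    2 * (\<integral>\<^sup>+x. ennreal ((norm (a x - b x))\<^sup>2) \<partial>M) + 2 * (\<integral>\<^sup>+x. ennreal ((norm (b x - c x))\<^sup>2) \<partial>M)"
    by (rule nn_integral_power2_triangle[OF assms(1-3)])
  also have "\<dots> < 2 * ennreal (\<epsilon> / 4) + 2 * ennreal (\<epsilon> / 4)"
    using assms(4,5) by (intro add_strict_mono ennreal_mult_strict_left_mono) auto
  also have "\<dots> = ennreal \<epsilon>"
  proof -
    have "2 * ennreal (\<epsilon> / 4) = ennreal (\<epsilon> / 2)"
      using \<open>\<epsilon> > 0\<close> ennreal_mult[of 2 "\<epsilon> / 4"] by simp
    then show ?thesis using \<open>\<epsilon> > 0\<close> by (simp add: ennreal_plus[symmetric] del: ennreal_plus)
  qed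
  finally show ?thesis .
qed

locale gaussian_spectral = prob_space M for M :: "'a measure" +
  fixes X :: "real \<Rightarrow> 'a \<Rightarrow> real" and r :: "real \<Rightarrow> real" and \<rho> :: "real measure"
  assumes gaussian_process: "gaussian_process M X" and centered: "centered_process M X"
    and covariance: "covariance_function M X r" and spectral: "spectral_measure r \<rho>"
begin

sublocale rho: real_distribution \<rho>
  using spectral by (simp add: spectral_measure_def)

lemma X_measurable[measurable]: "X t \<in> borel_measurable M"
  using centered by (auto simp: centered_process_def)

definition lin :: "real set \<Rightarrow> (real \<Rightarrow> real) \<Rightarrow> 'a \<Rightarrow> real" where
  "lin J a \<omega> = (\<Sum>t\<in>J. a t * X t \<omega>)"

definition trig :: "real set \<Rightarrow> (real \<Rightarrow> real) \<Rightarrow> real \<Rightarrow> complex" where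
  "trig J a s = (\<Sum>t\<in>J. of_real (a t) * exp (- \<i> * of_real (s * t)))"

lemma lin_measurable[measurable]: "lin J a \<in> borel_measurable M"
  unfolding lin_def by measurable

lemma trig_measurable[measurable]: "trig J a \<in> borel_measurable \<rho>"
  unfolding trig_def by measurable

lemma trig_norm_le: "norm (trig J a s) \<le> (\<Sum>t\<in>J. \<bar>a t\<bar>)"
  unfolding trig_def by (rule order_trans[OF norm_sum]) (simp add: norm_mult)

lemma r_eq: "complex_of_real (r t) = (CLINT s|\<rho>. exp (- \<i> * of_real (s * t)))"
  using spectral by (simp add: spectral_measure_def)

lemma gaussian_square_integrable:
  assumes "gaussian_rv M Y" shows "integrable M (\<lambda>\<omega>. (Y \<omega>)\<^sup>2)"
proof -
  have [measurable]: "Y \<in> borel_measurable M" using assms by (simp add: gaussian_rv_def)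
  from assms obtain \<mu> where "(AE \<omega> in M. Y \<omega> = \<mu>) \<or>
          (\<exists>\<sigma>>0. distributed M lborel Y (\<lambda>x. ennreal (normal_density \<mu> \<sigma> x)))"
    by (auto simp: gaussian_rv_def)
  then show ?thesis
  proof
    assume "AE \<omega> in M. Y \<omega> = \<mu>"
    then show ?thesis by (intro integrable_const_bound[where B = "\<mu>\<^sup>2"]) auto
  next
    assume "\<exists>\<sigma>>0. distributed M lborel Y (\<lambda>x. ennreal (normal_density \<mu> \<sigma> x))"
    then obtain \<sigma> where \<sigma>: "\<sigma> > 0" and d: "distributed M lborel Y (\<lambda>x. ennreal (normal_density \<mu> \<sigma> x))" by auto
    have "integrable lborel (\<lambda>x. normal_density \<mu> \<sigma> x * x\<^sup>2)"
    proof -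
      have "integrable lborel (\<lambda>x. normal_density \<mu> \<sigma> x * (x - \<mu>)\<^sup>2 + 2 * \<mu> * (normal_density \<mu> \<sigma> x * x) - \<mu>\<^sup>2 * normal_density \<mu> \<sigma> x)"
        using \<sigma> by (intro Bochner_Integration.integrable_add Bochner_Integration.integrable_diff integrable_mult_right
            integrable_normal_moment[of \<sigma> \<mu> 2] integrable_normal_moment_nz_1 integrable_normal_density) auto
      then show ?thesis by (rule back_subst[of "integrable lborel"]) (auto simp: fun_eq_iff power2_eq_square algebra_simps)
    qed
    then show ?thesis
      using distributed_integrable[OF d, of "\<lambda>x. x\<^sup>2"] by simp
  qed
qed

lemma lin_gaussian_rv: "finite J \<Longrightarrow> gaussian_rv M (lin J a)"
  using gaussian_process unfolding gaussian_process_def lin_def by blast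

lemma lin_singleton: "lin {t} (\<lambda>_. 1) = X t" by (auto simp: lin_def)
lemma trig_singleton: "trig {t} (\<lambda>_. 1) = (\<lambda>s. exp (- \<i> * of_real (s * t)))" by (auto simp: trig_def)

lemma X_product_integrable: "integrable M (\<lambda>\<omega>. X s \<omega> * X t \<omega>)"
proof (rule Bochner_Integration.integrable_bound)
  have "integrable M (\<lambda>\<omega>. (X t \<omega>)\<^sup>2)" for t
    using gaussian_square_integrable[OF lin_gaussian_rv[of "{t}" "\<lambda>_. 1"]] by (simp add: lin_singleton)
  then show "integrable M (\<lambda>\<omega>. (X s \<omega>)\<^sup>2 + (X t \<omega>)\<^sup>2)" by (intro Bochner_Integration.integrable_add)
  have "\<bar>x * y\<bar> \<le> x\<^sup>2 + y\<^sup>2" for x y :: real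
  proof -
    have "0 \<le> \<bar>x\<bar> * \<bar>y\<bar>" by simp
    moreover have "2 * (\<bar>x\<bar> * \<bar>y\<bar>) \<le> x\<^sup>2 + y\<^sup>2" using sum_squares_bound[of "\<bar>x\<bar>" "\<bar>y\<bar>"] by simp
    ultimately show ?thesis unfolding abs_mult by linarith
  qed
  then show "AE \<omega> in M. norm (X s \<omega> * X t \<omega>) \<le> norm ((X s \<omega>)\<^sup>2 + (X t \<omega>)\<^sup>2)" by auto
qed auto

lemma X_product_expectation: "(\<integral>\<omega>. X s \<omega> * X t \<omega> \<partial>M) = r (s - t)"
  using centered covariance by (simp add: covariance_function_def covariance_def centered_process_def)

text \<open>The isometry on finite combinations: both sides expand into the same form in
  \<open>r (s - t)\<close>, one through the covariance and the other through the Fourier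
  representation of r.\<close>

lemma lin_second_moment:
  assumes "finite J"
  shows "(\<integral>\<omega>. (lin J a \<omega>)\<^sup>2 \<partial>M) = (\<integral>s. (norm (trig J a s))\<^sup>2 \<partial>\<rho>)"
proof -
  have "(\<integral>\<omega>. (lin J a \<omega>)\<^sup>2 \<partial>M) = (\<integral>\<omega>. (\<Sum>s\<in>J. \<Sum>t\<in>J. a s * a t * (X s \<omega> * X t \<omega>)) \<partial>M)"
    by (simp add: lin_def power2_eq_square sum_product mult_ac)
  also have "\<dots> = (\<Sum>s\<in>J. \<Sum>t\<in>J. a s * a t * r (s - t))"
    using X_product_integrable X_product_expectation by (simp add: Bochner_Integration.integral_sum Bochner_Integration.integrable_sum)
  finally have 1: "(\<integral>\<omega>. (lin J a \<omega>)\<^sup>2 \<partial>M) = (\<Sum>s\<in>J. \<Sum>t\<in>J. a s * a t * r (s - t))" .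
  have ne: "of_real ((norm (trig J a u))\<^sup>2) = (\<Sum>s\<in>J. \<Sum>t\<in>J. of_real (a s * a t) * exp (- \<i> * of_real (u * (s - t))))" for u
  proof -
    have "complex_of_real ((norm (trig J a u))\<^sup>2) = trig J a u * cnj (trig J a u)"
      by (simp only: complex_norm_square)
    also have "cnj (trig J a u) = (\<Sum>t\<in>J. of_real (a t) * exp (\<i> * of_real (u * t)))"
      by (simp add: trig_def exp_cnj)
    also have "trig J a u * \<dots> = (\<Sum>s\<in>J. \<Sum>t\<in>J. of_real (a s * a t) * exp (- \<i> * of_real (u * (s - t))))"
      unfolding trig_def sum_product
      by (intro sum.cong refl) (simp add: exp_diff exp_minus field_simps)
    finally show ?thesis .
  qed
  have "complex_of_real (\<integral>s. (norm (trig J a s))\<^sup>2 \<partial>\<rho>) = (\<integral>u. (\<Sum>s\<in>J. \<Sum>t\<in>J. of_real (a s * a t) * exp (- \<i> * of_real (u * (s - t)))) \<partial>\<rho>)"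
    unfolding ne[symmetric] by (rule integral_complex_of_real[symmetric])
  also have "\<dots> = (\<Sum>s\<in>J. \<Sum>t\<in>J. of_real (a s * a t) * (CLINT u|\<rho>. exp (- \<i> * of_real (u * (s - t)))))"
  proof -
    have i: "complex_integrable \<rho> (\<lambda>u. of_real (a s * a t) * exp (- \<i> * of_real (u * (s - t))))" for s t
      by (intro integrable_mult_right rho.integrable_const_bound[where B = 1]) auto
    show ?thesis
      by (simp only: Bochner_Integration.integral_sum[OF i] Bochner_Integration.integral_sum[OF Bochner_Integration.integrable_sum[OF i]] integral_mult_right_zero)
  qed
  also have "\<dots> = of_real (\<Sum>s\<in>J. \<Sum>t\<in>J. a s * a t * r (s - t))"
    by (simp add: r_eq)
  finally show ?thesis using 1 by (simp only: of_real_eq_iff)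
qed

lemma lin_centered_gaussian:
  assumes "finite J"
  shows "centered_gaussian M (lin J a) (\<integral>s. (norm (trig J a s))\<^sup>2 \<partial>\<rho>)"
proof -
  define Y where "Y = lin J a"
  have [measurable]: "Y \<in> borel_measurable M" by (simp add: Y_def)
  have mean: "(\<integral>\<omega>. Y \<omega> \<partial>M) = 0"
    unfolding Y_def lin_def using centered by (subst Bochner_Integration.integral_sum) (auto simp: centered_process_def)
  define v where "v = (\<integral>\<omega>. (Y \<omega>)\<^sup>2 \<partial>M)"
  have v: "v = (\<integral>s. (norm (trig J a s))\<^sup>2 \<partial>\<rho>)" unfolding v_def Y_def by (rule lin_second_moment[OF assms])
  have "v \<ge> 0" unfolding v_def by simp
  from lin_gaussian_rv[OF assms, of a] obtain \<mu> where "(AE \<omega> in M. Y \<omega> = \<mu>) \<or>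
          (\<exists>\<sigma>>0. distributed M lborel Y (\<lambda>x. ennreal (normal_density \<mu> \<sigma> x)))"
    by (auto simp: gaussian_rv_def Y_def)
  then have "(CLINT \<omega>|M. exp (\<i> * of_real (u * Y \<omega>))) = of_real (exp (- (u\<^sup>2 * v / 2)))" for u
  proof
    assume ae: "AE \<omega> in M. Y \<omega> = \<mu>"
    have "(\<integral>\<omega>. Y \<omega> \<partial>M) = (\<integral>\<omega>. \<mu> \<partial>M)" by (rule integral_cong_AE) (use ae in auto)
    then have "\<mu> = 0" using mean by (simp add: prob_space)
    have "v = (\<integral>\<omega>. 0 \<partial>M)" unfolding v_def by (rule integral_cong_AE) (use ae \<open>\<mu> = 0\<close> in auto)
    moreover have "(CLINT \<omega>|M. exp (\<i> * of_real (u * Y \<omega>))) = (CLINT \<omega>|M. 1)"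
      by (rule integral_cong_AE) (use ae \<open>\<mu> = 0\<close> in auto)
    ultimately show ?thesis by (simp add: prob_space)
  next
    assume "\<exists>\<sigma>>0. distributed M lborel Y (\<lambda>x. ennreal (normal_density \<mu> \<sigma> x))"
    then obtain \<sigma> where \<sigma>: "\<sigma> > 0" and d: "distributed M lborel Y (\<lambda>x. ennreal (normal_density \<mu> \<sigma> x))" by auto
    have "\<mu> = 0" using normal_distributed_expectation[OF \<sigma> d] mean by simp
    have "v = \<sigma>\<^sup>2" using normal_distributed_variance[OF \<sigma> d] mean by (simp add: v_def)
    have "distributed M lborel (\<lambda>\<omega>. Y \<omega> / \<sigma>) (\<lambda>x. ennreal (std_normal_density x))"
      using d normal_standard_normal_convert[OF \<sigma>, of Y \<mu>] \<open>\<mu> = 0\<close> by simp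
    then have D: "distr M lborel (\<lambda>\<omega>. Y \<omega> / \<sigma>) = std_normal_distribution"
      by (simp add: distributed_distr_eq_density)
    have "of_real (exp (- ((u * \<sigma>)\<^sup>2) / 2)) = char std_normal_distribution (u * \<sigma>)"
      by (simp add: char_std_normal_distribution)
    also have "\<dots> = (CLINT \<omega>|M. exp (\<i> * of_real (u * \<sigma> * (Y \<omega> / \<sigma>))))"
      unfolding char_def D[symmetric] by (subst integral_distr) auto
    also have "\<dots> = (CLINT \<omega>|M. exp (\<i> * of_real (u * Y \<omega>)))"
      using \<sigma> by (intro Bochner_Integration.integral_cong) auto
    finally show ?thesis by (simp add: \<open>v = \<sigma>\<^sup>2\<close> power_mult_distrib)
  qed
  then show ?thesis
    using \<open>v \<ge> 0\<close> unfolding centered_gaussian_def v[symmetric] Y_def[symmetric] by auto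
qed

text \<open>The graph of the isometry between the closed linear spans of the variables \<open>X t\<close> and of the
  exponentials \<open>exp (- \<i> * s * t)\<close>.\<close>

definition rep :: "('a \<Rightarrow> real) \<Rightarrow> (real \<Rightarrow> complex) \<Rightarrow> bool" where
  "rep Y f \<longleftrightarrow> Y \<in> borel_measurable M \<and> f \<in> borel_measurable \<rho> \<and>
     (\<forall>\<epsilon>>0. \<exists>J a. finite J \<and>
        (\<integral>\<^sup>+\<omega>. ennreal ((norm (Y \<omega> - lin J a \<omega>))\<^sup>2) \<partial>M) < ennreal \<epsilon> \<and>
        (\<integral>\<^sup>+s. ennreal ((norm (f s - trig J a s))\<^sup>2) \<partial>\<rho>) < ennreal \<epsilon>)"

lemma rep_measurable: "rep Y f \<Longrightarrow> Y \<in> borel_measurable M" "rep Y f \<Longrightarrow> f \<in> borel_measurable \<rho>"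
  by (auto simp: rep_def)

lemma rep_lin: "finite J \<Longrightarrow> rep (lin J a) (trig J a)"
  unfolding rep_def by (auto intro!: exI[of _ J] exI[of _ a])

lemma rep_X: "rep (X t) (\<lambda>s. exp (- \<i> * of_real (s * t)))"
  using rep_lin[of "{t}" "\<lambda>_. 1"] by (simp only: lin_singleton trig_singleton finite.intros)

lemma rep_zero: "rep (\<lambda>_. 0) (\<lambda>_. 0)"
  using rep_lin[of "{}"] by (simp add: lin_def[abs_def] trig_def[abs_def])

lemma lin_add:
  assumes "finite J" "finite K"
  obtains a' where "lin (J \<union> K) a' = (\<lambda>\<omega>. lin J a \<omega> + lin K b \<omega>)" "trig (J \<union> K) a' = (\<lambda>s. trig J a s + trig K b s)"
proof
  let ?c = "\<lambda>t. (if t \<in> J then a t else 0) + (if t \<in> K then b t else 0)"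
  have aux: "(\<Sum>t\<in>J \<union> K. (if t \<in> J then g t else 0) + (if t \<in> K then h t else 0)) = sum g J + sum h K"
    for g h :: "real \<Rightarrow> 'c::comm_monoid_add"
    using assms by (simp add: sum.distrib sum.inter_restrict[symmetric] Int_absorb1 Int_absorb2)
  have "lin (J \<union> K) ?c \<omega> = (\<Sum>t\<in>J \<union> K. (if t \<in> J then a t * X t \<omega> else 0) + (if t \<in> K then b t * X t \<omega> else 0))" for \<omega>
    unfolding lin_def by (intro sum.cong) (auto simp: distrib_right)
  then show "lin (J \<union> K) ?c = (\<lambda>\<omega>. lin J a \<omega> + lin K b \<omega>)" unfolding aux by (simp add: lin_def fun_eq_iff)
  have "trig (J \<union> K) ?c s = (\<Sum>t\<in>J \<union> K. (if t \<in> J then of_real (a t) * exp (- \<i> * of_real (s * t)) else 0) +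
      (if t \<in> K then of_real (b t) * exp (- \<i> * of_real (s * t)) else 0))" for s
    unfolding trig_def by (intro sum.cong) (auto simp: distrib_right)
  then show "trig (J \<union> K) ?c = (\<lambda>s. trig J a s + trig K b s)" unfolding aux by (simp add: trig_def fun_eq_iff)
qed

lemma lin_scale: "lin J (\<lambda>t. c * a t) \<omega> = c * lin J a \<omega>" "trig J (\<lambda>t. c * a t) s = of_real c * trig J a s"
  by (simp_all add: lin_def trig_def sum_distrib_left mult.assoc)

lemma rep_add:
  assumes "rep Y f" "rep Z g"
  shows "rep (\<lambda>\<omega>. Y \<omega> + Z \<omega>) (\<lambda>s. f s + g s)"
  unfolding rep_def
proof (intro conjI allI impI)
  note [measurable] = rep_measurable[OF assms(1)] rep_measurable[OF assms(2)]
  show "(\<lambda>\<omega>. Y \<omega> + Z \<omega>) \<in> borel_measurable M" "(\<lambda>s. f s + g s) \<in> borel_measurable \<rho>" by measurable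
  fix \<epsilon> :: real assume "\<epsilon> > 0"
  then have e4: "\<epsilon> / 4 > 0" by simp
  obtain J a where 1: "finite J" "(\<integral>\<^sup>+\<omega>. ennreal ((norm (Y \<omega> - lin J a \<omega>))\<^sup>2) \<partial>M) < ennreal (\<epsilon> / 4)"
     "(\<integral>\<^sup>+s. ennreal ((norm (f s - trig J a s))\<^sup>2) \<partial>\<rho>) < ennreal (\<epsilon> / 4)"
    using assms(1) e4 unfolding rep_def by blast
  obtain K b where 2: "finite K" "(\<integral>\<^sup>+\<omega>. ennreal ((norm (Z \<omega> - lin K b \<omega>))\<^sup>2) \<partial>M) < ennreal (\<epsilon> / 4)"
     "(\<integral>\<^sup>+s. ennreal ((norm (g s - trig K b s))\<^sup>2) \<partial>\<rho>) < ennreal (\<epsilon> / 4)"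
    using assms(2) e4 unfolding rep_def by blast
  obtain c where c: "lin (J \<union> K) c = (\<lambda>\<omega>. lin J a \<omega> + lin K b \<omega>)" "trig (J \<union> K) c = (\<lambda>s. trig J a s + trig K b s)"
    by (rule lin_add[OF 1(1) 2(1)])
  have "(\<integral>\<^sup>+\<omega>. ennreal ((norm ((Y \<omega> + Z \<omega>) - (lin J a \<omega> + lin K b \<omega>)))\<^sup>2) \<partial>M) < ennreal \<epsilon>"
    by (rule nn_integral_power2_triangle_less[where b = "\<lambda>\<omega>. lin J a \<omega> + Z \<omega>"]) (use 1 2 \<open>\<epsilon> > 0\<close> in auto)
  moreover have "(\<integral>\<^sup>+s. ennreal ((norm ((f s + g s) - (trig J a s + trig K b s)))\<^sup>2) \<partial>\<rho>) < ennreal \<epsilon>"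
    by (rule nn_integral_power2_triangle_less[where b = "\<lambda>s. trig J a s + g s"]) (use 1 2 \<open>\<epsilon> > 0\<close> in auto)
  ultimately show "\<exists>J a. finite J \<and>
        (\<integral>\<^sup>+\<omega>. ennreal ((norm ((Y \<omega> + Z \<omega>) - lin J a \<omega>))\<^sup>2) \<partial>M) < ennreal \<epsilon> \<and>
        (\<integral>\<^sup>+s. ennreal ((norm ((f s + g s) - trig J a s))\<^sup>2) \<partial>\<rho>) < ennreal \<epsilon>"
    using 1 2 by (intro exI[of _ "J \<union> K"] exI[of _ c]) (simp add: c)
qed

lemma rep_scale:
  assumes "rep Y f"
  shows "rep (\<lambda>\<omega>. c * Y \<omega>) (\<lambda>s. of_real c * f s)"
  unfolding rep_def
proof (intro conjI allI impI)
  note [measurable] = rep_measurable[OF assms(1)]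
  show "(\<lambda>\<omega>. c * Y \<omega>) \<in> borel_measurable M" "(\<lambda>s. of_real c * f s) \<in> borel_measurable \<rho>" by measurable
  fix \<epsilon> :: real assume "\<epsilon> > 0"
  define \<eta> where "\<eta> = \<epsilon> / (c\<^sup>2 + 1)"
  have c1: "c\<^sup>2 + 1 > 0" by (simp add: add_nonneg_pos)
  then have \<eta>: "\<eta> > 0" "c\<^sup>2 * \<eta> < \<epsilon>" using \<open>\<epsilon> > 0\<close> by (auto simp: \<eta>_def field_simps)
  obtain J a where 1: "finite J" "(\<integral>\<^sup>+\<omega>. ennreal ((norm (Y \<omega> - lin J a \<omega>))\<^sup>2) \<partial>M) < ennreal \<eta>"
     "(\<integral>\<^sup>+s. ennreal ((norm (f s - trig J a s))\<^sup>2) \<partial>\<rho>) < ennreal \<eta>"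
    using assms(1) \<eta>(1) unfolding rep_def by blast
  have sc: "(norm (of_real c * u - of_real c * v))\<^sup>2 = c\<^sup>2 * (norm (u - v))\<^sup>2" for u v :: "'c :: real_normed_div_algebra"
    by (simp add: right_diff_distrib[symmetric] norm_mult power_mult_distrib)
  have *: "ennreal (c\<^sup>2) * I < ennreal \<epsilon>" if "I < ennreal \<eta>" for I
  proof -
    have "ennreal (c\<^sup>2) * I \<le> ennreal (c\<^sup>2) * ennreal \<eta>" using that by (intro mult_left_mono) auto
    also have "\<dots> = ennreal (c\<^sup>2 * \<eta>)" using \<eta> by (simp add: ennreal_mult)
    also have "\<dots> < ennreal \<epsilon>" using \<eta> \<open>\<epsilon> > 0\<close> by (intro ennreal_lessI) auto
    finally show ?thesis .
  qed
  have "(\<integral>\<^sup>+\<omega>. ennreal ((norm (c * Y \<omega> - c * lin J a \<omega>))\<^sup>2) \<partial>M) < ennreal \<epsilon>"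
    using *[OF 1(2)] sc[of "Y _" "lin J a _"] by (simp add: ennreal_mult nn_integral_cmult)
  moreover have "(\<integral>\<^sup>+s. ennreal ((norm (of_real c * f s - of_real c * trig J a s))\<^sup>2) \<partial>\<rho>) < ennreal \<epsilon>"
    using *[OF 1(3)] by (simp add: sc ennreal_mult nn_integral_cmult)
  ultimately show "\<exists>J a. finite J \<and>
        (\<integral>\<^sup>+\<omega>. ennreal ((norm (c * Y \<omega> - lin J a \<omega>))\<^sup>2) \<partial>M) < ennreal \<epsilon> \<and>
        (\<integral>\<^sup>+s. ennreal ((norm (of_real c * f s - trig J a s))\<^sup>2) \<partial>\<rho>) < ennreal \<epsilon>"
    using 1(1) by (intro exI[of _ J] exI[of _ "\<lambda>t. c * a t"]) (simp add: lin_scale)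
qed

lemma rep_sum:
  assumes "finite I" "\<And>i. i \<in> I \<Longrightarrow> rep (Y i) (f i)"
  shows "rep (\<lambda>\<omega>. \<Sum>i\<in>I. w i * Y i \<omega>) (\<lambda>s. \<Sum>i\<in>I. of_real (w i) * f i s)"
  using assms by (induction I rule: finite_induct) (auto simp: rep_zero intro!: rep_add rep_scale)

lemma rep_diff:
  assumes "rep Y f" "rep Z g"
  shows "rep (\<lambda>\<omega>. Y \<omega> - Z \<omega>) (\<lambda>s. f s - g s)"
  using rep_add[OF assms(1) rep_scale[OF assms(2), of "-1"]] by simp

lemma rep_limit:
  assumes "\<And>n. rep (Yn n) (fn n)" and [measurable]: "Y \<in> borel_measurable M" "f \<in> borel_measurable \<rho>"
    and Y: "\<And>\<epsilon>. \<epsilon> > 0 \<Longrightarrow> \<forall>\<^sub>F n in sequentially. (\<integral>\<^sup>+\<omega>. ennreal ((norm (Y \<omega> - Yn n \<omega>))\<^sup>2) \<partial>M) < ennreal \<epsilon>"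
    and f: "\<And>\<epsilon>. \<epsilon> > 0 \<Longrightarrow> \<forall>\<^sub>F n in sequentially. (\<integral>\<^sup>+s. ennreal ((norm (f s - fn n s))\<^sup>2) \<partial>\<rho>) < ennreal \<epsilon>"
  shows "rep Y f"
  unfolding rep_def
proof (intro conjI allI impI)
  note [measurable] = rep_measurable[OF assms(1)]
  fix \<epsilon> :: real assume "\<epsilon> > 0"
  then have e4: "\<epsilon> / 4 > 0" by simp
  obtain n where n: "(\<integral>\<^sup>+\<omega>. ennreal ((norm (Y \<omega> - Yn n \<omega>))\<^sup>2) \<partial>M) < ennreal (\<epsilon> / 4)"
    "(\<integral>\<^sup>+s. ennreal ((norm (f s - fn n s))\<^sup>2) \<partial>\<rho>) < ennreal (\<epsilon> / 4)"
    using eventually_happens[OF eventually_conj[OF Y[OF e4] f[OF e4]]] by auto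
  obtain J a where 1: "finite J" "(\<integral>\<^sup>+\<omega>. ennreal ((norm (Yn n \<omega> - lin J a \<omega>))\<^sup>2) \<partial>M) < ennreal (\<epsilon> / 4)"
     "(\<integral>\<^sup>+s. ennreal ((norm (fn n s - trig J a s))\<^sup>2) \<partial>\<rho>) < ennreal (\<epsilon> / 4)"
    using assms(1)[of n] e4 unfolding rep_def by blast
  show "\<exists>J a. finite J \<and>
        (\<integral>\<^sup>+\<omega>. ennreal ((norm (Y \<omega> - lin J a \<omega>))\<^sup>2) \<partial>M) < ennreal \<epsilon> \<and>
        (\<integral>\<^sup>+s. ennreal ((norm (f s - trig J a s))\<^sup>2) \<partial>\<rho>) < ennreal \<epsilon>"
    using 1(1) nn_integral_power2_triangle_less[OF _ _ _ n(1) 1(2) \<open>\<epsilon> > 0\<close>]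
      nn_integral_power2_triangle_less[OF _ _ _ n(2) 1(3) \<open>\<epsilon> > 0\<close>]
    by (intro exI[of _ J] exI[of _ a]) auto
qed fact+

lemma trig_square_integrable: "integrable \<rho> (\<lambda>s. (norm (trig J a s))\<^sup>2)"
  by (rule rho.integrable_const_bound[where B = "(\<Sum>t\<in>J. \<bar>a t\<bar>)\<^sup>2"]) (auto intro!: power_mono trig_norm_le)

lemma rep_square_integrable:
  assumes "rep Y f" shows "integrable \<rho> (\<lambda>s. (norm (f s))\<^sup>2)"
proof -
  note [measurable] = rep_measurable[OF assms(1)]
  obtain J a where 1: "finite J" "(\<integral>\<^sup>+s. ennreal ((norm (f s - trig J a s))\<^sup>2) \<partial>\<rho>) < ennreal 1"
    using assms(1) zero_less_one unfolding rep_def by blast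
  have "(\<integral>\<^sup>+s. ennreal ((norm (f s - 0))\<^sup>2) \<partial>\<rho>) \<le>
     2 * (\<integral>\<^sup>+s. ennreal ((norm (f s - trig J a s))\<^sup>2) \<partial>\<rho>) + 2 * (\<integral>\<^sup>+s. ennreal ((norm (trig J a s - 0))\<^sup>2) \<partial>\<rho>)"
    by (rule nn_integral_power2_triangle) auto
  also have "(\<integral>\<^sup>+s. ennreal ((norm (trig J a s - 0))\<^sup>2) \<partial>\<rho>) = ennreal (\<integral>s. (norm (trig J a s))\<^sup>2 \<partial>\<rho>)"
    using trig_square_integrable by (simp add: nn_integral_eq_integral)
  also have "2 * (\<integral>\<^sup>+s. ennreal ((norm (f s - trig J a s))\<^sup>2) \<partial>\<rho>) + 2 * ennreal (\<integral>s. (norm (trig J a s))\<^sup>2 \<partial>\<rho>) \<le>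
      2 * ennreal 1 + 2 * ennreal (\<integral>s. (norm (trig J a s))\<^sup>2 \<partial>\<rho>)"
    using 1(2) by (intro add_right_mono mult_left_mono) auto
  also have "\<dots> = ennreal (2 + 2 * (\<integral>s. (norm (trig J a s))\<^sup>2 \<partial>\<rho>))"
    by (simp add: ennreal_plus ennreal_mult)
  also have "\<dots> < \<infinity>" by simp
  finally have "(\<integral>\<^sup>+s. ennreal ((norm (f s))\<^sup>2) \<partial>\<rho>) < \<infinity>" by simp
  then show ?thesis by (intro integrableI_nonneg) auto
qed

lemma integral_le_of_nn_integral_less:
  assumes "(\<integral>\<^sup>+x. ennreal (g x) \<partial>N) < ennreal e" "\<And>x. g x \<ge> 0" "g \<in> borel_measurable N" "e > 0"
  shows "integrable N g" "(\<integral>x. g x \<partial>N) \<le> e"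
proof -
  show i: "integrable N g"
    using assms by (intro integrableI_nonneg) (auto simp: less_top[symmetric] elim: order.strict_trans)
  have "ennreal (\<integral>x. g x \<partial>N) < ennreal e"
    using assms nn_integral_eq_integral[OF i] by auto
  then show "(\<integral>x. g x \<partial>N) \<le> e" using assms by (simp add: ennreal_less_iff)
qed

text \<open>Along approximating finite combinations both the spectral norms and the characteristic
  functions converge, so the Gaussian law with variance the spectral norm survives the
  limit.\<close>

lemma rep_centered_gaussian:
  assumes "rep Y f"
  shows "centered_gaussian M Y (\<integral>s. (norm (f s))\<^sup>2 \<partial>\<rho>)"
  unfolding centered_gaussian_def
proof (intro conjI allI)
  note [measurable] = rep_measurable[OF assms(1)]
  show "Y \<in> borel_measurable M" by measurable
  show "(\<integral>s. (norm (f s))\<^sup>2 \<partial>\<rho>) \<ge> 0" by simp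
  fix u
  define F where "F = (\<integral>s. (norm (f s))\<^sup>2 \<partial>\<rho>)"
  have "\<forall>n. \<exists>J a. finite J \<and>
        (\<integral>\<^sup>+\<omega>. ennreal ((norm (Y \<omega> - lin J a \<omega>))\<^sup>2) \<partial>M) < ennreal ((1 / real (Suc n))\<^sup>2) \<and>
        (\<integral>\<^sup>+s. ennreal ((norm (f s - trig J a s))\<^sup>2) \<partial>\<rho>) < ennreal ((1 / real (Suc n))\<^sup>2)"
  proof
    fix n
    have "(1 / real (Suc n))\<^sup>2 > 0" by simp
    then show "\<exists>J a. finite J \<and>
        (\<integral>\<^sup>+\<omega>. ennreal ((norm (Y \<omega> - lin J a \<omega>))\<^sup>2) \<partial>M) < ennreal ((1 / real (Suc n))\<^sup>2) \<and>
        (\<integral>\<^sup>+s. ennreal ((norm (f s - trig J a s))\<^sup>2) \<partial>\<rho>) < ennreal ((1 / real (Suc n))\<^sup>2)"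
      using assms unfolding rep_def by blast
  qed
  then obtain J a where "\<forall>n. finite (J n) \<and>
      (\<integral>\<^sup>+\<omega>. ennreal ((norm (Y \<omega> - lin (J n) (a n) \<omega>))\<^sup>2) \<partial>M) < ennreal ((1 / real (Suc n))\<^sup>2) \<and>
      (\<integral>\<^sup>+s. ennreal ((norm (f s - trig (J n) (a n) s))\<^sup>2) \<partial>\<rho>) < ennreal ((1 / real (Suc n))\<^sup>2)"
    unfolding choice_iff by (elim exE)
  then have Ja: "\<And>n. finite (J n)"
      "\<And>n. (\<integral>\<^sup>+\<omega>. ennreal ((norm (Y \<omega> - lin (J n) (a n) \<omega>))\<^sup>2) \<partial>M) < ennreal ((1 / real (Suc n))\<^sup>2)"
      "\<And>n. (\<integral>\<^sup>+s. ennreal ((norm (f s - trig (J n) (a n) s))\<^sup>2) \<partial>\<rho>) < ennreal ((1 / real (Suc n))\<^sup>2)"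
    by blast+
  define h where "h n = 1 / real (Suc n)" for n
  have h: "h n > 0" for n by (simp add: h_def)
  have h0: "h \<longlonglongrightarrow> 0" unfolding h_def using LIMSEQ_inverse_real_of_nat by (simp add: inverse_eq_divide)
  define P where "P n = (\<integral>s. (norm (trig (J n) (a n) s))\<^sup>2 \<partial>\<rho>)" for n
  have P_lim: "P \<longlonglongrightarrow> F"
  proof (rule Lim_transform2[where f = "\<lambda>_. F"])
    have "\<bar>F - P n\<bar> \<le> (1 + 1 / h n) * (h n)\<^sup>2 + h n * F" for n
    proof -
      let ?p = "trig (J n) (a n)"
      note I = integral_le_of_nn_integral_less[OF Ja(3)[of n, folded h_def]]
      have i: "integrable \<rho> (\<lambda>s. (norm (f s - ?p s))\<^sup>2)" "(\<integral>s. (norm (f s - ?p s))\<^sup>2 \<partial>\<rho>) \<le> (h n)\<^sup>2"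
        by (rule I; use h[of n] in simp)+
      note i2 = rep_square_integrable[OF assms] trig_square_integrable[of "J n" "a n"]
      have "\<bar>F - P n\<bar> = \<bar>\<integral>s. (norm (f s))\<^sup>2 - (norm (?p s))\<^sup>2 \<partial>\<rho>\<bar>"
        unfolding F_def P_def using i2 by simp
      also have "\<dots> \<le> (\<integral>s. \<bar>(norm (f s))\<^sup>2 - (norm (?p s))\<^sup>2\<bar> \<partial>\<rho>)"
        by (rule integral_abs_bound)
      also have "\<dots> \<le> (\<integral>s. (1 + 1 / h n) * (norm (f s - ?p s))\<^sup>2 + h n * (norm (f s))\<^sup>2 \<partial>\<rho>)"
      proof (rule integral_mono)
        fix s
        define A B D where "A = norm (f s)" and "B = norm (?p s)" and "D = norm (f s - ?p s)"
        have "\<bar>A - B\<bar> \<le> D" unfolding A_def B_def D_def by (rule norm_triangle_ineq3)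
        moreover have "A \<ge> 0" "B \<ge> 0" "D \<ge> 0" by (auto simp: A_def B_def D_def)
        moreover have "\<bar>A\<^sup>2 - B\<^sup>2\<bar> = \<bar>A - B\<bar> * (A + B)"
        proof -
          have "A\<^sup>2 - B\<^sup>2 = (A - B) * (A + B)" by (simp add: power2_eq_square algebra_simps)
          then show ?thesis using \<open>A \<ge> 0\<close> \<open>B \<ge> 0\<close> by (simp add: abs_mult)
        qed
        ultimately have "\<bar>A\<^sup>2 - B\<^sup>2\<bar> \<le> D * (2 * A + D)" by (simp only:) (intro mult_mono, auto)
        \<comment> \<open>The mixed product is split with weight \<open>h n\<close>. As the
          mean-square error is at most (h n)^2, the resulting bound (h n)^2 + h n + h n * F
          vanishes.\<close>
        also have "\<dots> \<le> (1 + 1 / h n) * D\<^sup>2 + h n * A\<^sup>2"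
        proof -
          have "0 \<le> (D - h n * A)\<^sup>2 / h n" using h[of n] by simp
          also have "\<dots> = D\<^sup>2 / h n - 2 * D * A + h n * A\<^sup>2"
            using h[of n] by (simp add: power2_eq_square field_simps)
          finally show ?thesis by (simp add: power2_eq_square algebra_simps)
        qed
        finally show "\<bar>(norm (f s))\<^sup>2 - (norm (?p s))\<^sup>2\<bar> \<le> (1 + 1 / h n) * (norm (f s - ?p s))\<^sup>2 + h n * (norm (f s))\<^sup>2"
          by (simp add: A_def B_def D_def)
      qed (use i i2 in auto)
      also have "\<dots> = (1 + 1 / h n) * (\<integral>s. (norm (f s - ?p s))\<^sup>2 \<partial>\<rho>) + h n * F"
        unfolding F_def using i(1) i2 by simp
      also have "\<dots> \<le> (1 + 1 / h n) * (h n)\<^sup>2 + h n * F"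
        using i(2) h[of n] by (intro add_right_mono mult_left_mono) auto
      finally show ?thesis .
    qed
    moreover have "(1 + 1 / h n) * (h n)\<^sup>2 + h n * F = (h n)\<^sup>2 + h n + h n * F" for n
      using h[of n] by (simp add: field_simps power2_eq_square)
    ultimately have bd: "dist F (P n) \<le> (h n)\<^sup>2 + h n + h n * F" for n by (simp only: dist_real_def)
    have "(\<lambda>n. (h n)\<^sup>2 + h n + h n * F) \<longlonglongrightarrow> 0\<^sup>2 + 0 + 0 * F" by (intro tendsto_intros h0)
    then have lim: "(\<lambda>n. (h n)\<^sup>2 + h n + h n * F) \<longlonglongrightarrow> 0" by simp
    show "(\<lambda>n. F - P n) \<longlonglongrightarrow> 0"
      by (rule Lim_null_comparison[OF _ lim]) (use bd in \<open>simp add: dist_norm\<close>)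
  qed simp
  define c where "c n = (CLINT \<omega>|M. exp (\<i> * of_real (u * lin (J n) (a n) \<omega>)))" for n
  define c0 where "c0 = (CLINT \<omega>|M. exp (\<i> * of_real (u * Y \<omega>)))"
  have cn: "c n = of_real (exp (- (u\<^sup>2 * P n / 2)))" for n
    using lin_centered_gaussian[OF Ja(1)[of n], of "a n"] by (simp add: centered_gaussian_def c_def P_def)
  have "c \<longlonglongrightarrow> of_real (exp (- (u\<^sup>2 * F / 2)))"
    unfolding cn by (intro tendsto_intros P_lim) auto
  moreover have "c \<longlonglongrightarrow> c0"
  proof (rule Lim_transform2[where f = "\<lambda>_. c0"])
    have "dist c0 (c n) \<le> \<bar>u\<bar> * h n" for n
    proof -
      let ?L = "lin (J n) (a n)"
      note I = integral_le_of_nn_integral_less[OF Ja(2)[of n, folded h_def]]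
      have i: "integrable M (\<lambda>\<omega>. (norm (Y \<omega> - ?L \<omega>))\<^sup>2)" "(\<integral>\<omega>. (norm (Y \<omega> - ?L \<omega>))\<^sup>2 \<partial>M) \<le> (h n)\<^sup>2"
        by (rule I; use h[of n] in simp)+
      have e: "integrable M (\<lambda>\<omega>. exp (\<i> * of_real (u * Z \<omega>)))" if "Z \<in> borel_measurable M" for Z :: "'a \<Rightarrow> real"
        using that by (intro integrable_const_bound[where B = 1]) auto
      have "dist c0 (c n) = norm (CLINT \<omega>|M. exp (\<i> * of_real (u * Y \<omega>)) - exp (\<i> * of_real (u * ?L \<omega>)))"
        unfolding c0_def c_def dist_norm by (subst Bochner_Integration.integral_diff[OF e e]) auto
      also have "\<dots> \<le> (\<integral>\<omega>. norm (exp (\<i> * of_real (u * Y \<omega>)) - exp (\<i> * of_real (u * ?L \<omega>))) \<partial>M)"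
        by (rule integral_norm_bound)
      also have "\<dots> \<le> (\<integral>\<omega>. \<bar>u\<bar> / 2 * (h n + (norm (Y \<omega> - ?L \<omega>))\<^sup>2 / h n) \<partial>M)"
      proof (rule integral_mono)
        fix \<omega>
        define D where "D = \<bar>Y \<omega> - ?L \<omega>\<bar>"
        have "norm (exp (\<i> * of_real (u * Y \<omega>)) - exp (\<i> * of_real (u * ?L \<omega>))) =
          norm (exp (\<i> * of_real (u * ?L \<omega>)) * (exp (\<i> * of_real (u * (Y \<omega> - ?L \<omega>))) - 1))"
          by (simp add: exp_add[symmetric] algebra_simps)
        also have "\<dots> \<le> \<bar>u * (Y \<omega> - ?L \<omega>)\<bar>"
          using iexp_approx1[of "u * (Y \<omega> - ?L \<omega>)" 0] by (simp add: norm_mult)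
        also have "\<dots> = \<bar>u\<bar> * D" by (simp add: D_def abs_mult)
        \<comment> \<open>The first absolute moment is estimated through the second one by 2D <= h +
          D^2 / h, in place of Cauchy-Schwarz.\<close>
        also have "\<dots> \<le> \<bar>u\<bar> * ((h n + D\<^sup>2 / h n) / 2)"
        proof (rule mult_left_mono)
          have "0 \<le> (D - h n)\<^sup>2 / h n" using h[of n] by simp
          also have "\<dots> = D\<^sup>2 / h n - 2 * D + h n"
            using h[of n] by (simp add: power2_eq_square field_simps)
          finally show "D \<le> (h n + D\<^sup>2 / h n) / 2" by simp
        qed simp
        finally show "norm (exp (\<i> * of_real (u * Y \<omega>)) - exp (\<i> * of_real (u * ?L \<omega>))) \<le> \<bar>u\<bar> / 2 * (h n + (norm (Y \<omega> - ?L \<omega>))\<^sup>2 / h n)"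
          by (simp add: D_def)
        show "integrable M (\<lambda>\<omega>. norm (exp (\<i> * of_real (u * Y \<omega>)) - exp (\<i> * of_real (u * ?L \<omega>))))"
          by (intro integrable_norm Bochner_Integration.integrable_diff e) auto
      qed (use i(1) in auto)
      also have "\<dots> = \<bar>u\<bar> / 2 * (h n + (\<integral>\<omega>. (norm (Y \<omega> - ?L \<omega>))\<^sup>2 \<partial>M) / h n)"
        using i(1) by (simp add: prob_space)
      also have "\<dots> \<le> \<bar>u\<bar> / 2 * (h n + (h n)\<^sup>2 / h n)"
        using i(2) h[of n] by (intro mult_left_mono add_left_mono divide_right_mono) auto
      also have "\<dots> = \<bar>u\<bar> * h n" using h[of n] by (simp add: power2_eq_square)
      finally show ?thesis .
    qed
    note bd = this
    have "(\<lambda>n. \<bar>u\<bar> * h n) \<longlonglongrightarrow> \<bar>u\<bar> * 0" by (intro tendsto_intros h0)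
    then have lim: "(\<lambda>n. \<bar>u\<bar> * h n) \<longlonglongrightarrow> 0" by simp
    show "(\<lambda>n. c0 - c n) \<longlonglongrightarrow> 0"
      by (rule Lim_null_comparison[OF _ lim]) (use bd in \<open>simp add: dist_norm\<close>)
  qed simp
  ultimately show "(CLINT \<omega>|M. exp (\<i> * of_real (u * Y \<omega>))) = of_real (exp (- (u\<^sup>2 * (\<integral>s. (norm (f s))\<^sup>2 \<partial>\<rho>) / 2)))"
    unfolding c0_def[symmetric] F_def[symmetric] by (rule LIMSEQ_unique[symmetric])
qed

lemma rep_isometry:
  assumes "rep Y f"
  shows "(\<integral>\<^sup>+\<omega>. ennreal ((norm (Y \<omega>))\<^sup>2) \<partial>M) = (\<integral>\<^sup>+s. ennreal ((norm (f s))\<^sup>2) \<partial>\<rho>)"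
  using centered_gaussian_second_moment[OF prob_space_axioms rep_centered_gaussian[OF assms]]
    nn_integral_eq_integral[OF rep_square_integrable[OF assms]] by simp

text \<open>Mean-square convergence is assumed on the spectral side only. The isometry makes the
  random variables Cauchy in mean square, and Fatou's lemma identifies their almost sure limit with
  the mean-square limit.\<close>

lemma rep_AE_limit:
  assumes rep: "\<And>n. rep (Yn n) (fn n)" and [measurable]: "Y \<in> borel_measurable M" "f \<in> borel_measurable \<rho>"
    and ae: "AE \<omega> in M. (\<lambda>n. Yn n \<omega>) \<longlonglongrightarrow> Y \<omega>"
    and f: "\<And>\<epsilon>. \<epsilon> > 0 \<Longrightarrow> \<forall>\<^sub>F n in sequentially. (\<integral>\<^sup>+s. ennreal ((norm (f s - fn n s))\<^sup>2) \<partial>\<rho>) < ennreal \<epsilon>"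
  shows "rep Y f"
proof (rule rep_limit[OF rep])
  note [measurable] = rep_measurable[OF rep]
  fix \<epsilon> :: real assume "\<epsilon> > 0"
  \<comment> \<open>Fatou yields only a weak inequality with 4e = \<epsilon> / 2, which leaves room
    for a strict one.\<close>
  define e where "e = \<epsilon> / 8"
  have e: "e > 0" using \<open>\<epsilon> > 0\<close> by (simp add: e_def)
  have 4: "2 * ennreal e + 2 * ennreal e = ennreal (4 * e)"
  proof -
    have "2 * ennreal e = ennreal (2 * e)" using e by (simp add: ennreal_mult)
    then show ?thesis using e by (simp add: ennreal_plus[symmetric] del: ennreal_plus)
  qed
  obtain N where N: "\<And>n. n \<ge> N \<Longrightarrow> (\<integral>\<^sup>+s. ennreal ((norm (f s - fn n s))\<^sup>2) \<partial>\<rho>) < ennreal e"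
    using f[OF e] by (auto simp: eventually_sequentially)
  have "(\<integral>\<^sup>+\<omega>. ennreal ((norm (Y \<omega> - Yn n \<omega>))\<^sup>2) \<partial>M) < ennreal \<epsilon>" if "n \<ge> N" for n
  proof -
    have "(\<integral>\<^sup>+\<omega>. ennreal ((norm (Y \<omega> - Yn n \<omega>))\<^sup>2) \<partial>M) = (\<integral>\<^sup>+\<omega>. liminf (\<lambda>k. ennreal ((norm (Yn k \<omega> - Yn n \<omega>))\<^sup>2)) \<partial>M)"
    proof (rule nn_integral_cong_AE)
      show "AE \<omega> in M. ennreal ((norm (Y \<omega> - Yn n \<omega>))\<^sup>2) = liminf (\<lambda>k. ennreal ((norm (Yn k \<omega> - Yn n \<omega>))\<^sup>2))"
        using ae
      proof eventually_elim
        case (elim \<omega>)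
        have "(\<lambda>k. ennreal ((norm (Yn k \<omega> - Yn n \<omega>))\<^sup>2)) \<longlonglongrightarrow> ennreal ((norm (Y \<omega> - Yn n \<omega>))\<^sup>2)"
          by (intro tendsto_ennrealI tendsto_intros elim)
        from lim_imp_Liminf[OF _ this] show ?case by simp
      qed
    qed
    also have "\<dots> \<le> liminf (\<lambda>k. \<integral>\<^sup>+\<omega>. ennreal ((norm (Yn k \<omega> - Yn n \<omega>))\<^sup>2) \<partial>M)"
      by (rule nn_integral_liminf) measurable
    also have "\<dots> \<le> liminf (\<lambda>k. ennreal (4 * e))"
    proof (rule Liminf_mono)
      have "(\<integral>\<^sup>+\<omega>. ennreal ((norm (Yn k \<omega> - Yn n \<omega>))\<^sup>2) \<partial>M) \<le> ennreal (4 * e)" if "k \<ge> N" for k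
      proof -
        have "(\<integral>\<^sup>+\<omega>. ennreal ((norm (Yn k \<omega> - Yn n \<omega>))\<^sup>2) \<partial>M) = (\<integral>\<^sup>+s. ennreal ((norm (fn k s - fn n s))\<^sup>2) \<partial>\<rho>)"
          by (rule rep_isometry) (rule rep_diff[OF rep rep])
        also have "\<dots> \<le> 2 * (\<integral>\<^sup>+s. ennreal ((norm (fn k s - f s))\<^sup>2) \<partial>\<rho>) + 2 * (\<integral>\<^sup>+s. ennreal ((norm (f s - fn n s))\<^sup>2) \<partial>\<rho>)"
          by (rule nn_integral_power2_triangle) auto
        also have "\<dots> \<le> 2 * ennreal e + 2 * ennreal e"
          using N[OF that] N[OF \<open>n \<ge> N\<close>]
          by (intro add_mono mult_left_mono) (auto simp: norm_minus_commute less_imp_le)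
        finally show ?thesis unfolding 4 .
      qed
      then show "\<forall>\<^sub>F k in sequentially. (\<integral>\<^sup>+\<omega>. ennreal ((norm (Yn k \<omega> - Yn n \<omega>))\<^sup>2) \<partial>M) \<le> ennreal (4 * e)"
        by (auto simp: eventually_sequentially)
    qed
    also have "\<dots> = ennreal (4 * e)" by (simp add: Liminf_const)
    also have "\<dots> < ennreal \<epsilon>" using \<open>\<epsilon> > 0\<close> by (intro ennreal_lessI) (auto simp: e_def)
    finally show ?thesis .
  qed
  then show "\<forall>\<^sub>F n in sequentially. (\<integral>\<^sup>+\<omega>. ennreal ((norm (Y \<omega> - Yn n \<omega>))\<^sup>2) \<partial>M) < ennreal \<epsilon>"
    by (auto simp: eventually_sequentially)
qed (fact | rule f)+

end

section \<open>Analytic extension of the paths\<close>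

context gaussian_spectral begin

text \<open>The spectral half of \<open>rep\<close>: membership in the closed span of the
  exponentials, before any random variable has been constructed.\<close>

definition appr :: "(real \<Rightarrow> complex) \<Rightarrow> bool" where
  "appr f \<longleftrightarrow> f \<in> borel_measurable \<rho> \<and>
     (\<forall>\<epsilon>>0. \<exists>J a. finite J \<and> (\<integral>\<^sup>+s. ennreal ((norm (f s - trig J a s))\<^sup>2) \<partial>\<rho>) < ennreal \<epsilon>)"

text \<open>Completeness of the space of random variables. Approximations with squared error 16^(-n)
  have increments of mean O(4^(-n)), so they converge almost surely, and the limit represents
  f.\<close>

lemma appr_imp_rep:
  assumes "appr f" shows "\<exists>Y. rep Y f"
proof -
  have [measurable]: "f \<in> borel_measurable \<rho>" using assms by (simp add: appr_def)
  have "\<forall>n. \<exists>J a. finite J \<and> (\<integral>\<^sup>+s. ennreal ((norm (f s - trig J a s))\<^sup>2) \<partial>\<rho>) < ennreal ((1 / 16) ^ n)"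
  proof
    fix n
    have "(1 / 16 :: real) ^ n > 0" by simp
    then show "\<exists>J a. finite J \<and> (\<integral>\<^sup>+s. ennreal ((norm (f s - trig J a s))\<^sup>2) \<partial>\<rho>) < ennreal ((1 / 16) ^ n)"
      using assms unfolding appr_def by blast
  qed
  then obtain J a where "\<forall>n. finite (J n) \<and> (\<integral>\<^sup>+s. ennreal ((norm (f s - trig (J n) (a n) s))\<^sup>2) \<partial>\<rho>) < ennreal ((1 / 16) ^ n)"
    unfolding choice_iff by (elim exE)
  then have fin: "\<And>n. finite (J n)"
    and less: "\<And>n. (\<integral>\<^sup>+s. ennreal ((norm (f s - trig (J n) (a n) s))\<^sup>2) \<partial>\<rho>) < ennreal ((1 / 16) ^ n)"
    by blast+
  define L where "L n = lin (J n) (a n)" for n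
  define p where "p n = trig (J n) (a n)" for n
  have rp: "rep (L n) (p n)" for n unfolding L_def p_def by (rule rep_lin[OF fin])
  note [measurable] = rep_measurable[OF rp]
  define d where "d n \<omega> = \<bar>L (Suc n) \<omega> - L n \<omega>\<bar>" for n \<omega>
  have [measurable]: "d n \<in> borel_measurable M" for n unfolding d_def by measurable
  have sq: "(\<integral>\<^sup>+\<omega>. ennreal ((norm (L (Suc n) \<omega> - L n \<omega>))\<^sup>2) \<partial>M) \<le> ennreal (4 * (1 / 16) ^ n)" for n
  proof -
    have "(\<integral>\<^sup>+\<omega>. ennreal ((norm (L (Suc n) \<omega> - L n \<omega>))\<^sup>2) \<partial>M) = (\<integral>\<^sup>+s. ennreal ((norm (p (Suc n) s - p n s))\<^sup>2) \<partial>\<rho>)"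
      by (rule rep_isometry) (rule rep_diff[OF rp rp])
    also have "\<dots> \<le> 2 * (\<integral>\<^sup>+s. ennreal ((norm (p (Suc n) s - f s))\<^sup>2) \<partial>\<rho>) + 2 * (\<integral>\<^sup>+s. ennreal ((norm (f s - p n s))\<^sup>2) \<partial>\<rho>)"
      by (rule nn_integral_power2_triangle) auto
    also have "\<dots> \<le> 2 * ennreal ((1 / 16) ^ n) + 2 * ennreal ((1 / 16) ^ n)"
    proof (intro add_mono mult_left_mono)
      have "(\<integral>\<^sup>+s. ennreal ((norm (p (Suc n) s - f s))\<^sup>2) \<partial>\<rho>) \<le> ennreal ((1 / 16) ^ Suc n)"
        using less[of "Suc n"] by (simp add: p_def norm_minus_commute)
      also have "\<dots> \<le> ennreal ((1 / 16) ^ n)" by (intro ennreal_leI power_decreasing) auto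
      finally show "(\<integral>\<^sup>+s. ennreal ((norm (p (Suc n) s - f s))\<^sup>2) \<partial>\<rho>) \<le> ennreal ((1 / 16) ^ n)" .
      show "(\<integral>\<^sup>+s. ennreal ((norm (f s - p n s))\<^sup>2) \<partial>\<rho>) \<le> ennreal ((1 / 16) ^ n)"
        using less[of n] by (simp add: p_def)
    qed auto
    also have "\<dots> = ennreal (4 * (1 / 16) ^ n)"
    proof -
      have "2 * ennreal ((1 / 16) ^ n) = ennreal (2 * (1 / 16) ^ n)" by (simp add: ennreal_mult)
      then show ?thesis by (simp add: ennreal_plus[symmetric] del: ennreal_plus)
    qed
    finally show ?thesis .
  qed
  have "(\<integral>\<^sup>+\<omega>. ennreal (d n \<omega>) \<partial>M) \<le> ennreal (5 / 2 * (1 / 4) ^ n)" for n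
  proof -
    \<comment> \<open>The weight 4^(-n) balances D <= \<eta> / 2 + D^2 / (2 \<eta>), since the mean
      of D^2 is at most 4 times its square.\<close>
    define \<eta> :: real where "\<eta> = (1 / 4) ^ n"
    have \<eta>: "\<eta> > 0" "(1 / 16) ^ n = \<eta> * \<eta>" by (simp_all add: \<eta>_def power_mult_distrib[symmetric])
    have "(\<integral>\<^sup>+\<omega>. ennreal (d n \<omega>) \<partial>M) \<le> (\<integral>\<^sup>+\<omega>. ennreal (\<eta> / 2) + ennreal (1 / (2 * \<eta>)) * ennreal ((norm (L (Suc n) \<omega> - L n \<omega>))\<^sup>2) \<partial>M)"
    proof (rule nn_integral_mono)
      fix \<omega>
      define D where "D = d n \<omega>"
      have "0 \<le> (D - \<eta>)\<^sup>2 / (2 * \<eta>)" using \<eta> by simp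
      also have "\<dots> = 1 / (2 * \<eta>) * D\<^sup>2 - D + \<eta> / 2"
        using \<eta>(1) by (simp add: power2_eq_square field_simps)
      finally have "D \<le> \<eta> / 2 + 1 / (2 * \<eta>) * D\<^sup>2" by simp
      then have "ennreal D \<le> ennreal (\<eta> / 2 + 1 / (2 * \<eta>) * D\<^sup>2)" by (rule ennreal_leI)
      also have "\<dots> = ennreal (\<eta> / 2) + ennreal (1 / (2 * \<eta>)) * ennreal (D\<^sup>2)"
        using \<eta>(1) by (subst ennreal_plus) (auto simp: ennreal_mult[symmetric])
      finally show "ennreal (d n \<omega>) \<le> ennreal (\<eta> / 2) + ennreal (1 / (2 * \<eta>)) * ennreal ((norm (L (Suc n) \<omega> - L n \<omega>))\<^sup>2)"
        by (simp add: D_def d_def)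
    qed
    also have "\<dots> = ennreal (\<eta> / 2) + ennreal (1 / (2 * \<eta>)) * (\<integral>\<^sup>+\<omega>. ennreal ((norm (L (Suc n) \<omega> - L n \<omega>))\<^sup>2) \<partial>M)"
      by (subst nn_integral_add) (auto simp: nn_integral_cmult emeasure_space_1)
    also have "\<dots> \<le> ennreal (\<eta> / 2) + ennreal (1 / (2 * \<eta>)) * ennreal (4 * (1 / 16) ^ n)"
      by (intro add_left_mono mult_left_mono sq) auto
    also have "\<dots> = ennreal (\<eta> / 2 + 1 / (2 * \<eta>) * (4 * (1 / 16) ^ n))"
      using \<eta>(1) by (subst ennreal_plus) (auto simp: ennreal_mult[symmetric])
    also have "\<eta> / 2 + 1 / (2 * \<eta>) * (4 * (1 / 16) ^ n) = 5 / 2 * \<eta>"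
      unfolding \<eta>(2) using \<eta>(1) by (simp add: field_simps)
    finally show ?thesis by (simp add: \<eta>_def)
  qed
  then have "AE \<omega> in M. summable (\<lambda>n. d n \<omega>)"
    by (rule AE_summable_of_nn_integral[rotated 2]) (auto simp: d_def intro!: summable_mult summable_geometric)
  then have ae: "AE \<omega> in M. (\<lambda>n. L n \<omega>) \<longlonglongrightarrow> lim (\<lambda>n. L n \<omega>)"
  proof eventually_elim
    case (elim \<omega>)
    then have "summable (\<lambda>n. L (Suc n) \<omega> - L n \<omega>)"
      unfolding d_def by (rule summable_rabs_cancel)
    then have "convergent (\<lambda>n. \<Sum>i<n. L (Suc i) \<omega> - L i \<omega>)" by (simp add: summable_iff_convergent)
    then have "convergent (\<lambda>n. L n \<omega> - L 0 \<omega>)" unfolding sum_lessThan_telescope[of "\<lambda>i. L i \<omega>"] .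
    then have "convergent (\<lambda>n. (L n \<omega> - L 0 \<omega>) + L 0 \<omega>)" by (intro convergent_add convergent_const)
    then show ?case by (simp add: convergent_LIMSEQ_iff)
  qed
  have "rep (\<lambda>\<omega>. lim (\<lambda>n. L n \<omega>)) f"
  proof (rule rep_AE_limit[OF rp _ _ ae])
    show "(\<lambda>\<omega>. lim (\<lambda>n. L n \<omega>)) \<in> borel_measurable M" by measurable
    fix \<epsilon> :: real assume "\<epsilon> > 0"
    have "(\<lambda>n. (1 / 16 :: real) ^ n) \<longlonglongrightarrow> 0" by (rule LIMSEQ_realpow_zero) auto
    then have "\<forall>\<^sub>F n in sequentially. (1 / 16 :: real) ^ n < \<epsilon>" using \<open>\<epsilon> > 0\<close> by (rule order_tendstoD)
    then show "\<forall>\<^sub>F n in sequentially. (\<integral>\<^sup>+s. ennreal ((norm (f s - p n s))\<^sup>2) \<partial>\<rho>) < ennreal \<epsilon>"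
    proof eventually_elim
      case (elim n)
      then show ?case unfolding p_def by (intro order.strict_trans[OF less] ennreal_lessI) (use \<open>\<epsilon> > 0\<close> in auto)
    qed
  qed measurable
  then show ?thesis by blast
qed

lemma trig_shift:
  "trig ((\<lambda>t. t + h) ` J) (\<lambda>t. a (t - h)) s = exp (- \<i> * of_real (s * h)) * trig J a s"
  unfolding trig_def
  by (subst sum.reindex) (auto simp: inj_on_def sum_distrib_left distrib_left exp_add[symmetric] algebra_simps
    intro!: sum.cong)

text \<open>A difference quotient of a trigonometric sum is again one, with the frequency set
  enlarged by its shift, and the multiplier is bounded by 2/h.\<close>

lemma appr_difference:
  assumes "appr f" "h > 0"
  shows "appr (\<lambda>s. of_real (1 / h) * ((exp (- \<i> * of_real (s * h)) - 1) * f s))"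
  unfolding appr_def
proof (intro conjI allI impI)
  have [measurable]: "f \<in> borel_measurable \<rho>" using assms by (simp add: appr_def)
  show "(\<lambda>s. of_real (1 / h) * ((exp (- \<i> * of_real (s * h)) - 1) * f s)) \<in> borel_measurable \<rho>" by measurable
  fix \<epsilon> :: real assume "\<epsilon> > 0"
  define e where "e = \<epsilon> * h\<^sup>2 / 4"
  have e: "e > 0" "4 / h\<^sup>2 * e = \<epsilon>" using \<open>\<epsilon> > 0\<close> assms(2) by (auto simp: e_def)
  obtain J a where Ja: "finite J" "(\<integral>\<^sup>+s. ennreal ((norm (f s - trig J a s))\<^sup>2) \<partial>\<rho>) < ennreal e"
    using assms(1) e(1) unfolding appr_def by blast
  obtain b where b: "trig ((\<lambda>t. t + h) ` J \<union> J) b = (\<lambda>s. trig ((\<lambda>t. t + h) ` J) (\<lambda>t. a (t - h)) s + trig J (\<lambda>t. - 1 * a t) s)"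
    using lin_add[of "(\<lambda>t. t + h) ` J" J "\<lambda>t. a (t - h)" "\<lambda>t. - 1 * a t"] Ja(1) by (metis finite_imageI)
  have T: "trig ((\<lambda>t. t + h) ` J \<union> J) (\<lambda>t. 1 / h * b t) s = of_real (1 / h) * ((exp (- \<i> * of_real (s * h)) - 1) * trig J a s)" for s
    unfolding lin_scale(2) b trig_shift by (simp add: left_diff_distrib)
  have "(\<integral>\<^sup>+s. ennreal ((norm (of_real (1 / h) * ((exp (- \<i> * of_real (s * h)) - 1) * f s) -
      trig ((\<lambda>t. t + h) ` J \<union> J) (\<lambda>t. 1 / h * b t) s))\<^sup>2) \<partial>\<rho>) \<le>
    (\<integral>\<^sup>+s. ennreal (4 / h\<^sup>2) * ennreal ((norm (f s - trig J a s))\<^sup>2) \<partial>\<rho>)"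
  proof (rule nn_integral_mono)
    fix s
    have "norm (exp (- \<i> * of_real (s * h)) - 1) \<le> 2"
      using norm_triangle_ineq4[of "exp (- \<i> * of_real (s * h))" 1] by simp
    then have n: "(norm (exp (- \<i> * of_real (s * h)) - 1))\<^sup>2 \<le> 2\<^sup>2" by (intro power_mono) auto
    have "(norm (of_real (1 / h) * ((exp (- \<i> * of_real (s * h)) - 1) * f s) -
      trig ((\<lambda>t. t + h) ` J \<union> J) (\<lambda>t. 1 / h * b t) s))\<^sup>2 =
      (norm (of_real (1 / h) * ((exp (- \<i> * of_real (s * h)) - 1) * (f s - trig J a s))))\<^sup>2"
      unfolding T by (simp only: right_diff_distrib)
    also have "\<dots> = (1 / h\<^sup>2) * ((norm (exp (- \<i> * of_real (s * h)) - 1))\<^sup>2 * (norm (f s - trig J a s))\<^sup>2)"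
      using assms(2) by (simp add: norm_mult norm_divide power_mult_distrib power_divide)
    also have "\<dots> \<le> (1 / h\<^sup>2) * (2\<^sup>2 * (norm (f s - trig J a s))\<^sup>2)"
      by (intro mult_left_mono mult_right_mono n) auto
    finally have "(norm (of_real (1 / h) * ((exp (- \<i> * of_real (s * h)) - 1) * f s) -
      trig ((\<lambda>t. t + h) ` J \<union> J) (\<lambda>t. 1 / h * b t) s))\<^sup>2 \<le> 4 / h\<^sup>2 * (norm (f s - trig J a s))\<^sup>2" by simp
    then show "ennreal ((norm (of_real (1 / h) * ((exp (- \<i> * of_real (s * h)) - 1) * f s) -
      trig ((\<lambda>t. t + h) ` J \<union> J) (\<lambda>t. 1 / h * b t) s))\<^sup>2) \<le> ennreal (4 / h\<^sup>2) * ennreal ((norm (f s - trig J a s))\<^sup>2)"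
      by (simp only: ennreal_mult[symmetric] ennreal_leI zero_le_power2 divide_nonneg_nonneg zero_le_numeral)
  qed
  also have "\<dots> = ennreal (4 / h\<^sup>2) * (\<integral>\<^sup>+s. ennreal ((norm (f s - trig J a s))\<^sup>2) \<partial>\<rho>)"
    by (rule nn_integral_cmult) measurable
  also have "\<dots> < ennreal (4 / h\<^sup>2) * ennreal e"
    using Ja(2) assms(2) by (intro ennreal_mult_strict_left_mono) auto
  also have "\<dots> = ennreal \<epsilon>" using e by (subst ennreal_mult[symmetric]) auto
  finally show "\<exists>J a. finite J \<and> (\<integral>\<^sup>+s. ennreal ((norm (of_real (1 / h) * ((exp (- \<i> * of_real (s * h)) - 1) * f s) - trig J a s))\<^sup>2) \<partial>\<rho>) < ennreal \<epsilon>"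
    using Ja(1) by (intro exI[of _ "(\<lambda>t. t + h) ` J \<union> J"] exI[of _ "\<lambda>t. 1 / h * b t"]) simp
qed

lemma appr_limit:
  assumes "\<And>n. appr (fn n)" and [measurable]: "f \<in> borel_measurable \<rho>"
    and lim: "(\<lambda>n. \<integral>\<^sup>+s. ennreal ((norm (f s - fn n s))\<^sup>2) \<partial>\<rho>) \<longlonglongrightarrow> 0"
  shows "appr f"
  unfolding appr_def
proof (intro conjI allI impI)
  have [measurable]: "fn n \<in> borel_measurable \<rho>" for n using assms(1)[of n] by (simp add: appr_def)
  fix \<epsilon> :: real assume "\<epsilon> > 0"
  then have e4: "\<epsilon> / 4 > 0" by simp
  then have "\<forall>\<^sub>F n in sequentially. (\<integral>\<^sup>+s. ennreal ((norm (f s - fn n s))\<^sup>2) \<partial>\<rho>) < ennreal (\<epsilon> / 4)"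
    using lim by (intro order_tendstoD(2)) auto
  then obtain n where n: "(\<integral>\<^sup>+s. ennreal ((norm (f s - fn n s))\<^sup>2) \<partial>\<rho>) < ennreal (\<epsilon> / 4)"
    using eventually_happens trivial_limit_sequentially by blast
  obtain J a where Ja: "finite J" "(\<integral>\<^sup>+s. ennreal ((norm (fn n s - trig J a s))\<^sup>2) \<partial>\<rho>) < ennreal (\<epsilon> / 4)"
    using assms(1)[of n] e4 unfolding appr_def by blast
  show "\<exists>J a. finite J \<and> (\<integral>\<^sup>+s. ennreal ((norm (f s - trig J a s))\<^sup>2) \<partial>\<rho>) < ennreal \<epsilon>"
    using Ja(1) nn_integral_power2_triangle_less[OF _ _ _ n Ja(2) \<open>\<epsilon> > 0\<close>]
    by (intro exI[of _ J] exI[of _ a]) auto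
qed measurable

lemma nn_integral_norm2_dominated:
  fixes f :: "real \<Rightarrow> complex"
  assumes [measurable]: "f \<in> borel_measurable \<rho>" "\<And>n. fn n \<in> borel_measurable \<rho>"
    and lim: "\<And>s. (\<lambda>n. fn n s) \<longlonglongrightarrow> f s"
    and le: "\<And>n s. norm (fn n s) \<le> g s" and g: "integrable \<rho> (\<lambda>s. (g s)\<^sup>2)"
  shows "(\<lambda>n. \<integral>\<^sup>+s. ennreal ((norm (f s - fn n s))\<^sup>2) \<partial>\<rho>) \<longlonglongrightarrow> 0"
proof -
  have [measurable]: "(\<lambda>s. (g s)\<^sup>2) \<in> borel_measurable \<rho>" using g by auto
  have "(\<lambda>n. \<integral>\<^sup>+s. ennreal ((norm (f s - fn n s))\<^sup>2) \<partial>\<rho>) \<longlonglongrightarrow> (\<integral>\<^sup>+s. 0 \<partial>\<rho>)"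
  proof (rule nn_integral_dominated_convergence[where w = "\<lambda>s. ennreal (4 * (g s)\<^sup>2)"])
    show "AE s in \<rho>. ennreal ((norm (f s - fn n s))\<^sup>2) \<le> ennreal (4 * (g s)\<^sup>2)" for n
    proof (intro AE_I2 ennreal_leI)
      fix s
      have "norm (f s) \<le> g s" by (rule LIMSEQ_le_const2[OF tendsto_norm[OF lim]]) (use le in auto)
      then have "norm (f s - fn n s) \<le> 2 * g s" using norm_triangle_ineq4[of "f s" "fn n s"] le[of n s] by simp
      then have "(norm (f s - fn n s))\<^sup>2 \<le> (2 * g s)\<^sup>2" by (intro power_mono) auto
      then show "(norm (f s - fn n s))\<^sup>2 \<le> 4 * (g s)\<^sup>2" by (simp add: power_mult_distrib)
    qed
    have "(\<integral>\<^sup>+s. ennreal (4 * (g s)\<^sup>2) \<partial>\<rho>) = ennreal (\<integral>s. 4 * (g s)\<^sup>2 \<partial>\<rho>)"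
      by (rule nn_integral_eq_integral) (use g in auto)
    then show "(\<integral>\<^sup>+s. ennreal (4 * (g s)\<^sup>2) \<partial>\<rho>) < \<infinity>" by simp
    show "AE s in \<rho>. (\<lambda>n. ennreal ((norm (f s - fn n s))\<^sup>2)) \<longlonglongrightarrow> 0"
    proof (intro AE_I2)
      fix s
      have "(\<lambda>n. (norm (f s - fn n s))\<^sup>2) \<longlonglongrightarrow> (norm (f s - f s))\<^sup>2" by (intro tendsto_intros lim)
      then show "(\<lambda>n. ennreal ((norm (f s - fn n s))\<^sup>2)) \<longlonglongrightarrow> 0"
        using tendsto_ennrealI by fastforce
    qed
  qed auto
  then show ?thesis by simp
qed

text \<open>Mean-square differentiation is multiplication by -is on the spectral side. The
  difference quotients are dominated by |s f(s)|.\<close>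

lemma appr_mult:
  assumes "appr f" and i: "integrable \<rho> (\<lambda>s. (s * norm (f s))\<^sup>2)"
  shows "appr (\<lambda>s. (- \<i> * of_real s) * f s)"
proof -
  have [measurable]: "f \<in> borel_measurable \<rho>" using assms by (simp add: appr_def)
  define h where "h n = 1 / real (Suc n)" for n
  have h: "h n > 0" for n by (simp add: h_def)
  have h0: "h \<longlonglongrightarrow> 0" unfolding h_def using LIMSEQ_inverse_real_of_nat by (simp add: inverse_eq_divide)
  show ?thesis
  proof (rule appr_limit[OF appr_difference[OF assms(1) h]])
    show "(\<lambda>n. \<integral>\<^sup>+s. ennreal ((norm ((- \<i> * of_real s) * f s - of_real (1 / h n) * ((exp (- \<i> * of_real (s * h n)) - 1) * f s)))\<^sup>2) \<partial>\<rho>) \<longlonglongrightarrow> 0"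
    proof (rule nn_integral_norm2_dominated[where g = "\<lambda>s. \<bar>s\<bar> * norm (f s)"])
      show "integrable \<rho> (\<lambda>s. (\<bar>s\<bar> * norm (f s))\<^sup>2)" using i by (simp add: power_mult_distrib)
      fix s
      have "((\<lambda>z. exp (- \<i> * of_real s * z)) has_field_derivative (- \<i> * of_real s)) (at 0)"
        by (auto intro!: derivative_eq_intros)
      then have "((\<lambda>y. (exp (- \<i> * of_real s * y) - 1) / y) \<longlongrightarrow> - \<i> * of_real s) (at 0)"
        by (simp add: has_field_derivative_iff)
      moreover have "filterlim (\<lambda>n. complex_of_real (h n)) (at 0) sequentially"
        unfolding filterlim_at using h h0 by (auto intro!: always_eventually simp: less_imp_neq[symmetric])
           (metis of_real_0 tendsto_of_real_iff)
      ultimately have "(\<lambda>n. (exp (- \<i> * of_real s * of_real (h n)) - 1) / of_real (h n)) \<longlonglongrightarrow> - \<i> * of_real s"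
        by (rule filterlim_compose)
      then have "(\<lambda>n. (exp (- \<i> * of_real s * of_real (h n)) - 1) / of_real (h n) * f s) \<longlonglongrightarrow> - \<i> * of_real s * f s"
        by (intro tendsto_mult tendsto_const)
      then show "(\<lambda>n. of_real (1 / h n) * ((exp (- \<i> * of_real (s * h n)) - 1) * f s)) \<longlonglongrightarrow> - \<i> * of_real s * f s"
        by (simp add: mult_ac)
      fix n
      have "norm (exp (\<i> * of_real (- s * h n)) - 1) \<le> \<bar>s\<bar> * h n"
        using iexp_approx1[of "- s * h n" 0] h[of n] by (simp add: abs_mult)
      then have "1 / h n * (norm (exp (\<i> * of_real (- s * h n)) - 1) * norm (f s)) \<le> 1 / h n * ((\<bar>s\<bar> * h n) * norm (f s))"
        using h[of n] by (intro mult_left_mono mult_right_mono) auto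
      then show "norm (of_real (1 / h n) * ((exp (- \<i> * of_real (s * h n)) - 1) * f s)) \<le> \<bar>s\<bar> * norm (f s)"
        using h[of n] by (simp add: norm_mult norm_divide)
    qed measurable
  qed measurable
qed

end

section \<open>Mean-square derivatives and their Taylor series under an exponential spectral
  moment\<close>

locale gaussian_exp_moment = gaussian_spectral +
  fixes \<kappa> :: real
  assumes kappa_pos: "\<kappa> > 0" and exp_integrable: "integrable \<rho> (\<lambda>s. exp (\<bar>s\<bar> * \<kappa>))"
begin

lemma exp_integrable_le:
  assumes "c \<le> \<kappa>" shows "integrable \<rho> (\<lambda>s. exp (c * \<bar>s\<bar>))"
  by (rule Bochner_Integration.integrable_bound[OF exp_integrable])
     (use assms in \<open>auto intro!: AE_I2 simp: mult.commute mult_right_mono\<close>)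

lemma power_exp_le: "c > 0 \<Longrightarrow> (c * \<bar>s\<bar>) ^ m / fact m \<le> exp (c * \<bar>s\<bar>)" for c s :: real
proof -
  assume "c > 0"
  define x where "x = c * \<bar>s\<bar>"
  have x: "x \<ge> 0" using \<open>c > 0\<close> by (simp add: x_def)
  have "(\<lambda>n. x ^ n / fact n) sums exp x"
    using exp_converges[of x] by (simp add: scaleR_conv_of_real field_simps)
  then show "(c * \<bar>s\<bar>) ^ m / fact m \<le> exp (c * \<bar>s\<bar>)"
    unfolding x_def[symmetric] using sum_le_suminf[OF sums_summable, of "\<lambda>n. x ^ n / fact n" "exp x" "{m}"] x
    by (simp add: sums_iff)
qed

lemma power_integrable: "integrable \<rho> (\<lambda>s. \<bar>s\<bar> ^ m)"
proof (rule Bochner_Integration.integrable_bound)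
  show "integrable \<rho> (\<lambda>s. fact m / \<kappa> ^ m * exp (\<kappa> * \<bar>s\<bar>))"
    by (intro integrable_mult_right exp_integrable_le) simp
  have "\<bar>s\<bar> ^ m \<le> fact m / \<kappa> ^ m * exp (\<kappa> * \<bar>s\<bar>)" for s
    using power_exp_le[OF kappa_pos, of s m] kappa_pos by (simp add: power_mult_distrib field_simps)
  then show "AE s in \<rho>. norm (\<bar>s\<bar> ^ m) \<le> norm (fact m / \<kappa> ^ m * exp (\<kappa> * \<bar>s\<bar>))"
    using kappa_pos by (intro AE_I2) (simp add: abs_mult)
qed auto

text \<open>The m-th derivative in t of exp(-ist) at t = c.\<close>

definition smon :: "real \<Rightarrow> nat \<Rightarrow> real \<Rightarrow> complex" where
  "smon c m s = (- \<i> * of_real s) ^ m * exp (- \<i> * of_real (s * c))"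

lemma smon_measurable[measurable]: "smon c m \<in> borel_measurable \<rho>"
  unfolding smon_def by measurable

lemma norm_smon: "norm (smon c m s) = \<bar>s\<bar> ^ m"
  by (simp add: smon_def norm_mult norm_power)

lemma appr_smon: "appr (smon c m)"
proof (induction m)
  case 0
  have "smon c 0 = trig {c} (\<lambda>_. 1)" by (simp only: trig_singleton) (simp add: smon_def fun_eq_iff)
  then show ?case unfolding appr_def by (auto intro!: exI[of _ "{c}"] exI[of _ "\<lambda>_. 1"])
next
  case (Suc m)
  have "integrable \<rho> (\<lambda>s. (s * norm (smon c m s))\<^sup>2)"
  proof -
    have "(s * norm (smon c m s))\<^sup>2 = \<bar>s\<bar> ^ (2 * Suc m)" for s
    proof -
      have "\<bar>s\<bar> ^ (2 * Suc m) = (\<bar>s\<bar> ^ Suc m)\<^sup>2" by (simp only: power_mult[symmetric] mult.commute)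
      also have "\<dots> = (s * norm (smon c m s))\<^sup>2" by (simp add: norm_smon power_mult_distrib)
      finally show ?thesis by simp
    qed
    then show ?thesis using power_integrable[of "2 * Suc m"] by simp
  qed
  then have "appr (\<lambda>s. (- \<i> * of_real s) * smon c m s)" by (rule appr_mult[OF Suc])
  then show ?case by (rule back_subst[of appr]) (simp add: smon_def fun_eq_iff)
qed

text \<open>A choice of representative; \<open>rep_eq_AE\<close> below shows that any two choices
  agree almost surely.\<close>

definition D :: "real \<Rightarrow> nat \<Rightarrow> 'a \<Rightarrow> real" where
  "D c m = (SOME Y. rep Y (smon c m))"

lemma rep_D: "rep (D c m) (smon c m)"
  unfolding D_def using someI_ex[OF appr_imp_rep[OF appr_smon]] .

lemma D_measurable[measurable]: "D c m \<in> borel_measurable M"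
  using rep_measurable[OF rep_D] by simp

end

context gaussian_spectral begin

lemma rep_cong_AE:
  assumes "rep Y f" "AE \<omega> in M. Y \<omega> = Y' \<omega>" "Y' \<in> borel_measurable M"
  shows "rep Y' f"
proof (rule rep_AE_limit[where Yn = "\<lambda>_. Y" and fn = "\<lambda>_. f"])
  show "AE \<omega> in M. (\<lambda>n. Y \<omega>) \<longlonglongrightarrow> Y' \<omega>" using assms(2) by eventually_elim simp
qed (use assms rep_measurable in auto)

lemma rep_eq_AE:
  assumes "rep Y f" "rep Z f"
  shows "AE \<omega> in M. Y \<omega> = Z \<omega>"
proof -
  note [measurable] = rep_measurable[OF assms(1)] rep_measurable[OF assms(2)]
  have "(\<integral>\<^sup>+\<omega>. ennreal ((norm (Y \<omega> - Z \<omega>))\<^sup>2) \<partial>M) = (\<integral>\<^sup>+s. ennreal ((norm (f s - f s))\<^sup>2) \<partial>\<rho>)"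
    by (rule rep_isometry) (rule rep_diff[OF assms])
  then have "AE \<omega> in M. ennreal ((norm (Y \<omega> - Z \<omega>))\<^sup>2) = 0"
    by (subst nn_integral_0_iff_AE[symmetric]) auto
  then show ?thesis by eventually_elim (auto simp: ennreal_eq_0_iff)
qed

end

context gaussian_exp_moment begin

text \<open>By the isometry the m-th Taylor term has spectral size (R|s|)^m / m!, which is at most
  q^m exp(\<kappa> |s| / 2) with q = 2R / \<kappa>. Squaring this uses the whole exponential moment,
  so \<kappa> / 2 is the radius that the moment allows.\<close>

lemma D_summable:
  assumes R: "0 < R" "R < \<kappa> / 2"
  shows "AE \<omega> in M. summable (\<lambda>m. \<bar>D c m \<omega>\<bar> * R ^ m / fact m)"
proof -
  define q where "q = R / (\<kappa> / 2)"
  define K where "K = (\<integral>s. exp (\<kappa> * \<bar>s\<bar>) \<partial>\<rho>)"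
  have q: "0 < q" "q < 1" using R by (auto simp: q_def)
  have K: "K \<ge> 0" by (simp add: K_def)
  have ptw: "(R * \<bar>s\<bar>) ^ m / fact m \<le> q ^ m * exp (\<kappa> / 2 * \<bar>s\<bar>)" for s m
  proof -
    have "R = q * (\<kappa> / 2)" using kappa_pos by (simp add: q_def)
    then have "R * \<bar>s\<bar> = q * (\<kappa> / 2 * \<bar>s\<bar>)" by (simp only: mult.assoc)
    then have "(R * \<bar>s\<bar>) ^ m / fact m = q ^ m * ((\<kappa> / 2 * \<bar>s\<bar>) ^ m / fact m)"
      by (simp only: power_mult_distrib[of q] times_divide_eq_right)
    also have "\<dots> \<le> q ^ m * exp (\<kappa> / 2 * \<bar>s\<bar>)"
      using power_exp_le[of "\<kappa> / 2" s m] kappa_pos q by (intro mult_left_mono) auto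
    finally show ?thesis .
  qed
  have sq: "(\<integral>\<^sup>+\<omega>. ennreal ((\<bar>D c m \<omega>\<bar> * R ^ m / fact m)\<^sup>2) \<partial>M) \<le> ennreal ((q ^ m)\<^sup>2 * K)" for m
  proof -
    have "(\<integral>\<^sup>+\<omega>. ennreal ((\<bar>D c m \<omega>\<bar> * R ^ m / fact m)\<^sup>2) \<partial>M) = (\<integral>\<^sup>+\<omega>. ennreal ((norm (R ^ m / fact m * D c m \<omega>))\<^sup>2) \<partial>M)"
      using R by (simp add: power_mult_distrib power_divide mult.commute)
    also have "\<dots> = (\<integral>\<^sup>+s. ennreal ((norm (of_real (R ^ m / fact m) * smon c m s))\<^sup>2) \<partial>\<rho>)"
      by (rule rep_isometry[OF rep_scale[OF rep_D]])
    also have "\<dots> \<le> (\<integral>\<^sup>+s. ennreal ((q ^ m)\<^sup>2 * exp (\<kappa> * \<bar>s\<bar>)) \<partial>\<rho>)"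
    proof (intro nn_integral_mono ennreal_leI)
      fix s
      have "norm (of_real (R ^ m / fact m) * smon c m s) = (R * \<bar>s\<bar>) ^ m / fact m"
        using R by (simp add: norm_mult norm_divide norm_power norm_smon power_mult_distrib)
      then have "(norm (of_real (R ^ m / fact m) * smon c m s))\<^sup>2 \<le> (q ^ m * exp (\<kappa> / 2 * \<bar>s\<bar>))\<^sup>2"
        using ptw[of s m] R by (intro power_mono) auto
      also have "\<dots> = (q ^ m)\<^sup>2 * exp (\<kappa> * \<bar>s\<bar>)"
        by (simp add: power_mult_distrib exp_double[symmetric])
      finally show "(norm (of_real (R ^ m / fact m) * smon c m s))\<^sup>2 \<le> (q ^ m)\<^sup>2 * exp (\<kappa> * \<bar>s\<bar>)" .
    qed
    also have "\<dots> = ennreal (\<integral>s. (q ^ m)\<^sup>2 * exp (\<kappa> * \<bar>s\<bar>) \<partial>\<rho>)"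
      by (rule nn_integral_eq_integral) (auto intro!: exp_integrable_le)
    also have "\<dots> = ennreal ((q ^ m)\<^sup>2 * K)" by (simp add: K_def)
    finally show ?thesis .
  qed
  show ?thesis
  proof (rule AE_summable_of_nn_integral)
    show "summable (\<lambda>m. (1 + K) / 2 * q ^ m)" using q by (intro summable_mult summable_geometric) auto
    fix m
    define \<eta> where "\<eta> = q ^ m"
    have \<eta>: "\<eta> > 0" using q by (simp add: \<eta>_def)
    have "(\<integral>\<^sup>+\<omega>. ennreal (\<bar>D c m \<omega>\<bar> * R ^ m / fact m) \<partial>M) \<le>
       (\<integral>\<^sup>+\<omega>. ennreal (\<eta> / 2) + ennreal (1 / (2 * \<eta>)) * ennreal ((\<bar>D c m \<omega>\<bar> * R ^ m / fact m)\<^sup>2) \<partial>M)"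
    proof (rule nn_integral_mono)
      fix \<omega>
      define E where "E = \<bar>D c m \<omega>\<bar> * R ^ m / fact m"
      have "0 \<le> (E - \<eta>)\<^sup>2 / (2 * \<eta>)" using \<eta> by simp
      also have "\<dots> = 1 / (2 * \<eta>) * E\<^sup>2 - E + \<eta> / 2"
        using \<eta> by (simp add: power2_eq_square field_simps)
      finally have "E \<le> \<eta> / 2 + 1 / (2 * \<eta>) * E\<^sup>2" by simp
      then have "ennreal E \<le> ennreal (\<eta> / 2 + 1 / (2 * \<eta>) * E\<^sup>2)" by (rule ennreal_leI)
      also have "\<dots> = ennreal (\<eta> / 2) + ennreal (1 / (2 * \<eta>)) * ennreal (E\<^sup>2)"
        using \<eta> by (subst ennreal_plus) (auto simp: ennreal_mult[symmetric])
      finally show "ennreal (\<bar>D c m \<omega>\<bar> * R ^ m / fact m) \<le> ennreal (\<eta> / 2) + ennreal (1 / (2 * \<eta>)) * ennreal ((\<bar>D c m \<omega>\<bar> * R ^ m / fact m)\<^sup>2)"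
        by (simp add: E_def)
    qed
    also have "\<dots> = ennreal (\<eta> / 2) + ennreal (1 / (2 * \<eta>)) * (\<integral>\<^sup>+\<omega>. ennreal ((\<bar>D c m \<omega>\<bar> * R ^ m / fact m)\<^sup>2) \<partial>M)"
      by (subst nn_integral_add) (auto simp: nn_integral_cmult emeasure_space_1)
    also have "\<dots> \<le> ennreal (\<eta> / 2) + ennreal (1 / (2 * \<eta>)) * ennreal (\<eta>\<^sup>2 * K)"
      using sq by (intro add_left_mono mult_left_mono) (auto simp: \<eta>_def)
    also have "\<dots> = ennreal (\<eta> / 2 + 1 / (2 * \<eta>) * (\<eta>\<^sup>2 * K))"
      using \<eta> K by (subst ennreal_plus) (auto simp: ennreal_mult[symmetric])
    also have "\<eta> / 2 + 1 / (2 * \<eta>) * (\<eta>\<^sup>2 * K) = (1 + K) / 2 * \<eta>"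
      using \<eta> by (simp add: field_simps power2_eq_square)
    finally show "(\<integral>\<^sup>+\<omega>. ennreal (\<bar>D c m \<omega>\<bar> * R ^ m / fact m) \<partial>M) \<le> ennreal ((1 + K) / 2 * q ^ m)"
      by (simp add: \<eta>_def)
    show "(1 + K) / 2 * q ^ m \<ge> 0" using K q by simp
  qed (use R in auto)
qed

text \<open>Power series in the derivatives at c correspond to power series in -is. The spectral
  partial sums are dominated by exp(R|s|), which is square integrable because 2R < \<kappa>.\<close>

lemma rep_series:
  fixes b :: "nat \<Rightarrow> real"
  assumes R: "0 < R" "R < \<kappa> / 2" and b: "\<And>m. \<bar>b m\<bar> \<le> R ^ m / fact m"
    and F: "\<And>s. (\<lambda>m. of_real (b m) * (- \<i> * of_real s) ^ m) sums F s"
  shows "rep (\<lambda>\<omega>. \<Sum>m. b m * D c m \<omega>) (\<lambda>s. F s * exp (- \<i> * of_real (s * c)))"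
proof (rule rep_AE_limit[where Yn = "\<lambda>n \<omega>. \<Sum>m<n. b m * D c m \<omega>" and fn = "\<lambda>n s. \<Sum>m<n. of_real (b m) * smon c m s"])
  show "rep (\<lambda>\<omega>. \<Sum>m<n. b m * D c m \<omega>) (\<lambda>s. \<Sum>m<n. of_real (b m) * smon c m s)" for n
    by (intro rep_sum rep_D) auto
  show "(\<lambda>\<omega>. \<Sum>m. b m * D c m \<omega>) \<in> borel_measurable M" by measurable
  have "F s = (\<Sum>m. of_real (b m) * (- \<i> * of_real s) ^ m)" for s using F by (simp add: sums_iff)
  then have "F = (\<lambda>s. \<Sum>m. of_real (b m) * (- \<i> * of_real s) ^ m)" by auto
  then have [measurable]: "F \<in> borel_measurable \<rho>" by simp
  show fm: "(\<lambda>s. F s * exp (- \<i> * of_real (s * c))) \<in> borel_measurable \<rho>" by measurable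
  show "AE \<omega> in M. (\<lambda>n. \<Sum>m<n. b m * D c m \<omega>) \<longlonglongrightarrow> (\<Sum>m. b m * D c m \<omega>)"
    using D_summable[OF R, of c]
  proof eventually_elim
    case (elim \<omega>)
    have "summable (\<lambda>m. b m * D c m \<omega>)"
    proof (rule summable_comparison_test'[OF elim, of 0])
      fix m
      show "norm (b m * D c m \<omega>) \<le> \<bar>D c m \<omega>\<bar> * R ^ m / fact m"
        using mult_right_mono[OF b[of m], of "\<bar>D c m \<omega>\<bar>"] by (simp add: abs_mult mult.commute)
    qed
    then show ?case using summable_LIMSEQ by blast
  qed
  have "(\<lambda>n. \<integral>\<^sup>+s. ennreal ((norm (F s * exp (- \<i> * of_real (s * c)) - (\<Sum>m<n. of_real (b m) * smon c m s)))\<^sup>2) \<partial>\<rho>) \<longlonglongrightarrow> 0"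
  proof (rule nn_integral_norm2_dominated[OF fm, where g = "\<lambda>s. exp (R * \<bar>s\<bar>)"])
    have "integrable \<rho> (\<lambda>s. exp ((2 * R) * \<bar>s\<bar>))" by (rule exp_integrable_le) (use R in simp)
    then show "integrable \<rho> (\<lambda>s. (exp (R * \<bar>s\<bar>))\<^sup>2)" by (simp add: exp_double[symmetric] mult.assoc)
    fix s
    have "(\<lambda>n. (\<Sum>m<n. of_real (b m) * (- \<i> * of_real s) ^ m) * exp (- \<i> * of_real (s * c))) \<longlonglongrightarrow> F s * exp (- \<i> * of_real (s * c))"
      using F[of s] unfolding sums_def by (intro tendsto_mult tendsto_const)
    then show "(\<lambda>n. \<Sum>m<n. of_real (b m) * smon c m s) \<longlonglongrightarrow> F s * exp (- \<i> * of_real (s * c))"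
      by (simp add: sum_distrib_right smon_def mult.assoc)
    fix n
    have es: "(\<lambda>m. (R * \<bar>s\<bar>) ^ m / fact m) sums exp (R * \<bar>s\<bar>)"
      using exp_converges[of "R * \<bar>s\<bar>"] by (simp add: scaleR_conv_of_real field_simps)
    have "norm (\<Sum>m<n. of_real (b m) * smon c m s) \<le> (\<Sum>m<n. \<bar>b m\<bar> * \<bar>s\<bar> ^ m)"
      by (rule order_trans[OF norm_sum]) (simp add: norm_mult norm_smon)
    also have "\<dots> \<le> (\<Sum>m<n. (R * \<bar>s\<bar>) ^ m / fact m)"
    proof (rule sum_mono)
      fix m
      show "\<bar>b m\<bar> * \<bar>s\<bar> ^ m \<le> (R * \<bar>s\<bar>) ^ m / fact m"
        using mult_right_mono[OF b[of m], of "\<bar>s\<bar> ^ m"] by (simp add: power_mult_distrib)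
    qed
    also have "\<dots> \<le> (\<Sum>m. (R * \<bar>s\<bar>) ^ m / fact m)"
      using R by (intro sum_le_suminf sums_summable[OF es]) auto
    also have "\<dots> = exp (R * \<bar>s\<bar>)" using es by (simp add: sums_iff)
    finally show "norm (\<Sum>m<n. of_real (b m) * smon c m s) \<le> exp (R * \<bar>s\<bar>)" .
  qed measurable
  then show "\<forall>\<^sub>F n in sequentially. (\<integral>\<^sup>+s. ennreal ((norm (F s * exp (- \<i> * of_real (s * c)) - (\<Sum>m<n. of_real (b m) * smon c m s)))\<^sup>2) \<partial>\<rho>) < ennreal \<epsilon>"
    if "\<epsilon> > 0" for \<epsilon> using that by (intro order_tendstoD(2)) auto
qed

text \<open>\<open>D c m\<close> is the \<open>m\<close>-th mean-square derivative of the process at \<open>c\<close>.\<close>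

definition Zs :: "real \<Rightarrow> 'a \<Rightarrow> complex \<Rightarrow> complex" where
  "Zs c \<omega> z = (\<Sum>m. of_real (D c m \<omega> / fact m) * z ^ m)"

lemma Zs_measurable: "(\<lambda>(\<omega>, z). Zs c \<omega> z) \<in> borel_measurable (M \<Otimes>\<^sub>M borel)"
  unfolding Zs_def by measurable

lemma Zs_measurable'[measurable]: "(\<lambda>\<omega>. Zs c \<omega> z) \<in> borel_measurable M"
  unfolding Zs_def by measurable

context
  fixes R :: real and c :: real and \<omega> :: 'a
  assumes R: "0 < R" and sm: "summable (\<lambda>m. \<bar>D c m \<omega>\<bar> * R ^ m / fact m)"
begin

lemma Zs_summable: "norm z \<le> R \<Longrightarrow> summable (\<lambda>m. of_real (D c m \<omega> / fact m) * z ^ m)" for z :: complex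
proof (rule summable_comparison_test'[OF sm, of 0])
  fix m assume "norm z \<le> R"
  then have "norm z ^ m \<le> R ^ m" by (intro power_mono) auto
  then show "norm (of_real (D c m \<omega> / fact m) * z ^ m) \<le> \<bar>D c m \<omega>\<bar> * R ^ m / fact m"
    by (simp add: norm_mult norm_divide norm_power divide_right_mono mult_left_mono)
qed

lemma Zs_holomorphic: "Zs c \<omega> holomorphic_on ball 0 R"
proof (rule power_series_holomorphic)
  fix w :: complex assume "w \<in> ball 0 R"
  then show "(\<lambda>m. of_real (D c m \<omega> / fact m) * (w - 0) ^ m) sums Zs c \<omega> w"
    unfolding Zs_def diff_zero by (intro summable_sums Zs_summable) simp
qed

lemma Zs_deriv: "deriv (Zs c \<omega>) 0 = of_real (D c 1 \<omega>)"
proof (rule DERIV_imp_deriv)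
  have "DERIV (\<lambda>z. \<Sum>m. of_real (D c m \<omega> / fact m) * z ^ m) (0::complex) :> (\<Sum>m. diffs (\<lambda>m. of_real (D c m \<omega> / fact m)) m * 0 ^ m)"
    by (rule termdiffs_strong[where K = "of_real R"]) (use R Zs_summable[of "of_real R"] in \<open>auto simp del: of_real_divide\<close>)
  then show "(Zs c \<omega> has_field_derivative of_real (D c 1 \<omega>)) (at 0)"
    unfolding Zs_def by (simp add: diffs_def)
qed

lemma Zs_Re_Im:
  assumes "norm z \<le> R"
  shows "Re (Zs c \<omega> z) = (\<Sum>m. (Re (z ^ m) / fact m) * D c m \<omega>)"
    and "Im (Zs c \<omega> z) = (\<Sum>m. (Im (z ^ m) / fact m) * D c m \<omega>)"
proof -
  have s: "(\<lambda>m. of_real (D c m \<omega> / fact m) * z ^ m) sums Zs c \<omega> z"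
    unfolding Zs_def by (intro summable_sums Zs_summable assms)
  have "Re (of_real (D c m \<omega> / fact m) * z ^ m) = (Re (z ^ m) / fact m) * D c m \<omega>"
    and "Im (of_real (D c m \<omega> / fact m) * z ^ m) = (Im (z ^ m) / fact m) * D c m \<omega>" for m
  proof -
    have "Re (complex_of_real a * w) = a * Re w" "Im (complex_of_real a * w) = a * Im w" for a w by simp_all
    then show "Re (of_real (D c m \<omega> / fact m) * z ^ m) = (Re (z ^ m) / fact m) * D c m \<omega>"
      and "Im (of_real (D c m \<omega> / fact m) * z ^ m) = (Im (z ^ m) / fact m) * D c m \<omega>"
      by (simp_all only: times_divide_eq_left times_divide_eq_right mult.commute)
  qed
  then show "Re (Zs c \<omega> z) = (\<Sum>m. (Re (z ^ m) / fact m) * D c m \<omega>)"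
     "Im (Zs c \<omega> z) = (\<Sum>m. (Im (z ^ m) / fact m) * D c m \<omega>)"
    using sums_Re[OF s] sums_Im[OF s] by (simp_all add: sums_iff)
qed

lemma Zs_real: "\<bar>t\<bar> \<le> R \<Longrightarrow> Zs c \<omega> (of_real t) = of_real (\<Sum>m. (t ^ m / fact m) * D c m \<omega>)"
  using Zs_Re_Im[of "of_real t"] by (intro complex_eqI) (simp_all flip: of_real_power)

end

text \<open>Formally the value at z corresponds to exp(-is(c + z)), but \<open>rep\<close> relates
  real variables only. The Taylor coefficients are real, so taking real or imaginary parts of z^m
  amounts to the half-sum or half-difference of the exponentials at z and its conjugate, whence cosh
  and sinh.\<close>

lemma rep_Zs:
  assumes R: "0 < R" "R < \<kappa> / 2" and z: "norm z \<le> R"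
  shows "rep (\<lambda>\<omega>. Re (Zs c \<omega> z)) (\<lambda>s. exp (- \<i> * of_real (s * (c + Re z))) * of_real (cosh (s * Im z)))"
    and "rep (\<lambda>\<omega>. Im (Zs c \<omega> z)) (\<lambda>s. - \<i> * exp (- \<i> * of_real (s * (c + Re z))) * of_real (sinh (s * Im z)))"
proof -
  define x y where "x = Re z" and "y = Im z"
  have zxy: "z = of_real x + \<i> * of_real y" "cnj z = of_real x - \<i> * of_real y"
    by (simp_all add: x_def y_def complex_eq_iff)
  have zm: "norm (z ^ m) / fact m \<le> R ^ m / fact m" for m
    using z by (intro divide_right_mono) (auto simp: norm_power power_mono)
  have E: "(\<lambda>m. (w * (- \<i> * of_real s)) ^ m / fact m) sums exp (w * (- \<i> * of_real s))" for w s
    using exp_converges[of "w * (- \<i> * of_real s)"] by (simp add: scaleR_conv_of_real field_simps)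
  have e1: "exp (z * (- \<i> * of_real s)) = exp (- \<i> * of_real (s * x)) * of_real (exp (s * y))" for s
    by (simp add: zxy exp_of_real[symmetric] exp_add[symmetric] algebra_simps)
  have e2: "exp (cnj z * (- \<i> * of_real s)) = exp (- \<i> * of_real (s * x)) * of_real (exp (- (s * y)))" for s
    unfolding zxy(2) exp_of_real[symmetric] exp_add[symmetric] by (rule arg_cong[where f = exp]) (simp add: algebra_simps)
  have sh: "exp (- \<i> * of_real (s * (c + x))) = exp (- \<i> * of_real (s * x)) * exp (- \<i> * of_real (s * c))" for s
    unfolding exp_add[symmetric] by (rule arg_cong[where f = exp]) (simp add: algebra_simps)
  have "rep (\<lambda>\<omega>. \<Sum>m. (Re (z ^ m) / fact m) * D c m \<omega>) (\<lambda>s. (exp (- \<i> * of_real (s * x)) * of_real (cosh (s * y))) * exp (- \<i> * of_real (s * c)))"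
  proof (rule rep_series[OF R])
    fix m
    have "\<bar>Re (z ^ m)\<bar> / fact m \<le> norm (z ^ m) / fact m" by (intro divide_right_mono abs_Re_le_cmod) auto
    then show "\<bar>Re (z ^ m) / fact m\<bar> \<le> R ^ m / fact m" using zm[of m] by simp
  next
    fix s
    have "(\<lambda>m. ((z * (- \<i> * of_real s)) ^ m / fact m + (cnj z * (- \<i> * of_real s)) ^ m / fact m) / 2) sums
      ((exp (z * (- \<i> * of_real s)) + exp (cnj z * (- \<i> * of_real s))) / 2)"
      by (intro sums_divide sums_add E)
    moreover have "((z * (- \<i> * of_real s)) ^ m / fact m + (cnj z * (- \<i> * of_real s)) ^ m / fact m) / 2 =
      of_real (Re (z ^ m) / fact m) * (- \<i> * of_real s) ^ m" for m
    proof -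
      have "of_real (Re (z ^ m)) = (z ^ m + cnj z ^ m) / 2"
        using complex_add_cnj[of "z ^ m"] by simp
      then show ?thesis by (simp only: of_real_divide power_mult_distrib of_real_fact) (simp add: field_simps)
    qed
    moreover have "(exp (z * (- \<i> * of_real s)) + exp (cnj z * (- \<i> * of_real s))) / 2 = exp (- \<i> * of_real (s * x)) * of_real (cosh (s * y))"
      unfolding e1 e2 by (simp add: cosh_field_def field_simps)
    ultimately show "(\<lambda>m. of_real (Re (z ^ m) / fact m) * (- \<i> * of_real s) ^ m) sums (exp (- \<i> * of_real (s * x)) * of_real (cosh (s * y)))"
      by simp
  qed
  then have 1: "rep (\<lambda>\<omega>. \<Sum>m. (Re (z ^ m) / fact m) * D c m \<omega>) (\<lambda>s. exp (- \<i> * of_real (s * (c + x))) * of_real (cosh (s * y)))"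
    unfolding sh by (simp add: mult_ac)
  have "rep (\<lambda>\<omega>. \<Sum>m. (Im (z ^ m) / fact m) * D c m \<omega>) (\<lambda>s. (- \<i> * exp (- \<i> * of_real (s * x)) * of_real (sinh (s * y))) * exp (- \<i> * of_real (s * c)))"
  proof (rule rep_series[OF R])
    fix m
    have "\<bar>Im (z ^ m)\<bar> / fact m \<le> norm (z ^ m) / fact m" by (intro divide_right_mono abs_Im_le_cmod) auto
    then show "\<bar>Im (z ^ m) / fact m\<bar> \<le> R ^ m / fact m" using zm[of m] by simp
  next
    fix s
    have "(\<lambda>m. ((z * (- \<i> * of_real s)) ^ m / fact m - (cnj z * (- \<i> * of_real s)) ^ m / fact m) / (2 * \<i>)) sums
      ((exp (z * (- \<i> * of_real s)) - exp (cnj z * (- \<i> * of_real s))) / (2 * \<i>))"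
      by (intro sums_divide sums_diff E)
    moreover have "((z * (- \<i> * of_real s)) ^ m / fact m - (cnj z * (- \<i> * of_real s)) ^ m / fact m) / (2 * \<i>) =
      of_real (Im (z ^ m) / fact m) * (- \<i> * of_real s) ^ m" for m
    proof -
      have "of_real (Im (z ^ m)) = (z ^ m - cnj z ^ m) / (2 * \<i>)"
        using complex_diff_cnj[of "z ^ m"] by (simp add: field_simps)
      then show ?thesis by (simp only: of_real_divide power_mult_distrib of_real_fact) (simp add: field_simps)
    qed
    moreover have "(exp (z * (- \<i> * of_real s)) - exp (cnj z * (- \<i> * of_real s))) / (2 * \<i>) = - \<i> * exp (- \<i> * of_real (s * x)) * of_real (sinh (s * y))"
      unfolding e1 e2 by (simp add: sinh_field_def field_simps)
    ultimately show "(\<lambda>m. of_real (Im (z ^ m) / fact m) * (- \<i> * of_real s) ^ m) sums (- \<i> * exp (- \<i> * of_real (s * x)) * of_real (sinh (s * y)))"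
      by (simp only:)
  qed
  then have 2: "rep (\<lambda>\<omega>. \<Sum>m. (Im (z ^ m) / fact m) * D c m \<omega>) (\<lambda>s. - \<i> * exp (- \<i> * of_real (s * (c + x))) * of_real (sinh (s * y)))"
    unfolding sh by (simp add: mult_ac)
  show "rep (\<lambda>\<omega>. Re (Zs c \<omega> z)) (\<lambda>s. exp (- \<i> * of_real (s * (c + Re z))) * of_real (cosh (s * Im z)))"
    using 1[unfolded x_def y_def]
    by (rule rep_cong_AE) (use D_summable[OF R, of c] Zs_Re_Im[OF R(1) _ z] in auto)
  show "rep (\<lambda>\<omega>. Im (Zs c \<omega> z)) (\<lambda>s. - \<i> * exp (- \<i> * of_real (s * (c + Re z))) * of_real (sinh (s * Im z)))"
    using 2[unfolded x_def y_def]
    by (rule rep_cong_AE) (use D_summable[OF R, of c] Zs_Re_Im[OF R(1) _ z] in auto)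
qed

text \<open>Equality holds almost surely at each single t, hence at all rational t simultaneously,
  and then everywhere since both sides are continuous in t.\<close>

lemma Zs_eq_X:
  assumes R: "0 < R" "R < \<kappa> / 2" and cont: "\<And>\<omega>. \<omega> \<in> space M \<Longrightarrow> continuous_on UNIV (\<lambda>t. X t \<omega>)"
  shows "AE \<omega> in M. summable (\<lambda>m. \<bar>D c m \<omega>\<bar> * R ^ m / fact m) \<and> (\<forall>t. \<bar>t\<bar> < R \<longrightarrow> of_real (X (c + t) \<omega>) = Zs c \<omega> (of_real t))"
proof -
  have "AE \<omega> in M. of_real (X (c + t) \<omega>) = Zs c \<omega> (of_real t)" if t: "\<bar>t\<bar> < R" for t
  proof -
    have "rep (\<lambda>\<omega>. Re (Zs c \<omega> (of_real t))) (\<lambda>s. exp (- \<i> * of_real (s * (c + t))))"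
      using rep_Zs(1)[OF R, of "of_real t" c] t by simp
    then have "AE \<omega> in M. X (c + t) \<omega> = Re (Zs c \<omega> (of_real t))" by (rule rep_eq_AE[OF rep_X])
    then show ?thesis using D_summable[OF R, of c]
      by eventually_elim (use t Zs_real[OF R(1)] in auto)
  qed
  then have "AE \<omega> in M. \<forall>t\<in>{t\<in>\<rat>. \<bar>t\<bar> < R}. of_real (X (c + t) \<omega>) = Zs c \<omega> (of_real t)"
    by (subst AE_ball_countable) (auto intro: countable_subset[OF _ countable_rat])
  then show ?thesis using D_summable[OF R, of c] AE_space
  proof eventually_elim
    case (elim \<omega>)
    have "of_real (X (c + t) \<omega>) = Zs c \<omega> (of_real t)" if t: "\<bar>t\<bar> < R" for t
    proof (rule ccontr)
      assume ne: "of_real (X (c + t) \<omega>) \<noteq> Zs c \<omega> (of_real t)"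
      define g where "g u = complex_of_real (X (c + u) \<omega>) - Zs c \<omega> (of_real u)" for u
      have "continuous_on {-R<..<R} g"
        unfolding g_def
      proof (intro continuous_intros)
        show "continuous_on {-R<..<R} (\<lambda>u. X (c + u) \<omega>)"
          using cont[OF elim(3)] by (rule continuous_on_compose2) (auto intro!: continuous_intros)
        show "continuous_on {-R<..<R} (\<lambda>u. Zs c \<omega> (of_real u))"
          by (rule continuous_on_compose2[OF holomorphic_on_imp_continuous_on[OF Zs_holomorphic[OF R(1) elim(2)]]])
             (auto intro!: continuous_intros)
      qed
      then have "isCont g t" using t continuous_on_eq_continuous_at[of "{-R<..<R}" g] by (auto simp: abs_less_iff)
      moreover have "g t \<noteq> 0" using ne by (simp add: g_def)
      ultimately obtain e where e: "e > 0" "\<And>u. dist t u < e \<Longrightarrow> g u \<noteq> 0"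
        using continuous_at_avoid[of t g 0] by auto
      \<comment> \<open>A rational point between l and t is both close to t and inside the disc; t
        itself may lie anywhere in (-R, R).\<close>
      define l where "l = max (t - e) (- R)"
      have "l < t" using e t by (auto simp: l_def)
      then obtain u where u: "u \<in> \<rat>" "l < u" "u < t" using Rats_dense_in_real by blast
      then have "\<bar>u\<bar> < R" "dist t u < e" using t by (auto simp: l_def dist_real_def)
      then show False using e(2)[of u] u(1) elim(1) by (auto simp: g_def)
    qed
    then show ?case using elim(2) by auto
  qed
qed

end

section \<open>Decay of the covariance along the grid\<close>

text \<open>The inequality between w_p w_q and the mean of the squares, together with symmetry of
  |A|, leaves only row sums. No spectral theory of matrices enters.\<close>

lemma schur_bound:
  fixes A :: "'i \<Rightarrow> 'i \<Rightarrow> real"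
  assumes "finite I" and sym: "\<And>p q. p \<in> I \<Longrightarrow> q \<in> I \<Longrightarrow> \<bar>A p q\<bar> = \<bar>A q p\<bar>"
    and row: "\<And>p. p \<in> I \<Longrightarrow> (\<Sum>q\<in>I. \<bar>A p q\<bar>) \<le> E"
  shows "\<bar>\<Sum>p\<in>I. \<Sum>q\<in>I. w p * w q * A p q\<bar> \<le> E * (\<Sum>p\<in>I. (w p)\<^sup>2)"
proof -
  have pt: "\<bar>w p * w q * A p q\<bar> \<le> (w p)\<^sup>2 / 2 * \<bar>A p q\<bar> + (w q)\<^sup>2 / 2 * \<bar>A p q\<bar>" for p q
  proof -
    have "\<bar>w p * w q\<bar> \<le> ((w p)\<^sup>2 + (w q)\<^sup>2) / 2"
      using sum_squares_bound[of "\<bar>w p\<bar>" "\<bar>w q\<bar>"] by (simp add: abs_mult)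
    then have "\<bar>w p * w q\<bar> * \<bar>A p q\<bar> \<le> ((w p)\<^sup>2 + (w q)\<^sup>2) / 2 * \<bar>A p q\<bar>" by (rule mult_right_mono) simp
    then show ?thesis by (simp add: abs_mult field_simps)
  qed
  have "\<bar>\<Sum>p\<in>I. \<Sum>q\<in>I. w p * w q * A p q\<bar> \<le> (\<Sum>p\<in>I. \<Sum>q\<in>I. \<bar>w p * w q * A p q\<bar>)"
    by (intro order_trans[OF sum_abs] sum_mono sum_abs)
  also have "\<dots> \<le> (\<Sum>p\<in>I. \<Sum>q\<in>I. (w p)\<^sup>2 / 2 * \<bar>A p q\<bar> + (w q)\<^sup>2 / 2 * \<bar>A p q\<bar>)"
    by (intro sum_mono pt)
  also have "\<dots> = (\<Sum>p\<in>I. \<Sum>q\<in>I. (w p)\<^sup>2 / 2 * \<bar>A p q\<bar>) + (\<Sum>p\<in>I. \<Sum>q\<in>I. (w q)\<^sup>2 / 2 * \<bar>A p q\<bar>)"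
    by (simp only: sum.distrib)
  also have "(\<Sum>p\<in>I. \<Sum>q\<in>I. (w q)\<^sup>2 / 2 * \<bar>A p q\<bar>) = (\<Sum>p\<in>I. \<Sum>q\<in>I. (w p)\<^sup>2 / 2 * \<bar>A p q\<bar>)"
    by (rule trans[OF sum.swap]) (intro sum.cong refl, simp add: sym)
  also have "(\<Sum>p\<in>I. \<Sum>q\<in>I. (w p)\<^sup>2 / 2 * \<bar>A p q\<bar>) + (\<Sum>p\<in>I. \<Sum>q\<in>I. (w p)\<^sup>2 / 2 * \<bar>A p q\<bar>) =
     (\<Sum>p\<in>I. (w p)\<^sup>2 * (\<Sum>q\<in>I. \<bar>A p q\<bar>))"
    by (simp add: sum_distrib_left sum.distrib[symmetric] mult.commute)
  also have "\<dots> \<le> (\<Sum>p\<in>I. (w p)\<^sup>2 * E)"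
    by (intro sum_mono mult_left_mono row) auto
  finally show ?thesis by (simp add: sum_distrib_left mult.commute)
qed

definition ndist :: "nat \<Rightarrow> nat \<Rightarrow> nat" where
  "ndist i j = (if i < j then j - i else i - j)"

text \<open>The points on either side of i have pairwise different positive distances to it; the two
  sides give the factor 2.\<close>

lemma sum_ndist_le:
  fixes h :: "nat \<Rightarrow> real"
  assumes "finite S" and le: "\<And>N. finite N \<Longrightarrow> 0 \<notin> N \<Longrightarrow> (\<Sum>l\<in>N. h l) \<le> e"
  shows "(\<Sum>j\<in>S - {i}. h (ndist i j)) \<le> 2 * e"
proof -
  have "S - {i} = {j\<in>S. i < j} \<union> {j\<in>S. j < i}" by auto
  then have "(\<Sum>j\<in>S - {i}. h (ndist i j)) = (\<Sum>j\<in>{j\<in>S. i < j}. h (ndist i j)) + (\<Sum>j\<in>{j\<in>S. j < i}. h (ndist i j))"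
    using assms(1) by (simp add: sum.union_disjoint disjoint_iff)
  also have "(\<Sum>j\<in>{j\<in>S. i < j}. h (ndist i j)) = (\<Sum>l\<in>(\<lambda>j. j - i) ` {j\<in>S. i < j}. h l)"
    by (subst sum.reindex) (auto simp: inj_on_def ndist_def)
  also have "(\<Sum>j\<in>{j\<in>S. j < i}. h (ndist i j)) = (\<Sum>l\<in>(\<lambda>j. i - j) ` {j\<in>S. j < i}. h l)"
    by (subst sum.reindex) (auto simp: inj_on_def ndist_def)
  also have "(\<Sum>l\<in>(\<lambda>j. j - i) ` {j\<in>S. i < j}. h l) \<le> e"
    by (rule le) (use assms(1) in auto)
  also have "(\<Sum>l\<in>(\<lambda>j. i - j) ` {j\<in>S. j < i}. h l) \<le> e"
    by (rule le) (use assms(1) in auto)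
  finally show ?thesis by simp
qed

section \<open>Covariances as Fourier transforms of weighted spectral measures\<close>

context gaussian_spectral begin

lemma rep_product_integrable:
  assumes "rep Y f" "rep Z g"
  shows "complex_integrable \<rho> (\<lambda>s. f s * cnj (g s))"
proof (rule Bochner_Integration.integrable_bound)
  note [measurable] = rep_measurable[OF assms(1)] rep_measurable[OF assms(2)]
  show "integrable \<rho> (\<lambda>s. (norm (f s))\<^sup>2 + (norm (g s))\<^sup>2)"
    by (intro Bochner_Integration.integrable_add rep_square_integrable[OF assms(1)] rep_square_integrable[OF assms(2)])
  have "norm u * norm v \<le> (norm u)\<^sup>2 + (norm v)\<^sup>2" for u v :: complex
  proof -
    have "0 \<le> norm u * norm v" by simp
    then show ?thesis using sum_squares_bound[of "norm u" "norm v"] by linarith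
  qed
  then show "AE s in \<rho>. norm (f s * cnj (g s)) \<le> norm ((norm (f s))\<^sup>2 + (norm (g s))\<^sup>2)"
    by (auto simp: norm_mult)
  show "(\<lambda>s. f s * cnj (g s)) \<in> borel_measurable \<rho>"
    by (intro borel_measurable_times measurable_compose[OF _ borel_measurable_continuous_onI[of cnj]] continuous_intros) auto
qed

text \<open>The coefficients are real, so only the real part of the spectral inner product enters
  the variance of a combination.\<close>

lemma gaussian_family_rep:
  fixes I :: "'i set"
  assumes "finite I" and rep: "\<And>i. i \<in> I \<Longrightarrow> rep (Y i) (f i)"
  shows "gaussian_family M I Y (\<lambda>i j. Re (CLINT s|\<rho>. f i s * cnj (f j s)))"
  unfolding gaussian_family_def
proof (intro conjI allI assms(1))
  fix w :: "'i \<Rightarrow> real"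
  have int: "complex_integrable \<rho> (\<lambda>s. f i s * cnj (f j s))" if "i \<in> I" "j \<in> I" for i j
    by (rule rep_product_integrable[OF rep[OF that(1)] rep[OF that(2)]])
  have pt: "(norm (\<Sum>i\<in>I. of_real (w i) * f i s))\<^sup>2 = (\<Sum>i\<in>I. \<Sum>j\<in>I. w i * w j * Re (f i s * cnj (f j s)))" for s
  proof -
    have "complex_of_real ((norm (\<Sum>i\<in>I. of_real (w i) * f i s))\<^sup>2) =
      (\<Sum>i\<in>I. of_real (w i) * f i s) * cnj (\<Sum>j\<in>I. of_real (w j) * f j s)"
      by (simp only: complex_norm_square)
    also have "\<dots> = (\<Sum>i\<in>I. \<Sum>j\<in>I. of_real (w i * w j) * (f i s * cnj (f j s)))"
      by (simp add: sum_product mult_ac)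
    finally have "Re (complex_of_real ((norm (\<Sum>i\<in>I. of_real (w i) * f i s))\<^sup>2)) =
       Re (\<Sum>i\<in>I. \<Sum>j\<in>I. of_real (w i * w j) * (f i s * cnj (f j s)))" by simp
    moreover have "Re (complex_of_real a * u) = a * Re u" for a u by simp
    ultimately show ?thesis by (simp only: Re_complex_of_real Re_sum)
  qed
  have "(\<integral>s. (norm (\<Sum>i\<in>I. of_real (w i) * f i s))\<^sup>2 \<partial>\<rho>) = (\<Sum>i\<in>I. \<Sum>j\<in>I. \<integral>s. w i * w j * Re (f i s * cnj (f j s)) \<partial>\<rho>)"
  proof -
    have i: "integrable \<rho> (\<lambda>s. w i * w j * Re (f i s * cnj (f j s)))" if "i \<in> I" "j \<in> I" for i j
      by (intro integrable_mult_right integrable_Re int that)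
    show ?thesis unfolding pt
      by (subst Bochner_Integration.integral_sum, intro Bochner_Integration.integrable_sum i, assumption+)
         (intro sum.cong refl Bochner_Integration.integral_sum i)
  qed
  also have "\<dots> = (\<Sum>i\<in>I. \<Sum>j\<in>I. w i * w j * Re (CLINT s|\<rho>. f i s * cnj (f j s)))"
    by (intro sum.cong refl) (simp only: integral_mult_right_zero integral_Re[OF int])
  finally have *: "(\<integral>s. (norm (\<Sum>i\<in>I. of_real (w i) * f i s))\<^sup>2 \<partial>\<rho>) = (\<Sum>i\<in>I. \<Sum>j\<in>I. w i * w j * Re (CLINT s|\<rho>. f i s * cnj (f j s)))" .
  show "centered_gaussian M (\<lambda>\<omega>. \<Sum>i\<in>I. w i * Y i \<omega>) (\<Sum>i\<in>I. \<Sum>j\<in>I. w i * w j * Re (CLINT s|\<rho>. f i s * cnj (f j s)))"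
  proof -
    have "rep (\<lambda>\<omega>. \<Sum>i\<in>I. w i * Y i \<omega>) (\<lambda>s. \<Sum>i\<in>I. of_real (w i) * f i s)"
      by (rule rep_sum[OF assms(1) rep])
    from rep_centered_gaussian[OF this] show ?thesis unfolding * .
  qed
qed

text \<open>The Fourier transform of the weighted measure g d\<rho>. The covariances along the grid
  and the functions r, r_1', r_2'' are all expressed through it.\<close>

definition Kc :: "(real \<Rightarrow> real) \<Rightarrow> real \<Rightarrow> complex" where
  "Kc g x = (CLINT s|\<rho>. of_real (g s) * exp (- \<i> * of_real (s * x)))"

lemma Kc_integrable:
  assumes "integrable \<rho> g" shows "complex_integrable \<rho> (\<lambda>s. of_real (g s) * exp (- \<i> * of_real (s * x)))"
proof (rule Bochner_Integration.integrable_bound[OF assms])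
  have [measurable]: "g \<in> borel_measurable \<rho>" using assms by auto
  show "(\<lambda>s. complex_of_real (g s) * exp (- \<i> * of_real (s * x))) \<in> borel_measurable \<rho>" by measurable
qed (simp add: norm_mult)

lemma norm_Kc_minus: "norm (Kc g (- x)) = norm (Kc g x)"
proof -
  have "Kc g (- x) = (CLINT s|\<rho>. cnj (of_real (g s) * exp (- \<i> * of_real (s * x))))"
    unfolding Kc_def by (intro Bochner_Integration.integral_cong refl) (simp add: exp_cnj)
  also have "\<dots> = cnj (Kc g x)" unfolding Kc_def by (rule Bochner_Integration.integral_cnj)
  finally show ?thesis by simp
qed

lemma Kc_one: "Kc (\<lambda>_. 1) x = of_real (r x)"
  by (simp add: Kc_def r_eq)

text \<open>Differentiation under the integral, tested along sequences so that dominated convergence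
  applies with majorant |s g(s)|.\<close>

lemma Kc_has_derivative:
  assumes g: "integrable \<rho> g" "integrable \<rho> (\<lambda>s. s * g s)"
  shows "((Kc g) has_vector_derivative (- \<i> * Kc (\<lambda>s. s * g s) x)) (at x)"
proof -
  have [measurable]: "g \<in> borel_measurable \<rho>" using g by auto
  have "((\<lambda>h. (Kc g (x + h) - Kc g x) /\<^sub>R h) \<longlongrightarrow> - \<i> * Kc (\<lambda>s. s * g s) x) (at 0)"
    unfolding tendsto_at_iff_sequentially comp_def
  proof (intro allI impI)
    fix h :: "nat \<Rightarrow> real" assume h: "\<forall>n. h n \<in> UNIV - {0}" "h \<longlonglongrightarrow> 0"
    define F where "F n s = of_real (g s) * exp (- \<i> * of_real (s * x)) * ((exp (- \<i> * of_real s * of_real (h n)) - 1) / of_real (h n))" for n s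
    have eq: "(Kc g (x + h n) - Kc g x) /\<^sub>R h n = integral\<^sup>L \<rho> (F n)" for n
    proof -
      have "(Kc g (x + h n) - Kc g x) /\<^sub>R h n = (CLINT s|\<rho>. (of_real (g s) * exp (- \<i> * of_real (s * (x + h n))) - of_real (g s) * exp (- \<i> * of_real (s * x))) /\<^sub>R h n)"
        unfolding Kc_def integral_scaleR_right[symmetric]
        by (simp only: Bochner_Integration.integral_diff[OF Kc_integrable[OF g(1)] Kc_integrable[OF g(1)]] integral_scaleR_right)
      also have "\<dots> = integral\<^sup>L \<rho> (F n)"
      proof (rule Bochner_Integration.integral_cong[OF refl])
        fix s
        have "exp (- \<i> * of_real (s * (x + h n))) = exp (- \<i> * of_real (s * x)) * exp (- \<i> * of_real s * of_real (h n))"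
          unfolding exp_add[symmetric] by (rule arg_cong[where f = exp]) (simp add: algebra_simps)
        then show "(of_real (g s) * exp (- \<i> * of_real (s * (x + h n))) - of_real (g s) * exp (- \<i> * of_real (s * x))) /\<^sub>R h n = F n s"
          unfolding F_def using h(1) by (simp add: scaleR_conv_of_real field_simps)
      qed
      finally show ?thesis .
    qed
    have "(\<lambda>n. integral\<^sup>L \<rho> (F n)) \<longlonglongrightarrow> (CLINT s|\<rho>. of_real (g s) * exp (- \<i> * of_real (s * x)) * (- \<i> * of_real s))"
    proof (rule integral_dominated_convergence[where w = "\<lambda>s. \<bar>s * g s\<bar>"])
      show "AE s in \<rho>. (\<lambda>n. F n s) \<longlonglongrightarrow> of_real (g s) * exp (- \<i> * of_real (s * x)) * (- \<i> * of_real s)"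
      proof (intro AE_I2)
        fix s
        have "((\<lambda>z. exp (- \<i> * of_real s * z)) has_field_derivative (- \<i> * of_real s)) (at 0)"
          by (auto intro!: derivative_eq_intros)
        then have "((\<lambda>y. (exp (- \<i> * of_real s * y) - 1) / y) \<longlongrightarrow> - \<i> * of_real s) (at 0)"
          by (simp add: has_field_derivative_iff)
        moreover have "filterlim (\<lambda>n. complex_of_real (h n)) (at 0) sequentially"
          unfolding filterlim_at using h by (auto intro!: always_eventually tendsto_of_real[of h 0, simplified])
        ultimately have "(\<lambda>n. (exp (- \<i> * of_real s * of_real (h n)) - 1) / of_real (h n)) \<longlonglongrightarrow> - \<i> * of_real s"
          by (rule filterlim_compose)
        then show "(\<lambda>n. F n s) \<longlonglongrightarrow> of_real (g s) * exp (- \<i> * of_real (s * x)) * (- \<i> * of_real s)"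
          unfolding F_def by (intro tendsto_mult tendsto_const)
      qed
      show "AE s in \<rho>. norm (F n s) \<le> \<bar>s * g s\<bar>" for n
      proof (intro AE_I2)
        fix s
        have "norm (exp (\<i> * of_real (- s * h n)) - 1) \<le> \<bar>s\<bar> * \<bar>h n\<bar>"
          using iexp_approx1[of "- s * h n" 0] by (simp add: abs_mult)
        then have "norm (exp (\<i> * of_real (- s * h n)) - 1) / \<bar>h n\<bar> \<le> \<bar>s\<bar>"
          using h(1) by (subst pos_divide_le_eq) auto
        then have "\<bar>g s\<bar> * (norm (exp (\<i> * of_real (- s * h n)) - 1) / \<bar>h n\<bar>) \<le> \<bar>g s\<bar> * \<bar>s\<bar>"
          by (rule mult_left_mono) simp
        then show "norm (F n s) \<le> \<bar>s * g s\<bar>"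
          by (simp add: F_def norm_mult norm_divide abs_mult mult_ac)
      qed
      show "F n \<in> borel_measurable \<rho>" for n unfolding F_def by measurable
    qed (use g in auto)
    also have "(CLINT s|\<rho>. of_real (g s) * exp (- \<i> * of_real (s * x)) * (- \<i> * of_real s)) = - \<i> * Kc (\<lambda>s. s * g s) x"
      unfolding Kc_def by (subst integral_mult_right_zero[symmetric]) (simp add: mult_ac)
    finally show "(\<lambda>n. (Kc g (x + h n) - Kc g x) /\<^sub>R h n) \<longlonglongrightarrow> - \<i> * Kc (\<lambda>s. s * g s) x"
      unfolding eq .
  qed
  then have "((\<lambda>h. norm ((Kc g (x + h) - Kc g x) /\<^sub>R h - (- \<i> * Kc (\<lambda>s. s * g s) x))) \<longlongrightarrow> 0) (at 0)"
    by (intro tendsto_norm_zero LIM_zero)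
  moreover have "\<forall>\<^sub>F h in at 0. norm ((Kc g (x + h) - Kc g x) /\<^sub>R h - (- \<i> * Kc (\<lambda>s. s * g s) x)) =
      norm (Kc g (x + h) - Kc g x - h *\<^sub>R (- \<i> * Kc (\<lambda>s. s * g s) x)) / norm h"
  proof (rule eventually_at_filter[THEN iffD2], intro always_eventually allI impI)
    fix h :: real assume h: "h \<noteq> 0"
    have "(Kc g (x + h) - Kc g x) /\<^sub>R h - (- \<i> * Kc (\<lambda>s. s * g s) x) =
      (Kc g (x + h) - Kc g x - h *\<^sub>R (- \<i> * Kc (\<lambda>s. s * g s) x)) /\<^sub>R h"
      using h by (simp add: scaleR_diff_right scaleR_add_right)
    then show "norm ((Kc g (x + h) - Kc g x) /\<^sub>R h - (- \<i> * Kc (\<lambda>s. s * g s) x)) =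
      norm (Kc g (x + h) - Kc g x - h *\<^sub>R (- \<i> * Kc (\<lambda>s. s * g s) x)) / norm h"
      by (simp only: norm_scaleR) (simp add: divide_inverse mult.commute)
  qed
  ultimately have "((\<lambda>h. norm (Kc g (x + h) - Kc g x - h *\<^sub>R (- \<i> * Kc (\<lambda>s. s * g s) x)) / norm h) \<longlongrightarrow> 0) (at 0)"
    by (rule Lim_transform_eventually)
  then show ?thesis
    unfolding has_vector_derivative_def has_derivative_at by (intro conjI bounded_linear_scaleR_left)
qed

end

context gaussian_exp_moment begin

lemma sinhc_bound: "\<bar>sinhc x\<bar> \<le> exp \<bar>x\<bar>"
proof (cases "x = 0")
  case False
  have "sinh \<bar>x\<bar> \<le> \<bar>x\<bar> * exp \<bar>x\<bar>"
  proof -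
    have "1 - exp (- (2 * \<bar>x\<bar>)) \<le> 2 * \<bar>x\<bar>" using exp_ge_add_one_self[of "- (2 * \<bar>x\<bar>)"] by simp
    then have "exp \<bar>x\<bar> * (1 - exp (- (2 * \<bar>x\<bar>))) \<le> exp \<bar>x\<bar> * (2 * \<bar>x\<bar>)" by (intro mult_left_mono) auto
    moreover have "exp \<bar>x\<bar> * (1 - exp (- (2 * \<bar>x\<bar>))) = exp \<bar>x\<bar> - exp (- \<bar>x\<bar>)"
      by (simp add: right_diff_distrib exp_add[symmetric])
    ultimately have "exp \<bar>x\<bar> - exp (- \<bar>x\<bar>) \<le> exp \<bar>x\<bar> * (2 * \<bar>x\<bar>)" by linarith
    then show ?thesis by (simp add: sinh_field_def mult_ac)
  qed
  moreover have "\<bar>sinh x\<bar> = sinh \<bar>x\<bar>"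
    by (rule sinh_real_abs[symmetric])
  ultimately have "\<bar>sinh x\<bar> / \<bar>x\<bar> \<le> exp \<bar>x\<bar>" using False by (simp only: pos_divide_le_eq zero_less_abs_iff mult.commute not_False_eq_True)
  then show ?thesis using False by (simp add: sinhc_def)
qed (simp add: sinhc_def)

lemma sinhc_measurable[measurable]: "sinhc \<in> borel_measurable borel"
proof -
  have "(\<lambda>x::real. sinh x) \<in> borel_measurable borel"
    by (intro borel_measurable_continuous_onI continuous_intros)
  then show ?thesis unfolding sinhc_def[abs_def] by measurable
qed

lemma power_exp_integrable:
  assumes "c < \<kappa>" "c \<ge> 0" shows "integrable \<rho> (\<lambda>s. \<bar>s\<bar> ^ m * exp (c * \<bar>s\<bar>))"
proof (rule Bochner_Integration.integrable_bound)
  define d where "d = \<kappa> - c"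
  have d: "d > 0" using assms by (simp add: d_def)
  show "integrable \<rho> (\<lambda>s. fact m / d ^ m * exp (\<kappa> * \<bar>s\<bar>))"
    by (intro integrable_mult_right exp_integrable_le) simp
  have "\<bar>s\<bar> ^ m * exp (c * \<bar>s\<bar>) \<le> fact m / d ^ m * exp (\<kappa> * \<bar>s\<bar>)" for s
  proof -
    have "\<bar>s\<bar> ^ m \<le> fact m / d ^ m * exp (d * \<bar>s\<bar>)"
      using power_exp_le[OF d, of s m] d by (simp add: power_mult_distrib field_simps)
    then have "\<bar>s\<bar> ^ m * exp (c * \<bar>s\<bar>) \<le> fact m / d ^ m * exp (d * \<bar>s\<bar>) * exp (c * \<bar>s\<bar>)"
      by (rule mult_right_mono) simp
    also have "\<dots> = fact m / d ^ m * exp (\<kappa> * \<bar>s\<bar>)"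
      by (simp add: d_def exp_add[symmetric] algebra_simps)
    finally show ?thesis .
  qed
  then show "AE s in \<rho>. norm (\<bar>s\<bar> ^ m * exp (c * \<bar>s\<bar>)) \<le> norm (fact m / d ^ m * exp (\<kappa> * \<bar>s\<bar>))"
    using d by (intro AE_I2) (simp add: abs_mult)
qed auto

lemma sinhc_power_integrable:
  assumes "real l * \<bar>y\<bar> < \<kappa>" shows "integrable \<rho> (\<lambda>s. s ^ m * sinhc (s * y) ^ l)"
proof (rule Bochner_Integration.integrable_bound)
  show "integrable \<rho> (\<lambda>s. \<bar>s\<bar> ^ m * exp ((real l * \<bar>y\<bar>) * \<bar>s\<bar>))"
    by (rule power_exp_integrable) (use assms in auto)
  have "\<bar>sinhc (s * y)\<bar> ^ l \<le> exp ((real l * \<bar>y\<bar>) * \<bar>s\<bar>)" for s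
  proof -
    have "\<bar>sinhc (s * y)\<bar> ^ l \<le> exp \<bar>s * y\<bar> ^ l" by (intro power_mono sinhc_bound) simp
    also have "\<dots> = exp ((real l * \<bar>y\<bar>) * \<bar>s\<bar>)"
      by (simp add: exp_of_nat_mult[symmetric] abs_mult mult_ac)
    finally show ?thesis .
  qed
  then show "AE s in \<rho>. norm (s ^ m * sinhc (s * y) ^ l) \<le> norm (\<bar>s\<bar> ^ m * exp ((real l * \<bar>y\<bar>) * \<bar>s\<bar>))"
    by (intro AE_I2) (simp add: abs_mult power_abs mult_left_mono)
qed auto

lemma r_ell_eq: "r_ell \<rho> l x y = Kc (\<lambda>s. sinhc (s * y) ^ l) x"
  unfolding r_ell_def Kc_def by (simp add: mult.commute)

lemma r_ell'_eq:
  assumes "real l * \<bar>y\<bar> < \<kappa>"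
  shows "r_ell' \<rho> l x y = - \<i> * Kc (\<lambda>s. s * sinhc (s * y) ^ l) x"
proof -
  have "((\<lambda>x. r_ell \<rho> l x y) has_vector_derivative - \<i> * Kc (\<lambda>s. s * sinhc (s * y) ^ l) x) (at x)"
    unfolding r_ell_eq
    by (rule Kc_has_derivative)
       (use sinhc_power_integrable[OF assms, of 0] sinhc_power_integrable[OF assms, of 1] in simp_all)
  then show ?thesis unfolding r_ell'_def by (rule vector_derivative_at)
qed

lemma r_ell''_eq:
  assumes "real l * \<bar>y\<bar> < \<kappa>"
  shows "r_ell'' \<rho> l x y = - Kc (\<lambda>s. s\<^sup>2 * sinhc (s * y) ^ l) x"
proof -
  have "((\<lambda>x. - \<i> * Kc (\<lambda>s. s * sinhc (s * y) ^ l) x) has_vector_derivative - \<i> * (- \<i> * Kc (\<lambda>s. s * (s * sinhc (s * y) ^ l)) x)) (at x)"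
    by (rule has_vector_derivative_mult_right[OF Kc_has_derivative])
       (use sinhc_power_integrable[OF assms, of 1] sinhc_power_integrable[OF assms, of 2] in \<open>simp_all add: power2_eq_square mult.assoc\<close>)
  then have "((\<lambda>x. r_ell' \<rho> l x y) has_vector_derivative - Kc (\<lambda>s. s\<^sup>2 * sinhc (s * y) ^ l) x) (at x)"
    unfolding r_ell'_eq[OF assms] by (simp add: power2_eq_square mult.assoc[symmetric])
  then show ?thesis unfolding r_ell''_def by (rule vector_derivative_at)
qed

text \<open>The consequences of the hypothesis at a suitable spacing L. The kernels with weights 1,
  s and (at y = 0) s^2 govern the pairs of value and derivative; the third kernel at general y
  governs the circle. The sets N will be sets of distances within an arbitrary finite subset of the
  grid.\<close>

definition decay :: "real \<Rightarrow> real \<Rightarrow> real \<Rightarrow> bool" where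
  "decay \<kappa>' L \<epsilon> \<longleftrightarrow> (\<forall>N. finite N \<and> 0 \<notin> N \<longrightarrow>
     (\<Sum>l\<in>N. \<bar>r (real l * L)\<bar>) \<le> \<epsilon> \<and>
     (\<Sum>l\<in>N. norm (Kc (\<lambda>s. s) (real l * L))) \<le> \<epsilon> \<and>
     (\<forall>y. \<bar>y\<bar> < \<kappa>' \<longrightarrow> (\<Sum>l\<in>N. norm (Kc (\<lambda>s. s\<^sup>2 * sinhc (s * y) ^ 2) (real l * L))) \<le> \<epsilon>))"

text \<open>With L = k|x| the points l L, l at least 1, correspond to distinct indices l k at least
  k of the original progression. Each sum over N is thus part of a tail, and the tail is small for
  large k.\<close>

lemma omega_star_imp_decay:
  assumes k': "0 < \<kappa>'" "\<kappa>' < \<kappa> / 2" and lim: "omega_star r \<rho> \<kappa>' x \<longlonglongrightarrow> 0" and "\<epsilon> > 0" and r0: "r 0 = 1"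
  shows "\<exists>L>0. decay \<kappa>' L \<epsilon>"
proof -
  have "\<forall>\<^sub>F k in sequentially. omega_star r \<rho> \<kappa>' x k < ennreal \<epsilon>"
    using lim \<open>\<epsilon> > 0\<close> by (intro order_tendstoD(2)) auto
  then obtain k0 where "\<And>k. k \<ge> k0 \<Longrightarrow> omega_star r \<rho> \<kappa>' x k < ennreal \<epsilon>"
    by (auto simp: eventually_sequentially)
  then have om: "omega_star r \<rho> \<kappa>' x (Suc k0) \<le> ennreal \<epsilon>" by (simp add: less_imp_le)
  \<comment> \<open>The successor guarantees k at least 1, so that l -> l k is injective and L can
    be positive.\<close>
  define k where "k = Suc k0"
  have k: "k \<ge> 1" by (simp add: k_def)
  \<comment> \<open>The sign of x does not matter since all kernels are even in absolute
    value.\<close>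
  define L where "L = real k * \<bar>x\<bar>"
  have sub: "(\<Sum>l\<in>N. f (real l * L)) \<le> \<epsilon>"
    if N: "finite N" "0 \<notin> N" and f: "\<And>u. f u \<ge> 0" "\<And>u. f (- u) = f u" and le: "(\<Sum>j. ennreal (f (real (j + k) * x))) \<le> ennreal \<epsilon>"
    for N and f :: "real \<Rightarrow> real"
  proof -
    \<comment> \<open>The tail is indexed by j + k, so the multiple l k has index l k - k. Truncated
      subtraction is harmless because l is at least 1.\<close>
    have inj: "inj_on (\<lambda>l. l * k - k) N"
    proof (rule inj_onI)
      fix a b assume ab: "a \<in> N" "b \<in> N" "a * k - k = b * k - k"
      then have "a \<ge> 1" "b \<ge> 1" using N(2) by (metis One_nat_def Suc_leI neq0_conv)+
      then have "a * k \<ge> k" "b * k \<ge> k" by (auto)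
      then have "a * k = b * k" using ab(3) by linarith
      then show "a = b" using k by simp
    qed
    have fe: "f (real l * L) = f (real ((l * k - k) + k) * x)" if "l \<in> N" for l
    proof -
      have "l \<ge> 1" using that N(2) by (metis One_nat_def Suc_leI neq0_conv)
      then have "(l * k - k) + k = l * k" by simp
      then show ?thesis using f(2)[of "real (l * k) * x"] by (simp add: L_def abs_if mult.assoc)
    qed
    have "ennreal (\<Sum>l\<in>N. f (real l * L)) = (\<Sum>l\<in>N. ennreal (f (real l * L)))"
      by (rule sum_ennreal[symmetric]) (rule f(1))
    also have "\<dots> = (\<Sum>l\<in>N. ennreal (f (real ((l * k - k) + k) * x)))"
      by (intro sum.cong refl arg_cong[where f = ennreal] fe)
    also have "\<dots> = (\<Sum>j\<in>(\<lambda>l. l * k - k) ` N. ennreal (f (real (j + k) * x)))"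
      by (simp only: sum.reindex[OF inj] o_def)
    also have "\<dots> \<le> (\<Sum>j. ennreal (f (real (j + k) * x)))"
      by (rule sum_le_suminf) (use N in auto)
    also have "\<dots> \<le> ennreal \<epsilon>" by (rule le)
    finally show ?thesis using \<open>\<epsilon> > 0\<close> by (simp add: ennreal_le_iff)
  qed
  have b0: "(\<Sum>j. ennreal \<bar>r (real (j + k) * x)\<bar>) \<le> ennreal \<epsilon>"
    using om unfolding omega_star_def k_def by (rule order_trans[rotated]) simp
  have "(SUP y\<in>{y. \<bar>y\<bar> < \<kappa>'}. (\<Sum>j. ennreal (norm (r_ell' \<rho> 1 (real (j + k) * x) (2 * y)))) +
        (\<Sum>j. ennreal (norm (r_ell'' \<rho> 2 (real (j + k) * x) y)))) \<le> ennreal \<epsilon>"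
    using om unfolding omega_star_def k_def by (rule order_trans[rotated]) simp
  then have bsum: "(\<Sum>j. ennreal (norm (r_ell' \<rho> 1 (real (j + k) * x) (2 * y)))) +
        (\<Sum>j. ennreal (norm (r_ell'' \<rho> 2 (real (j + k) * x) y))) \<le> ennreal \<epsilon>" if "\<bar>y\<bar> < \<kappa>'" for y
    using that by (simp add: SUP_le_iff)
  have b1: "(\<Sum>j. ennreal (norm (r_ell' \<rho> 1 (real (j + k) * x) (2 * y)))) \<le> ennreal \<epsilon>" if "\<bar>y\<bar> < \<kappa>'" for y
    using bsum[OF that] by (rule order_trans[rotated]) simp
  have b2: "(\<Sum>j. ennreal (norm (r_ell'' \<rho> 2 (real (j + k) * x) y))) \<le> ennreal \<epsilon>" if "\<bar>y\<bar> < \<kappa>'" for y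
    using bsum[OF that] by (rule order_trans[rotated]) simp
  have reven: "r (- u) = r u" for u
  proof -
    have "complex_of_real (r (- u)) = cnj (of_real (r u))"
      unfolding r_eq by (subst Bochner_Integration.integral_cnj[symmetric]) (simp add: exp_cnj)
    then show ?thesis by simp
  qed
  have "decay \<kappa>' L \<epsilon>"
    unfolding decay_def
  proof (intro allI impI conjI)
    fix N :: "nat set" assume N: "finite N \<and> 0 \<notin> N"
    show "(\<Sum>l\<in>N. \<bar>r (real l * L)\<bar>) \<le> \<epsilon>"
      by (rule sub[of N "\<lambda>u. \<bar>r u\<bar>", OF conjunct1[OF N] conjunct2[OF N] abs_ge_zero _ b0]) (simp only: reven)
    \<comment> \<open>At y = 0 the weight sinhc is 1, and r_1' becomes the covariance of value and
      derivative up to a phase.\<close>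
    have "norm (r_ell' \<rho> 1 u (2 * 0)) = norm (Kc (\<lambda>s. s) u)" for u
      using r_ell'_eq[of 1 0 u] kappa_pos by (simp add: norm_mult sinhc_def)
    then have c1: "(\<Sum>j. ennreal (norm (Kc (\<lambda>s. s) (real (j + k) * x)))) \<le> ennreal \<epsilon>"
      using b1[of 0] k'(1) by (simp only: abs_zero)
    show "(\<Sum>l\<in>N. norm (Kc (\<lambda>s. s) (real l * L))) \<le> \<epsilon>"
      by (rule sub[of N "\<lambda>u. norm (Kc (\<lambda>s. s) u)", OF conjunct1[OF N] conjunct2[OF N] norm_ge_zero norm_Kc_minus c1])
    fix y :: real assume y: "\<bar>y\<bar> < \<kappa>'"
    have "norm (r_ell'' \<rho> 2 u y) = norm (Kc (\<lambda>s. s\<^sup>2 * sinhc (s * y) ^ 2) u)" for u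
      using r_ell''_eq[of 2 y u] y k' by simp
    then have c2: "(\<Sum>j. ennreal (norm (Kc (\<lambda>s. s\<^sup>2 * sinhc (s * y) ^ 2) (real (j + k) * x)))) \<le> ennreal \<epsilon>"
      using b2[OF y] by (simp only:)
    show "(\<Sum>l\<in>N. norm (Kc (\<lambda>s. s\<^sup>2 * sinhc (s * y) ^ 2) (real l * L))) \<le> \<epsilon>"
      by (rule sub[of N "\<lambda>u. norm (Kc (\<lambda>s. s\<^sup>2 * sinhc (s * y) ^ 2) u)", OF conjunct1[OF N] conjunct2[OF N] norm_ge_zero norm_Kc_minus c2])
  qed
  \<comment> \<open>For x = 0 every term of the first series would be |r 0| = 1 and the series would
    diverge.\<close>
  moreover have "L > 0"
  proof (rule ccontr)
    assume "\<not> L > 0"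
    then have "x = 0" using k by (auto simp: L_def zero_less_mult_iff)
    then have "(\<Sum>j. ennreal 1) \<le> ennreal \<epsilon>" using b0 r0 by simp
    moreover have "(\<Sum>j<n. ennreal 1) \<le> (\<Sum>j. ennreal 1)" for n :: nat by (rule sum_le_suminf) auto
    ultimately have "(\<Sum>j<n. ennreal 1) \<le> ennreal \<epsilon>" for n :: nat by (rule order_trans[rotated])
    then have "ennreal (real n) \<le> ennreal \<epsilon>" for n by (simp add: ennreal_of_nat_eq_real_of_nat)
    then have "real n \<le> \<epsilon>" for n using \<open>\<epsilon> > 0\<close> by (simp add: ennreal_le_iff)
    then show False using reals_Archimedean2[of \<epsilon>] by (auto simp: not_less[symmetric])
  qed
  ultimately show ?thesis by blast
qed

end

section \<open>The Gaussian families attached to one class of grid points\<close>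

locale zero_counting = gaussian_exp_moment +
  fixes \<kappa>' :: real
  assumes kp: "0 < \<kappa>'" "\<kappa>' < \<kappa> / 2" and r0: "r 0 = 1" and non_atomic: "non_atomic \<rho>"
    and cont: "\<And>\<omega>. \<omega> \<in> space M \<Longrightarrow> continuous_on UNIV (\<lambda>t. X t \<omega>)"
begin

definition m2 :: real where "m2 = (\<integral>s. s\<^sup>2 \<partial>\<rho>)"
definition \<mu> :: real where "\<mu> = sqrt m2"

lemma square_integrable: "integrable \<rho> (\<lambda>s. s\<^sup>2)"
  using power_integrable[of 2] by simp

text \<open>A vanishing second moment would concentrate all mass at 0, which is an atom.\<close>

lemma m2_pos: "m2 > 0"
proof (rule ccontr)
  assume "\<not> m2 > 0"
  moreover have "m2 \<ge> 0" unfolding m2_def by simp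
  ultimately have "m2 = 0" by simp
  then have "AE s in \<rho>. s\<^sup>2 = 0"
    using integral_nonneg_eq_0_iff_AE[OF square_integrable] by (simp add: m2_def)
  then have "AE s in \<rho>. s = 0" by simp
  then have "emeasure \<rho> {0} = emeasure \<rho> (space \<rho>)"
    by (intro emeasure_eq_AE) auto
  then show False using non_atomic rho.emeasure_space_1 by (simp add: non_atomic_def)
qed

lemma \<mu>_pos: "\<mu> > 0" and \<mu>_sq: "\<mu>\<^sup>2 = m2"
  using m2_pos by (auto simp: \<mu>_def)

text \<open>Spectral functions of X t and X' t / \<mu>. Dividing by \<mu>, the standard deviation of
  the derivative, makes the covariance of the pair at one time the identity.\<close>

definition pf :: "real \<Rightarrow> bool \<Rightarrow> real \<Rightarrow> complex" where
  "pf t e s = (if e then of_real (1 / \<mu>) * smon t 1 s else exp (- \<i> * of_real (s * t)))"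

definition V :: "real \<Rightarrow> 'a \<Rightarrow> real" where "V t \<omega> = 1 / \<mu> * D t 1 \<omega>"

lemma V_measurable[measurable]: "V t \<in> borel_measurable M" unfolding V_def by measurable

lemma rep_pf: "rep (if e then V t else X t) (pf t e)"
  using rep_scale[OF rep_D[of t 1], of "1 / \<mu>"] rep_X[of t]
  by (cases e) (simp_all add: V_def[abs_def] pf_def[abs_def])

definition cf :: "bool \<Rightarrow> complex" where "cf e = (if e then - \<i> / of_real \<mu> else 1)"

lemma pf_product: "(CLINT s|\<rho>. pf t a s * cnj (pf u b s)) = cf a * cnj (cf b) * Kc (\<lambda>s. s ^ (of_bool a + of_bool b)) (t - u)"
proof -
  have e: "exp (- \<i> * of_real (s * t)) * cnj (exp (- \<i> * of_real (s * u))) = exp (- \<i> * of_real (s * (t - u)))" for s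
    unfolding exp_cnj exp_add[symmetric] by (rule arg_cong[where f = exp]) (simp add: algebra_simps)
  have pf: "pf t a s = cf a * of_real s ^ of_bool a * exp (- \<i> * of_real (s * t))" for t a s
    by (cases a) (simp_all add: pf_def cf_def smon_def)
  have "pf t a s * cnj (pf u b s) = cf a * cnj (cf b) * (of_real (s ^ (of_bool a + of_bool b)) * exp (- \<i> * of_real (s * (t - u))))" for s
  proof -
    have "pf t a s * cnj (pf u b s) = cf a * cnj (cf b) * (of_real s ^ of_bool a * of_real s ^ of_bool b) *
       (exp (- \<i> * of_real (s * t)) * cnj (exp (- \<i> * of_real (s * u))))"
      unfolding pf by (simp only: complex_cnj_mult complex_cnj_power complex_cnj_complex_of_real mult_ac)
    then show ?thesis unfolding e by (simp only: of_real_power of_real_mult power_add mult.assoc)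
  qed
  then show ?thesis unfolding Kc_def by (simp only: integral_mult_right_zero)
qed

lemma norm_cf: "norm (cf e) = (if e then 1 / \<mu> else 1)"
  using \<mu>_pos by (simp add: cf_def norm_divide)

definition Cp :: "(nat \<Rightarrow> real) \<Rightarrow> nat \<times> bool \<Rightarrow> nat \<times> bool \<Rightarrow> real" where
  "Cp t p q = Re (CLINT s|\<rho>. pf (t (fst p)) (snd p) s * cnj (pf (t (fst q)) (snd q) s))"

lemma pair_family:
  assumes "finite S"
  shows "gaussian_family M (S \<times> UNIV) (\<lambda>(j, e). if e then V (t j) else X (t j)) (Cp t)"
proof -
  have "gaussian_family M (S \<times> UNIV) (\<lambda>p. if snd p then V (t (fst p)) else X (t (fst p)))
     (\<lambda>p q. Re (CLINT s|\<rho>. pf (t (fst p)) (snd p) s * cnj (pf (t (fst q)) (snd q) s)))"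
    by (rule gaussian_family_rep) (use assms rep_pf in auto)
  then show ?thesis unfolding Cp_def[abs_def] by (simp add: case_prod_beta')
qed

text \<open>Row sum of the covariance minus the identity: the kernels with weights 1, s, s^2 are
  divided by 1, \<mu>, \<mu>^2 and each sums to at most \<epsilon>. The factor 2 counts the grid
  points on either side.\<close>

definition pair_eps :: "real \<Rightarrow> real" where "pair_eps \<epsilon> = 2 * (\<epsilon> * (1 + 1 / \<mu> + 1 / \<mu>\<^sup>2))"

lemma grid_diff: "norm (Kc g ((t0 + real i * L) - (t0 + real j * L))) = norm (Kc g (real (ndist i j) * L))"
proof (cases "i < j")
  case True
  then have "(t0 + real i * L) - (t0 + real j * L) = - (real (ndist i j) * L)"
    by (simp add: ndist_def algebra_simps of_nat_diff)
  then show ?thesis by (simp only: norm_Kc_minus)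
next
  case False
  then have "(t0 + real i * L) - (t0 + real j * L) = real (ndist i j) * L"
    by (simp add: ndist_def algebra_simps of_nat_diff)
  then show ?thesis by (simp only:)
qed

lemma sum_UNIV_bool: "(\<Sum>e\<in>UNIV. f e) = f False + f True" for f :: "bool \<Rightarrow> 'z::comm_monoid_add"
  by (simp add: UNIV_bool)

text \<open>The diagonal blocks are exactly the identity, and Schur's test bounds the remaining
  blocks through the decay along the grid.\<close>

lemma pair_bounds:
  fixes t0 L :: real
  assumes "finite S" and dec: "decay \<kappa>' L \<epsilon>"
  defines "t \<equiv> \<lambda>j. t0 + real j * L"
  shows "\<bar>(\<Sum>p\<in>S \<times> UNIV. \<Sum>q\<in>S \<times> UNIV. w p * w q * Cp t p q) - (\<Sum>p\<in>S \<times> UNIV. (w p)\<^sup>2)\<bar> \<le>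
     pair_eps \<epsilon> * (\<Sum>p\<in>S \<times> UNIV. (w p)\<^sup>2)"
proof -
  define G where "G m l = norm (Kc (\<lambda>s. s ^ m) (real l * L))" for m l
  define h where "h l = G 0 l + G 1 l / \<mu> + G 2 l / \<mu>\<^sup>2" for l
  have hsum: "(\<Sum>l\<in>N. h l) \<le> \<epsilon> * (1 + 1 / \<mu> + 1 / \<mu>\<^sup>2)" if N: "finite N" "0 \<notin> N" for N
  proof -
    have "(\<Sum>l\<in>N. G 0 l) \<le> \<epsilon>" using dec N by (simp add: decay_def G_def Kc_one)
    moreover have "(\<Sum>l\<in>N. G 1 l) \<le> \<epsilon>" using dec N by (simp add: decay_def G_def)
    moreover have "(\<Sum>l\<in>N. G 2 l) \<le> \<epsilon>"
    proof -
      have "(\<lambda>s. s\<^sup>2 * sinhc (s * 0) ^ 2) = (\<lambda>s. s\<^sup>2)" by (simp add: sinhc_def)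
      moreover have "\<forall>y. \<bar>y\<bar> < \<kappa>' \<longrightarrow> (\<Sum>l\<in>N. norm (Kc (\<lambda>s. s\<^sup>2 * sinhc (s * y) ^ 2) (real l * L))) \<le> \<epsilon>"
        using dec N unfolding decay_def by blast
      then have "(\<Sum>l\<in>N. norm (Kc (\<lambda>s. s\<^sup>2 * sinhc (s * 0) ^ 2) (real l * L))) \<le> \<epsilon>"
        using kp(1) by (elim allE[of _ 0]) (simp only: abs_zero simp_thms)
      ultimately show ?thesis by (simp only: G_def)
    qed
    ultimately have "(\<Sum>l\<in>N. G 0 l) + (\<Sum>l\<in>N. G 1 l) / \<mu> + (\<Sum>l\<in>N. G 2 l) / \<mu>\<^sup>2 \<le> \<epsilon> + \<epsilon> / \<mu> + \<epsilon> / \<mu>\<^sup>2"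
      using \<mu>_pos by (intro add_mono divide_right_mono) auto
    then show ?thesis by (simp add: h_def sum.distrib sum_divide_distrib[symmetric] distrib_left)
  qed
  define A where "A p q = Cp t p q - of_bool (p = q)" for p q
  have nC: "norm (CLINT s|\<rho>. pf (t i) a s * cnj (pf (t j) b s)) = norm (cf a) * norm (cf b) * G (of_bool a + of_bool b) (ndist i j)" for i j a b
    unfolding pf_product t_def by (simp only: norm_mult complex_mod_cnj grid_diff G_def)
  have sym: "Cp t p q = Cp t q p" for p q
  proof -
    have "Cp t p q = Re (cnj (CLINT s|\<rho>. pf (t (fst p)) (snd p) s * cnj (pf (t (fst q)) (snd q) s)))"
      by (simp only: Cp_def cnj.simps)
    also have "\<dots> = Cp t q p"
      unfolding Cp_def Bochner_Integration.integral_cnj[symmetric] by (simp only: complex_cnj_mult complex_cnj_cnj mult.commute)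
    finally show ?thesis .
  qed
  \<comment> \<open>At equal times value and derivative are uncorrelated: their spectral inner
    product is purely imaginary, being i or -i times a real moment.\<close>
  have diag: "Cp t (i, a) (i, b) = of_bool (a = b)" for i a b
  proof -
    have K0: "Kc (\<lambda>s. s ^ m) 0 = of_real (\<integral>s. s ^ m \<partial>\<rho>)" for m
      unfolding Kc_def by (simp flip: of_real_power)
    show ?thesis
    proof (cases a; cases b)
      assume "a" "b"
      then show ?thesis using K0[of 2] \<mu>_pos \<mu>_sq m2_pos
        by (simp add: Cp_def pf_product cf_def m2_def power2_eq_square numeral_2_eq_2[symmetric])
    next
      assume "\<not> a" "\<not> b"
      then show ?thesis using r0 by (simp add: Cp_def pf_product cf_def Kc_one)
    qed (use K0[of 1] in \<open>simp_all add: Cp_def pf_product cf_def\<close>)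
  qed
  have row: "(\<Sum>q\<in>S \<times> UNIV. \<bar>A p q\<bar>) \<le> pair_eps \<epsilon>" if "p \<in> S \<times> UNIV" for p
  proof -
    obtain i a where p: "p = (i, a)" "i \<in> S" using \<open>p \<in> S \<times> UNIV\<close> by auto
    have "(\<Sum>q\<in>S \<times> UNIV. \<bar>A p q\<bar>) = (\<Sum>j\<in>S. \<Sum>b\<in>UNIV. \<bar>A p (j, b)\<bar>)"
      by (simp add: sum.cartesian_product)
    also have "\<dots> = (\<Sum>b\<in>UNIV. \<bar>A p (i, b)\<bar>) + (\<Sum>j\<in>S - {i}. \<Sum>b\<in>UNIV. \<bar>A p (j, b)\<bar>)"
      by (rule sum.remove[OF assms(1) p(2)])
    also have "(\<Sum>b\<in>UNIV. \<bar>A p (i, b)\<bar>) = 0"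
      by (simp add: A_def p(1) diag)
    also have "(\<Sum>j\<in>S - {i}. \<Sum>b\<in>UNIV. \<bar>A p (j, b)\<bar>) \<le> (\<Sum>j\<in>S - {i}. h (ndist i j))"
    proof (rule sum_mono)
      fix j assume "j \<in> S - {i}"
      then have "\<bar>A p (j, b)\<bar> \<le> norm (cf a) * norm (cf b) * G (of_bool a + of_bool b) (ndist i j)" for b
        unfolding A_def p(1) nC[symmetric] by (simp add: Cp_def abs_Re_le_cmod)
      then have "(\<Sum>b\<in>UNIV. \<bar>A p (j, b)\<bar>) \<le> (\<Sum>b\<in>UNIV. norm (cf a) * norm (cf b) * G (of_bool a + of_bool b) (ndist i j))"
        by (rule sum_mono)
      also have "\<dots> \<le> h (ndist i j)"
      proof -
        have "G m l \<ge> 0" for m l by (simp add: G_def)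
        then show ?thesis using \<mu>_pos
          by (cases a) (simp_all add: sum_UNIV_bool norm_cf h_def power2_eq_square numeral_2_eq_2)
      qed
      finally show "(\<Sum>b\<in>UNIV. \<bar>A p (j, b)\<bar>) \<le> h (ndist i j)" .
    qed
    also have "\<dots> \<le> pair_eps \<epsilon>"
      unfolding pair_eps_def by (rule sum_ndist_le[OF assms(1) hsum])
    finally show ?thesis by simp
  qed
  have "\<bar>\<Sum>p\<in>S \<times> UNIV. \<Sum>q\<in>S \<times> UNIV. w p * w q * A p q\<bar> \<le> pair_eps \<epsilon> * (\<Sum>p\<in>S \<times> UNIV. (w p)\<^sup>2)"
    by (rule schur_bound[OF _ _ row]) (use assms(1) sym in \<open>auto simp: A_def\<close>)
  moreover have "(\<Sum>p\<in>S \<times> UNIV. \<Sum>q\<in>S \<times> UNIV. w p * w q * A p q) =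
      (\<Sum>p\<in>S \<times> UNIV. \<Sum>q\<in>S \<times> UNIV. w p * w q * Cp t p q) - (\<Sum>p\<in>S \<times> UNIV. (w p)\<^sup>2)"
  proof -
    have "(\<Sum>q\<in>S \<times> UNIV. w p * w q * of_bool (p = q)) = (w p)\<^sup>2" if "p \<in> S \<times> UNIV" for p
      using that assms(1) by (subst sum.remove[of _ p]) (auto simp: power2_eq_square intro!: sum.neutral)
    then have "(\<Sum>p\<in>S \<times> UNIV. \<Sum>q\<in>S \<times> UNIV. w p * w q * of_bool (p = q)) = (\<Sum>p\<in>S \<times> UNIV. (w p)\<^sup>2)"
      by (rule sum.cong[OF refl])
    then show ?thesis unfolding A_def right_diff_distrib sum_subtractf by simp
  qed
  ultimately show ?thesis by simp
qed

definition K1 :: real where "K1 = (\<integral>s. exp (\<kappa> * \<bar>s\<bar>) \<partial>\<rho>)"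
text \<open>Row-sum bound for the circle families: \<open>K1\<close> for the diagonal, and twice 1 +
  \<kappa>'^2 for the rest at decay level 1. Here a fixed bound suffices, while the pairs need a
  covariance close to the identity.\<close>

definition \<Lambda>c :: real where "\<Lambda>c = K1 + 2 * (1 + \<kappa>'\<^sup>2)"

lemma \<Lambda>c_pos: "\<Lambda>c > 0"
  unfolding \<Lambda>c_def K1_def by (intro add_nonneg_pos) (auto intro: add_pos_nonneg)

text \<open>Serves real parts (e = 1) and imaginary parts (e = 0) together. As sinh(sy)^2 = y^2 s^2
  sinhc(sy)^2 and cosh^2 = 1 + sinh^2, their covariances combine r and the kernel of r_2''.\<close>

lemma circle_family_bound:
  fixes g :: "real \<Rightarrow> real" and f :: "nat \<Rightarrow> real \<Rightarrow> complex" and Y :: "nat \<Rightarrow> 'a \<Rightarrow> real"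
  assumes "finite S" and dec: "decay \<kappa>' L 1" and y: "\<bar>y\<bar> < \<kappa>'" and e: "e = 0 \<or> e = 1"
    and rep: "\<And>j. j \<in> S \<Longrightarrow> rep (Y j) (f j)"
    and fg: "\<And>i j s. f i s * cnj (f j s) = of_real (e + y\<^sup>2 * (s\<^sup>2 * (sinhc (s * y))\<^sup>2)) * exp (- \<i> * of_real (s * ((t0 + real i * L) - (t0 + real j * L))))"
  shows "(\<integral>\<^sup>+\<omega>. ennreal (exp (\<Sum>j\<in>S. 3 / (4 * \<Lambda>c) * (Y j \<omega>)\<^sup>2 / 2)) \<partial>M) \<le> ennreal (2 ^ card S)"
proof -
  define C where "C i j = Re (CLINT s|\<rho>. f i s * cnj (f j s))" for i j
  define G where "G u = norm (Kc (\<lambda>s. s\<^sup>2 * (sinhc (s * y))\<^sup>2) u)" for u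
  have i2: "integrable \<rho> (\<lambda>s. s\<^sup>2 * (sinhc (s * y))\<^sup>2)"
    using sinhc_power_integrable[of 2 y 2] y kp by simp
  have i1: "integrable \<rho> (\<lambda>s. e)" by simp
  have Keq: "(CLINT s|\<rho>. f i s * cnj (f j s)) = of_real e * of_real (r ((t0 + real i * L) - (t0 + real j * L))) +
      of_real (y\<^sup>2) * Kc (\<lambda>s. s\<^sup>2 * (sinhc (s * y))\<^sup>2) ((t0 + real i * L) - (t0 + real j * L))" for i j
  proof -
    define u where "u = (t0 + real i * L) - (t0 + real j * L)"
    have "(CLINT s|\<rho>. f i s * cnj (f j s)) = (CLINT s|\<rho>. of_real e * (of_real 1 * exp (- \<i> * of_real (s * u))) +
       of_real (y\<^sup>2) * (of_real (s\<^sup>2 * (sinhc (s * y))\<^sup>2) * exp (- \<i> * of_real (s * u))))"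
      unfolding fg u_def by (intro Bochner_Integration.integral_cong refl) (simp add: algebra_simps)
    also have "\<dots> = of_real e * (CLINT s|\<rho>. of_real 1 * exp (- \<i> * of_real (s * u))) +
       of_real (y\<^sup>2) * (CLINT s|\<rho>. of_real (s\<^sup>2 * (sinhc (s * y))\<^sup>2) * exp (- \<i> * of_real (s * u)))"
    proof -
      have a: "complex_integrable \<rho> (\<lambda>s. of_real 1 * exp (- \<i> * of_real (s * u)))"
        by (rule Kc_integrable) simp
      have b: "complex_integrable \<rho> (\<lambda>s. of_real (s\<^sup>2 * (sinhc (s * y))\<^sup>2) * exp (- \<i> * of_real (s * u)))"
        by (rule Kc_integrable[OF i2])
      show ?thesis
        by (subst Bochner_Integration.integral_add) (intro integrable_mult_right a b | simp only: integral_mult_right_zero)+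
    qed
    also have "(CLINT s|\<rho>. of_real 1 * exp (- \<i> * of_real (s * u))) = of_real (r u)"
      using Kc_one[of u] by (simp add: Kc_def)
    finally show ?thesis unfolding Kc_def u_def .
  qed
  define h where "h l = \<bar>r (real l * L)\<bar> + \<kappa>'\<^sup>2 * G (real l * L)" for l
  have y2: "y\<^sup>2 \<le> \<kappa>'\<^sup>2" using y kp by (simp add: abs_le_square_iff[symmetric])
  have Cle: "\<bar>C i j\<bar> \<le> h (ndist i j)" for i j
  proof -
    have "\<bar>C i j\<bar> \<le> norm (CLINT s|\<rho>. f i s * cnj (f j s))" unfolding C_def by (rule abs_Re_le_cmod)
    also have "\<dots> \<le> norm (of_real e * complex_of_real (r ((t0 + real i * L) - (t0 + real j * L)))) +
       norm (complex_of_real (y\<^sup>2) * Kc (\<lambda>s. s\<^sup>2 * (sinhc (s * y))\<^sup>2) ((t0 + real i * L) - (t0 + real j * L)))"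
      unfolding Keq by (rule norm_triangle_ineq)
    also have "\<dots> = \<bar>e\<bar> * norm (Kc (\<lambda>_. 1) ((t0 + real i * L) - (t0 + real j * L))) + y\<^sup>2 * G (real (ndist i j) * L)"
      unfolding norm_mult Kc_one G_def grid_diff[of _ t0 i L j] by (simp add: norm_power)
    also have "\<dots> \<le> h (ndist i j)"
      unfolding grid_diff h_def using e y2 by (intro add_mono mult_right_mono) (auto simp: Kc_one G_def)
    finally show ?thesis .
  qed
  \<comment> \<open>The weight is at most cosh(sy)^2, hence at most exp(2|y||s|), and 2|y| <
    \<kappa>.\<close>
  have Cdiag: "\<bar>C i i\<bar> \<le> K1" for i
  proof -
    have "C i i = (\<integral>s. e + y\<^sup>2 * (s\<^sup>2 * (sinhc (s * y))\<^sup>2) \<partial>\<rho>)"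
      unfolding C_def fg
      by (simp only: diff_self mult_zero_right of_real_0 exp_zero mult_1_right integral_complex_of_real Re_complex_of_real)
    also have "\<bar>\<dots>\<bar> \<le> K1"
      unfolding K1_def
    proof (rule order_trans[OF integral_abs_bound], rule integral_mono)
      show "integrable \<rho> (\<lambda>s. \<bar>e + y\<^sup>2 * (s\<^sup>2 * (sinhc (s * y))\<^sup>2)\<bar>)"
        by (intro integrable_abs Bochner_Integration.integrable_add i1 integrable_mult_right i2)
      show "integrable \<rho> (\<lambda>s. exp (\<kappa> * \<bar>s\<bar>))" by (rule exp_integrable_le) simp
      fix s
      have "y\<^sup>2 * (s\<^sup>2 * (sinhc (s * y))\<^sup>2) = (sinh (s * y))\<^sup>2"
        by (simp add: sinhc_def power_divide power_mult_distrib)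
      then have "\<bar>e + y\<^sup>2 * (s\<^sup>2 * (sinhc (s * y))\<^sup>2)\<bar> \<le> 1 + (sinh (s * y))\<^sup>2" using e by auto
      also have "\<dots> = (cosh (s * y))\<^sup>2" by (simp add: cosh_square_eq)
      also have "\<dots> \<le> (exp \<bar>s * y\<bar>)\<^sup>2"
      proof (rule power_mono)
        have "cosh (s * y) = (exp \<bar>s * y\<bar> + exp (- \<bar>s * y\<bar>)) / 2"
          using cosh_real_abs[of "s * y"] by (simp add: cosh_field_def)
        also have "\<dots> \<le> exp \<bar>s * y\<bar>" by simp
        finally show "cosh (s * y) \<le> exp \<bar>s * y\<bar>" .
      qed (simp add: cosh_real_pos less_imp_le)
      also have "\<dots> = exp (2 * \<bar>y\<bar> * \<bar>s\<bar>)" by (simp add: exp_double[symmetric] abs_mult mult_ac)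
      also have "\<dots> \<le> exp (\<kappa> * \<bar>s\<bar>)"
        using y kp by (auto intro!: mult_right_mono)
      finally show "\<bar>e + y\<^sup>2 * (s\<^sup>2 * (sinhc (s * y))\<^sup>2)\<bar> \<le> exp (\<kappa> * \<bar>s\<bar>)" .
    qed
    finally show ?thesis .
  qed
  have hsum: "(\<Sum>l\<in>N. h l) \<le> 1 + \<kappa>'\<^sup>2" if N: "finite N" "0 \<notin> N" for N
  proof -
    have "(\<Sum>l\<in>N. \<bar>r (real l * L)\<bar>) \<le> 1" "(\<Sum>l\<in>N. G (real l * L)) \<le> 1"
      using dec N y unfolding decay_def G_def by blast+
    then have "(\<Sum>l\<in>N. \<bar>r (real l * L)\<bar>) + \<kappa>'\<^sup>2 * (\<Sum>l\<in>N. G (real l * L)) \<le> 1 + \<kappa>'\<^sup>2 * 1"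
      by (intro add_mono mult_left_mono) auto
    then show ?thesis by (simp add: h_def sum.distrib sum_distrib_left)
  qed
  have row: "(\<Sum>q\<in>S. \<bar>C p q\<bar>) \<le> \<Lambda>c" if "p \<in> S" for p
  proof -
    have "(\<Sum>q\<in>S. \<bar>C p q\<bar>) = \<bar>C p p\<bar> + (\<Sum>q\<in>S - {p}. \<bar>C p q\<bar>)"
      by (rule sum.remove[OF assms(1) that])
    also have "\<dots> \<le> K1 + (\<Sum>q\<in>S - {p}. h (ndist p q))"
      by (intro add_mono Cdiag sum_mono Cle)
    also have "\<dots> \<le> K1 + 2 * (1 + \<kappa>'\<^sup>2)"
      by (intro add_left_mono sum_ndist_le[OF assms(1) hsum])
    finally show ?thesis by (simp add: \<Lambda>c_def)
  qed
  have sym: "\<bar>C p q\<bar> = \<bar>C q p\<bar>" for p q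
  proof -
    have "C p q = Re (cnj (CLINT s|\<rho>. f p s * cnj (f q s)))" by (simp only: C_def cnj.simps)
    also have "\<dots> = C q p"
      unfolding C_def Bochner_Integration.integral_cnj[symmetric] by (simp only: complex_cnj_mult complex_cnj_cnj mult.commute)
    finally show ?thesis by simp
  qed
  have fam: "gaussian_family M S Y C"
    unfolding C_def[abs_def] by (rule gaussian_family_rep[OF assms(1) rep])
  \<comment> \<open>The factor 3 / (4 \<Lambda>) makes 1 - s \<Lambda> = 1/4, so each grid point
    costs exactly a factor 2.\<close>
  have "(\<integral>\<^sup>+\<omega>. ennreal (exp (\<Sum>j\<in>S. 3 / (4 * \<Lambda>c) * (Y j \<omega>)\<^sup>2 / 2)) \<partial>M) \<le>
    ennreal ((1 / sqrt (1 - 3 / (4 * \<Lambda>c) * \<Lambda>c)) ^ card S)"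
  proof (rule nn_integral_exp_sum_squares_le[OF prob_space_axioms fam])
    show "(\<Sum>i\<in>S. \<Sum>j\<in>S. w i * w j * C i j) \<le> \<Lambda>c * (\<Sum>i\<in>S. (w i)\<^sup>2)" for w
      using schur_bound[OF assms(1) sym row, of w] by linarith
  qed (use \<Lambda>c_pos in auto)
  also have "1 / sqrt (1 - 3 / (4 * \<Lambda>c) * \<Lambda>c) = 2"
    using \<Lambda>c_pos by (simp add: real_sqrt_divide)
  finally show ?thesis .
qed

text \<open>The squared modulus splits into real and imaginary parts, which are separated by exp(a +
  b) <= (exp(2a) + exp(2b)) / 2. Their joint law is thereby avoided at the price of halving the
  exponent, from 3 / (8 \<Lambda>) to 3 / (16 \<Lambda>).\<close>

lemma Zs_exp_moment:
  assumes "finite S" and dec: "decay \<kappa>' L 1" and z: "norm z < \<kappa>'"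
  shows "(\<integral>\<^sup>+\<omega>. ennreal (exp (\<Sum>j\<in>S. 3 / (16 * \<Lambda>c) * (norm (Zs (t0 + real j * L) \<omega> z))\<^sup>2)) \<partial>M) \<le> ennreal (2 ^ card S)"
proof -
  define x y where "x = Re z" and "y = Im z"
  have y: "\<bar>y\<bar> < \<kappa>'" using z abs_Im_le_cmod[of z] by (simp add: y_def)
  have sy: "y\<^sup>2 * (s\<^sup>2 * (sinhc (s * y))\<^sup>2) = (sinh (s * y))\<^sup>2" for s
    by (simp add: sinhc_def power_divide power_mult_distrib)
  have z': "norm z \<le> \<kappa>'" using z by simp
  note rz = rep_Zs[OF kp z']
  have ex: "exp (- \<i> * of_real (s * (t + x))) * cnj (exp (- \<i> * of_real (s * (u + x)))) = exp (- \<i> * of_real (s * (t - u)))" for s t u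
    unfolding exp_cnj exp_add[symmetric] by (rule arg_cong[where f = exp]) (simp add: algebra_simps)
  define ReZ ImZ where "ReZ j \<omega> = Re (Zs (t0 + real j * L) \<omega> z)" and "ImZ j \<omega> = Im (Zs (t0 + real j * L) \<omega> z)" for j \<omega>
  have [measurable]: "ReZ j \<in> borel_measurable M" "ImZ j \<in> borel_measurable M" for j
    unfolding ReZ_def ImZ_def by measurable
  have 1: "(\<integral>\<^sup>+\<omega>. ennreal (exp (\<Sum>j\<in>S. 3 / (4 * \<Lambda>c) * (ReZ j \<omega>)\<^sup>2 / 2)) \<partial>M) \<le> ennreal (2 ^ card S)"
  proof (rule circle_family_bound[OF assms(1) dec y, where e = 1 and ?t0.0 = t0])
    show "rep (ReZ j) (\<lambda>s. exp (- \<i> * of_real (s * ((t0 + real j * L) + x))) * of_real (cosh (s * y)))" for j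
      unfolding ReZ_def x_def y_def by (rule rz(1))
    show "exp (- \<i> * of_real (s * ((t0 + real i * L) + x))) * of_real (cosh (s * y)) *
        cnj (exp (- \<i> * of_real (s * ((t0 + real j * L) + x))) * of_real (cosh (s * y))) =
        of_real (1 + y\<^sup>2 * (s\<^sup>2 * (sinhc (s * y))\<^sup>2)) * exp (- \<i> * of_real (s * ((t0 + real i * L) - (t0 + real j * L))))" for i j s
    proof -
      have "of_real (1 + y\<^sup>2 * (s\<^sup>2 * (sinhc (s * y))\<^sup>2)) = complex_of_real (cosh (s * y)) * of_real (cosh (s * y))"
      proof -
        have "1 + (sinh (s * y))\<^sup>2 = cosh (s * y) * cosh (s * y)"
          using cosh_square_eq[of "s * y"] by (simp add: power2_eq_square)
        then show ?thesis unfolding sy by (simp only: of_real_mult)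
      qed
      then show ?thesis
        unfolding ex[symmetric] by (simp only: complex_cnj_mult complex_cnj_complex_of_real mult_ac)
    qed
  qed simp
  have 2: "(\<integral>\<^sup>+\<omega>. ennreal (exp (\<Sum>j\<in>S. 3 / (4 * \<Lambda>c) * (ImZ j \<omega>)\<^sup>2 / 2)) \<partial>M) \<le> ennreal (2 ^ card S)"
  proof (rule circle_family_bound[OF assms(1) dec y, where e = 0 and ?t0.0 = t0])
    show "rep (ImZ j) (\<lambda>s. - \<i> * exp (- \<i> * of_real (s * ((t0 + real j * L) + x))) * of_real (sinh (s * y)))" for j
      unfolding ImZ_def x_def y_def by (rule rz(2))
    show "- \<i> * exp (- \<i> * of_real (s * ((t0 + real i * L) + x))) * of_real (sinh (s * y)) *
        cnj (- \<i> * exp (- \<i> * of_real (s * ((t0 + real j * L) + x))) * of_real (sinh (s * y))) =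
        of_real (0 + y\<^sup>2 * (s\<^sup>2 * (sinhc (s * y))\<^sup>2)) * exp (- \<i> * of_real (s * ((t0 + real i * L) - (t0 + real j * L))))" for i j s
    proof -
      have "of_real (0 + y\<^sup>2 * (s\<^sup>2 * (sinhc (s * y))\<^sup>2)) = (- \<i> * cnj (- \<i>)) * (complex_of_real (sinh (s * y)) * of_real (sinh (s * y)))"
        unfolding sy by (simp add: power2_eq_square)
      then show ?thesis
        unfolding ex[symmetric] by (simp only: complex_cnj_mult complex_cnj_complex_of_real mult_ac)
    qed
  qed simp
  have "(\<integral>\<^sup>+\<omega>. ennreal (exp (\<Sum>j\<in>S. 3 / (16 * \<Lambda>c) * (norm (Zs (t0 + real j * L) \<omega> z))\<^sup>2)) \<partial>M) \<le>
     (\<integral>\<^sup>+\<omega>. ennreal (1 / 2) * ennreal (exp (\<Sum>j\<in>S. 3 / (4 * \<Lambda>c) * (ReZ j \<omega>)\<^sup>2 / 2)) +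
        ennreal (1 / 2) * ennreal (exp (\<Sum>j\<in>S. 3 / (4 * \<Lambda>c) * (ImZ j \<omega>)\<^sup>2 / 2)) \<partial>M)"
  proof (rule nn_integral_mono)
    fix \<omega>
    define a b where "a = (\<Sum>j\<in>S. 3 / (16 * \<Lambda>c) * (ReZ j \<omega>)\<^sup>2)" and "b = (\<Sum>j\<in>S. 3 / (16 * \<Lambda>c) * (ImZ j \<omega>)\<^sup>2)"
    have ab: "(\<Sum>j\<in>S. 3 / (16 * \<Lambda>c) * (norm (Zs (t0 + real j * L) \<omega> z))\<^sup>2) = a + b"
      by (simp add: a_def b_def ReZ_def ImZ_def cmod_power2 distrib_left sum.distrib)
    have ra: "(\<Sum>j\<in>S. 3 / (4 * \<Lambda>c) * (ReZ j \<omega>)\<^sup>2 / 2) = 2 * a" "(\<Sum>j\<in>S. 3 / (4 * \<Lambda>c) * (ImZ j \<omega>)\<^sup>2 / 2) = 2 * b"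
      by (simp_all add: a_def b_def sum_distrib_left)
    have "2 * (exp a * exp b) \<le> (exp a)\<^sup>2 + (exp b)\<^sup>2" using sum_squares_bound[of "exp a" "exp b"] by (simp add: mult.assoc)
    then have "exp (a + b) \<le> 1 / 2 * exp (2 * a) + 1 / 2 * exp (2 * b)" by (simp add: exp_add exp_double)
    then have "ennreal (exp (a + b)) \<le> ennreal (1 / 2 * exp (2 * a) + 1 / 2 * exp (2 * b))" by (rule ennreal_leI)
    also have "\<dots> = ennreal (1 / 2) * ennreal (exp (2 * a)) + ennreal (1 / 2) * ennreal (exp (2 * b))"
      by (simp only: ennreal_plus ennreal_mult exp_ge_zero mult_nonneg_nonneg divide_nonneg_nonneg zero_le_one zero_le_numeral)
    finally show "ennreal (exp (\<Sum>j\<in>S. 3 / (16 * \<Lambda>c) * (norm (Zs (t0 + real j * L) \<omega> z))\<^sup>2)) \<le>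
      ennreal (1 / 2) * ennreal (exp (\<Sum>j\<in>S. 3 / (4 * \<Lambda>c) * (ReZ j \<omega>)\<^sup>2 / 2)) +
        ennreal (1 / 2) * ennreal (exp (\<Sum>j\<in>S. 3 / (4 * \<Lambda>c) * (ImZ j \<omega>)\<^sup>2 / 2))"
      unfolding ab ra .
  qed
  also have "\<dots> = ennreal (1 / 2) * (\<integral>\<^sup>+\<omega>. ennreal (exp (\<Sum>j\<in>S. 3 / (4 * \<Lambda>c) * (ReZ j \<omega>)\<^sup>2 / 2)) \<partial>M) +
      ennreal (1 / 2) * (\<integral>\<^sup>+\<omega>. ennreal (exp (\<Sum>j\<in>S. 3 / (4 * \<Lambda>c) * (ImZ j \<omega>)\<^sup>2 / 2)) \<partial>M)"
    by (subst nn_integral_add) (simp_all add: nn_integral_cmult del: times_divide_eq_left)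
  also have "\<dots> \<le> ennreal (1 / 2) * ennreal (2 ^ card S) + ennreal (1 / 2) * ennreal (2 ^ card S)"
    by (intro add_mono mult_left_mono 1 2) auto
  also have "\<dots> = ennreal (2 ^ card S)"
  proof -
    have "ennreal (1 / 2) * ennreal (2 ^ card S) + ennreal (1 / 2) * ennreal (2 ^ card S) = ennreal (1 / 2 * 2 ^ card S + 1 / 2 * 2 ^ card S)"
      by (subst ennreal_plus) (auto simp only: ennreal_mult zero_le_power zero_le_numeral mult_nonneg_nonneg divide_nonneg_nonneg zero_le_one)
    then show ?thesis by simp
  qed
  finally show ?thesis .
qed

end

section \<open>Exponential moments along the grid\<close>

lemma emeasure_cone_section_le:
  fixes a b v :: real
  assumes "a \<ge> 0" "b \<ge> 0"
  shows "emeasure lborel {x. (x - a * v) * (x + b * v) < 0} \<le> ennreal ((a + b) * \<bar>v\<bar>)"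
proof -
  have "{x. (x - a * v) * (x + b * v) < 0} \<subseteq> {min (a * v) (- (b * v))..max (a * v) (- (b * v))}"
    by (auto simp: mult_less_0_iff)
  then have "emeasure lborel {x. (x - a * v) * (x + b * v) < 0} \<le> emeasure lborel {min (a * v) (- (b * v))..max (a * v) (- (b * v))}"
    by (rule emeasure_mono) auto
  also have "\<dots> = ennreal (max (a * v) (- (b * v)) - min (a * v) (- (b * v)))" by simp
  also have "max (a * v) (- (b * v)) - min (a * v) (- (b * v)) = \<bar>(a + b) * v\<bar>"
    by (simp add: max_def min_def algebra_simps)
  also have "\<dots> = (a + b) * \<bar>v\<bar>" using assms by (simp add: abs_mult)
  finally show ?thesis .
qed

lemma normal_density_le: "s > 0 \<Longrightarrow> normal_density 0 (sqrt s) x \<le> 1 / sqrt (2 * pi * s)"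
  by (simp add: normal_density_def divide_right_mono)

text \<open>For fixed v the admissible x form an interval of length (a + b)|v|, and the density of x
  is at most its value at 0. The first absolute moment of v then gives (a + b) / pi; the variance s
  cancels, so the bound is uniform in s. This is the Kac-Rice density computation.\<close>

lemma cone_gaussian_le:
  fixes a b s :: real
  assumes ab: "a \<ge> 0" "b \<ge> 0" and s: "s > 0"
  shows "(\<integral>\<^sup>+x. \<integral>\<^sup>+v. ennreal (of_bool ((x - a * v) * (x + b * v) < 0) * normal_density 0 (sqrt s) x * normal_density 0 (sqrt s) v) \<partial>lborel \<partial>lborel)
     \<le> ennreal ((a + b) / pi)"
proof -
  let ?n = "normal_density 0 (sqrt s)"
  have n_le: "?n x \<le> 1 / sqrt (2 * pi * s)" for x
    by (rule normal_density_le[OF s])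
  have "(\<integral>\<^sup>+x. \<integral>\<^sup>+v. ennreal (of_bool ((x - a * v) * (x + b * v) < 0) * ?n x * ?n v) \<partial>lborel \<partial>lborel) =
     (\<integral>\<^sup>+v. \<integral>\<^sup>+x. ennreal (of_bool ((x - a * v) * (x + b * v) < 0) * ?n x * ?n v) \<partial>lborel \<partial>lborel)"
    by (rule lborel_pair.Fubini') measurable
  also have "\<dots> \<le> (\<integral>\<^sup>+v. ennreal (1 / sqrt (2 * pi * s) * (a + b)) * ennreal (?n v * \<bar>v\<bar>) \<partial>lborel)"
  proof (rule nn_integral_mono)
    fix v
    have "(\<integral>\<^sup>+x. ennreal (of_bool ((x - a * v) * (x + b * v) < 0) * ?n x * ?n v) \<partial>lborel) \<le>
       (\<integral>\<^sup>+x. ennreal (1 / sqrt (2 * pi * s) * ?n v) * indicator {x. (x - a * v) * (x + b * v) < 0} x \<partial>lborel)"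
    proof (rule nn_integral_mono)
      fix x
      have "?n x * ?n v \<le> 1 / sqrt (2 * pi * s) * ?n v" by (intro mult_right_mono n_le) auto
      then show "ennreal (of_bool ((x - a * v) * (x + b * v) < 0) * ?n x * ?n v) \<le>
          ennreal (1 / sqrt (2 * pi * s) * ?n v) * indicator {x. (x - a * v) * (x + b * v) < 0} x"
        by (cases "(x - a * v) * (x + b * v) < 0") (simp_all add: ennreal_leI)
    qed
    also have "\<dots> = ennreal (1 / sqrt (2 * pi * s) * ?n v) * emeasure lborel {x. (x - a * v) * (x + b * v) < 0}"
      by (rule nn_integral_cmult_indicator) measurable
    also have "\<dots> \<le> ennreal (1 / sqrt (2 * pi * s) * ?n v) * ennreal ((a + b) * \<bar>v\<bar>)"
      by (intro mult_left_mono emeasure_cone_section_le ab) auto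
    also have "\<dots> = ennreal (1 / sqrt (2 * pi * s) * (a + b)) * ennreal (?n v * \<bar>v\<bar>)"
      using ab s by (simp add: ennreal_mult[symmetric] mult_ac)
    finally show "(\<integral>\<^sup>+x. ennreal (of_bool ((x - a * v) * (x + b * v) < 0) * ?n x * ?n v) \<partial>lborel) \<le>
       ennreal (1 / sqrt (2 * pi * s) * (a + b)) * ennreal (?n v * \<bar>v\<bar>)" .
  qed
  also have "\<dots> = ennreal (1 / sqrt (2 * pi * s) * (a + b)) * (\<integral>\<^sup>+v. ennreal (?n v * \<bar>v\<bar>) \<partial>lborel)"
    by (rule nn_integral_cmult) measurable
  also have "(\<integral>\<^sup>+v. ennreal (?n v * \<bar>v\<bar>) \<partial>lborel) = ennreal (sqrt s * sqrt (2 / pi))"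
  proof -
    have "has_bochner_integral lborel (\<lambda>v. ?n v * \<bar>v\<bar>) (sqrt s * sqrt (2 / pi))"
      using normal_moment_abs_odd[of "sqrt s" 0 0] s by simp
    then show ?thesis by (subst nn_integral_eq_integral) (auto simp: has_bochner_integral_iff)
  qed
  also have "ennreal (1 / sqrt (2 * pi * s) * (a + b)) * ennreal (sqrt s * sqrt (2 / pi)) = ennreal ((a + b) / pi)"
  proof -
    define p q t where "p = sqrt (2 * pi)" and "q = sqrt (2 / pi)" and "t = sqrt s"
    have pt: "p > 0" "t > 0" using s by (auto simp: p_def t_def)
    have "q / p = sqrt ((2 / pi) / (2 * pi))" unfolding p_def q_def by (rule real_sqrt_divide[symmetric])
    also have "(2 / pi) / (2 * pi) = (1 / pi)\<^sup>2" by (simp add: power2_eq_square)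
    also have "sqrt ((1 / pi)\<^sup>2) = 1 / pi" by simp
    finally have qp: "q / p = 1 / pi" .
    have "sqrt (2 * pi * s) = p * t" unfolding p_def t_def by (rule real_sqrt_mult)
    then have "1 / sqrt (2 * pi * s) * (a + b) * (sqrt s * sqrt (2 / pi)) = (a + b) * (q / p)"
      using pt unfolding q_def[symmetric] t_def[symmetric] by (simp add: mult.commute)
    then have eq: "1 / sqrt (2 * pi * s) * (a + b) * (sqrt s * sqrt (2 / pi)) = (a + b) / pi"
      unfolding qp by simp
    have "0 \<le> 1 / sqrt (2 * pi * s) * (a + b)" "0 \<le> sqrt s * sqrt (2 / pi)" using ab s by auto
    then show ?thesis unfolding eq[symmetric] by (rule ennreal_mult[symmetric])
  qed
  finally show ?thesis .
qed

text \<open>For s at least 1/2 the normal density is at most 1, so only the integral of |x|^(-1/12)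
  near 0 remains; its constant 24/11 is rounded up to 3.\<close>

lemma power_gaussian_le:
  fixes \<tau> s :: real
  assumes \<tau>: "\<tau> > 0" and s: "s \<ge> 1 / 2"
  shows "(\<integral>\<^sup>+x. \<integral>\<^sup>+v. ennreal ((if 0 < \<bar>x\<bar> \<and> \<bar>x\<bar> < \<tau> then \<bar>x\<bar> powr (- (1 / 12)) else 0) *
      normal_density 0 (sqrt s) x * normal_density 0 (sqrt s) v) \<partial>lborel \<partial>lborel) \<le> ennreal (3 * \<tau> powr (11 / 12))"
proof -
  let ?n = "normal_density 0 (sqrt s)"
  define h where "h x = (if 0 < \<bar>x\<bar> \<and> \<bar>x\<bar> < \<tau> then \<bar>x\<bar> powr (- (1 / 12)) else 0)" for x :: real
  have h_meas[measurable]: "h \<in> borel_measurable borel" unfolding h_def by measurable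
  have n1: "(\<integral>\<^sup>+v. ennreal (?n v) \<partial>lborel) = 1"
    using s by (subst nn_integral_eq_integral) auto
  have n_le: "?n x \<le> 1" for x
  proof -
    have "1 \<le> 2 * pi * s"
      using mult_mono[of 1 "2 * s" 1 pi] pi_ge_two s by (simp add: mult_ac)
    then have "1 \<le> sqrt (2 * pi * s)" by simp
    then have "1 / sqrt (2 * pi * s) \<le> 1" by simp
    moreover have "?n x \<le> 1 / sqrt (2 * pi * s)"
      by (rule normal_density_le) (use s in simp)
    ultimately show ?thesis by linarith
  qed
  have "(\<integral>\<^sup>+x. \<integral>\<^sup>+v. ennreal (h x * ?n x * ?n v) \<partial>lborel \<partial>lborel) = (\<integral>\<^sup>+x. ennreal (h x * ?n x) * (\<integral>\<^sup>+v. ennreal (?n v) \<partial>lborel) \<partial>lborel)"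
    by (subst nn_integral_cmult[symmetric]) (auto simp: h_def ennreal_mult)
  also have "\<dots> \<le> (\<integral>\<^sup>+x. ennreal (h x) \<partial>lborel)"
    unfolding n1 mult_1_right using n_le by (intro nn_integral_mono ennreal_leI mult_left_le) (auto simp: h_def)
  also have "\<dots> \<le> (\<integral>\<^sup>+x. ennreal (x powr (- (1 / 12))) * indicator {0..\<tau>} x + ennreal ((- x) powr (- (1 / 12))) * indicator {0..\<tau>} (- x) \<partial>lborel)"
    by (intro nn_integral_mono) (auto simp: h_def indicator_def abs_if)
  also have "\<dots> = (\<integral>\<^sup>+x. ennreal (x powr (- (1 / 12))) * indicator {0..\<tau>} x \<partial>lborel) +
     (\<integral>\<^sup>+x. ennreal ((- x) powr (- (1 / 12))) * indicator {0..\<tau>} (- x) \<partial>lborel)"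
    by (rule nn_integral_add) measurable
  also have "(\<integral>\<^sup>+x. ennreal ((- x) powr (- (1 / 12))) * indicator {0..\<tau>} (- x) \<partial>lborel) =
     (\<integral>\<^sup>+x. ennreal (x powr (- (1 / 12))) * indicator {0..\<tau>} x \<partial>lborel)"
    using nn_integral_real_affine[of "\<lambda>x. ennreal (x powr (- (1 / 12))) * indicator {0..\<tau>} x" "-1" 0] by simp
  also have "(\<integral>\<^sup>+x. ennreal (x powr (- (1 / 12))) * indicator {0..\<tau>} x \<partial>lborel) = ennreal (\<tau> powr (- (1 / 12) + 1) / (- (1 / 12) + 1))"
  proof (rule nn_integral_has_integral_lebesgue')
    show "((\<lambda>x. x powr (- (1 / 12))) has_integral (\<tau> powr (- (1 / 12) + 1) / (- (1 / 12) + 1))) {0..\<tau>}"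
      using \<tau> by (intro has_integral_powr_from_0) auto
  qed auto
  also have "ennreal (\<tau> powr (- (1 / 12) + 1) / (- (1 / 12) + 1)) + ennreal (\<tau> powr (- (1 / 12) + 1) / (- (1 / 12) + 1)) \<le> ennreal (3 * \<tau> powr (11 / 12))"
    by (simp add: ennreal_plus[symmetric] ennreal_leI del: ennreal_plus)
  finally show ?thesis by (simp add: h_def)
qed

context prob_space begin

lemma exp_Markov:
  assumes [measurable]: "F \<in> borel_measurable M" and le: "(\<integral>\<^sup>+\<omega>. ennreal (exp (F \<omega>)) \<partial>M) \<le> ennreal B" and B: "B \<ge> 0"
  shows "prob {\<omega>\<in>space M. F \<omega> \<ge> a} \<le> exp (- a) * B"
proof -
  have "emeasure M {\<omega>\<in>space M. F \<omega> \<ge> a} = (\<integral>\<^sup>+\<omega>. indicator {\<omega>\<in>space M. F \<omega> \<ge> a} \<omega> \<partial>M)"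
    by (rule nn_integral_indicator[symmetric]) measurable
  also have "\<dots> \<le> (\<integral>\<^sup>+\<omega>. ennreal (exp (- a)) * ennreal (exp (F \<omega>)) \<partial>M)"
  proof (rule nn_integral_mono)
    fix \<omega>
    have "1 \<le> exp (F \<omega> - a)" if "F \<omega> \<ge> a" using that by simp
    then show "indicator {\<omega>\<in>space M. F \<omega> \<ge> a} \<omega> \<le> ennreal (exp (- a)) * ennreal (exp (F \<omega>))"
      by (auto simp: indicator_def ennreal_mult[symmetric] exp_add[symmetric])
  qed
  also have "\<dots> = ennreal (exp (- a)) * (\<integral>\<^sup>+\<omega>. ennreal (exp (F \<omega>)) \<partial>M)"
    by (rule nn_integral_cmult) measurable
  also have "\<dots> \<le> ennreal (exp (- a)) * ennreal B" by (intro mult_left_mono le) auto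
  also have "\<dots> = ennreal (exp (- a) * B)" using B by (simp add: ennreal_mult)
  finally show ?thesis using B by (simp add: emeasure_eq_measure ennreal_le_iff)
qed

end

context zero_counting begin

text \<open>Any radius strictly below \<kappa>' would keep the circle inside the disc of analyticity
  and decay; half is a convenient choice.\<close>

definition R :: real where "R = \<kappa>' / 2"

lemma R: "0 < R" "R < \<kappa>'" using kp by (auto simp: R_def)

definition circ :: "real \<Rightarrow> complex" where
  "circ u = of_real R * exp (2 * of_real pi * \<i> * of_real u)"

lemma norm_circ: "norm (circ u) = R" using R by (simp add: circ_def norm_mult)

lemma circ_measurable[measurable]: "circ \<in> borel_measurable borel"
  unfolding circ_def by measurable

text \<open>A Lebesgue integral over a probability space, so that it is measurable in \<omega> and
  open to Jensen and Fubini. On good \<omega> it equals the gauge integral of the deterministic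
  estimates.\<close>

definition Q :: "real \<Rightarrow> 'a \<Rightarrow> real" where
  "Q c \<omega> = (\<integral>u. (norm (Zs c \<omega> (circ u)))\<^sup>2 \<partial>restrict_space lborel {0..1::real})"

lemma prob_space_unit_interval: "prob_space (restrict_space lborel {0..1::real})"
  by (rule prob_spaceI) (simp add: emeasure_restrict_space space_restrict_space)

lemma Zs_circ_measurable[measurable]:
  "(\<lambda>(\<omega>, u). Zs c \<omega> (circ u)) \<in> borel_measurable (M \<Otimes>\<^sub>M restrict_space lborel {0..1::real})"
proof -
  have "(\<lambda>p. (fst p, circ (snd p))) \<in> M \<Otimes>\<^sub>M restrict_space lborel {0..1::real} \<rightarrow>\<^sub>M M \<Otimes>\<^sub>M borel"
    by (intro measurable_Pair measurable_fst measurable_compose[OF measurable_snd] measurable_restrict_space1) measurable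
  from measurable_compose[OF this Zs_measurable] show ?thesis by (simp add: case_prod_beta')
qed

lemma Q_measurable[measurable]: "Q c \<in> borel_measurable M"
proof -
  interpret U: prob_space "restrict_space lborel {0..1::real}" by (rule prob_space_unit_interval)
  show ?thesis unfolding Q_def by measurable
qed

lemma Q_nonneg: "Q c \<omega> \<ge> 0" unfolding Q_def by simp

text \<open>The almost sure conditions at c under which the deterministic count applies, including f
  0 nonzero.\<close>

definition good :: "real \<Rightarrow> 'a \<Rightarrow> bool" where
  "good c \<omega> \<longleftrightarrow> summable (\<lambda>m. \<bar>D c m \<omega>\<bar> * \<kappa>' ^ m / fact m) \<and>
     (\<forall>t. \<bar>t\<bar> < \<kappa>' \<longrightarrow> of_real (X (c + t) \<omega>) = Zs c \<omega> (of_real t)) \<and> X c \<omega> \<noteq> 0"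

lemma AE_good: "AE \<omega> in M. good c \<omega>"
proof -
  have "(\<integral>s. (norm (exp (- \<i> * of_real (s * c))))\<^sup>2 \<partial>\<rho>) = 1" using rho.prob_space by simp
  then have "centered_gaussian M (X c) 1" using rep_centered_gaussian[OF rep_X[of c]] by simp
  then have "AE \<omega> in M. X c \<omega> \<noteq> 0"
    by (rule centered_gaussian_AE_nonzero[OF prob_space_axioms]) simp
  moreover have "AE \<omega> in M. summable (\<lambda>m. \<bar>D c m \<omega>\<bar> * \<kappa>' ^ m / fact m) \<and> (\<forall>t. \<bar>t\<bar> < \<kappa>' \<longrightarrow> of_real (X (c + t) \<omega>) = Zs c \<omega> (of_real t))"
    by (rule Zs_eq_X[OF kp]) (rule cont)
  ultimately show ?thesis
    by eventually_elim (auto simp: good_def)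
qed

lemma circ_continuous:
  assumes "good c \<omega>"
  shows "continuous_on UNIV (\<lambda>u. (norm (Zs c \<omega> (circ u)))\<^sup>2)"
proof -
  have "Zs c \<omega> holomorphic_on ball 0 \<kappa>'"
    using assms kp by (intro Zs_holomorphic) (auto simp: good_def)
  then have "continuous_on (ball 0 \<kappa>') (Zs c \<omega>)" by (rule holomorphic_on_imp_continuous_on)
  moreover have "continuous_on UNIV circ" unfolding circ_def by (intro continuous_intros)
  ultimately have "continuous_on UNIV (\<lambda>u. Zs c \<omega> (circ u))"
    by (rule continuous_on_compose2) (use R in \<open>auto simp: norm_circ\<close>)
  then show ?thesis by (intro continuous_intros)
qed

lemma restrict_integral_continuous:
  fixes g :: "real \<Rightarrow> real"
  assumes "continuous_on UNIV g"
  shows "integrable (restrict_space lborel {0..1}) g" "(\<integral>u. g u \<partial>restrict_space lborel {0..1}) = integral {0..1} g"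
proof -
  have "continuous_on {0..1} g" using assms by (rule continuous_on_subset) auto
  then have s: "set_integrable lborel {0..1} g"
    unfolding set_integrable_def by (intro borel_integrable_compact) auto
  then show "integrable (restrict_space lborel {0..1}) g"
    by (subst integrable_restrict_space) (auto simp: set_integrable_def)
  have "(\<integral>u. g u \<partial>restrict_space lborel {0..1}) = (LINT u:{0..1}|lborel. g u)"
    by (subst integral_restrict_space) (auto simp: set_lebesgue_integral_def)
  also have "\<dots> = integral {0..1} g" by (rule set_borel_integral_eq_integral(2)[OF s])
  finally show "(\<integral>u. g u \<partial>restrict_space lborel {0..1}) = integral {0..1} g" .
qed

lemma Q_eq_integral:
  assumes "good c \<omega>" shows "Q c \<omega> = integral {0..1} (\<lambda>u. (norm (Zs c \<omega> (circ u)))\<^sup>2)"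
  unfolding Q_def by (rule restrict_integral_continuous(2)[OF circ_continuous[OF assms]])

text \<open>Jensen's inequality over the circle parameter, one parameter for all grid points at
  once, reduces the claim to a single point of the circle.\<close>

lemma Q_exp_moment:
  assumes "finite S" and dec: "decay \<kappa>' L 1"
  shows "(\<integral>\<^sup>+\<omega>. ennreal (exp (\<Sum>j\<in>S. 3 / (16 * \<Lambda>c) * Q (t0 + real j * L) \<omega>)) \<partial>M) \<le> ennreal (2 ^ card S)"
proof -
  let ?U = "restrict_space lborel {0..1::real}"
  interpret U: prob_space ?U by (rule prob_space_unit_interval)
  interpret P: pair_sigma_finite M ?U ..
  define g where "g \<omega> u = (\<Sum>j\<in>S. 3 / (16 * \<Lambda>c) * (norm (Zs (t0 + real j * L) \<omega> (circ u)))\<^sup>2)" for \<omega> u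
  have [measurable]: "(\<lambda>(\<omega>, u). g \<omega> u) \<in> borel_measurable (M \<Otimes>\<^sub>M ?U)"
    unfolding g_def by measurable
  have "AE \<omega> in M. \<forall>j\<in>S. good (t0 + real j * L) \<omega>"
    using assms(1) AE_good by (intro AE_finite_allI) auto
  then have "AE \<omega> in M. ennreal (exp (\<Sum>j\<in>S. 3 / (16 * \<Lambda>c) * Q (t0 + real j * L) \<omega>)) \<le> (\<integral>\<^sup>+u. ennreal (exp (g \<omega> u)) \<partial>?U)"
  proof eventually_elim
    case (elim \<omega>)
    have cj: "continuous_on UNIV (\<lambda>u. 3 / (16 * \<Lambda>c) * (norm (Zs (t0 + real j * L) \<omega> (circ u)))\<^sup>2)" if "j \<in> S" for j
      by (rule continuous_on_mult_left, rule circ_continuous) (use elim that in blast)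
    have ij: "integrable ?U (\<lambda>u. 3 / (16 * \<Lambda>c) * (norm (Zs (t0 + real j * L) \<omega> (circ u)))\<^sup>2)" if "j \<in> S" for j
      by (rule restrict_integral_continuous(1)[OF cj[OF that]])
    have cg: "continuous_on UNIV (g \<omega>)"
      unfolding g_def
      by (rule continuous_on_sum[OF cj])
    have i: "integrable ?U (g \<omega>)" "integrable ?U (\<lambda>u. exp (g \<omega> u))"
      by (intro restrict_integral_continuous(1) cg continuous_intros)+
    define m where "m = (\<integral>u. g \<omega> u \<partial>?U)"
    have m: "m = (\<Sum>j\<in>S. 3 / (16 * \<Lambda>c) * Q (t0 + real j * L) \<omega>)"
      unfolding m_def g_def Q_def
      by (simp only: Bochner_Integration.integral_sum[OF ij] integral_mult_right_zero)
    \<comment> \<open>Jensen through the tangent line of exp at the mean m.\<close>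
    have "exp m = (\<integral>u. exp m * (1 + (g \<omega> u - m)) \<partial>?U)"
      using i(1) U.prob_space by (simp add: m_def space_restrict_space)
    also have "\<dots> \<le> (\<integral>u. exp (g \<omega> u) \<partial>?U)"
    proof (rule integral_mono)
      fix u
      have "exp m * (1 + (g \<omega> u - m)) \<le> exp m * exp (g \<omega> u - m)"
        by (intro mult_left_mono exp_ge_add_one_self) auto
      then show "exp m * (1 + (g \<omega> u - m)) \<le> exp (g \<omega> u)" by (simp add: exp_diff)
    qed (use i in auto)
    finally have "ennreal (exp m) \<le> ennreal (\<integral>u. exp (g \<omega> u) \<partial>?U)" by (rule ennreal_leI)
    also have "\<dots> = (\<integral>\<^sup>+u. ennreal (exp (g \<omega> u)) \<partial>?U)"
      by (rule nn_integral_eq_integral[symmetric]) (use i in auto)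
    finally show ?case by (simp only: m)
  qed
  then have "(\<integral>\<^sup>+\<omega>. ennreal (exp (\<Sum>j\<in>S. 3 / (16 * \<Lambda>c) * Q (t0 + real j * L) \<omega>)) \<partial>M) \<le>
      (\<integral>\<^sup>+\<omega>. \<integral>\<^sup>+u. ennreal (exp (g \<omega> u)) \<partial>?U \<partial>M)"
    by (rule nn_integral_mono_AE)
  also have "\<dots> = (\<integral>\<^sup>+u. \<integral>\<^sup>+\<omega>. ennreal (exp (g \<omega> u)) \<partial>M \<partial>?U)"
    by (rule P.Fubini'[symmetric]) measurable
  also have "\<dots> \<le> (\<integral>\<^sup>+u. ennreal (2 ^ card S) \<partial>?U)"
  proof (rule nn_integral_mono)
    fix u
    have "norm (circ u) < \<kappa>'" using R by (simp add: norm_circ)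
    then show "(\<integral>\<^sup>+\<omega>. ennreal (exp (g \<omega> u)) \<partial>M) \<le> ennreal (2 ^ card S)"
      unfolding g_def by (rule Zs_exp_moment[OF assms])
  qed
  also have "\<dots> = ennreal (2 ^ card S)" using U.emeasure_space_1 by (simp add: space_restrict_space)
  finally show ?thesis .
qed

text \<open>The pair comparison with form bounds 1 - E and 1 + E; asking \<open>h_le\<close> for all
  s at least 1 covers the variances from 1 + E on.\<close>

lemma pair_domination:
  fixes h :: "real \<times> real \<Rightarrow> real"
  assumes "finite S" and dec: "decay \<kappa>' L \<epsilon>" and E: "0 \<le> pair_eps \<epsilon>" "pair_eps \<epsilon> < 1"
    and h: "h \<in> borel_measurable borel" "\<And>y. h y \<ge> 0" "\<And>y. h y \<noteq> 0 \<Longrightarrow> isCont h y"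
    and h_le: "\<And>s. s \<ge> 1 \<Longrightarrow> (\<integral>\<^sup>+x. \<integral>\<^sup>+v. ennreal (h (x, v) * normal_density 0 (sqrt s) x * normal_density 0 (sqrt s) v) \<partial>lborel \<partial>lborel) \<le> ennreal b"
    and b: "b \<ge> 0"
  shows "(\<integral>\<^sup>+\<omega>. (\<Prod>j\<in>S. ennreal (h (X (t0 + real j * L) \<omega>, V (t0 + real j * L) \<omega>))) \<partial>M) \<le>
    ennreal ((b * (1 + pair_eps \<epsilon>) / (1 - pair_eps \<epsilon>)) ^ card S)"
proof (rule nn_integral_prod_gaussian_pairs_le[OF prob_space_axioms assms(1) pair_family[OF assms(1), of "\<lambda>j. t0 + real j * L"]])
  fix w
  note pb = pair_bounds[OF assms(1) dec, where w = w and ?t0.0 = t0]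
  show "(1 - pair_eps \<epsilon>) * (\<Sum>i\<in>S \<times> UNIV. (w i)\<^sup>2) \<le> (\<Sum>i\<in>S \<times> UNIV. \<Sum>j\<in>S \<times> UNIV. w i * w j * Cp (\<lambda>j. t0 + real j * L) i j)"
    "(\<Sum>i\<in>S \<times> UNIV. \<Sum>j\<in>S \<times> UNIV. w i * w j * Cp (\<lambda>j. t0 + real j * L) i j) \<le> (1 + pair_eps \<epsilon>) * (\<Sum>i\<in>S \<times> UNIV. (w i)\<^sup>2)"
    using pb by (simp_all add: algebra_simps abs_le_iff)
qed (use E h h_le b in auto)

end

lemma isCont_if_open:
  assumes "open U" "continuous_on U g" "y \<in> U"
  shows "isCont (\<lambda>y. if y \<in> U then g y else (0::real)) y"
proof -
  have "continuous_on U (\<lambda>y. if y \<in> U then g y else 0)"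
    using assms(2) by (rule continuous_on_eq) auto
  then show ?thesis using assms(3) continuous_on_eq_continuous_at[OF assms(1), of "\<lambda>y. if y \<in> U then g y else 0"] by blast
qed

lemma power_le_exp: "x \<ge> 0 \<Longrightarrow> (1 + x) ^ n \<le> exp (real n * x)" for x :: real
  using power_mono[OF exp_ge_add_one_self[of x], of n] by (simp add: exp_of_nat_mult)

section \<open>Chernoff bounds along one class and the count on one cell\<close>

context zero_counting begin

text \<open>The sign change of \<open>x + s * x'\<close> on \<open>[0, d]\<close>, with a margin \<open>\<gamma> * d\<close> on both sides that absorbs the
  second order remainder.\<close>

definition cone :: "real \<Rightarrow> real \<Rightarrow> real \<Rightarrow> 'a \<Rightarrow> bool" where
  "cone \<gamma> d c \<omega> \<longleftrightarrow> (X c \<omega> - \<gamma> * d * D c 1 \<omega>) * (X c \<omega> + (1 + \<gamma>) * d * D c 1 \<omega>) < 0"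

text \<open>The logarithmic term of \<open>ln_ratio_split\<close> at |X c|. The guard describes an
  open set on which the corresponding exponential weight is continuous.\<close>

definition slog :: "real \<Rightarrow> real \<Rightarrow> 'a \<Rightarrow> real" where
  "slog \<tau> c \<omega> = 2 * (if 0 < \<bar>X c \<omega>\<bar> \<and> \<bar>X c \<omega>\<bar> < \<tau> then ln (1 / \<bar>X c \<omega>\<bar>) else 0)"

lemma cone_measurable[measurable]: "Measurable.pred M (cone \<gamma> d c)"
  unfolding cone_def[abs_def] by measurable

lemma slog_measurable[measurable]: "slog \<tau> c \<in> borel_measurable M"
  unfolding slog_def[abs_def] by measurable

text \<open>The ratio of the two bounds on the covariance form, that is, the price per pair of
  passing to independent pairs.\<close>

definition CE :: "real \<Rightarrow> real" where "CE \<epsilon> = (1 + pair_eps \<epsilon>) / (1 - pair_eps \<epsilon>)"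

context
  fixes L \<epsilon> :: real
  assumes dec: "decay \<kappa>' L \<epsilon>" and E: "0 \<le> pair_eps \<epsilon>" "pair_eps \<epsilon> < 1"
begin

lemma CE_pos: "CE \<epsilon> \<ge> 0" using E by (simp add: CE_def)

text \<open>Writing the exponential as 1 + h with h supported on a rare event, the subset expansion
  needs only the small mass b of h per grid point, and (1 + b CE)^n is at most exp(n b CE).\<close>

lemma exp_moment_of_factor:
  fixes h :: "real \<times> real \<Rightarrow> real" and F :: "nat \<Rightarrow> 'a \<Rightarrow> real"
  assumes h: "h \<in> borel_measurable borel" "\<And>y. h y \<ge> 0" "\<And>y. h y \<noteq> 0 \<Longrightarrow> isCont h y"
    and h_le: "\<And>s. s \<ge> 1 \<Longrightarrow> (\<integral>\<^sup>+x. \<integral>\<^sup>+v. ennreal (h (x, v) * normal_density 0 (sqrt s) x * normal_density 0 (sqrt s) v) \<partial>lborel \<partial>lborel) \<le> ennreal b"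
    and b: "b \<ge> 0"
    and F: "\<And>j \<omega>. exp (F j \<omega>) \<le> 1 + h (X (t0 + real j * L) \<omega>, V (t0 + real j * L) \<omega>)"
  shows "(\<integral>\<^sup>+\<omega>. ennreal (exp (\<Sum>j<n. F j \<omega>)) \<partial>M) \<le> ennreal (exp (real n * (b * CE \<epsilon>)))"
proof -
  have [measurable]: "(\<lambda>\<omega>. h (X (t0 + real j * L) \<omega>, V (t0 + real j * L) \<omega>)) \<in> borel_measurable M" for j
    by (rule measurable_compose[OF _ h(1)]) measurable
  have "(\<integral>\<^sup>+\<omega>. ennreal (exp (\<Sum>j<n. F j \<omega>)) \<partial>M) \<le> (\<integral>\<^sup>+\<omega>. (\<Prod>j<n. ennreal (1 + h (X (t0 + real j * L) \<omega>, V (t0 + real j * L) \<omega>))) \<partial>M)"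
  proof (rule nn_integral_mono)
    fix \<omega>
    have "exp (\<Sum>j<n. F j \<omega>) = (\<Prod>j<n. exp (F j \<omega>))" by (rule exp_sum) simp
    also have "\<dots> \<le> (\<Prod>j<n. 1 + h (X (t0 + real j * L) \<omega>, V (t0 + real j * L) \<omega>))"
      by (intro prod_mono) (use F in auto)
    finally show "ennreal (exp (\<Sum>j<n. F j \<omega>)) \<le> (\<Prod>j<n. ennreal (1 + h (X (t0 + real j * L) \<omega>, V (t0 + real j * L) \<omega>)))"
      using h(2) by (subst prod_ennreal) (auto intro!: ennreal_leI add_nonneg_nonneg)
  qed
  also have "\<dots> \<le> ennreal ((1 + b * CE \<epsilon>) ^ card {..<n})"
  proof (rule nn_integral_prod_one_plus_le)
    fix S :: "nat set" assume "S \<subseteq> {..<n}"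
    then have "finite S" by (rule finite_subset) simp
    from pair_domination[OF this dec E h h_le b, where ?t0.0 = t0]
    show "(\<integral>\<^sup>+\<omega>. (\<Prod>j\<in>S. ennreal (h (X (t0 + real j * L) \<omega>, V (t0 + real j * L) \<omega>))) \<partial>M) \<le> ennreal ((b * CE \<epsilon>) ^ card S)"
      by (simp add: CE_def)
  qed (use h(2) b CE_pos in auto)
  also have "\<dots> \<le> ennreal (exp (real n * (b * CE \<epsilon>)))"
    using power_le_exp[of "b * CE \<epsilon>" n] b CE_pos by (intro ennreal_leI) simp
  finally show ?thesis .
qed

text \<open>On the cone the exponential exceeds 1 by exp \<theta> - 1. In the variables (X, X' /
  \<mu>) the slopes carry a factor \<mu>, so the cone has mass (1 + 2 \<gamma>) d \<mu> / pi: the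
  expected intensity up to the margin.\<close>

lemma cone_event:
  assumes \<gamma>: "\<gamma> > 0" and d: "d > 0" and \<theta>: "\<theta> > 0"
  shows "prob {\<omega>\<in>space M. (\<Sum>j<n. of_bool (cone \<gamma> d (t0 + real j * L) \<omega>)) \<ge> (a :: real)} \<le>
    exp (- (\<theta> * a)) * exp (real n * ((exp \<theta> - 1) * ((1 + 2 * \<gamma>) * d * \<mu> / pi) * CE \<epsilon>))"
proof -
  define p q where "p = \<gamma> * d * \<mu>" and "q = (1 + \<gamma>) * d * \<mu>"
  have pq: "p \<ge> 0" "q \<ge> 0" "p + q = (1 + 2 * \<gamma>) * d * \<mu>"
    using \<gamma> d \<mu>_pos by (auto simp: p_def q_def algebra_simps)
  define U where "U = {y :: real \<times> real. (fst y - p * snd y) * (fst y + q * snd y) < 0}"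
  have U: "open U" unfolding U_def by (intro open_Collect_less continuous_intros)
  define h where "h y = (if y \<in> U then exp \<theta> - 1 else 0)" for y
  have "(\<integral>\<^sup>+\<omega>. ennreal (exp (\<Sum>j<n. \<theta> * of_bool (cone \<gamma> d (t0 + real j * L) \<omega>))) \<partial>M) \<le>
     ennreal (exp (real n * ((exp \<theta> - 1) * ((p + q) / pi) * CE \<epsilon>)))"
  proof (rule exp_moment_of_factor[where h = h])
    show "h \<in> borel_measurable borel" unfolding h_def using U by (intro measurable_If_set) auto
    show "h y \<ge> 0" for y using \<theta> by (simp add: h_def)
    show "isCont h y" if "h y \<noteq> 0" for y
      unfolding h_def by (rule isCont_if_open[OF U]) (use that in \<open>auto simp: h_def split: if_splits\<close>)
    show "(exp \<theta> - 1) * ((p + q) / pi) \<ge> 0" using \<theta> pq by simp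
    show "(\<integral>\<^sup>+x. \<integral>\<^sup>+v. ennreal (h (x, v) * normal_density 0 (sqrt s) x * normal_density 0 (sqrt s) v) \<partial>lborel \<partial>lborel) \<le>
        ennreal ((exp \<theta> - 1) * ((p + q) / pi))" if "s \<ge> 1" for s
    proof -
      let ?n = "normal_density 0 (sqrt s)"
      have "(\<integral>\<^sup>+x. \<integral>\<^sup>+v. ennreal (h (x, v) * ?n x * ?n v) \<partial>lborel \<partial>lborel) =
        (\<integral>\<^sup>+x. \<integral>\<^sup>+v. ennreal (exp \<theta> - 1) * ennreal (of_bool ((x - p * v) * (x + q * v) < 0) * ?n x * ?n v) \<partial>lborel \<partial>lborel)"
        using \<theta> by (intro nn_integral_cong) (auto simp: h_def U_def ennreal_mult[symmetric] mult.assoc)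
      also have "\<dots> = ennreal (exp \<theta> - 1) * (\<integral>\<^sup>+x. \<integral>\<^sup>+v. ennreal (of_bool ((x - p * v) * (x + q * v) < 0) * ?n x * ?n v) \<partial>lborel \<partial>lborel)"
        by (simp add: nn_integral_cmult)
      also have "\<dots> \<le> ennreal (exp \<theta> - 1) * ennreal ((p + q) / pi)"
        by (intro mult_left_mono cone_gaussian_le) (use pq that in auto)
      also have "\<dots> = ennreal ((exp \<theta> - 1) * ((p + q) / pi))" by (rule ennreal_mult[symmetric]) (use \<theta> pq in auto)
      finally show ?thesis .
    qed
    show "exp (\<theta> * of_bool (cone \<gamma> d (t0 + real j * L) \<omega>)) \<le> 1 + h (X (t0 + real j * L) \<omega>, V (t0 + real j * L) \<omega>)" for j \<omega>
    proof -
      have "\<mu> * V c \<omega> = D c 1 \<omega>" for c using \<mu>_pos by (simp add: V_def)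
      then have "(X c \<omega>, V c \<omega>) \<in> U \<longleftrightarrow> cone \<gamma> d c \<omega>" for c
        by (simp add: U_def cone_def p_def q_def mult.assoc)
      then show ?thesis by (simp add: h_def)
    qed
  qed
  then show ?thesis
    using exp_Markov[of "\<lambda>\<omega>. \<Sum>j<n. \<theta> * of_bool (cone \<gamma> d (t0 + real j * L) \<omega>)" "exp (real n * ((exp \<theta> - 1) * ((p + q) / pi) * CE \<epsilon>))" "\<theta> * a"] \<theta>
    by (simp add: sum_distrib_left[symmetric] pq(3))
qed

text \<open>The exponent 1/24 turns 2 ln(1/|x|) into the integrable weight |x|^(-1/12).\<close>

lemma slog_event:
  assumes \<tau>: "\<tau> > 0"
  shows "prob {\<omega>\<in>space M. (\<Sum>j<n. slog \<tau> (t0 + real j * L) \<omega>) \<ge> a} \<le>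
    exp (- (a / 24)) * exp (real n * (3 * \<tau> powr (11 / 12) * CE \<epsilon>))"
proof -
  define U where "U = {y :: real \<times> real. 0 < \<bar>fst y\<bar> \<and> \<bar>fst y\<bar> < \<tau>}"
  have "U = {y. fst y \<noteq> 0} \<inter> {y. \<bar>fst y\<bar> < \<tau>}" by (auto simp: U_def)
  then have U: "open U" by (auto intro!: open_Int open_Collect_less open_Collect_neq continuous_intros)
  define h where "h y = (if y \<in> U then \<bar>fst y\<bar> powr (- (1 / 12)) else 0)" for y :: "real \<times> real"
  have cU: "continuous_on U (\<lambda>y. \<bar>fst y\<bar> powr (- (1 / 12)))"
    by (intro continuous_intros) (auto simp: U_def)
  have "(\<integral>\<^sup>+\<omega>. ennreal (exp (\<Sum>j<n. 1 / 24 * slog \<tau> (t0 + real j * L) \<omega>)) \<partial>M) \<le>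
     ennreal (exp (real n * (3 * \<tau> powr (11 / 12) * CE \<epsilon>)))"
  proof (rule exp_moment_of_factor[where h = h])
    have "(fst :: real \<times> real \<Rightarrow> real) \<in> borel_measurable borel"
      by (intro borel_measurable_continuous_onI continuous_intros)
    then show "h \<in> borel_measurable borel"
      unfolding h_def using U by (intro measurable_If_set) auto
    show "h y \<ge> 0" for y by (simp add: h_def)
    show "isCont h y" if "h y \<noteq> 0" for y
      unfolding h_def by (rule isCont_if_open[OF U cU]) (use that in \<open>auto simp: h_def split: if_splits\<close>)
    show "3 * \<tau> powr (11 / 12) \<ge> 0" by simp
    show "(\<integral>\<^sup>+x. \<integral>\<^sup>+v. ennreal (h (x, v) * normal_density 0 (sqrt s) x * normal_density 0 (sqrt s) v) \<partial>lborel \<partial>lborel) \<le>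
        ennreal (3 * \<tau> powr (11 / 12))" if "s \<ge> 1" for s
    proof -
      have "h (x, v) = (if 0 < \<bar>x\<bar> \<and> \<bar>x\<bar> < \<tau> then \<bar>x\<bar> powr (- (1 / 12)) else 0)" for x v
        by (auto simp: h_def U_def)
      then show ?thesis using power_gaussian_le[OF \<tau>, of s] that by (simp only:) 
    qed
    show "exp (1 / 24 * slog \<tau> (t0 + real j * L) \<omega>) \<le> 1 + h (X (t0 + real j * L) \<omega>, V (t0 + real j * L) \<omega>)" for j \<omega>
    proof -
      define x where "x = X (t0 + real j * L) \<omega>"
      show ?thesis
      proof (cases "0 < \<bar>x\<bar> \<and> \<bar>x\<bar> < \<tau>")
        case True
        then have "exp (1 / 24 * slog \<tau> (t0 + real j * L) \<omega>) = \<bar>x\<bar> powr (- (1 / 12))"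
          by (simp add: slog_def x_def[symmetric] powr_def ln_div)
        then show ?thesis using True by (simp add: h_def U_def x_def[symmetric])
      next
        case False
        then have "slog \<tau> (t0 + real j * L) \<omega> = 0" unfolding slog_def x_def by (simp only: if_False mult_zero_right)
        then show ?thesis by (simp add: h_def)
      qed
    qed
  qed
  then show ?thesis
    using exp_Markov[of "\<lambda>\<omega>. \<Sum>j<n. 1 / 24 * slog \<tau> (t0 + real j * L) \<omega>" "exp (real n * (3 * \<tau> powr (11 / 12) * CE \<epsilon>))" "a / 24"]
    by (simp add: sum_divide_distrib[symmetric])
qed

end

lemma Q_event:
  assumes dec: "decay \<kappa>' L 1"
  shows "prob {\<omega>\<in>space M. (\<Sum>j<n. Q (t0 + real j * L) \<omega>) \<ge> a} \<le> exp (- (3 / (16 * \<Lambda>c) * a)) * 2 ^ n"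
proof -
  have k: "3 / (16 * \<Lambda>c) > 0" using \<Lambda>c_pos by simp
  have "(\<integral>\<^sup>+\<omega>. ennreal (exp (\<Sum>j<n. 3 / (16 * \<Lambda>c) * Q (t0 + real j * L) \<omega>)) \<partial>M) \<le> ennreal (2 ^ n)"
    using Q_exp_moment[of "{..<n}" L t0] dec by simp
  then have "prob {\<omega>\<in>space M. (\<Sum>j<n. 3 / (16 * \<Lambda>c) * Q (t0 + real j * L) \<omega>) \<ge> 3 / (16 * \<Lambda>c) * a} \<le> exp (- (3 / (16 * \<Lambda>c) * a)) * 2 ^ n"
    by (intro exp_Markov) auto
  then show ?thesis
    unfolding sum_distrib_left[symmetric] using k by (simp only: mult_le_cancel_left_pos)
qed

text \<open>The constant of \<open>zeros_count_bound\<close>, raised to at least 1 as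
  \<open>ln_ratio_split\<close> requires.\<close>

definition C0 :: "real \<Rightarrow> real" where "C0 \<gamma> = max 1 (16 * ((1 + 2 * \<gamma>) / \<gamma>) / R\<^sup>2)"

text \<open>Either the sign change indicator already bounds the count, or X c is so small that the
  logarithmic bound applies and \<open>ln_ratio_split\<close> distributes it over the two error
  terms.\<close>

lemma zeros_le:
  assumes good: "good c \<omega>" and \<gamma>: "\<gamma> > 0" and \<nu>: "0 < \<nu>" "\<nu> \<le> 1" "2 * C0 \<gamma> * \<nu>\<^sup>2 \<le> 1" "12 * \<nu> ^ 5 \<le> R"
  shows "finite {s\<in>{0..\<nu> ^ 5}. X (c + s) \<omega> = 0}"
    and "real (card {s\<in>{0..\<nu> ^ 5}. X (c + s) \<omega> = 0}) \<le>
      of_bool (cone \<gamma> (\<nu> ^ 5) c \<omega>) + 72 * \<nu> ^ 6 * Q c \<omega> + slog (2 * C0 \<gamma> * \<nu> ^ 6) c \<omega>"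
proof -
  define f where "f s = X (c + s) \<omega>" for s
  define d where "d = \<nu> ^ 5"
  have d: "0 < d" "12 * d \<le> R" using \<nu> by (auto simp: d_def)
  have sm: "summable (\<lambda>m. \<bar>D c m \<omega>\<bar> * \<kappa>' ^ m / fact m)" using good by (simp add: good_def)
  have hol: "Zs c \<omega> holomorphic_on ball 0 \<kappa>'" by (rule Zs_holomorphic[OF kp(1) sm])
  have fZ: "complex_of_real (f s) = Zs c \<omega> (of_real s)" if "0 \<le> s" "s \<le> d" for s
    using good that d R unfolding good_def f_def by auto
  have f0: "f 0 \<noteq> 0" using good by (simp add: good_def f_def)
  have q: "Q c \<omega> = integral {0..1} (\<lambda>t. (norm (Zs c \<omega> (of_real R * exp (2 * of_real pi * \<i> * of_real t))))\<^sup>2)"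
    using Q_eq_integral[OF good] by (simp add: circ_def)
  have zc1: "finite {s\<in>{0..d}. f s = 0}"
    by (rule zeros_count_bound(1)[where f = f and Z = "Zs c \<omega>" and d = d and v = "D c 1 \<omega>" and \<gamma> = \<gamma> and q = "Q c \<omega>" and R = R and ?R1.0 = \<kappa>'])
      (fact hol R fZ Zs_deriv[OF kp(1) sm, symmetric] q d \<gamma> f0)+
  have zc2: "\<bar>f 0\<bar> \<le> 16 * ((1 + 2 * \<gamma>) / \<gamma>) / R\<^sup>2 * (2 * sqrt (Q c \<omega>)) * d\<^sup>2 \<and>
      real (card {s\<in>{0..d}. f s = 0}) \<le> ln (2 * sqrt (Q c \<omega>) / \<bar>f 0\<bar>)"
    if "of_bool ((f 0 - \<gamma> * d * D c 1 \<omega>) * (f 0 + (1 + \<gamma>) * d * D c 1 \<omega>) < 0) < real (card {s\<in>{0..d}. f s = 0})"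
    by (rule zeros_count_bound(2)[where f = f and Z = "Zs c \<omega>" and d = d and v = "D c 1 \<omega>" and \<gamma> = \<gamma> and q = "Q c \<omega>" and R = R and ?R1.0 = \<kappa>'])
      (fact hol R fZ Zs_deriv[OF kp(1) sm, symmetric] q d \<gamma> f0 that)+
  show "finite {s\<in>{0..\<nu> ^ 5}. X (c + s) \<omega> = 0}" using zc1 by (simp add: f_def d_def)
  have C0: "1 \<le> C0 \<gamma>" "16 * ((1 + 2 * \<gamma>) / \<gamma>) / R\<^sup>2 \<le> C0 \<gamma>" unfolding C0_def by auto
  have "2 * C0 \<gamma> * \<nu> ^ 6 = (2 * C0 \<gamma> * \<nu>\<^sup>2) * \<nu> ^ 4" by (simp add: mult.assoc power_add[symmetric])
  also have "\<dots> \<le> 1 * 1" using C0 \<nu> by (intro mult_mono) (auto simp: power_le_one)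
  finally have t1: "2 * C0 \<gamma> * \<nu> ^ 6 \<le> 1" by simp
  \<comment> \<open>The threshold is at most 1, so the logarithm is nonnegative wherever it is
    counted.\<close>
  have slog_nn: "slog (2 * C0 \<gamma> * \<nu> ^ 6) c \<omega> \<ge> 0" using t1 by (auto simp: slog_def)
  show "real (card {s\<in>{0..\<nu> ^ 5}. X (c + s) \<omega> = 0}) \<le>
      of_bool (cone \<gamma> (\<nu> ^ 5) c \<omega>) + 72 * \<nu> ^ 6 * Q c \<omega> + slog (2 * C0 \<gamma> * \<nu> ^ 6) c \<omega>"
  proof (cases "real (card {s\<in>{0..d}. f s = 0}) > of_bool ((f 0 - \<gamma> * d * D c 1 \<omega>) * (f 0 + (1 + \<gamma>) * d * D c 1 \<omega>) < 0)")
    case False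
    moreover have "72 * \<nu> ^ 6 * Q c \<omega> \<ge> 0" using Q_nonneg[of c \<omega>] \<nu> by simp
    ultimately show ?thesis using slog_nn by (simp add: f_def d_def cone_def)
  next
    case True
    define A where "A = 2 * sqrt (Q c \<omega>)"
    from zc2[OF True] have le: "\<bar>f 0\<bar> \<le> 16 * ((1 + 2 * \<gamma>) / \<gamma>) / R\<^sup>2 * A * d\<^sup>2" "real (card {s\<in>{0..d}. f s = 0}) \<le> ln (A / \<bar>f 0\<bar>)"
      by (auto simp: A_def)
    have Ann: "A \<ge> 0" using Q_nonneg by (simp add: A_def)
    have "A \<noteq> 0" using le(1) f0 by auto
    then have A: "A > 0" using Ann by simp
    have "\<bar>f 0\<bar> \<le> C0 \<gamma> * A * (\<nu> ^ 5)\<^sup>2"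
      unfolding d_def[symmetric] by (rule order_trans[OF le(1)], intro mult_right_mono C0(2) Ann) simp
    then have "ln (A / \<bar>f 0\<bar>) \<le> 18 * A\<^sup>2 * \<nu> ^ 6 + 2 * (if \<bar>f 0\<bar> < 2 * C0 \<gamma> * \<nu> ^ 6 then ln (1 / \<bar>f 0\<bar>) else 0)"
      using ln_ratio_split[OF \<nu>(1,2) C0(1) \<nu>(3) _ _ A, of "\<bar>f 0\<bar>"] f0 by simp
    also have "2 * (if \<bar>f 0\<bar> < 2 * C0 \<gamma> * \<nu> ^ 6 then ln (1 / \<bar>f 0\<bar>) else 0) = slog (2 * C0 \<gamma> * \<nu> ^ 6) c \<omega>"
      using f0 by (simp add: slog_def f_def)
    \<comment> \<open>A^2 = 4 Q turns 18 into 72.\<close>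
    also have "18 * A\<^sup>2 * \<nu> ^ 6 = 72 * \<nu> ^ 6 * Q c \<omega>"
      using Q_nonneg[of c \<omega>] by (simp add: A_def power_mult_distrib)
    finally show ?thesis using le(2) by (simp add: f_def d_def)
  qed
qed

text \<open>The closed cells overlap in their end points, which can only increase the sum.\<close>

lemma num_zeroes_le:
  assumes "d > 0" and N: "N > 0" and T: "T \<le> real N * d"
    and fin: "\<And>i. i < N \<Longrightarrow> finite {s\<in>{0..d}. X (real i * d + s) \<omega> = 0}"
  shows "num_zeroes X {0..T} \<omega> \<le> ennreal (\<Sum>i<N. real (card {s\<in>{0..d}. X (real i * d + s) \<omega> = 0}))"
proof -
  define A where "A i = (\<lambda>s. real i * d + s) ` {s\<in>{0..d}. X (real i * d + s) \<omega> = 0}" for i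
  have finA: "finite (A i)" if "i < N" for i unfolding A_def using fin[OF that] by simp
  have cA: "card (A i) = card {s\<in>{0..d}. X (real i * d + s) \<omega> = 0}" for i
    unfolding A_def by (rule card_image) (auto simp: inj_on_def)
  have sub: "{t\<in>{0..T}. X t \<omega> = 0} \<subseteq> (\<Union>i<N. A i)"
  proof
    fix t assume t: "t \<in> {t\<in>{0..T}. X t \<omega> = 0}"
    then have t0: "0 \<le> t" "t \<le> real N * d" "X t \<omega> = 0" using T by auto
    show "t \<in> (\<Union>i<N. A i)"
    proof (cases "t = real N * d")
      \<comment> \<open>The right end of the last cell would get the index N from the floor and is
        assigned to cell N - 1.\<close>
      case True
      then have tN: "t = real (N - 1) * d + d" using N by (simp add: algebra_simps of_nat_diff)
      then have "t \<in> A (N - 1)" using t0 assms(1) unfolding A_def by (intro image_eqI[of _ _ d]) auto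
      then show ?thesis using N by auto
    next
      case False
      then have lt: "t / d < real N" using t0 assms(1) by (simp add: pos_divide_less_eq)
      define i where "i = nat \<lfloor>t / d\<rfloor>"
      have td: "t / d \<ge> 0" using t0 assms(1) by simp
      have i1: "real i \<le> t / d" "t / d < real i + 1" unfolding i_def using td by (auto simp: of_nat_nat)
      have "i < N" using i1 lt by linarith
      moreover have "t \<in> A i"
        unfolding A_def
      proof (rule image_eqI)
        show "t = real i * d + (t - real i * d)" by simp
        have "real i * d \<le> t" "t \<le> real i * d + d"
          using i1 assms(1) by (simp_all add: field_simps)
        then show "t - real i * d \<in> {s\<in>{0..d}. X (real i * d + s) \<omega> = 0}" using t0 by auto
      qed
      ultimately show ?thesis by auto
    qed
  qed
  have finU: "finite (\<Union>i<N. A i)" using finA by simp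
  have "num_zeroes X {0..T} \<omega> = of_nat (card {t\<in>{0..T}. X t \<omega> = 0})"
    unfolding num_zeroes_def using finite_subset[OF sub finU] by (simp add: emeasure_count_space_finite)
  also have "card {t\<in>{0..T}. X t \<omega> = 0} \<le> (\<Sum>i<N. card (A i))"
    by (rule order_trans[OF card_mono[OF finU sub] card_UN_le]) simp
  then have "of_nat (card {t\<in>{0..T}. X t \<omega> = 0}) \<le> ennreal (real (\<Sum>i<N. card (A i)))"
    by (simp add: ennreal_of_nat_eq_real_of_nat ennreal_leI del: of_nat_sum)
  finally show ?thesis by (simp add: cA)
qed

end

section \<open>The upper tail of the number of zeroes\<close>

text \<open>An arbitrarily small \<nu> can be chosen such that a whole number K of cells of length
  \<nu>^m fills a period L. This is what makes the cells fall into K classes of spacing L.\<close>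

lemma eventually_at_right_nat_root:
  assumes "eventually P (at_right (0::real))" "L > 0" "m > 0"
  shows "\<exists>\<nu> K. K > 0 \<and> \<nu> > 0 \<and> \<nu> ^ m = L / real K \<and> P \<nu>"
proof -
  have "((\<lambda>n. L * inverse (real n)) \<longlongrightarrow> L * 0) sequentially"
    by (intro tendsto_intros lim_inverse_n)
  then have "((\<lambda>n. root m (L / real n)) \<longlongrightarrow> root m 0) sequentially"
    unfolding divide_inverse mult_zero_right by (intro tendsto_intros)
  moreover have "eventually (\<lambda>n. root m (L / real n) > 0) sequentially"
    using eventually_gt_at_top[of 0] by eventually_elim (use assms in \<open>simp add: real_root_gt_zero\<close>)
  ultimately have "filterlim (\<lambda>n. root m (L / real n)) (at_right 0) sequentially"
    using assms by (intro tendsto_imp_filterlim_at_right) auto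
  then have "eventually (\<lambda>n. P (root m (L / real n))) sequentially"
    using assms(1) by (rule eventually_compose_filterlim[rotated])
  with eventually_gt_at_top[of 0] have "eventually (\<lambda>n. n > 0 \<and> P (root m (L / real n))) sequentially"
    by (rule eventually_conj)
  then obtain K where "K > 0" "P (root m (L / real K))"
    by (auto simp: eventually_sequentially)
  then show ?thesis
    using assms by (intro exI[of _ "root m (L / real K)"] exI[of _ K]) (auto simp: real_root_gt_zero)
qed

lemma sum_residues: "(\<Sum>i<n * k. f i) = (\<Sum>b<k. \<Sum>j<n. f (b + j * k))" for f :: "nat \<Rightarrow> 'b::comm_monoid_add"
proof -
  have "(\<Sum>i<n * k. f i) = (\<Sum>j<n. sum f {j * k..<j * k + k})" by (rule sum.nat_group[symmetric])
  also have "\<dots> = (\<Sum>j<n. \<Sum>b<k. f (b + j * k))"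
    by (rule sum.cong[OF refl]) (metis add_0 add.commute sum.shift_bounds_nat_ivl lessThan_atLeast0)
  finally show ?thesis by (subst sum.swap)
qed

text \<open>All conditions hold for small \<nu>: the logarithmic term is of order \<nu>^(11/2)
  against \<nu>^5, and the level allowed for the mean square grows like 1 / \<nu>.\<close>

lemma tail_parameters:
  assumes "(\<eta>::real) > 0" "C > 0" "\<Lambda> > 0" "r > 0"
  shows "eventually (\<lambda>\<nu>. \<nu> \<le> 1 \<and> 12 * \<nu> ^ 5 \<le> r \<and> 2 * C * \<nu>\<^sup>2 \<le> 1 \<and>
    6 * (2 * C * \<nu> ^ 6) powr (11 / 12) \<le> \<eta> * \<nu> ^ 5 / 96 \<and>
    ln 2 + 1 \<le> 3 / (16 * \<Lambda>) * (\<eta> / (144 * \<nu>))) (at_right (0::real))"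
  using assms by (intro eventually_conj; real_asymp)

context zero_counting begin

text \<open>Stated for measurable events that force a large count almost surely, because
  measurability of the counting variable itself is not established.\<close>

lemma tail_bound:
  assumes dec: "\<And>\<epsilon>. \<epsilon> > 0 \<Longrightarrow> \<exists>L>0. decay \<kappa>' L \<epsilon>" and \<eta>: "\<eta> > 0"
  shows "\<exists>K c T0. K > 0 \<and> c > 0 \<and> (\<forall>T\<ge>T0. \<forall>A\<in>sets M. T > 0 \<longrightarrow>
     (AE \<omega> in M. \<omega> \<in> A \<longrightarrow> ennreal ((\<mu> / pi + 3 * \<eta>) * T) \<le> num_zeroes X {0..T} \<omega>) \<longrightarrow> prob A \<le> K * exp (- (c * T)))"
proof -
  define \<beta> where "\<beta> = \<mu> / pi"
  have \<beta>: "\<beta> > 0" using \<mu>_pos by (simp add: \<beta>_def)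
  \<comment> \<open>Chosen so that the margin raises the intensity \<beta> exactly to \<beta> +
    \<eta> / 4.\<close>
  define \<gamma> where "\<gamma> = \<eta> / (8 * \<beta>)"
  have \<gamma>: "\<gamma> > 0" using \<beta> \<eta> by (simp add: \<gamma>_def)
  \<comment> \<open>The Chernoff parameter for the sign changes: small enough that second order
    effects use at most another \<eta> / 4.\<close>
  define \<zeta> where "\<zeta> = min 1 (\<eta> / (12 * (\<beta> + \<eta>)))"
  have \<zeta>: "\<zeta> > 0" "\<zeta> \<le> 1" "\<zeta> \<le> \<eta> / (12 * (\<beta> + \<eta>))" using \<beta> \<eta> by (auto simp: \<zeta>_def)
  have \<zeta>2: "12 * \<zeta> * (\<beta> + \<eta>) \<le> \<eta>" using \<zeta>(3) \<beta> \<eta> by (simp add: field_simps)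
  define \<kappa>1 where "\<kappa>1 = 1 + 1 / \<mu> + 1 / \<mu>\<^sup>2"
  have \<kappa>1: "\<kappa>1 > 0" unfolding \<kappa>1_def using \<mu>_pos by (intro add_pos_pos) auto
  \<comment> \<open>Makes E at most \<zeta> / 3, so that the comparison factor is at most 1 +
    \<zeta>.\<close>
  define \<epsilon> where "\<epsilon> = min 1 (\<zeta> / (6 * \<kappa>1))"
  have \<epsilon>: "\<epsilon> > 0" "\<epsilon> \<le> 1" "\<epsilon> \<le> \<zeta> / (6 * \<kappa>1)" using \<zeta> \<kappa>1 by (auto simp: \<epsilon>_def)
  define E where "E = pair_eps \<epsilon>"
  have Eeq: "E = 2 * (\<epsilon> * \<kappa>1)" by (simp add: E_def pair_eps_def \<kappa>1_def)
  have "\<epsilon> * \<kappa>1 \<le> \<zeta> / 6" using \<epsilon>(3) \<kappa>1 by (simp add: field_simps)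
  then have E: "0 \<le> E" "E \<le> \<zeta> / 3" using \<epsilon> \<kappa>1 by (auto simp: Eeq)
  then have E1: "E < 1" using \<zeta> by simp
  have CE: "CE \<epsilon> \<le> 1 + \<zeta>"
  proof -
    have "E * \<zeta> \<le> \<zeta> / 3" using mult_mono[OF E(2) \<zeta>(2)] E \<zeta> by simp
    then show ?thesis using E E1 unfolding CE_def E_def[symmetric]
      by (simp add: pos_divide_le_eq algebra_simps)
  qed
  from dec[OF \<epsilon>(1)] obtain L where L: "L > 0" and dL: "decay \<kappa>' L \<epsilon>" by blast
  have dL1: "decay \<kappa>' L 1" using dL \<epsilon>(2) unfolding decay_def by (meson order_trans)
  have C0: "C0 \<gamma> > 0" by (simp add: C0_def less_max_iff_disj)
  from eventually_at_right_nat_root[OF tail_parameters[OF \<eta> C0 \<Lambda>c_pos R(1)] L, of 5]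
  obtain \<nu> K where K: "K > 0" and \<nu>: "\<nu> > 0" "\<nu> ^ 5 = L / real K" "\<nu> \<le> 1" "12 * \<nu> ^ 5 \<le> R" "2 * C0 \<gamma> * \<nu>\<^sup>2 \<le> 1"
    and \<nu>B: "6 * (2 * C0 \<gamma> * \<nu> ^ 6) powr (11 / 12) \<le> \<eta> * \<nu> ^ 5 / 96"
    and \<nu>C: "ln 2 + 1 \<le> 3 / (16 * \<Lambda>c) * (\<eta> / (144 * \<nu>))" using zero_less_numeral[where ?'a = nat] by metis
  define d where "d = \<nu> ^ 5"
  have d: "d > 0" "real K * d = L" using \<nu> K L by (auto simp: d_def)
  define \<tau> where "\<tau> = 2 * C0 \<gamma> * \<nu> ^ 6"
  have \<tau>: "\<tau> > 0" using C0 \<nu> by (simp add: \<tau>_def)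
  \<comment> \<open>The rates left over by the three Chernoff bounds. For the logarithmic term this
    is \<eta> d / 48 from the threshold minus \<eta> d / 96 from the moment.\<close>
  define c where "c = min (\<zeta> * \<eta> * d / 2) (min (\<eta> * d / 96) 1)"
  have c: "c > 0" "c \<le> \<zeta> * \<eta> * d / 2" "c \<le> \<eta> * d / 96" "c \<le> 1" using \<zeta> \<eta> d by (auto simp: c_def)
  \<comment> \<open>From here on, rounding T up to a whole number of periods costs at most \<eta>
    T.\<close>
  define T0 where "T0 = (\<beta> + 2 * \<eta>) * L / \<eta>"

  define EA where "EA n b = {\<omega>\<in>space M. (\<Sum>j<n. of_bool (cone \<gamma> d (real b * d + real j * L) \<omega>)) \<ge> (\<beta> + \<eta>) * d * real n}" for n b
  define EB where "EB n b = {\<omega>\<in>space M. (\<Sum>j<n. slog \<tau> (real b * d + real j * L) \<omega>) \<ge> \<eta> * d * real n / 2}" for n b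
  define EC where "EC n b = {\<omega>\<in>space M. (\<Sum>j<n. Q (real b * d + real j * L) \<omega>) \<ge> real n * (\<eta> / (144 * \<nu>))}" for n b
  have sets: "EA n b \<in> sets M" "EB n b \<in> sets M" "EC n b \<in> sets M" for n b
    unfolding EA_def EB_def EC_def by measurable
  have PA: "prob (EA n b) \<le> exp (- (c * real n))" for n b
  proof -
    have "prob (EA n b) \<le> exp (- (\<zeta> * ((\<beta> + \<eta>) * d * real n))) * exp (real n * ((exp \<zeta> - 1) * ((1 + 2 * \<gamma>) * d * \<mu> / pi) * CE \<epsilon>))"
      unfolding EA_def by (rule cone_event[OF dL _ _ \<gamma> d(1) \<zeta>(1)]) (use E E1 in \<open>auto simp: E_def\<close>)
    also have "\<dots> \<le> exp (- (c * real n))"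
    proof -
      \<comment> \<open>Threshold rate \<zeta> (\<beta> + \<eta>) against moment rate at most
        \<zeta> (1 + \<zeta>)^2 (\<beta> + \<eta> / 4), which is at most \<zeta> (\<beta> + \<eta> /
        2). The difference is \<zeta> \<eta> / 2 per unit length.\<close>
      have e: "exp \<zeta> - 1 \<le> \<zeta> * (1 + \<zeta>)" using exp_bound[of \<zeta>] \<zeta> by (simp add: algebra_simps power2_eq_square)
      have g: "(1 + 2 * \<gamma>) * \<beta> = \<beta> + \<eta> / 4" using \<beta> by (simp add: \<gamma>_def field_simps)
      have "(exp \<zeta> - 1) * CE \<epsilon> \<le> (\<zeta> * (1 + \<zeta>)) * (1 + \<zeta>)"
        using e CE \<zeta> CE_pos[OF dL] E E1 by (intro mult_mono) (auto simp: E_def)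
      also have "\<dots> \<le> \<zeta> * (1 + 3 * \<zeta>)"
        using \<zeta> mult_mono[of \<zeta> 1 \<zeta> 1] mult_left_mono[of "(1 + \<zeta>) * (1 + \<zeta>)" "1 + 3 * \<zeta>" \<zeta>] mult_left_mono[OF \<zeta>(2), of \<zeta>]
        by (simp add: algebra_simps)
      finally have "(exp \<zeta> - 1) * CE \<epsilon> * (\<beta> + \<eta> / 4) \<le> \<zeta> * (1 + 3 * \<zeta>) * (\<beta> + \<eta> / 4)"
        using \<beta> \<eta> by (intro mult_right_mono) auto
      also have "\<dots> \<le> \<zeta> * (\<beta> + \<eta> / 2)"
      proof -
        have "\<zeta> * (\<beta> + \<eta> / 4) \<le> \<zeta> * (\<beta> + \<eta>)" using \<zeta> \<eta> by simp
        then have "(1 + 3 * \<zeta>) * (\<beta> + \<eta> / 4) \<le> \<beta> + \<eta> / 2" using \<zeta>2 by (simp add: algebra_simps)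
        from mult_left_mono[OF this, of \<zeta>] \<zeta> show ?thesis by (simp add: mult.assoc)
      qed
      finally have "(exp \<zeta> - 1) * CE \<epsilon> * (\<beta> + \<eta> / 4) * d \<le> \<zeta> * (\<beta> + \<eta> / 2) * d"
        using d by (intro mult_right_mono) auto
      moreover have "(exp \<zeta> - 1) * ((1 + 2 * \<gamma>) * d * \<mu> / pi) * CE \<epsilon> = (exp \<zeta> - 1) * CE \<epsilon> * (\<beta> + \<eta> / 4) * d"
      proof -
        have "(exp \<zeta> - 1) * ((1 + 2 * \<gamma>) * d * \<mu> / pi) * CE \<epsilon> = (exp \<zeta> - 1) * CE \<epsilon> * ((1 + 2 * \<gamma>) * \<beta>) * d"
          unfolding \<beta>_def by simp
        then show ?thesis by (simp only: g)
      qed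
      ultimately have "real n * ((exp \<zeta> - 1) * ((1 + 2 * \<gamma>) * d * \<mu> / pi) * CE \<epsilon>) \<le> real n * (\<zeta> * (\<beta> + \<eta> / 2) * d)"
        by (intro mult_left_mono) auto
      moreover have "real n * c \<le> real n * (\<zeta> * \<eta> * d / 2)" using c(2) by (intro mult_left_mono) auto
      ultimately show ?thesis by (simp add: exp_add[symmetric] algebra_simps)
    qed
    finally show ?thesis .
  qed
  have PB: "prob (EB n b) \<le> exp (- (c * real n))" for n b
  proof -
    have "prob (EB n b) \<le> exp (- (\<eta> * d * real n / 2 / 24)) * exp (real n * (3 * \<tau> powr (11 / 12) * CE \<epsilon>))"
      unfolding EB_def by (rule slog_event[OF dL _ _ \<tau>]) (use E E1 in \<open>auto simp: E_def\<close>)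
    also have "\<dots> \<le> exp (- (c * real n))"
    proof -
      have "3 * \<tau> powr (11 / 12) * CE \<epsilon> \<le> 3 * \<tau> powr (11 / 12) * 2"
        using CE \<zeta> by (intro mult_left_mono) auto
      also have "\<dots> \<le> \<eta> * d / 96" using \<nu>B by (simp add: \<tau>_def d_def)
      finally have "real n * (3 * \<tau> powr (11 / 12) * CE \<epsilon>) \<le> real n * (\<eta> * d / 96)" by (intro mult_left_mono) auto
      moreover have "real n * c \<le> real n * (\<eta> * d / 96)" using c(3) by (intro mult_left_mono) auto
      ultimately show ?thesis by (simp add: exp_add[symmetric] algebra_simps)
    qed
    finally show ?thesis .
  qed
  have PC: "prob (EC n b) \<le> exp (- (c * real n))" for n b
  proof -
    have "prob (EC n b) \<le> exp (- (3 / (16 * \<Lambda>c) * (real n * (\<eta> / (144 * \<nu>))))) * 2 ^ n"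
      unfolding EC_def by (rule Q_event[OF dL1])
    also have "2 ^ n = exp (real n * ln 2)" by (simp add: exp_of_nat_mult)
    also have "exp (- (3 / (16 * \<Lambda>c) * (real n * (\<eta> / (144 * \<nu>))))) * exp (real n * ln 2) \<le> exp (- (c * real n))"
    proof -
      \<comment> \<open>The summand ln 2 pays for the moment bound 2^n; the remaining 1 is the
        rate.\<close>
      have "real n * (ln 2 + 1) \<le> real n * (3 / (16 * \<Lambda>c) * (\<eta> / (144 * \<nu>)))" using \<nu>C by (intro mult_left_mono) auto
      also have "\<dots> = 3 / (16 * \<Lambda>c) * (real n * (\<eta> / (144 * \<nu>)))" by (rule mult.left_commute)
      finally have "real n * (ln 2 + 1) \<le> 3 / (16 * \<Lambda>c) * (real n * (\<eta> / (144 * \<nu>)))" .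
      moreover have "real n * c \<le> real n * 1" using c(4) by (intro mult_left_mono) auto
      ultimately show ?thesis unfolding exp_add[symmetric] by (simp only: exp_le_cancel_iff) (simp add: distrib_left mult.commute)
    qed
    finally show ?thesis .
  qed
  have main: "prob A \<le> (3 * real K) * exp (- (c / L * T))"
    if T: "T \<ge> T0" "T > 0" and A: "A \<in> sets M"
      and big: "AE \<omega> in M. \<omega> \<in> A \<longrightarrow> ennreal ((\<beta> + 3 * \<eta>) * T) \<le> num_zeroes X {0..T} \<omega>" for T A
  proof -
    \<comment> \<open>The number of periods L covering [0, T], which is also the number of points in
      each class.\<close>
    define n where "n = nat \<lceil>T / L\<rceil>"
    have n: "T / L \<le> real n" "real n \<le> T / L + 1" using T(2) L unfolding n_def
      by (auto simp: of_nat_nat le_of_int_ceiling of_int_ceiling_le_add_one)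
    have nL: "T \<le> real n * L" "real n * L \<le> T + L" using n L by (simp_all add: field_simps)
    have n0: "n > 0" using nL(1) T(2) L by (cases n) auto
    have Kd: "real (n * K) * d = real n * L" using d(2) by (simp add: mult.assoc)
    define W where "W = (\<Union>b<K. EA n b \<union> EB n b \<union> EC n b)"
    have W: "W \<in> sets M" unfolding W_def using sets by auto
    have "AE \<omega> in M. \<forall>i\<in>{..<n * K}. good (real i * d) \<omega>"
      using AE_good by (intro AE_finite_allI) auto
    with big AE_space have "AE \<omega> in M. \<omega> \<in> A \<longrightarrow> \<omega> \<in> W"
    proof eventually_elim
      case (elim \<omega>)
      show ?case
      proof (rule impI, rule ccontr)
        assume "\<omega> \<in> A" and nW: "\<omega> \<notin> W"
        then have le: "ennreal ((\<beta> + 3 * \<eta>) * T) \<le> num_zeroes X {0..T} \<omega>" using elim by blast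
        define N where "N i = real (card {s\<in>{0..d}. X (real i * d + s) \<omega> = 0})" for i :: nat
        define F where "F t = of_bool (cone \<gamma> d t \<omega>) + 72 * \<nu> ^ 6 * Q t \<omega> + slog \<tau> t \<omega>" for t
        have z: "finite {s\<in>{0..d}. X (real i * d + s) \<omega> = 0}" "N i \<le> F (real i * d)" if "i < n * K" for i
        proof -
          have g: "good (real i * d) \<omega>" using elim that by auto
          show "finite {s\<in>{0..d}. X (real i * d + s) \<omega> = 0}" "N i \<le> F (real i * d)"
            using zeros_le[OF g \<gamma> \<nu>(1,3,5,4)] by (auto simp: N_def F_def d_def \<tau>_def)
        qed
        have "num_zeroes X {0..T} \<omega> \<le> ennreal (\<Sum>i<n * K. N i)"
          unfolding N_def by (rule num_zeroes_le[OF d(1)]) (use n0 K nL(1) z(1) Kd in auto)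
        with le have "ennreal ((\<beta> + 3 * \<eta>) * T) \<le> ennreal (\<Sum>i<n * K. N i)" by (rule order_trans)
        then have "(\<beta> + 3 * \<eta>) * T \<le> (\<Sum>i<n * K. N i)"
          by (subst (asm) ennreal_le_iff) (auto intro!: sum_nonneg simp: N_def)
        also have "\<dots> \<le> (\<Sum>i<n * K. F (real i * d))" by (intro sum_mono z(2)) auto
        \<comment> \<open>Cell i = b + j K starts at b d + j L, so fixed b runs through one class of
          spacing L.\<close>
        also have "\<dots> = (\<Sum>b<K. \<Sum>j<n. F (real (b + j * K) * d))" by (rule sum_residues)
        also have "\<dots> < (\<Sum>b<K. (\<beta> + 2 * \<eta>) * d * real n)"
        proof (rule sum_strict_mono)
          fix b assume b: "b \<in> {..<K}"
          have "real (b + j * K) * d = real b * d + real j * L" for j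
            using d(2) by (simp add: distrib_right mult.assoc)
          then have "(\<Sum>j<n. F (real (b + j * K) * d)) = (\<Sum>j<n. of_bool (cone \<gamma> d (real b * d + real j * L) \<omega>)) +
             72 * \<nu> ^ 6 * (\<Sum>j<n. Q (real b * d + real j * L) \<omega>) + (\<Sum>j<n. slog \<tau> (real b * d + real j * L) \<omega>)"
            unfolding F_def by (simp only: sum.distrib sum_distrib_left)
          \<comment> \<open>The budget per class: \<beta> + \<eta> for the sign changes and \<eta> /
            2 for each of the two error terms.\<close>
          also have "\<dots> < (\<beta> + \<eta>) * d * real n + \<eta> * d * real n / 2 + \<eta> * d * real n / 2"
          proof (intro add_strict_mono)
            have nb: "\<omega> \<notin> EA n b" "\<omega> \<notin> EB n b" "\<omega> \<notin> EC n b" using nW b by (auto simp: W_def)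
            show "(\<Sum>j<n. of_bool (cone \<gamma> d (real b * d + real j * L) \<omega>)) < (\<beta> + \<eta>) * d * real n"
              "(\<Sum>j<n. slog \<tau> (real b * d + real j * L) \<omega>) < \<eta> * d * real n / 2"
              using nb elim unfolding EA_def EB_def by (auto simp: not_le)
            have "(\<Sum>j<n. Q (real b * d + real j * L) \<omega>) < real n * (\<eta> / (144 * \<nu>))"
              using nb elim unfolding EC_def by (auto simp: not_le)
            then have "72 * \<nu> ^ 6 * (\<Sum>j<n. Q (real b * d + real j * L) \<omega>) < 72 * \<nu> ^ 6 * (real n * (\<eta> / (144 * \<nu>)))"
              using \<nu>(1) by (intro mult_strict_left_mono) auto
            \<comment> \<open>The level \<eta> / (144 \<nu>) was chosen for this identity, with d =
              \<nu>^5.\<close>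
            also have "\<dots> = \<eta> * d * real n / 2"
              using \<nu>(1) by (simp add: d_def field_simps eval_nat_numeral)
            finally show "72 * \<nu> ^ 6 * (\<Sum>j<n. Q (real b * d + real j * L) \<omega>) < \<eta> * d * real n / 2" .
          qed
          also have "\<dots> = (\<beta> + 2 * \<eta>) * d * real n" by (simp add: field_simps)
          finally show "(\<Sum>j<n. F (real (b + j * K) * d)) < (\<beta> + 2 * \<eta>) * d * real n" .
        qed (use K in auto)
        also have "\<dots> = (\<beta> + 2 * \<eta>) * (real n * L)" using d(2) by (simp add: mult_ac)
        also have "\<dots> \<le> (\<beta> + 2 * \<eta>) * (T + L)" using nL(2) \<beta> \<eta> by (intro mult_left_mono) auto
        also have "\<dots> \<le> (\<beta> + 3 * \<eta>) * T"
        proof -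
          have "(\<beta> + 2 * \<eta>) * L \<le> \<eta> * T" using T(1) \<eta> by (simp add: T0_def field_simps)
          then show ?thesis by (simp add: algebra_simps)
        qed
        finally show False by simp
      qed
    qed
    then have "prob A \<le> prob W" by (rule finite_measure_mono_AE[OF _ W])
    also have "\<dots> \<le> (\<Sum>b<K. prob (EA n b \<union> EB n b \<union> EC n b))"
      unfolding W_def by (rule finite_measure_subadditive_finite) (use sets in auto)
    also have "\<dots> \<le> (\<Sum>b<K. 3 * exp (- (c * real n)))"
    proof (rule sum_mono)
      fix b
      have "prob (EA n b \<union> EB n b \<union> EC n b) \<le> prob (EA n b) + prob (EB n b) + prob (EC n b)"
        using measure_Un_le[of "EA n b \<union> EB n b" M "EC n b"] measure_Un_le[of "EA n b" M "EB n b"] sets[of n b] sets.Un[OF sets(1,2)[of n b]] by linarith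
      also have "\<dots> \<le> 3 * exp (- (c * real n))" using PA[of n b] PB[of n b] PC[of n b] by simp
      finally show "prob (EA n b \<union> EB n b \<union> EC n b) \<le> 3 * exp (- (c * real n))" .
    qed
    also have "\<dots> = (3 * real K) * exp (- (c * real n))" by simp
    also have "\<dots> \<le> (3 * real K) * exp (- (c / L * T))"
    proof -
      have "c * (T / L) \<le> c * real n" using c(1) n(1) by (intro mult_left_mono) auto
      then show ?thesis by (intro mult_left_mono) auto
    qed
    finally show ?thesis .
  qed
  show ?thesis
    by (rule exI[of _ "3 * real K"], rule exI[of _ "c / L"], rule exI[of _ T0])
      (use main K c(1) L in \<open>auto simp: \<beta>_def\<close>)
qed

end

section \<open>The intensity of the zeroes\<close>

lemma nn_integral_abs_normal:
  assumes "\<sigma> > 0"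
  shows "(\<integral>\<^sup>+v. ennreal (normal_density 0 \<sigma> v * \<bar>v\<bar>) \<partial>lborel) = ennreal (\<sigma> * sqrt (2 / pi))"
proof -
  have "has_bochner_integral lborel (\<lambda>v. normal_density 0 \<sigma> v * \<bar>v\<bar>) (\<sigma> * sqrt (2 / pi))"
    using normal_moment_abs_odd[of \<sigma> 0 0] assms by simp
  then show ?thesis
    using nn_integral_eq_integral[of lborel "\<lambda>v. normal_density 0 \<sigma> v * \<bar>v\<bar>"] by (auto simp: has_bochner_integral_iff)
qed

text \<open>For fixed v the sign changes between 0 and -cv/r, where the density of x is at least its
  value at the far end. The exact probability is arccos(r) / pi; the bound rc / pi is simpler and
  equally sharp as r tends to 1.\<close>

lemma sign_change_gaussian_ge:
  fixes r c s :: real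
  assumes r: "r > 0" "c > 0" "r\<^sup>2 + c\<^sup>2 = 1" and s: "s > 0"
  shows "ennreal (r * c / pi) \<le>
    (\<integral>\<^sup>+x. \<integral>\<^sup>+v. ennreal (of_bool (x * (r * x + c * v) < 0) * normal_density 0 (sqrt s) x * normal_density 0 (sqrt s) v) \<partial>lborel \<partial>lborel)"
proof -
  let ?n = "normal_density 0 (sqrt s)"
  define a where "a = c / r"
  have a: "a > 0" "1 + a\<^sup>2 = 1 / r\<^sup>2" using r by (simp_all add: a_def field_simps)
  \<comment> \<open>Since 1 + a^2 = 1/r^2, the product of the two densities is again Gaussian in v,
    with variance s r^2.\<close>
  have prod: "?n (a * v) * ?n v = r / sqrt (2 * pi * s) * normal_density 0 (sqrt s * r) v" for v
  proof -
    have "- (a * v)\<^sup>2 / (2 * s) + - v\<^sup>2 / (2 * s) = - (v\<^sup>2 * (1 + a\<^sup>2) / (2 * s))"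
      by (simp add: power_mult_distrib distrib_left add_divide_distrib mult.commute)
    also have "\<dots> = - v\<^sup>2 / (2 * (s * r\<^sup>2))" unfolding a(2) by simp
    finally have "exp (- (a * v)\<^sup>2 / (2 * s)) * exp (- v\<^sup>2 / (2 * s)) = exp (- v\<^sup>2 / (2 * (s * r\<^sup>2)))"
      unfolding exp_add[symmetric] by (rule arg_cong)
    then show ?thesis
      using r s by (simp add: normal_density_def power_mult_distrib real_sqrt_mult mult.assoc[symmetric])
  qed
  have "ennreal (r * c / pi) = ennreal (a * (r / sqrt (2 * pi * s))) * ennreal (sqrt s * r * sqrt (2 / pi))"
  proof -
    have "a * (r / sqrt (2 * pi * s)) * (sqrt s * r * sqrt (2 / pi)) = r * c / pi"
      using r s by (simp add: a_def real_sqrt_mult real_sqrt_divide field_simps)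
    then show ?thesis using r s a by (simp add: ennreal_mult[symmetric])
  qed
  also have "\<dots> = (\<integral>\<^sup>+v. ennreal (a * (r / sqrt (2 * pi * s))) * ennreal (normal_density 0 (sqrt s * r) v * \<bar>v\<bar>) \<partial>lborel)"
    using r s by (subst nn_integral_cmult) (simp_all add: nn_integral_abs_normal)
  also have "\<dots> \<le> (\<integral>\<^sup>+v. \<integral>\<^sup>+x. ennreal (of_bool (x * (r * x + c * v) < 0) * ?n x * ?n v) \<partial>lborel \<partial>lborel)"
  proof (rule nn_integral_mono)
    fix v
    have sub: "x * (r * x + c * v) < 0 \<and> ?n (a * v) \<le> ?n x" if "x \<in> {min 0 (- (a * v))<..<max 0 (- (a * v))}" for x
    proof
      have "\<bar>x\<bar> \<le> \<bar>a * v\<bar>" using that by (auto simp: min_def max_def split: if_splits)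
      then have "x\<^sup>2 \<le> (a * v)\<^sup>2" by (simp add: abs_le_square_iff)
      then show "?n (a * v) \<le> ?n x" using s by (simp add: normal_density_def divide_right_mono)
      have "r * x + c * v = r * (x + a * v)" using r by (simp add: a_def field_simps)
      moreover have "x * (x + a * v) < 0" using that by (auto simp: min_def max_def mult_less_0_iff split: if_splits)
      ultimately show "x * (r * x + c * v) < 0" using r by (simp add: mult.left_commute[of x r] mult_pos_neg)
    qed
    have "ennreal (a * (r / sqrt (2 * pi * s))) * ennreal (normal_density 0 (sqrt s * r) v * \<bar>v\<bar>) = ennreal (?n (a * v) * ?n v) * ennreal (\<bar>a * v\<bar>)"
    proof -
      have "a * (r / sqrt (2 * pi * s)) * (normal_density 0 (sqrt s * r) v * \<bar>v\<bar>) = (?n (a * v) * ?n v) * \<bar>a * v\<bar>"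
        unfolding prod using a by (simp add: abs_mult)
      then show ?thesis using a r s by (simp add: ennreal_mult[symmetric])
    qed
    also have "\<dots> = ennreal (?n (a * v) * ?n v) * emeasure lborel {min 0 (- (a * v))<..<max 0 (- (a * v))}"
      by (subst emeasure_lborel_Ioo) (auto simp: min_def max_def abs_if)
    also have "\<dots> = (\<integral>\<^sup>+x. ennreal (?n (a * v) * ?n v) * indicator {min 0 (- (a * v))<..<max 0 (- (a * v))} x \<partial>lborel)"
      by (rule nn_integral_cmult_indicator[symmetric]) simp
    also have "\<dots> \<le> (\<integral>\<^sup>+x. ennreal (of_bool (x * (r * x + c * v) < 0) * ?n x * ?n v) \<partial>lborel)"
      by (rule nn_integral_mono) (use sub in \<open>auto split: split_indicator intro!: ennreal_leI mult_right_mono\<close>)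
    finally show "ennreal (a * (r / sqrt (2 * pi * s))) * ennreal (normal_density 0 (sqrt s * r) v * \<bar>v\<bar>) \<le>
      (\<integral>\<^sup>+x. ennreal (of_bool (x * (r * x + c * v) < 0) * ?n x * ?n v) \<partial>lborel)" .
  qed
  also have "\<dots> = (\<integral>\<^sup>+x. \<integral>\<^sup>+v. ennreal (of_bool (x * (r * x + c * v) < 0) * ?n x * ?n v) \<partial>lborel \<partial>lborel)"
    by (rule lborel_pair.Fubini') measurable
  finally show ?thesis .
qed

lemma nn_integral_normal_pair:
  assumes "s > 0"
  shows "(\<integral>\<^sup>+x. \<integral>\<^sup>+v. ennreal (normal_density 0 (sqrt s) x * normal_density 0 (sqrt s) v) \<partial>lborel \<partial>lborel) = 1"
proof -
  have "(\<integral>\<^sup>+v. ennreal (normal_density 0 (sqrt s) v) \<partial>lborel) = 1"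
    using assms nn_integral_eq_integral[OF integrable_normal_density[of "sqrt s" 0]] integral_normal_density[of "sqrt s" 0]
    by simp
  then show ?thesis
    by (simp add: ennreal_mult nn_integral_cmult)
qed

text \<open>Passes to the complement, because the comparison estimate for pairs bounds integrals
  only from above.\<close>

lemma sign_agree_gaussian_le:
  fixes r c s :: real
  assumes r: "r > 0" "c > 0" "r\<^sup>2 + c\<^sup>2 = 1" and s: "s > 0"
  shows "(\<integral>\<^sup>+x. \<integral>\<^sup>+v. ennreal (of_bool (x * (r * x + c * v) > 0) * normal_density 0 (sqrt s) x * normal_density 0 (sqrt s) v) \<partial>lborel \<partial>lborel) \<le>
    ennreal (1 - r * c / pi)"
proof -
  let ?n = "normal_density 0 (sqrt s)"
  let ?I = "\<lambda>P. (\<integral>\<^sup>+x. \<integral>\<^sup>+v. ennreal (of_bool (P x v) * ?n x * ?n v) \<partial>lborel \<partial>lborel)"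
  have "?I (\<lambda>x v. x * (r * x + c * v) > 0) + ?I (\<lambda>x v. x * (r * x + c * v) < 0) =
    (\<integral>\<^sup>+x. \<integral>\<^sup>+v. ennreal (of_bool (x * (r * x + c * v) > 0) * ?n x * ?n v) + ennreal (of_bool (x * (r * x + c * v) < 0) * ?n x * ?n v) \<partial>lborel \<partial>lborel)"
    by (simp add: nn_integral_add)
  also have "\<dots> \<le> (\<integral>\<^sup>+x. \<integral>\<^sup>+v. ennreal (?n x * ?n v) \<partial>lborel \<partial>lborel)"
    by (intro nn_integral_mono) (auto split: split_of_bool)
  also have "\<dots> = 1" by (rule nn_integral_normal_pair[OF s])
  finally have "?I (\<lambda>x v. x * (r * x + c * v) > 0) + ennreal (r * c / pi) \<le> 1"
    using add_left_mono[OF sign_change_gaussian_ge[OF r s]] by (rule order_trans[rotated])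
  then have "?I (\<lambda>x v. x * (r * x + c * v) > 0) \<le> 1 - ennreal (r * c / pi)"
    by (simp add: ennreal_le_minus_iff add.commute)
  also have "\<dots> = ennreal (1 - r * c / pi)" using r by (simp add: ennreal_minus flip: ennreal_1)
  finally show ?thesis .
qed

context zero_counting begin

lemma pair_variance: "(\<integral>\<omega>. (a * X s \<omega> + b * X t \<omega>)\<^sup>2 \<partial>M) = a\<^sup>2 + 2 * a * b * r (s - t) + b\<^sup>2"
proof -
  have "(\<integral>\<omega>. (a * X s \<omega> + b * X t \<omega>)\<^sup>2 \<partial>M) = (\<integral>\<omega>. a\<^sup>2 * (X s \<omega> * X s \<omega>) + 2 * a * b * (X s \<omega> * X t \<omega>) + b\<^sup>2 * (X t \<omega> * X t \<omega>) \<partial>M)"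
    by (intro Bochner_Integration.integral_cong refl) (simp add: power2_eq_square algebra_simps)
  also have "\<dots> = a\<^sup>2 * r 0 + 2 * a * b * r (s - t) + b\<^sup>2 * r 0"
    by (simp add: X_product_integrable X_product_expectation)
  finally show ?thesis using r0 by simp
qed

text \<open>Gram-Schmidt: X(t + h) = r(h) X(t) + c W with (X t, W) a standard pair. Its covariance
  form is exactly the identity, so the comparison estimate with both bounds equal to 1 loses
  nothing.\<close>

lemma sign_change_prob:
  assumes h: "h \<noteq> 0" and r: "r h > 0" "r h < 1"
  shows "r h * sqrt (1 - (r h)\<^sup>2) / pi \<le> prob {\<omega>\<in>space M. X t \<omega> * X (t + h) \<omega> < 0}"
proof -
  define \<rho>h where "\<rho>h = r h"
  define c where "c = sqrt (1 - \<rho>h\<^sup>2)"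
  have "\<rho>h\<^sup>2 < 1" using r by (simp add: \<rho>h_def power_less_one_iff abs_square_less_1)
  then have c: "c > 0" "\<rho>h\<^sup>2 + c\<^sup>2 = 1" by (auto simp: c_def)
  have rh: "\<rho>h > 0" "r (t - (t + h)) = \<rho>h"
    using r X_product_expectation[of t "t + h"] X_product_expectation[of "t + h" t] by (auto simp: \<rho>h_def mult.commute)
  define W where "W \<omega> = (X (t + h) \<omega> - \<rho>h * X t \<omega>) / c" for \<omega>
  have W: "X (t + h) \<omega> = \<rho>h * X t \<omega> + c * W \<omega>" for \<omega> using c by (simp add: W_def)
  have [measurable]: "W \<in> borel_measurable M" unfolding W_def by measurable
  define U where "U = {y :: real \<times> real. fst y * (\<rho>h * fst y + c * snd y) > 0}"
  have U: "open U" unfolding U_def by (intro open_Collect_less continuous_intros)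
  define g where "g y = (if y \<in> U then 1 else 0 :: real)" for y
  have fam: "gaussian_family M ({0::nat} \<times> UNIV) (\<lambda>(j, e). if e then W else X t) (\<lambda>i j. of_bool (i = j))"
    unfolding gaussian_family_def
  proof (intro conjI allI)
    show "finite ({0::nat} \<times> (UNIV :: bool set))" by simp
    fix w :: "nat \<times> bool \<Rightarrow> real"
    \<comment> \<open>Rewrites a combination of X t and W in terms of X t and X(t + h); h nonzero
      keeps the two times distinct in \<open>lin\<close>.\<close>
    define a b where "a = w (0, False) - w (0, True) * \<rho>h / c" and "b = w (0, True) / c"
    have prod: "{0::nat} \<times> (UNIV :: bool set) = {(0, False), (0, True)}" by (auto simp: UNIV_bool)
    have lin: "lin {t, t + h} (\<lambda>u. if u = t then a else b) \<omega> = a * X t \<omega> + b * X (t + h) \<omega>" for \<omega>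
      using h by (simp add: lin_def)
    have "centered_gaussian M (lin {t, t + h} (\<lambda>u. if u = t then a else b)) (\<integral>\<omega>. (lin {t, t + h} (\<lambda>u. if u = t then a else b) \<omega>)\<^sup>2 \<partial>M)"
      by (subst lin_second_moment) (auto intro: lin_centered_gaussian)
    moreover have "(\<integral>\<omega>. (lin {t, t + h} (\<lambda>u. if u = t then a else b) \<omega>)\<^sup>2 \<partial>M) = (w (0, False))\<^sup>2 + (w (0, True))\<^sup>2"
    proof -
      have "a\<^sup>2 + 2 * a * b * \<rho>h + b\<^sup>2 = (a + b * \<rho>h)\<^sup>2 + b\<^sup>2 * (1 - \<rho>h\<^sup>2)" by (simp add: power2_eq_square algebra_simps)
      also have "1 - \<rho>h\<^sup>2 = c\<^sup>2" using c(2) by simp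
      also have "(a + b * \<rho>h)\<^sup>2 + b\<^sup>2 * c\<^sup>2 = (w (0, False))\<^sup>2 + (w (0, True))\<^sup>2"
        using c(1) by (simp add: a_def b_def power_divide)
      finally show ?thesis unfolding lin pair_variance rh(2) .
    qed
    moreover have "lin {t, t + h} (\<lambda>u. if u = t then a else b) = (\<lambda>\<omega>. \<Sum>i\<in>{0} \<times> UNIV. w i * (case i of (j, e) \<Rightarrow> if e then W else X t) \<omega>)"
    proof
      fix \<omega> show "lin {t, t + h} (\<lambda>u. if u = t then a else b) \<omega> = (\<Sum>i\<in>{0} \<times> UNIV. w i * (case i of (j, e) \<Rightarrow> if e then W else X t) \<omega>)"
        unfolding lin prod using c(1) by (simp add: a_def b_def W_def field_simps)
    qed
    ultimately show "centered_gaussian M (\<lambda>\<omega>. \<Sum>i\<in>{0} \<times> UNIV. w i * (case i of (j, e) \<Rightarrow> if e then W else X t) \<omega>)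
       (\<Sum>i\<in>{0} \<times> UNIV. \<Sum>j\<in>{0} \<times> UNIV. w i * w j * of_bool (i = j))"
      by (simp add: prod power2_eq_square)
  qed
  have sq: "(\<Sum>i\<in>{0::nat} \<times> UNIV. \<Sum>j\<in>{0} \<times> UNIV. w i * w j * of_bool (i = j)) = (\<Sum>i\<in>{0} \<times> UNIV. (w i)\<^sup>2)" for w :: "nat \<times> bool \<Rightarrow> real"
  proof -
    have prod: "{0::nat} \<times> (UNIV :: bool set) = {(0, False), (0, True)}" by (auto simp: UNIV_bool)
    show ?thesis by (simp add: prod power2_eq_square)
  qed
  have q: "0 \<le> 1 - \<rho>h * c / pi"
  proof -
    have "\<rho>h * c \<le> 1 * 1" using c rh \<open>\<rho>h\<^sup>2 < 1\<close> r by (intro mult_mono) (auto simp: c_def \<rho>h_def)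
    then have "\<rho>h * c \<le> pi" using pi_ge_two by linarith
    then show ?thesis by simp
  qed
  have "(\<integral>\<^sup>+\<omega>. (\<Prod>j\<in>{0::nat}. ennreal (g (X t \<omega>, W \<omega>))) \<partial>M) \<le> ennreal (((1 - \<rho>h * c / pi) * 1 / 1) ^ card {0::nat})"
  proof (rule nn_integral_prod_gaussian_pairs_le[OF prob_space_axioms _ fam])
    show "g \<in> borel_measurable borel" unfolding g_def using U by (intro measurable_If_set) auto
    show "isCont g y" if "g y \<noteq> 0" for y
      unfolding g_def by (rule isCont_if_open[OF U]) (use that in \<open>auto simp: g_def split: if_splits\<close>)
    show "(\<integral>\<^sup>+x. \<integral>\<^sup>+v. ennreal (g (x, v) * normal_density 0 (sqrt s) x * normal_density 0 (sqrt s) v) \<partial>lborel \<partial>lborel) \<le> ennreal (1 - \<rho>h * c / pi)"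
      if "1 \<le> s" for s
    proof -
      have "g (x, v) = of_bool (x * (\<rho>h * x + c * v) > 0)" for x v by (simp add: g_def U_def)
      then show ?thesis using sign_agree_gaussian_le[OF rh(1) c, of s] that by (simp only:)
    qed
  next
    fix w :: "nat \<times> bool \<Rightarrow> real"
    show "1 * (\<Sum>i\<in>{0} \<times> UNIV. (w i)\<^sup>2) \<le> (\<Sum>i\<in>{0} \<times> UNIV. \<Sum>j\<in>{0} \<times> UNIV. w i * w j * of_bool (i = j))"
      "(\<Sum>i\<in>{0} \<times> UNIV. \<Sum>j\<in>{0} \<times> UNIV. w i * w j * of_bool (i = j)) \<le> 1 * (\<Sum>i\<in>{0} \<times> UNIV. (w i)\<^sup>2)"
      unfolding sq by simp_all
  qed (use q in \<open>auto simp: g_def\<close>)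
  moreover have "(\<integral>\<^sup>+\<omega>. (\<Prod>j\<in>{0::nat}. ennreal (g (X t \<omega>, W \<omega>))) \<partial>M) = emeasure M {\<omega>\<in>space M. X t \<omega> * X (t + h) \<omega> > 0}"
  proof -
    have "(\<integral>\<^sup>+\<omega>. (\<Prod>j\<in>{0::nat}. ennreal (g (X t \<omega>, W \<omega>))) \<partial>M) = (\<integral>\<^sup>+\<omega>. indicator {\<omega>\<in>space M. X t \<omega> * X (t + h) \<omega> > 0} \<omega> \<partial>M)"
      by (rule nn_integral_cong) (auto simp: g_def U_def W split: split_indicator)
    then show ?thesis by simp
  qed
  ultimately have le: "prob {\<omega>\<in>space M. X t \<omega> * X (t + h) \<omega> > 0} \<le> 1 - \<rho>h * c / pi"
    using q by (simp add: emeasure_eq_measure)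
  have nz: "AE \<omega> in M. X u \<omega> \<noteq> 0" for u
  proof -
    have "(\<integral>s. (norm (exp (- \<i> * of_real (s * u))))\<^sup>2 \<partial>\<rho>) = 1" using rho.prob_space by simp
    then have "centered_gaussian M (X u) 1" using rep_centered_gaussian[OF rep_X[of u]] by simp
    then show ?thesis by (rule centered_gaussian_AE_nonzero[OF prob_space_axioms]) simp
  qed
  \<comment> \<open>Zero values are null events, so up to a null set the complement of agreeing
    signs is the sign change.\<close>
  from nz[of t] nz[of "t + h"] have "AE \<omega> in M. \<not> X t \<omega> * X (t + h) \<omega> > 0 \<longleftrightarrow> X t \<omega> * X (t + h) \<omega> < 0"
    by eventually_elim (auto simp: not_less order.order_iff_strict)
  then have "prob {\<omega>\<in>space M. X t \<omega> * X (t + h) \<omega> < 0} = prob {\<omega>\<in>space M. \<not> X t \<omega> * X (t + h) \<omega> > 0}"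
    by (intro finite_measure_eq_AE) auto
  also have "\<dots> = 1 - prob {\<omega>\<in>space M. X t \<omega> * X (t + h) \<omega> > 0}"
    by (rule prob_neg) measurable
  finally show ?thesis using le by (simp add: \<rho>h_def[symmetric] c_def)
qed

text \<open>The intermediate value theorem gives a zero strictly inside each cell with a sign
  change, so different cells give different zeroes.\<close>

lemma sign_changes_le_num_zeroes:
  assumes \<omega>: "\<omega> \<in> space M" and h: "h > 0" "real N * h \<le> T"
  shows "(\<Sum>i<N. indicator {\<omega>\<in>space M. X (real i * h) \<omega> * X (real i * h + h) \<omega> < 0} \<omega>) \<le> num_zeroes X {0..T} \<omega>"
proof -
  define I where "I = {i\<in>{..<N}. X (real i * h) \<omega> * X (real i * h + h) \<omega> < 0}"
  have "\<exists>z. real i * h < z \<and> z < real i * h + h \<and> X z \<omega> = 0" if "i \<in> I" for i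
  proof -
    have c: "continuous_on {real i * h..real i * h + h} (\<lambda>t. X t \<omega>)"
      using cont[OF \<omega>] by (rule continuous_on_subset) auto
    have s: "X (real i * h) \<omega> < 0 \<and> X (real i * h + h) \<omega> > 0 \<or> X (real i * h) \<omega> > 0 \<and> X (real i * h + h) \<omega> < 0"
      using that by (auto simp: I_def mult_less_0_iff)
    then have "\<exists>z\<ge>real i * h. z \<le> real i * h + h \<and> X z \<omega> = 0"
      using IVT'[of "\<lambda>t. X t \<omega>" "real i * h" 0 "real i * h + h"] IVT2'[of "\<lambda>t. X t \<omega>" "real i * h + h" 0 "real i * h"] c h by auto
    then obtain z where z: "real i * h \<le> z" "z \<le> real i * h + h" "X z \<omega> = 0" by blast
    then have "z \<noteq> real i * h" "z \<noteq> real i * h + h" using s by auto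
    then show ?thesis using z by (intro exI[of _ z]) auto
  qed
  then have "\<exists>f. \<forall>i\<in>I. real i * h < f i \<and> f i < real i * h + h \<and> X (f i) \<omega> = 0" by (intro bchoice) blast
  then obtain f where f: "\<And>i. i \<in> I \<Longrightarrow> real i * h < f i \<and> f i < real i * h + h \<and> X (f i) \<omega> = 0" by blast
  have fin: "finite I" by (simp add: I_def)
  have lt: "i \<le> j" if "f i = f j" "i \<in> I" "j \<in> I" for i j
  proof -
    have "real i * h < (real j + 1) * h" using f[of i] f[of j] that by (auto simp: distrib_right)
    then have "real i < real j + 1" using h by simp
    then show ?thesis by linarith
  qed
  have inj: "inj_on f I" by (rule inj_onI) (use lt in \<open>auto intro: antisym\<close>)
  have sub: "f ` I \<subseteq> {t\<in>{0..T}. X t \<omega> = 0}"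
  proof
    fix z assume "z \<in> f ` I"
    then obtain i where i: "i \<in> I" "z = f i" by blast
    have "0 \<le> real i * h" using h by simp
    moreover have "real i * h + h \<le> real N * h"
    proof -
      have "real i + 1 \<le> real N" using i by (auto simp: I_def)
      then have "(real i + 1) * h \<le> real N * h" using h by (intro mult_right_mono) auto
      then show ?thesis by (simp add: distrib_right)
    qed
    ultimately show "z \<in> {t\<in>{0..T}. X t \<omega> = 0}" using f[OF i(1)] h(2) i(2) by (intro CollectI conjI, unfold atLeastAtMost_iff) (linarith | simp)+
  qed
  have "(\<Sum>i<N. indicator {\<omega>\<in>space M. X (real i * h) \<omega> * X (real i * h + h) \<omega> < 0} \<omega>) = (\<Sum>i<N. if i \<in> I then 1 else (0::ennreal))"
    by (rule sum.cong) (use \<omega> in \<open>auto simp: I_def\<close>)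
  also have "\<dots> = of_nat (card I)"
    using fin by (subst sum.If_cases) (auto simp: I_def Int_def)
  also have "\<dots> = emeasure (count_space UNIV) (f ` I)"
    using fin inj by (simp add: emeasure_count_space_finite card_image)
  also have "\<dots> \<le> num_zeroes X {0..T} \<omega>"
    unfolding num_zeroes_def by (rule emeasure_mono[OF sub]) simp
  finally show ?thesis .
qed

lemma r_eq_cos: "r t = (\<integral>s. cos (s * t) \<partial>\<rho>)"
proof -
  have i: "complex_integrable \<rho> (\<lambda>s. exp (- \<i> * of_real (s * t)))"
    by (rule rho.integrable_const_bound[of _ 1]) auto
  have "r t = Re (CLINT s|\<rho>. exp (- \<i> * of_real (s * t)))" by (simp only: r_eq[symmetric] Re_complex_of_real)
  also have "\<dots> = (\<integral>s. Re (exp (- \<i> * of_real (s * t))) \<partial>\<rho>)" using i by (rule integral_Re[symmetric])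
  finally show ?thesis by (simp add: Re_exp)
qed

text \<open>The curvature of r at 0, by dominated convergence with majorant s^2 / 2.\<close>

lemma r_second_difference: "(\<lambda>n. (real n)\<^sup>2 * (1 - r (1 / real n))) \<longlonglongrightarrow> m2 / 2"
proof -
  have eq: "(real n)\<^sup>2 * (1 - r (1 / real n)) = (\<integral>s. (real n)\<^sup>2 * (1 - cos (s * (1 / real n))) \<partial>\<rho>)" for n
  proof -
    have "integrable \<rho> (\<lambda>s. cos (s * (1 / real n)))" by (rule rho.integrable_const_bound[of _ 1]) auto
    then show ?thesis using rho.prob_space by (simp add: r_eq_cos del: times_divide_eq_right)
  qed
  have "(\<lambda>n. \<integral>s. (real n)\<^sup>2 * (1 - cos (s * (1 / real n))) \<partial>\<rho>) \<longlonglongrightarrow> (\<integral>s. s\<^sup>2 / 2 \<partial>\<rho>)"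
  proof (rule integral_dominated_convergence[where w = "\<lambda>s. s\<^sup>2 / 2"])
    show "integrable \<rho> (\<lambda>s. s\<^sup>2 / 2)" using square_integrable by simp
    show "AE s in \<rho>. (\<lambda>n. (real n)\<^sup>2 * (1 - cos (s * (1 / real n)))) \<longlonglongrightarrow> s\<^sup>2 / 2"
    proof (rule AE_I2)
      fix s :: real show "(\<lambda>n. (real n)\<^sup>2 * (1 - cos (s * (1 / real n)))) \<longlonglongrightarrow> s\<^sup>2 / 2"
      proof (cases "s = 0")
        case False then show ?thesis unfolding power2_eq_square by real_asymp
      qed simp
    qed
    show "AE s in \<rho>. norm ((real n)\<^sup>2 * (1 - cos (s * (1 / real n)))) \<le> s\<^sup>2 / 2" for n
    proof (rule AE_I2)
      fix s :: real
      have "1 - cos (s * (1 / real n)) = 2 * (sin (s * (1 / real n) / 2))\<^sup>2"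
        using cos_double_sin[of "s * (1 / real n) / 2"] by simp
      also have "(sin (s * (1 / real n) / 2))\<^sup>2 \<le> (s * (1 / real n) / 2)\<^sup>2"
        using abs_sin_x_le_abs_x by (simp only: abs_le_square_iff[symmetric])
      finally have "(real n)\<^sup>2 * (1 - cos (s * (1 / real n))) \<le> (real n)\<^sup>2 * (2 * (s * (1 / real n) / 2)\<^sup>2)"
        by (intro mult_left_mono) auto
      also have "\<dots> \<le> s\<^sup>2 / 2" by (cases "n = 0") (auto simp: power2_eq_square field_simps)
      finally show "norm ((real n)\<^sup>2 * (1 - cos (s * (1 / real n)))) \<le> s\<^sup>2 / 2" by simp
    qed
  qed measurable
  then show ?thesis by (simp add: eq m2_def)
qed

text \<open>On a mesh of n cells the expected number of sign changes is at least n q sqrt(1 - q^2) /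
  pi with q = r(1/n). As n^2 (1 - q^2) tends to m2, this tends to \<mu> / pi.\<close>

lemma zero_intensity_ge: "ennreal (\<mu> / pi) \<le> (\<integral>\<^sup>+\<omega>. num_zeroes X {0..1} \<omega> \<partial>M)"
proof -
  define q where "q n = r (1 / real n)" for n
  define e where "e n = (real n)\<^sup>2 * (1 - q n)" for n
  have e: "e \<longlonglongrightarrow> m2 / 2" unfolding e_def q_def by (rule r_second_difference)
  have "(\<lambda>n. 1 - e n * (inverse (real n) * inverse (real n))) \<longlonglongrightarrow> 1 - m2 / 2 * (0 * 0)"
    by (intro tendsto_intros e lim_inverse_n)
  moreover have "\<forall>\<^sub>F n in sequentially. 1 - e n * (inverse (real n) * inverse (real n)) = q n"
    using eventually_gt_at_top[of 0] by eventually_elim (simp add: e_def power2_eq_square field_simps)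
  ultimately have q: "q \<longlonglongrightarrow> 1" by (auto intro: Lim_transform_eventually)
  have "(\<lambda>n. q n * sqrt (e n * (1 + q n)) / pi) \<longlonglongrightarrow> 1 * sqrt (m2 / 2 * (1 + 1)) / pi"
    by (intro tendsto_intros e q) simp
  then have lim: "(\<lambda>n. ennreal (q n * sqrt (e n * (1 + q n)) / pi)) \<longlonglongrightarrow> ennreal (\<mu> / pi)"
    by (intro tendsto_ennrealI) (simp add: \<mu>_def)
  have "\<forall>\<^sub>F n in sequentially. ennreal (q n * sqrt (e n * (1 + q n)) / pi) \<le> (\<integral>\<^sup>+\<omega>. num_zeroes X {0..1} \<omega> \<partial>M)"
    using eventually_gt_at_top[of 0] order_tendstoD(1)[OF q, of 0, simplified] order_tendstoD(1)[OF e half_gt_zero[OF m2_pos]]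
  proof eventually_elim
    case (elim n)
    define h where "h = 1 / real n"
    have h: "h > 0" "real n * h \<le> 1" using elim by (auto simp: h_def)
    have e0: "e n > 0" by (rule elim(3))
    then have q1: "q n < 1" by (simp add: e_def zero_less_mult_iff)
    have "q n * sqrt (e n * (1 + q n)) / pi = real n * (q n * sqrt (1 - (q n)\<^sup>2) / pi)"
    proof -
      have "e n * (1 + q n) = (real n)\<^sup>2 * (1 - (q n)\<^sup>2)" by (simp add: e_def power2_eq_square algebra_simps)
      then show ?thesis by (simp add: real_sqrt_mult)
    qed
    also have "\<dots> = (\<Sum>i<n. q n * sqrt (1 - (q n)\<^sup>2) / pi)" by simp
    also have "\<dots> \<le> (\<Sum>i<n. prob {\<omega>\<in>space M. X (real i * h) \<omega> * X (real i * h + h) \<omega> < 0})"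
      unfolding q_def h_def[symmetric]
      by (intro sum_mono sign_change_prob) (use h elim q1 in \<open>auto simp: q_def h_def\<close>)
    finally have "ennreal (q n * sqrt (e n * (1 + q n)) / pi) \<le> (\<Sum>i<n. emeasure M {\<omega>\<in>space M. X (real i * h) \<omega> * X (real i * h + h) \<omega> < 0})"
      by (simp add: emeasure_eq_measure sum_ennreal ennreal_leI)
    also have "\<dots> = (\<integral>\<^sup>+\<omega>. (\<Sum>i<n. indicator {\<omega>\<in>space M. X (real i * h) \<omega> * X (real i * h + h) \<omega> < 0} \<omega>) \<partial>M)"
      by (subst nn_integral_sum) auto
    also have "\<dots> \<le> (\<integral>\<^sup>+\<omega>. num_zeroes X {0..1} \<omega> \<partial>M)"
      by (intro nn_integral_mono sign_changes_le_num_zeroes h)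
    finally show ?case .
  qed
  then show ?thesis by (intro tendsto_upperbound[OF lim]) auto
qed

end

section \<open>The large deviation bound\<close>

lemma absolutely_continuous_paths_imp_continuous:
  assumes "absolutely_continuous_paths M X" "\<omega> \<in> space M"
  shows "continuous_on UNIV (\<lambda>t. X t \<omega>)"
proof (rule continuous_at_imp_continuous_on, rule ballI)
  fix x :: real
  define f where "f t = X t \<omega>" for t
  have ac: "absolutely_continuous_fun_on (x - 1) (x + 1) f"
    using assms unfolding absolutely_continuous_paths_def f_def by blast
  show "isCont (\<lambda>t. X t \<omega>) x"
    unfolding f_def[symmetric] continuous_at_eps_delta
  proof (intro allI impI)
    fix e :: real assume "e > 0"
    with ac obtain \<delta> where \<delta>: "\<delta> > 0" and
      ac': "\<forall>(n::nat) u v. (\<forall>i<n. x - 1 \<le> u i \<and> u i \<le> v i \<and> v i \<le> x + 1) \<longrightarrow>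
        disjoint_family_on (\<lambda>i. {u i<..<v i}) {..<n} \<longrightarrow> (\<Sum>i<n. v i - u i) < \<delta> \<longrightarrow> (\<Sum>i<n. \<bar>f (v i) - f (u i)\<bar>) < e"
      unfolding absolutely_continuous_fun_on_def by (elim allE[of _ e]) (erule impE, assumption, elim exE conjE, rule that)
    have "dist (f y) (f x) < e" if "dist y x < min \<delta> 1" for y
    proof -
      \<comment> \<open>Absolute continuity is applied to the single interval between x and y;
        length below 1 keeps it inside [x - 1, x + 1].\<close>
      have "\<bar>f (max x y) - f (min x y)\<bar> < e"
        using ac'[rule_format, of 1 "\<lambda>_. min x y" "\<lambda>_. max x y"] that
        by (auto simp: disjoint_family_on_def dist_real_def max_def min_def abs_if split: if_splits)
      then show ?thesis by (auto simp: dist_real_def max_def min_def abs_minus_commute split: if_splits)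
    qed
    then show "\<exists>d>0. \<forall>y. dist y x < d \<longrightarrow> dist (f y) (f x) < e"
      using \<delta> by (intro exI[of _ "min \<delta> 1"]) auto
  qed
qed

text \<open>If \<open>\<alpha> = \<infinity>\<close> the hypothesis forces \<open>z = \<infinity>\<close>, because \<open>\<infinity> - \<infinity> = \<infinity>\<close> in \<^typ>\<open>ereal\<close>.\<close>

lemma excess_imp_ge:
  fixes z \<alpha> :: ennreal and T \<beta> \<eta> :: real
  assumes "T > 0" "\<eta> \<ge> 0" "\<beta> \<ge> 0" "ennreal \<beta> \<le> \<alpha>"
    and ex: "ereal (3 * \<eta> * T) \<le> enn2ereal z - enn2ereal \<alpha> * ereal T"
  shows "ennreal ((\<beta> + 3 * \<eta>) * T) \<le> z"
proof (cases z)
  case (real w)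
  show ?thesis
  proof (cases \<alpha>)
    case (real a)
    then have "\<beta> \<le> a" using assms(3,4) by (simp add: ennreal_le_iff)
    then have "\<beta> * T \<le> a * T" using assms(1) by (intro mult_right_mono) auto
    moreover have "3 * \<eta> * T \<le> w - a * T"
      using ex real \<open>z = ennreal w\<close> \<open>0 \<le> w\<close> by (simp add: enn2ereal_ennreal)
    ultimately show ?thesis using \<open>z = ennreal w\<close> by (auto intro!: ennreal_leI simp: algebra_simps)
  next
    case top
    then have "ereal (3 * \<eta> * T) \<le> - \<infinity>" using ex assms(1) real by (simp add: enn2ereal_ennreal)
    then show ?thesis by simp
  qed
qed simp

text \<open>Trades the prefactor K, which depends on \<eta>, for the universal constant e. For large
  T half of the rate absorbs K; for smaller T the rate 1/T1 makes the right side at least 1.\<close>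

lemma exponential_bound_all_times:
  fixes p :: "real \<Rightarrow> real"
  assumes K: "K > 0" "c > 0" and large: "\<And>T. T \<ge> T0 \<Longrightarrow> T > 0 \<Longrightarrow> p T \<le> K * exp (- (c * T))"
    and p1: "\<And>T. p T \<le> 1"
  shows "\<exists>c'>0. \<forall>T>0. p T \<le> exp 1 * exp (- c' * T)"
proof -
  define T1 where "T1 = max T0 (max 1 (2 * ln K / c))"
  define c' where "c' = min (c / 2) (1 / T1)"
  have T1: "T1 \<ge> T0" "T1 \<ge> 1" "T1 \<ge> 2 * ln K / c" by (auto simp: T1_def)
  have c': "c' > 0" "c' \<le> c / 2" "c' \<le> 1 / T1" using T1(2) K by (auto simp: c'_def)
  have "p T \<le> exp 1 * exp (- c' * T)" if "T > 0" for T
  proof (cases "T \<ge> T1")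
    case True
    have "p T \<le> exp (ln K) * exp (- (c * T))" using large[of T] True T1 that K by simp
    also have "\<dots> \<le> exp 1 * exp (- c' * T)"
    proof -
      have "2 * ln K / c \<le> T" using True T1 by simp
      then have "ln K \<le> c / 2 * T" using K by (simp add: field_simps)
      moreover have "c' * T \<le> c / 2 * T" using c'(2) that by (intro mult_right_mono) auto
      ultimately show ?thesis unfolding exp_add[symmetric] by simp
    qed
    finally show ?thesis .
  next
    case False
    have "c' * T \<le> 1 / T1 * T1" using c' False that T1 by (intro mult_mono) auto
    then have "1 \<le> exp 1 * exp (- c' * T)" using T1 unfolding exp_add[symmetric] by simp
    then show ?thesis using p1[of T] by simp
  qed
  then show ?thesis using c'(1) by blast
qed

theorem theorem1p6:
  fixes M :: "'a measure" and X :: "real \<Rightarrow> 'a \<Rightarrow> real"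
    and r :: "real \<Rightarrow> real" and \<rho> :: "real measure"
    and \<kappa> \<kappa>' x_star :: real and \<alpha> :: ennreal
  assumes "prob_space M"
    and "gaussian_process M X" and "centered_process M X" and "stationary_process M X"
    and "absolutely_continuous_paths M X"
    and "covariance_function M X r" and "r 0 = 1"
    and "spectral_measure r \<rho>"
    and "non_atomic \<rho>"
    and "\<kappa> > 0" and "integrable \<rho> (\<lambda>s. exp (\<bar>s\<bar> * \<kappa>))"
    and "0 < \<kappa>'" and "\<kappa>' < \<kappa> / 2"
    and "omega_star r \<rho> \<kappa>' x_star \<longlonglongrightarrow> 0"
    and "\<alpha> = (\<integral>\<^sup>+\<omega>. num_zeroes X {0..1} \<omega> \<partial>M)"
  shows "\<exists>(C::real) (c::real \<Rightarrow> real). (\<forall>\<eta>>0. c \<eta> > 0) \<and>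
           (\<forall>\<eta>>0. \<forall>T>0.
              measure M {\<omega>\<in>space M.
                enn2ereal (num_zeroes X {0..T} \<omega>) - enn2ereal \<alpha> * ereal T \<ge> ereal (3 * \<eta> * T)}
              \<le> C * exp (- c \<eta> * T))"
proof -
  interpret prob_space M by fact
  have "zero_counting M X r \<rho> \<kappa> \<kappa>'"
    by (intro zero_counting.intro zero_counting_axioms.intro gaussian_exp_moment.intro
        gaussian_exp_moment_axioms.intro gaussian_spectral.intro gaussian_spectral_axioms.intro
        absolutely_continuous_paths_imp_continuous)
      (use assms in \<open>simp_all add: mult.commute\<close>)
  then interpret zero_counting M X r \<rho> \<kappa> \<kappa>' .
  define A where "A \<eta> T = {\<omega>\<in>space M.
     enn2ereal (num_zeroes X {0..T} \<omega>) - enn2ereal \<alpha> * ereal T \<ge> ereal (3 * \<eta> * T)}" for \<eta> T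
  have dec: "\<exists>L>0. decay \<kappa>' L \<epsilon>" if "\<epsilon> > 0" for \<epsilon>
    using omega_star_imp_decay[OF assms(12,13,14) that assms(7)] .
  have "\<exists>c'>0. \<forall>T>0. prob (A \<eta> T) \<le> exp 1 * exp (- c' * T)" if \<eta>: "\<eta> > 0" for \<eta>
  proof -
    from tail_bound[OF dec \<eta>] obtain K c T0 where K: "K > 0" "c > 0" and
      tb: "\<And>T A. T \<ge> T0 \<Longrightarrow> A \<in> sets M \<Longrightarrow> T > 0 \<Longrightarrow>
        AE \<omega> in M. \<omega> \<in> A \<longrightarrow> ennreal ((\<mu> / pi + 3 * \<eta>) * T) \<le> num_zeroes X {0..T} \<omega> \<Longrightarrow> prob A \<le> K * exp (- (c * T))"
      by blast
    show ?thesis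
    proof (rule exponential_bound_all_times[OF K])
      fix T :: real assume T: "T \<ge> T0" "T > 0"
      show "prob (A \<eta> T) \<le> K * exp (- (c * T))"
      \<comment> \<open>If the event is not measurable, \<open>measure\<close> has the default value
        0 and the bound is trivial.\<close>
      proof (cases "A \<eta> T \<in> sets M")
        case True
        have "ennreal (\<mu> / pi) \<le> \<alpha>" using zero_intensity_ge assms(15) by simp
        then have "ennreal ((\<mu> / pi + 3 * \<eta>) * T) \<le> num_zeroes X {0..T} \<omega>" if "\<omega> \<in> A \<eta> T" for \<omega>
          using excess_imp_ge[of T \<eta> "\<mu> / pi" \<alpha> "num_zeroes X {0..T} \<omega>"] that T(2) \<eta> \<mu>_pos by (simp add: A_def)
        then show ?thesis by (intro tb[OF T(1) True T(2)]) simp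
      next
        case False
        then show ?thesis using K by (simp add: measure_notin_sets)
      qed
    qed simp
  qed
  \<comment> \<open>The rate is chosen for every \<eta>, with arbitrary values for \<eta> not
    positive.\<close>
  then have "\<forall>\<eta>. \<exists>c'. \<eta> > 0 \<longrightarrow> c' > 0 \<and> (\<forall>T>0. prob (A \<eta> T) \<le> exp 1 * exp (- c' * T))" by blast
  then obtain c where "\<forall>\<eta>. \<eta> > 0 \<longrightarrow> c \<eta> > 0 \<and> (\<forall>T>0. prob (A \<eta> T) \<le> exp 1 * exp (- c \<eta> * T))"
    unfolding choice_iff by (elim exE)
  then show ?thesis unfolding A_def by (intro exI[of _ "exp 1"] exI[of _ c]) blast
qed

end
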